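(* Let $d\in\{1,2,3\}$, let $\Omega=\mathbb T^d_L$ be the $d$-dimensional torus with side lengths $L_1,\dots,L_d>0$, let $\nu_0,\nu_1,\nu_2>0$ be constants and let $f=f(t,x)$ be an external force. Let $y_{\mathtt r}$ be a strong solution, defined for all $t\ge0$, of the Kuramoto--Sivashinsky equation $$\tfrac{\partial}{\partial t}y_{\mathtt r}+\nu_2\Delta^2y_{\mathtt r}+\nu_1\Delta y_{\mathtt r}+\tfrac{\nu_0}{2}|\nabla y_{\mathtt r}|_{\mathbb R^d}^2=f\quad\text{in }(0,+\infty)\times\Omega,\qquad y_{\mathtt r}(0,\cdot)\in W^{2,2}(\Omega),$$ and suppose that $y_{\mathtt r}$ is persistently uniformly bounded in the following sense: with $\overline y_{\mathtt r}(t,\cdot)\coloneqq y_{\mathtt r}(t,\cdot)-\frac{1}{\int_\Omega 1\,dx}\int_\Omega y_{\mathtt r}(t,x)\,dx$, there are constants $C_{y_{\mathtt r}}\ge0$ and $\tau_{y_{\mathtt r}}>0$ such that $$\sup_{s\ge0}|\overline y_{\mathtt r}(s)|_V\le C_{y_{\mathtt r}}\quad\text{and}\quad\sup_{s\ge0}|\overline y_{\mathtt r}|_{L^2((s,s+\tau_{y_{\mathtt r}}),\mathrm D(A))}<C_{y_{\mathtt r}}.$$ Then there exist a strictly increasing function $\sigma\colon\mathbb N_+\to\mathbb N_+$, $S\mapsto S_\sigma\coloneqq\sigma(S)$, and a sequence $(W_S)_{S\in\mathbb N_+}$ of finite sets of points $W_S=\{x^{S,j}\mid 1\le j\le S_\sigma\}\subset\Omega$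 such that the following holds. For any given $R>0$, $\varrho>1$ and $\mu>0$, there is a large enough $S\in\mathbb N_+$ such that for every matrix $\Lambda\in\mathbb R^{S_\sigma\times S_\sigma}$ for which the smallest eigenvalue of $\Lambda+\Lambda^\top$ equals $1$, we can find a large enough $\lambda>0$ such that: for all $y_{\mathtt e0}\in W^{2,2}(\Omega)$ with $|y_{\mathtt e0}-y_{\mathtt r}(0,\cdot)|_V\le R$, the corresponding solution $y_{\mathtt e}$ of the observer $$\tfrac{\partial}{\partial t}y_{\mathtt e}+\nu_2\Delta^2y_{\mathtt e}+\nu_1\Delta y_{\mathtt e}+\tfrac{\nu_0}{2}|\nabla y_{\mathtt e}|_{\mathbb R^d}^2=f-\lambda\,\nu_2^{-1}(-\Delta+\mathbf 1)^{-2}\mathcal Z_S^*\Lambda\big(\mathcal Z_Sy_{\mathtt e}-\mathcal Z_Sy_{\mathtt r}\big),\qquad y_{\mathtt e}(0,\cdot)=y_{\mathtt e0},$$ satisfies, with $z\coloneqq y_{\mathtt e}-y_{\mathtt r}$, $$|z(t,\cdot)|_V\le\varrho\,e^{-\mu(t-s)}|z(s,\cdot)|_V\quad\text{for all }t\ge s\ge0.$$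
   Context: $\mathbb T^d_L\sim\prod_{i=1}^d[0,L_i)$, that is, periodic boundary conditions are imposed. $\mathbf 1$ denotes the identity operator. $H=L^2(\Omega)$ is the pivot space, identified with its dual. $V=W^{2,2}(\Omega)$ is endowed with the norm $|v|_V\coloneqq\nu_2^{1/2}|(-\Delta+\mathbf 1)v|_{L^2(\Omega)}$, which is equivalent to the usual $W^{2,2}(\Omega)$-norm. $A\coloneqq\nu_2(-\Delta+\mathbf 1)^2$, with domain $\mathrm D(A)=W^{4,2}(\Omega)$ endowed with the norm $|v|_{\mathrm D(A)}\coloneqq|Av|_{L^2(\Omega)}$. The output operator of point measurements is $$\mathcal Z_S\colon W^{2,2}(\Omega)\to\mathbb R^{S_\sigma},\qquad \mathcal Z_Sh\coloneqq\big(h(x^{S,1}),h(x^{S,2}),\dots,h(x^{S,S_\sigma})\big)^\top,$$ which is well defined since $W^{2,2}(\Omega)\subset\mathcal C(\Omega)$ for $d\le3$. Its adjoint is $\mathcal Z_S^*v=\sum_{i=1}^{S_\sigma}v_i\boldsymbol\delta_{x^{S,i}}\in W^{-2,2}(\Omega)$, where $\boldsymbol\delta_{x}$ is the delta distribution $\langle\boldsymbol\delta_x,h\rangle=h(x)$; hence $(-\Delta+\mathbf 1)^{-2}\mathcal Z_S^*v\in L^2(\Omega)$. Solutions are strong solutions; in particular the error $z=y_{\mathtt e}-y_{\mathtt r}$ satisfies $z\in L^2((0,s),\mathrm D(A))$ and $\dot z\in L^2((0,s),H)$ for every $s>0$. *)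

theory Defs
  imports "HOL-Analysis.Analysis" "Jordan_Normal_Form.Char_Poly"
begin

no_notation Matrix.vec_index (infixl \<open>$\<close> 100)

text \<open>
  The torus with side lengths \<open>L $ i\<close> is represented by its fundamental domain
  \<open>Torus L\<close> in \<open>real^'n\<close>.  An element of a function space on the torus is a function
  \<open>real^'n \<Rightarrow> real\<close> of which only the values on \<open>Torus L\<close>, up to Lebesgue null sets, matter.
  The periodic boundary conditions enter through the (periodic) test functions defining
  weak derivatives and through the periodicity of continuous representatives.
\<close>

definition Torus :: "real^'n \<Rightarrow> (real^'n) set" where
  "Torus L = {x. \<forall>i. 0 \<le> x $ i \<and> x $ i < L $ i}"

definition periodic :: "real^'n \<Rightarrow> (real^'n \<Rightarrow> real) \<Rightarrow> bool" where
  "periodic L \<phi> \<longleftrightarrow> (\<forall>x i. \<phi> (x + axis i (L $ i)) = \<phi> x)"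

definition L2_space :: "real^'n \<Rightarrow> (real^'n \<Rightarrow> real) set" where
  "L2_space L = {u \<in> borel_measurable (lebesgue_on (Torus L)).
                   integrable (lebesgue_on (Torus L)) (\<lambda>x. (u x)\<^sup>2)}"

definition L2_inner :: "real^'n \<Rightarrow> (real^'n \<Rightarrow> real) \<Rightarrow> (real^'n \<Rightarrow> real) \<Rightarrow> real" where
  "L2_inner L u w = (\<integral>x. u x * w x \<partial>lebesgue_on (Torus L))"

definition L2_norm :: "real^'n \<Rightarrow> (real^'n \<Rightarrow> real) \<Rightarrow> real" where
  "L2_norm L u = sqrt (L2_inner L u u)"


section \<open>Weak derivatives and Sobolev spaces\<close>

definition partial_deriv :: "'n \<Rightarrow> (real^'n \<Rightarrow> real) \<Rightarrow> real^'n \<Rightarrow> real" where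
  "partial_deriv i \<phi> x = frechet_derivative \<phi> (at x) (axis i 1)"

text \<open>A list of indices plays the role of a multi-index; its length is the order.\<close>

definition iter_partial :: "'n list \<Rightarrow> (real^'n \<Rightarrow> real) \<Rightarrow> real^'n \<Rightarrow> real" where
  "iter_partial is \<phi> = foldr partial_deriv is \<phi>"

definition test_functions :: "real^'n \<Rightarrow> (real^'n \<Rightarrow> real) set" where
  "test_functions L =
     {\<phi>. periodic L \<phi> \<and> (\<forall>is x. iter_partial is \<phi> differentiable (at x))}"

definition weak_deriv ::
    "real^'n \<Rightarrow> 'n list \<Rightarrow> (real^'n \<Rightarrow> real) \<Rightarrow> (real^'n \<Rightarrow> real) \<Rightarrow> bool" where
  "weak_deriv L is u g \<longleftrightarrow> g \<in> L2_space L \<and>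
     (\<forall>\<phi>\<in>test_functions L.
        L2_inner L u (iter_partial is \<phi>) = (- 1) ^ length is * L2_inner L g \<phi>)"

text \<open>\<open>Sobolev L k\<close> is the space $W^{k,2}$ of the torus.\<close>

definition Sobolev :: "real^'n \<Rightarrow> nat \<Rightarrow> (real^'n \<Rightarrow> real) set" where
  "Sobolev L k = {u \<in> L2_space L. \<forall>is. length is \<le> k \<longrightarrow> (\<exists>g. weak_deriv L is u g)}"

text \<open>Weak derivatives are unique up to null sets, so the choice of \<open>g\<close> is immaterial.\<close>

definition wD :: "real^'n \<Rightarrow> 'n list \<Rightarrow> (real^'n \<Rightarrow> real) \<Rightarrow> real^'n \<Rightarrow> real" where
  "wD L is u = (SOME g. weak_deriv L is u g)"

definition gradient :: "real^'n \<Rightarrow> (real^'n \<Rightarrow> real) \<Rightarrow> real^'n \<Rightarrow> real^'n" where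
  "gradient L u x = (\<chi> i. wD L [i] u x)"

definition laplacian :: "real^'n \<Rightarrow> (real^'n \<Rightarrow> real) \<Rightarrow> real^'n \<Rightarrow> real" where
  "laplacian L u x = (\<Sum>i\<in>UNIV. wD L [i, i] u x)"

definition shifted_lap :: "real^'n \<Rightarrow> (real^'n \<Rightarrow> real) \<Rightarrow> real^'n \<Rightarrow> real" where
  "shifted_lap L u x = - laplacian L u x + u x"

definition A_op :: "real^'n \<Rightarrow> real \<Rightarrow> (real^'n \<Rightarrow> real) \<Rightarrow> real^'n \<Rightarrow> real" where
  "A_op L \<nu>2 u x = \<nu>2 * shifted_lap L (shifted_lap L u) x"

definition V_norm :: "real^'n \<Rightarrow> real \<Rightarrow> (real^'n \<Rightarrow> real) \<Rightarrow> real" where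
  "V_norm L \<nu>2 u = sqrt \<nu>2 * L2_norm L (shifted_lap L u)"

definition DA_norm :: "real^'n \<Rightarrow> real \<Rightarrow> (real^'n \<Rightarrow> real) \<Rightarrow> real" where
  "DA_norm L \<nu>2 u = L2_norm L (A_op L \<nu>2 u)"


section \<open>Point measurements and output injection\<close>

text \<open>
  Point evaluation uses the continuous representative, which exists (and is unique) for
  elements of \<open>Sobolev L 2\<close> in dimension at most three.
\<close>

definition cont_rep :: "real^'n \<Rightarrow> (real^'n \<Rightarrow> real) \<Rightarrow> real^'n \<Rightarrow> real" where
  "cont_rep L u = (THE w. continuous_on UNIV w \<and> periodic L w \<and>
                          (AE x in lebesgue_on (Torus L). w x = u x))"

text \<open>Distributions in $W^{-2,2}$ are represented as functionals on \<open>Sobolev L 2\<close>.\<close>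

definition delta :: "real^'n \<Rightarrow> real^'n \<Rightarrow> (real^'n \<Rightarrow> real) \<Rightarrow> real" where
  "delta L p h = cont_rep L h p"

text \<open>Points and vector entries are indexed from \<open>0\<close> to \<open>m - 1\<close>.\<close>

definition Z_op :: "real^'n \<Rightarrow> nat \<Rightarrow> (nat \<Rightarrow> real^'n) \<Rightarrow> (real^'n \<Rightarrow> real) \<Rightarrow> real Matrix.vec" where
  "Z_op L m p h = Matrix.vec m (\<lambda>j. cont_rep L h (p j))"

definition Z_adj ::
    "real^'n \<Rightarrow> nat \<Rightarrow> (nat \<Rightarrow> real^'n) \<Rightarrow> real Matrix.vec \<Rightarrow> (real^'n \<Rightarrow> real) \<Rightarrow> real" where
  "Z_adj L m p v h = (\<Sum>j<m. vec_index v j * delta L (p j) h)"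

text \<open>
  \<open>inv_bilap L F\<close> is $(-\Delta+\mathbf{1})^{-2}F$ for $F\in W^{-2,2}$, where
  $(-\Delta+\mathbf{1})^{2}$ is the isomorphism from $W^{2,2}$ onto its dual $W^{-2,2}$
  (with pivot space $L^2$); the solution is unique up to null sets.
\<close>

definition inv_bilap ::
    "real^'n \<Rightarrow> ((real^'n \<Rightarrow> real) \<Rightarrow> real) \<Rightarrow> real^'n \<Rightarrow> real" where
  "inv_bilap L F = (SOME g. g \<in> Sobolev L 2 \<and>
     (\<forall>h\<in>Sobolev L 2. L2_inner L (shifted_lap L g) (shifted_lap L h) = F h))"


section \<open>Strong solutions\<close>

text \<open>
  \<open>in_L2_DA L \<nu>2 a b y\<close>: membership in $L^2((a,b),\mathrm{D}(A))$.  Since the domain of \<open>A\<close>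
  is a separable Hilbert space isometric to $L^2$ through \<open>A\<close>, strong measurability is weak
  measurability of \<open>t \<mapsto> A (y t)\<close>.
\<close>

definition L2_DA_norm ::
    "real^'n \<Rightarrow> real \<Rightarrow> real \<Rightarrow> real \<Rightarrow> (real \<Rightarrow> real^'n \<Rightarrow> real) \<Rightarrow> ennreal" where
  "L2_DA_norm L \<nu>2 a b y =
     (let I = (\<integral>\<^sup>+t. ennreal ((DA_norm L \<nu>2 (y t))\<^sup>2) \<partial>lebesgue_on {a<..<b})
      in if I = \<infinity> then \<infinity> else ennreal (sqrt (enn2real I)))"

definition in_L2_DA ::
    "real^'n \<Rightarrow> real \<Rightarrow> real \<Rightarrow> real \<Rightarrow> (real \<Rightarrow> real^'n \<Rightarrow> real) \<Rightarrow> bool" where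
  "in_L2_DA L \<nu>2 a b y \<longleftrightarrow>
     (AE t in lebesgue_on {a<..<b}. y t \<in> Sobolev L 4) \<and>
     (\<forall>h\<in>L2_space L. (\<lambda>t. L2_inner L (A_op L \<nu>2 (y t)) h)
                        \<in> borel_measurable (lebesgue_on {a<..<b})) \<and>
     L2_DA_norm L \<nu>2 a b y < \<infinity>"

text \<open>
  \<open>time_deriv L y v\<close>: the curve \<open>y\<close> is locally absolutely continuous on $[0,\infty)$ with values in
  $L^2$ and derivative \<open>v\<close>, where $v\in L^2((0,T),L^2)=L^2((0,T)\times\Omega)$ for all $T>0$.
\<close>

definition time_deriv ::
    "real^'n \<Rightarrow> (real \<Rightarrow> real^'n \<Rightarrow> real) \<Rightarrow> (real \<Rightarrow> real^'n \<Rightarrow> real) \<Rightarrow> bool" where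
  "time_deriv L y v \<longleftrightarrow>
     (\<forall>T>0. (\<lambda>(t, x). v t x) \<in> borel_measurable (lebesgue_on ({0<..<T} \<times> Torus L)) \<and>
             integrable (lebesgue_on ({0<..<T} \<times> Torus L)) (\<lambda>(t, x). (v t x)\<^sup>2)) \<and>
     (\<forall>t\<ge>0. AE x in lebesgue_on (Torus L).
        y t x = y 0 x + (\<integral>\<tau>. v \<tau> x \<partial>lebesgue_on {0<..<t}))"

text \<open>
  Strong solutions on $[0,\infty)$ of the Kuramoto--Sivashinsky equation with right-hand side \<open>g\<close>.
  The values \<open>y t\<close>, \<open>t \<ge> 0\<close>, are those of the representative that is continuous in time.
\<close>

definition KS_strong_solution ::
    "real^'n \<Rightarrow> real \<Rightarrow> real \<Rightarrow> real \<Rightarrow> (real \<Rightarrow> real^'n \<Rightarrow> real) \<Rightarrow>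
     (real \<Rightarrow> real^'n \<Rightarrow> real) \<Rightarrow> bool" where
  "KS_strong_solution L \<nu>0 \<nu>1 \<nu>2 g y \<longleftrightarrow>
     (\<forall>t\<ge>0. y t \<in> Sobolev L 2) \<and>
     (\<forall>T>0. in_L2_DA L \<nu>2 0 T y) \<and>
     (\<exists>v. time_deriv L y v \<and>
        (AE t in lebesgue_on {0<..}. AE x in lebesgue_on (Torus L).
           v t x + \<nu>2 * laplacian L (laplacian L (y t)) x + \<nu>1 * laplacian L (y t) x
             + \<nu>0 / 2 * (norm (gradient L (y t) x))\<^sup>2 = g t x))"

definition observer_solution ::
    "real^'n \<Rightarrow> real \<Rightarrow> real \<Rightarrow> real \<Rightarrow> (real \<Rightarrow> real^'n \<Rightarrow> real) \<Rightarrow> (real \<Rightarrow> real^'n \<Rightarrow> real) \<Rightarrow>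
     nat \<Rightarrow> (nat \<Rightarrow> real^'n) \<Rightarrow> real mat \<Rightarrow> real \<Rightarrow> (real^'n \<Rightarrow> real) \<Rightarrow>
     (real \<Rightarrow> real^'n \<Rightarrow> real) \<Rightarrow> bool" where
  "observer_solution L \<nu>0 \<nu>1 \<nu>2 f yr m p \<Lambda> l y0 y \<longleftrightarrow>
     KS_strong_solution L \<nu>0 \<nu>1 \<nu>2
       (\<lambda>t x. f t x - l * inverse \<nu>2 *
          inv_bilap L (Z_adj L m p (\<Lambda> *\<^sub>v (Z_op L m p (y t) - Z_op L m p (yr t)))) x) y \<and>
     (AE x in lebesgue_on (Torus L). y 0 x = y0 x)"

definition zero_mean_part ::
    "real^'n \<Rightarrow> (real \<Rightarrow> real^'n \<Rightarrow> real) \<Rightarrow> real \<Rightarrow> real^'n \<Rightarrow> real" where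
  "zero_mean_part L y t x =
     y t x - 1 / (\<integral>x. 1 \<partial>lebesgue_on (Torus L)) * (\<integral>x. y t x \<partial>lebesgue_on (Torus L))"

definition smallest_eigenvalue :: "real mat \<Rightarrow> real \<Rightarrow> bool" where
  "smallest_eigenvalue M a \<longleftrightarrow> eigenvalue M a \<and> (\<forall>e. eigenvalue M e \<longrightarrow> a \<le> e)"

end

theory Submission imports Defs begin

text \<open>
  In the Fourier (Hartley) basis the error $z = y_e - y_r$ solves a diagonal parabolic system
  $z_k' = -\nu_2\lambda_k^2 z_k + N_k(t,z)$, where $\lambda_k$ are the eigenvalues of $-\Delta+1$.
  Testing with $\lambda_k^2 z_k$ turns the output injection into a multiple of
  $-(\mathcal{Z}z)^\top\Lambda(\mathcal{Z}z)\le-\frac12|\mathcal{Z}z|^2$, and if the sensors form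
  a fine enough grid, $M|z|_V^2\le|z|_{D(A)}^2+C_M|\mathcal{Z}z|^2$ for any prescribed $M$; hence all
  lower order terms are absorbed and $|z|_V$ decays at the rate $\mu$.  The only term that is not globally
  Lipschitz in $V$ is $|\nabla z|^2$.  Composing it with the radial projection onto the ball
  of radius $R$ in $V$ makes Picard iteration global, and the decay estimate then shows that the
  projection never acts.
\<close>

section \<open>Absolutely continuous functions on the line\<close>

text \<open>The constants are fixed in the order \<open>Kpert\<close>, \<open>M\<close>,
  \<open>S\<close>, gain. \<open>Kpert\<close> bounds all lower order terms on the ball of radius
  \<open>R\<close> in V and sees neither the sensors nor \<Lambda>; \<open>M\<close> absorbs it
  together with \<mu>; the grid is then made fine enough for \<open>M\<close>. Of \<Lambda> only the
  lower bound on its symmetric part enters the decay, so one gain serves every admissible \<Lambda>;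
  its entries enter only the Lipschitz constant behind existence and uniqueness. The condition d
  \<le> 3 is spent on the summability of the inverse squares of the eigenvalues, which gives point
  values, the bilinear gradient estimate from V x V to H and a feedback with values in V. The
  reference is bounded only modulo its mean; this suffices because gradients annihilate constants.
  An arbitrary observer solution is not known in advance to stay in the ball of radius
  \<open>R\<close>: for uniqueness it is compared with the constructed one through a truncation at a
  larger radius, taken from its energy bound on a bounded time interval. The decay is obtained with
  factor 1, which implies it for every \<rho> > 1.\<close>

lemma set_lebesgue_integral_real: "set_lebesgue_integral M A f = (\<integral>x. indicator A x * f x \<partial>M)" for f :: "'a \<Rightarrow> real"
  by (simp add: set_lebesgue_integral_def)

lemma set_integrable_real: "set_integrable M A f \<longleftrightarrow> integrable M (\<lambda>x. indicator A x * f x)" for f :: "'a \<Rightarrow> real"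
  by (simp add: set_integrable_def)

text \<open>Fubini on the square: the integral of f(r) g(s) over [0,t]^2 is split into the triangles
  r \<le> s and s < r, whose inner integrals are F(s) - F0 and G(r) - G0. This yields the product
  rule for functions known only as indefinite Lebesgue integrals.\<close>

lemma absolutely_continuous_prod:
  fixes f g :: "real \<Rightarrow> real"
  assumes t: "0 \<le> t"
    and [measurable]: "f \<in> borel_measurable borel" "g \<in> borel_measurable borel"
    and f: "set_integrable lborel {0..t} f" and g: "set_integrable lborel {0..t} g"
    and F: "\<And>s. s \<in> {0..t} \<Longrightarrow> F s = F0 + (LINT r:{0..s}|lborel. f r)"
    and G: "\<And>s. s \<in> {0..t} \<Longrightarrow> G s = G0 + (LINT r:{0..s}|lborel. g r)"
  shows "set_integrable lborel {0..t} (\<lambda>s. f s * G s + F s * g s)"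
    and "F t * G t = F0 * G0 + (LINT s:{0..t}|lborel. f s * G s + F s * g s)"
proof -
  define f' where "f' = (\<lambda>s. indicator {0..t} s * f s)"
  define g' where "g' = (\<lambda>s. indicator {0..t} s * g s)"
  have [measurable]: "f' \<in> borel_measurable borel" "g' \<in> borel_measurable borel"
    unfolding f'_def g'_def by measurable
  have fi: "integrable lborel f'" and gi: "integrable lborel g'"
    using f g by (simp_all add: f'_def g'_def set_integrable_real)
  have prod_int: "integrable (lborel \<Otimes>\<^sub>M lborel) (\<lambda>(r, s). f' r * g' s)"
  proof (rule lborel_pair.Fubini_integrable)
    show "integrable lborel (\<lambda>x. LINT y|lborel. norm (case (x, y) of (r, s) \<Rightarrow> f' r * g' s))"
      using fi gi by (simp add: abs_mult)
    show "AE x in lborel. integrable lborel (\<lambda>y. case (x, y) of (r, s) \<Rightarrow> f' r * g' s)"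
      using gi by simp
  qed measurable
  let ?a = "\<lambda>(r, s). (if r \<le> s then 1 else 0) * (f' r * g' s)"
  let ?b = "\<lambda>(r, s). (if s < r then 1 else 0) * (f' r * g' s)"
  have [measurable]: "?a \<in> borel_measurable (lborel \<Otimes>\<^sub>M lborel)" "?b \<in> borel_measurable (lborel \<Otimes>\<^sub>M lborel)"
    by measurable
  have a_int: "integrable (lborel \<Otimes>\<^sub>M lborel) ?a"
    by (rule Bochner_Integration.integrable_bound[OF prod_int]) (auto split: if_splits)
  have b_int: "integrable (lborel \<Otimes>\<^sub>M lborel) ?b"
    by (rule Bochner_Integration.integrable_bound[OF prod_int]) (auto split: if_splits)
  have fs: "(\<integral>r. (if r \<le> s then 1 else 0) * f' r \<partial>lborel) = F s - F0" if "s \<in> {0..t}" for s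
    using that F[OF that] unfolding f'_def set_lebesgue_integral_real
    by (auto intro!: Bochner_Integration.integral_cong simp: indicator_def)
  have gs: "(\<integral>s. (if s < r then 1 else 0) * g' s \<partial>lborel) = G r - G0" if "r \<in> {0..t}" for r
  proof -
    have "(\<integral>s. (if s < r then 1 else 0) * g' s \<partial>lborel) = (\<integral>s. indicator {0..r} s * g s \<partial>lborel)"
    proof (rule integral_cong_AE)
      show "AE s in lborel. (if s < r then 1 else 0) * g' s = indicator {0..r} s * g s"
        using AE_lborel_singleton[of r] by eventually_elim (use that in \<open>auto simp: g'_def indicator_def\<close>)
    qed measurable
    then show ?thesis using G[OF that] by (simp add: set_lebesgue_integral_real)
  qed
  have ia: "(\<integral>z. ?a z \<partial>(lborel \<Otimes>\<^sub>M lborel)) = (\<integral>s. g' s * (F s - F0) \<partial>lborel)"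
    and ia': "integrable lborel (\<lambda>s. g' s * (F s - F0))"
  proof -
    have eq: "(\<integral>r. (if r \<le> s then 1 else 0) * (f' r * g' s) \<partial>lborel) = g' s * (F s - F0)" for s
    proof (cases "s \<in> {0..t}")
      case True
      have "(\<integral>r. (if r \<le> s then 1 else 0) * (f' r * g' s) \<partial>lborel)
          = (\<integral>r. g' s * ((if r \<le> s then 1 else 0) * f' r) \<partial>lborel)"
        by (rule Bochner_Integration.integral_cong) auto
      then show ?thesis using fs[OF True] by simp
    qed (simp add: g'_def)
    show "(\<integral>z. ?a z \<partial>(lborel \<Otimes>\<^sub>M lborel)) = (\<integral>s. g' s * (F s - F0) \<partial>lborel)"
      using lborel_pair.integral_snd[of "\<lambda>r s. (if r \<le> s then 1 else 0) * (f' r * g' s)"] a_int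
      by (simp add: eq)
    show "integrable lborel (\<lambda>s. g' s * (F s - F0))"
      using lborel_pair.integrable_snd[of "\<lambda>r s. (if r \<le> s then 1 else 0) * (f' r * g' s)"] a_int
      by (simp add: eq)
  qed
  have ib: "(\<integral>z. ?b z \<partial>(lborel \<Otimes>\<^sub>M lborel)) = (\<integral>r. f' r * (G r - G0) \<partial>lborel)"
    and ib': "integrable lborel (\<lambda>s. f' s * (G s - G0))"
  proof -
    have eq: "(\<integral>s. (if s < r then 1 else 0) * (f' r * g' s) \<partial>lborel) = f' r * (G r - G0)" for r
    proof (cases "r \<in> {0..t}")
      case True
      have "(\<integral>s. (if s < r then 1 else 0) * (f' r * g' s) \<partial>lborel)
          = (\<integral>s. f' r * ((if s < r then 1 else 0) * g' s) \<partial>lborel)"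
        by (rule Bochner_Integration.integral_cong) auto
      then show ?thesis using gs[OF True] by simp
    qed (simp add: f'_def)
    show "(\<integral>z. ?b z \<partial>(lborel \<Otimes>\<^sub>M lborel)) = (\<integral>r. f' r * (G r - G0) \<partial>lborel)"
      using lborel_pair.integral_fst'[OF b_int] by (simp add: eq)
    show "integrable lborel (\<lambda>r. f' r * (G r - G0))"
      using lborel_pair.integrable_fst'[OF b_int] by (simp add: eq)
  qed
  have "(\<integral>r. f' r \<partial>lborel) * (\<integral>s. g' s \<partial>lborel) = (\<integral>z. (\<lambda>(r, s). f' r * g' s) z \<partial>(lborel \<Otimes>\<^sub>M lborel))"
    using lborel_pair.integral_fst'[OF prod_int] by simp
  also have "\<dots> = (\<integral>z. ?a z + ?b z \<partial>(lborel \<Otimes>\<^sub>M lborel))"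
    by (rule Bochner_Integration.integral_cong) auto
  also have "\<dots> = (\<integral>s. g' s * (F s - F0) \<partial>lborel) + (\<integral>r. f' r * (G r - G0) \<partial>lborel)"
    using ia ib a_int b_int by (simp add: Bochner_Integration.integral_add)
  finally have key: "(\<integral>r. f' r \<partial>lborel) * (\<integral>s. g' s \<partial>lborel)
      = (\<integral>s. g' s * (F s - F0) \<partial>lborel) + (\<integral>r. f' r * (G r - G0) \<partial>lborel)" .
  have Ft: "F t = F0 + (\<integral>r. f' r \<partial>lborel)" and Gt: "G t = G0 + (\<integral>r. g' r \<partial>lborel)"
    using F[of t] G[of t] t by (simp_all add: f'_def g'_def set_lebesgue_integral_real)
  have split: "indicator {0..t} s * (f s * G s + F s * g s)
      = (f' s * (G s - G0) + g' s * (F s - F0)) + (G0 * f' s + F0 * g' s)" for s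
    by (auto simp: f'_def g'_def indicator_def algebra_simps)
  show "set_integrable lborel {0..t} (\<lambda>s. f s * G s + F s * g s)"
    unfolding set_integrable_real split using ia' ib' fi gi by (intro Bochner_Integration.integrable_add) auto
  have "(LINT s:{0..t}|lborel. f s * G s + F s * g s)
     = (\<integral>r. f' r * (G r - G0) \<partial>lborel) + (\<integral>s. g' s * (F s - F0) \<partial>lborel)
        + (G0 * (\<integral>r. f' r \<partial>lborel) + F0 * (\<integral>r. g' r \<partial>lborel))"
    unfolding set_lebesgue_integral_real split using ia' ib' fi gi
    by (simp add: Bochner_Integration.integral_add Bochner_Integration.integrable_add)
  then show "F t * G t = F0 * G0 + (LINT s:{0..t}|lborel. f s * G s + F s * g s)"
    using key Ft Gt by (simp add: algebra_simps)
qed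

lemma continuous_indefinite_integral:
  fixes f :: "real \<Rightarrow> real"
  assumes "\<And>t. t \<ge> 0 \<Longrightarrow> set_integrable lborel {0..t} f"
  shows "continuous_on {0..} (\<lambda>t. LINT r:{0..t}|lborel. f r)"
proof -
  have "continuous_on {0..T} (\<lambda>t. LINT r:{0..t}|lborel. f r)" if "T \<ge> 0" for T
  proof -
    have I: "f absolutely_integrable_on {0..t}" if "t \<ge> 0" for t
      using assms[OF that] absolutely_integrable_on_def
      by (simp add: set_integrable_def integrable_completion)
    have "continuous_on {0..T} (\<lambda>t. integral {0..t} f)"
      using I[OF that] by (intro indefinite_integral_continuous_1) (simp add: absolutely_integrable_on_def)
    moreover have "(LINT r:{0..t}|lborel. f r) = integral {0..t} f" if "t \<ge> 0" for t
      using set_borel_integral_eq_integral(2)[OF assms[OF that]] by simp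
    ultimately show ?thesis by (subst continuous_on_cong) auto
  qed
  then have *: "continuous (at t within {0..}) (\<lambda>t. LINT r:{0..t}|lborel. f r)" if "t \<ge> 0" for t
  proof -
    have "continuous (at t within {0..t+1}) (\<lambda>t. LINT r:{0..t}|lborel. f r)"
      using \<open>\<And>T. 0 \<le> T \<Longrightarrow> continuous_on {0..T} _\<close>[of "t+1"] that by (auto simp: continuous_on_eq_continuous_within)
    moreover have "at t within {0..} = at t within {0..t+1}"
      by (rule at_within_nhd[of _ "{..<t+1}"]) auto
    ultimately show ?thesis by (metis)
  qed
  then show ?thesis by (auto simp: continuous_on_eq_continuous_within)
qed

text \<open>Variation of constants: z(t) is exp(-a t) times z0 plus the integral of exp(a s) h(s),
  and the integral equation is the product rule for these two factors. Replacing t by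
  \<open>max 0 t\<close> freezes the curve before time 0, so that it is continuous, hence Borel, on
  the whole line.\<close>

lemma mode_solution:
  fixes h :: "real \<Rightarrow> real"
  assumes [measurable]: "h \<in> borel_measurable borel"
    and h: "\<And>t. t \<ge> 0 \<Longrightarrow> set_integrable lborel {0..t} h"
  obtains z where "\<And>t. t \<le> 0 \<Longrightarrow> z t = z0" "continuous_on UNIV z"
    "\<And>t. t \<ge> 0 \<Longrightarrow> set_integrable lborel {0..t} (\<lambda>s. h s - a * z s)"
    "\<And>t. t \<ge> 0 \<Longrightarrow> z t = z0 + (LINT s:{0..t}|lborel. h s - a * z s)"
proof -
  have eint: "set_integrable lborel {0..t} (\<lambda>s. exp (a * s) * h s)" if "t \<ge> 0" for t
  proof -
    have "set_integrable lborel {0..t} (\<lambda>s. exp (\<bar>a\<bar> * t) * \<bar>h s\<bar>)"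
      using h[OF that] by (auto intro: set_integrable_abs)
    then show ?thesis
    proof (rule set_integrable_bound)
      show "set_borel_measurable lborel {0..t} (\<lambda>s. exp (a * s) * h s)"
        unfolding set_borel_measurable_def by measurable
      have "exp (a * s) \<le> exp (\<bar>a\<bar> * t)" if "s \<in> {0..t}" for s
        using that by (auto intro!: mult_mono)
      then show "AE s in lborel. s \<in> {0..t} \<longrightarrow> norm (exp (a * s) * h s) \<le> norm (exp (\<bar>a\<bar> * t) * \<bar>h s\<bar>)"
        by (auto simp: abs_mult intro!: mult_right_mono)
    qed
  qed
  define G where "G t = z0 + (LINT s:{0..t}|lborel. exp (a * s) * h s)" for t
  define z where "z t = exp (- a * max 0 t) * G (max 0 t)" for t
  have Gc: "continuous_on {0..} G" unfolding G_def by (intro continuous_intros continuous_indefinite_integral eint)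
  have zc: "continuous_on UNIV z" unfolding z_def
    by (intro continuous_intros continuous_on_compose2[OF Gc]) auto
  have G0: "G 0 = z0" unfolding G_def set_lebesgue_integral_real
  proof -
    have "(\<integral>x. indicator {0..0} x * (exp (a * x) * h x) \<partial>lborel) = (\<integral>x. 0 \<partial>(lborel::real measure))"
    proof (rule integral_cong_AE)
      show "AE x in lborel. indicator {0..0} x * (exp (a * x) * h x) = 0"
        using AE_lborel_singleton[of "0::real"] by eventually_elim (auto simp: indicator_def)
    qed measurable
    then show "z0 + (\<integral>x. indicator {0..0} x * (exp (a * x) * h x) \<partial>lborel) = z0" by simp
  qed
  have E: "exp (- a * s) = 1 + (LINT r:{0..s}|lborel. (- a) * exp (- a * r))"
      and Ei: "set_integrable lborel {0..s} (\<lambda>r. - a * exp (- a * r))" if "s \<ge> 0" for s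
  proof -
    have "((\<lambda>r. (- a) * exp (- a * r)) has_integral (exp (- a * s) - exp (- a * 0))) {0..s}"
      using that by (intro fundamental_theorem_of_calculus)
        (auto intro!: derivative_eq_intros simp: has_real_derivative_iff_has_vector_derivative[symmetric])
    then have e: "integral {0..s} (\<lambda>r. (- a) * exp (- a * r)) = exp (- a * s) - exp (- a * 0)"
      by (rule integral_unique)
    show i: "set_integrable lborel {0..s} (\<lambda>r. (- a) * exp (- a * r))"
      by (rule borel_integrable_atLeastAtMost') (intro continuous_intros)
    show "exp (- a * s) = 1 + (LINT r:{0..s}|lborel. (- a) * exp (- a * r))"
      unfolding set_borel_integral_eq_integral(2)[OF i] e by simp
  qed
  have st: "set_integrable lborel {0..t} (\<lambda>s. h s - a * z s) \<and>
    z t = z0 + (LINT s:{0..t}|lborel. h s - a * z s)" if "t \<ge> 0" for t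
  proof -
    have "exp (- (a * s)) * (exp (a * s) * h s) = h s" for s
      by (simp add: exp_minus mult.assoc[symmetric])
    then have cong: "(\<lambda>s. indicator {0..t} s * ((- a) * exp (- a * s) * G s + exp (- a * s) * (exp (a * s) * h s)))
        = (\<lambda>s. indicator {0..t} s * (h s - a * z s))"
      by (intro ext) (simp add: z_def indicator_def)
    have m: "(\<lambda>s. (- a) * exp (- a * s)) \<in> borel_measurable borel" "(\<lambda>s. exp (a * s) * h s) \<in> borel_measurable borel"
      by measurable
    have Fs: "exp (- a * s) = 1 + (LINT r:{0..s}|lborel. (- a) * exp (- a * r))" if "s \<in> {0..t}" for s
      by (rule E) (use that in simp)
    have Gs: "G s = z0 + (LINT r:{0..s}|lborel. exp (a * r) * h r)" for s
      by (simp add: G_def)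
    note 1 = absolutely_continuous_prod(1)[OF that m Ei[OF that] eint[OF that] Fs Gs]
    note 2 = absolutely_continuous_prod(2)[OF that m Ei[OF that] eint[OF that] Fs Gs]
    show ?thesis using 1 2 that unfolding set_integrable_real set_lebesgue_integral_real cong by (simp add: z_def)
  qed
  show ?thesis
  proof (rule that[of z])
    show "z t = z0" if "t \<le> 0" for t using that G0 by (simp add: z_def)
  qed (use zc st in blast)+
qed

text \<open>Gronwall for a function known only to be nonnegative and integrable. The inequality
  first makes \<phi> nonincreasing, so the integral over [s,t] is at least (t - s) \<phi>(t). This
  is an implicit Euler step, and n of them give the factor (1 + c(t - s)/n)^n, which tends to the
  exponential.\<close>

lemma exp_decay_of_integral_inequality:
  fixes \<phi> :: "real \<Rightarrow> real"
  assumes nn: "\<And>t. t \<ge> 0 \<Longrightarrow> \<phi> t \<ge> 0"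
    and c: "c \<ge> 0"
    and int: "\<And>t. t \<ge> 0 \<Longrightarrow> set_integrable lborel {0..t} \<phi>"
    and le: "\<And>s t. 0 \<le> s \<Longrightarrow> s \<le> t \<Longrightarrow> \<phi> t \<le> \<phi> s - c * (LINT r:{s..t}|lborel. \<phi> r)"
    and st: "0 \<le> s" "s \<le> t"
  shows "\<phi> t \<le> exp (- c * (t - s)) * \<phi> s"
proof -
  have dec: "\<phi> t \<le> \<phi> s" if "0 \<le> s" "s \<le> t" for s t
  proof -
    have "(LINT r:{s..t}|lborel. \<phi> r) \<ge> 0"
      unfolding set_lebesgue_integral_real using nn that by (intro integral_nonneg_AE) (auto simp: indicator_def)
    then show ?thesis using le[OF that] c mult_nonneg_nonneg[of c] by (smt (verit))
  qed
  have int2: "set_integrable lborel {s..t} \<phi>" if "0 \<le> s" "s \<le> t" for s t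
    by (rule set_integrable_subset[OF int[of t]]) (use that in auto)
  have step: "\<phi> t * (1 + c * (t - s)) \<le> \<phi> s" if "0 \<le> s" "s \<le> t" for s t
  proof -
    have "(LINT r:{s..t}|lborel. \<phi> t) \<le> (LINT r:{s..t}|lborel. \<phi> r)"
      by (rule set_integral_mono) (use that int2 dec in \<open>auto simp: set_integrable_def\<close>)
    then have "(t - s) * \<phi> t \<le> (LINT r:{s..t}|lborel. \<phi> r)"
      using that by (simp add: set_lebesgue_integral_def)
    then have "c * ((t - s) * \<phi> t) \<le> c * (LINT r:{s..t}|lborel. \<phi> r)"
      using c by (rule mult_left_mono)
    then show ?thesis using le[OF that] by (simp add: algebra_simps)
  qed
  have iter: "\<phi> (s + real m * d) * (1 + c * d) ^ m \<le> \<phi> s" if "d \<ge> 0" for d m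
  proof (induction m)
    case (Suc m)
    have "\<phi> (s + real (Suc m) * d) * (1 + c * d) \<le> \<phi> (s + real m * d)"
      using step[of "s + real m * d" "s + real (Suc m) * d"] st that by (simp add: algebra_simps)
    then have "\<phi> (s + real (Suc m) * d) * (1 + c * d) * (1 + c * d) ^ m \<le> \<phi> (s + real m * d) * (1 + c * d) ^ m"
      using c that by (intro mult_right_mono) auto
    then show ?case using Suc by (simp add: mult.assoc)
  qed simp
  have "\<phi> t * (1 + (c * (t - s)) / real n) ^ n \<le> \<phi> s" if "n > 0" for n
    using iter[of "(t - s) / n" n] st that by simp
  moreover have "(\<lambda>n. \<phi> t * (1 + (c * (t - s)) / real n) ^ n) \<longlonglongrightarrow> \<phi> t * exp (c * (t - s))"
    by (intro tendsto_intros tendsto_exp_limit_sequentially)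
  ultimately have "\<phi> t * exp (c * (t - s)) \<le> \<phi> s"
    by (intro tendsto_upperbound[where F = sequentially]) (auto intro!: eventually_sequentiallyI[of 1])
  then have "\<phi> t \<le> \<phi> s / exp (c * (t - s))" by (simp only: pos_le_divide_eq exp_gt_zero)
  moreover have "exp (- c * (t - s)) = inverse (exp (c * (t - s)))" by (simp add: exp_minus[symmetric])
  ultimately show ?thesis by (simp only: divide_inverse mult.commute)
qed

section \<open>Square integrable functions\<close>

text \<open>Stated over an arbitrary measure so that the same inequalities serve functions on the
  torus, coefficient families over a counting measure, and functions of time. Elements are
  functions, not classes, in accordance with \<open>L2_space\<close>.\<close>

definition sq_int :: "'a measure \<Rightarrow> ('a \<Rightarrow> real) set" where
  "sq_int M = {f \<in> borel_measurable M. integrable M (\<lambda>x. (f x)\<^sup>2)}"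

definition nrm :: "'a measure \<Rightarrow> ('a \<Rightarrow> real) \<Rightarrow> real" where
  "nrm M f = sqrt (\<integral>x. (f x)\<^sup>2 \<partial>M)"

lemma sq_int_measurable: "f \<in> sq_int M \<Longrightarrow> f \<in> borel_measurable M"
  by (simp add: sq_int_def)

lemma sq_int_integrable: "f \<in> sq_int M \<Longrightarrow> integrable M (\<lambda>x. (f x)\<^sup>2)"
  by (simp add: sq_int_def)

lemma nrm_nonneg [simp]: "nrm M f \<ge> 0"
  by (simp add: nrm_def)

lemma nrm_sq: "(nrm M f)\<^sup>2 = (\<integral>x. (f x)\<^sup>2 \<partial>M)"
  by (simp add: nrm_def)

lemma nn_integral_sq: "f \<in> sq_int M \<Longrightarrow> (\<integral>\<^sup>+x. ennreal ((f x)\<^sup>2) \<partial>M) = ennreal ((nrm M f)\<^sup>2)"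
  unfolding nrm_sq by (intro nn_integral_eq_integral) (auto simp: sq_int_def)

lemma sq_int_iff_nn_integral:
  "f \<in> sq_int M \<longleftrightarrow> f \<in> borel_measurable M \<and> (\<integral>\<^sup>+x. ennreal ((f x)\<^sup>2) \<partial>M) < \<infinity>"
  by (auto simp: sq_int_def integrable_iff_bounded)

lemma sq_int_nn_integral_le:
  assumes "f \<in> borel_measurable M" "(\<integral>\<^sup>+x. ennreal ((f x)\<^sup>2) \<partial>M) \<le> ennreal (B\<^sup>2)" "B \<ge> 0"
  shows "f \<in> sq_int M" "nrm M f \<le> B"
proof -
  show f: "f \<in> sq_int M" using assms(1,2) le_less_trans[OF assms(2)]
    by (auto simp: sq_int_iff_nn_integral)
  show "nrm M f \<le> B" using assms(2,3) unfolding nn_integral_sq[OF f] by simp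
qed

lemma sq_int_cong_AE:
  assumes "f \<in> sq_int M" "g \<in> borel_measurable M" "AE x in M. g x = f x"
  shows "g \<in> sq_int M"
  using assms by (auto simp: sq_int_def intro!: integrable_cong_AE_imp[of M "\<lambda>x. (f x)\<^sup>2"])

lemma nrm_cong_AE:
  assumes "f \<in> borel_measurable M" "g \<in> borel_measurable M" "AE x in M. g x = f x"
  shows "nrm M g = nrm M f"
proof -
  have "(\<integral>x. (g x)\<^sup>2 \<partial>M) = (\<integral>x. (f x)\<^sup>2 \<partial>M)"
    using assms by (intro integral_cong_AE) auto
  then show ?thesis by (simp add: nrm_def)
qed

lemma sq_int_mult_integrable:
  assumes "f \<in> sq_int M" "g \<in> sq_int M"
  shows "integrable M (\<lambda>x. f x * g x)"
proof (rule Bochner_Integration.integrable_bound)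
  show "integrable M (\<lambda>x. (f x)\<^sup>2 + (g x)\<^sup>2)" using assms by (auto simp: sq_int_def)
  show "(\<lambda>x. f x * g x) \<in> borel_measurable M" using assms by (auto simp: sq_int_def)
  show "AE x in M. norm (f x * g x) \<le> norm ((f x)\<^sup>2 + (g x)\<^sup>2)"
  proof (rule AE_I2)
    fix x
    have "2 * (\<bar>f x\<bar> * \<bar>g x\<bar>) \<le> (f x)\<^sup>2 + (g x)\<^sup>2"
      using sum_squares_bound[of "\<bar>f x\<bar>" "\<bar>g x\<bar>"] by simp
    moreover have "0 \<le> \<bar>f x\<bar> * \<bar>g x\<bar>" by simp
    ultimately have "\<bar>f x\<bar> * \<bar>g x\<bar> \<le> (f x)\<^sup>2 + (g x)\<^sup>2" by linarith
    then show "norm (f x * g x) \<le> norm ((f x)\<^sup>2 + (g x)\<^sup>2)" by (simp add: abs_mult)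
  qed
qed

lemma sq_int_zero [simp]: "(\<lambda>x. 0) \<in> sq_int M"
  by (simp add: sq_int_def)

lemma sq_int_scale: "f \<in> sq_int M \<Longrightarrow> (\<lambda>x. c * f x) \<in> sq_int M"
  by (auto simp: sq_int_def power_mult_distrib)

lemma sq_int_add:
  assumes "f \<in> sq_int M" "g \<in> sq_int M"
  shows "(\<lambda>x. f x + g x) \<in> sq_int M"
  using assms sq_int_mult_integrable[OF assms]
  by (auto simp: sq_int_def power2_sum mult.assoc)

lemma sq_int_diff:
  assumes "f \<in> sq_int M" "g \<in> sq_int M"
  shows "(\<lambda>x. f x - g x) \<in> sq_int M"
  using sq_int_add[OF assms(1) sq_int_scale[OF assms(2), of "-1"]] by simp

lemma sq_int_sum: "(\<And>i. i \<in> A \<Longrightarrow> f i \<in> sq_int M) \<Longrightarrow> (\<lambda>x. \<Sum>i\<in>A. f i x) \<in> sq_int M"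
  by (induction A rule: infinite_finite_induct) (auto intro: sq_int_add)

lemma sq_int_bound:
  assumes "g \<in> sq_int M" "f \<in> borel_measurable M" "\<And>x. x \<in> space M \<Longrightarrow> \<bar>f x\<bar> \<le> \<bar>g x\<bar>"
  shows "f \<in> sq_int M" "nrm M f \<le> nrm M g"
proof -
  have le: "(f x)\<^sup>2 \<le> (g x)\<^sup>2" if "x \<in> space M" for x
    using assms(3)[OF that] by (rule abs_le_square_iff[THEN iffD1])
  show f: "f \<in> sq_int M"
    using assms le by (auto simp: sq_int_def intro!: Bochner_Integration.integrable_bound[of M "\<lambda>x. (g x)\<^sup>2"])
  show "nrm M f \<le> nrm M g" unfolding nrm_def
    using f assms(1) le by (auto simp: sq_int_def intro!: integral_mono)
qed

lemma nrm_scale: "nrm M (\<lambda>x. c * f x) = \<bar>c\<bar> * nrm M f"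
  by (simp add: nrm_def power_mult_distrib real_sqrt_mult)

lemma nrm_minus_commute: "nrm M (\<lambda>x. f x - g x) = nrm M (\<lambda>x. g x - f x)"
  by (simp add: nrm_def power2_commute)

lemma Cauchy_Schwarz_integral:
  assumes f: "f \<in> sq_int M" and g: "g \<in> sq_int M"
  shows "\<bar>\<integral>x. f x * g x \<partial>M\<bar> \<le> nrm M f * nrm M g"
proof -
  let ?A = "(nrm M f)\<^sup>2" and ?B = "\<integral>x. f x * g x \<partial>M" and ?C = "(nrm M g)\<^sup>2"
  have q: "0 \<le> ?A * s\<^sup>2 + 2 * ?B * s + ?C" for s
  proof -
    have "0 \<le> (\<integral>x. (s * f x + g x)\<^sup>2 \<partial>M)" by simp
    also have "\<dots> = (\<integral>x. s\<^sup>2 * (f x)\<^sup>2 + 2 * s * (f x * g x) + (g x)\<^sup>2 \<partial>M)"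
      by (rule Bochner_Integration.integral_cong) (auto simp: power2_eq_square algebra_simps)
    also have "\<dots> = ?A * s\<^sup>2 + 2 * ?B * s + ?C"
      using sq_int_mult_integrable[OF f g] f g
      by (simp add: nrm_sq sq_int_def)
    finally show ?thesis .
  qed
  have "?B\<^sup>2 \<le> ?A * ?C"
  proof (cases "?A = 0")
    case True
    have "?B = 0"
    proof (rule ccontr)
      assume "?B \<noteq> 0"
      \<comment> \<open>At this point the nonnegative affine function of s takes the value
        -1.\<close>
      then show False using q[of "- (?C + 1) / (2 * ?B)"] True by (simp add: field_simps)
    qed
    then show ?thesis by simp
  next
    case False
    then have A: "?A > 0" using zero_le_power2[of "nrm M f"] by linarith
    have "0 \<le> ?A * (?A * (- ?B / ?A)\<^sup>2 + 2 * ?B * (- ?B / ?A) + ?C)"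
      using q[of "- ?B / ?A"] A by (intro mult_nonneg_nonneg) auto
    also have "\<dots> = ?A * ?C - ?B\<^sup>2" using False by (simp add: field_simps power2_eq_square)
    finally show ?thesis by simp
  qed
  then have "?B\<^sup>2 \<le> (nrm M f * nrm M g)\<^sup>2" by (simp add: power_mult_distrib)
  then show ?thesis using abs_le_square_iff[of ?B "nrm M f * nrm M g"] by (simp add: abs_mult)
qed

lemma nrm_triangle:
  assumes f: "f \<in> sq_int M" and g: "g \<in> sq_int M"
  shows "nrm M (\<lambda>x. f x + g x) \<le> nrm M f + nrm M g"
proof -
  have "(nrm M (\<lambda>x. f x + g x))\<^sup>2 = (\<integral>x. (f x)\<^sup>2 + 2 * (f x * g x) + (g x)\<^sup>2 \<partial>M)"
    unfolding nrm_sq by (rule Bochner_Integration.integral_cong) (auto simp: power2_sum)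
  also have "\<dots> = (nrm M f)\<^sup>2 + 2 * (\<integral>x. f x * g x \<partial>M) + (nrm M g)\<^sup>2"
    using sq_int_mult_integrable[OF f g] f g by (simp add: nrm_sq sq_int_def)
  also have "\<dots> \<le> (nrm M f + nrm M g)\<^sup>2"
    using Cauchy_Schwarz_integral[OF f g] by (simp add: power2_sum abs_le_iff)
  finally show ?thesis by (rule power2_le_imp_le) simp
qed

lemma nrm_triangle_diff:
  assumes "f \<in> sq_int M" "g \<in> sq_int M"
  shows "nrm M (\<lambda>x. f x - g x) \<le> nrm M f + nrm M g"
  using nrm_triangle[OF assms(1) sq_int_scale[OF assms(2), of "-1"]] nrm_scale[of M "-1" g] by simp

lemma nrm_triangle_sum:
  assumes "finite A" "\<And>i. i \<in> A \<Longrightarrow> f i \<in> sq_int M"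
  shows "nrm M (\<lambda>x. \<Sum>i\<in>A. f i x) \<le> (\<Sum>i\<in>A. nrm M (f i))"
  using assms
proof (induction A rule: finite_induct)
  case (insert a A)
  then show ?case using nrm_triangle[of "f a" M "\<lambda>x. \<Sum>i\<in>A. f i x"] sq_int_sum[of A f M] by simp
qed (simp add: nrm_def)

text \<open>The bounds on limits (synthesis of a function, products of two series, Picard iterates)
  all come from here: convergence almost everywhere together with a bound along the
  sequence.\<close>

lemma sq_int_Fatou:
  assumes F: "\<And>n. F n \<in> borel_measurable M" and f: "f \<in> borel_measurable M"
    and lim: "AE x in M. (\<lambda>n. F n x) \<longlonglongrightarrow> f x"
    and le: "\<And>n. n \<ge> m \<Longrightarrow> (\<integral>\<^sup>+x. ennreal ((F n x)\<^sup>2) \<partial>M) \<le> B"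
  shows "(\<integral>\<^sup>+x. ennreal ((f x)\<^sup>2) \<partial>M) \<le> B"
proof -
  have "(\<integral>\<^sup>+x. ennreal ((f x)\<^sup>2) \<partial>M) = (\<integral>\<^sup>+x. liminf (\<lambda>n. ennreal ((F n x)\<^sup>2)) \<partial>M)"
  proof (rule nn_integral_cong_AE, use lim in eventually_elim)
    fix x assume "(\<lambda>n. F n x) \<longlonglongrightarrow> f x"
    then have "(\<lambda>n. ennreal ((F n x)\<^sup>2)) \<longlonglongrightarrow> ennreal ((f x)\<^sup>2)" by (intro tendsto_intros)
    then show "ennreal ((f x)\<^sup>2) = liminf (\<lambda>n. ennreal ((F n x)\<^sup>2))"
      by (metis lim_imp_Liminf sequentially_bot)
  qed
  also have "\<dots> \<le> liminf (\<lambda>n. \<integral>\<^sup>+x. ennreal ((F n x)\<^sup>2) \<partial>M)"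
    using F by (intro nn_integral_liminf) auto
  also have "\<dots> \<le> liminf (\<lambda>n. B)"
    by (rule Liminf_mono) (use le in \<open>auto intro!: eventually_sequentiallyI[of m]\<close>)
  also have "\<dots> = B" by (simp add: Liminf_const)
  finally show ?thesis .
qed

text \<open>Energies are sums over modes; this makes them measurable in time as soon as each
  coefficient is. Countability of the modes provides the joint measurability.\<close>

lemma borel_measurable_nn_integral_count_space:
  fixes f :: "'k::countable \<Rightarrow> 'a \<Rightarrow> ennreal"
  assumes "\<And>k. f k \<in> borel_measurable M"
  shows "(\<lambda>x. \<integral>\<^sup>+k. f k x \<partial>count_space UNIV) \<in> borel_measurable M"
proof -
  interpret sigma_finite_measure "count_space (UNIV :: 'k set)"
    by (rule sigma_finite_measure_count_space)
  have "(\<lambda>(x, k). f k x) \<in> borel_measurable (M \<Otimes>\<^sub>M count_space UNIV)"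
  proof -
    have [measurable]: "(\<lambda>x. case x of (k, y) \<Rightarrow> f k y) \<in> borel_measurable (count_space UNIV \<Otimes>\<^sub>M M)"
      by (rule measurable_pair_measure_countable1) (use assms in auto)
    have "(\<lambda>z. (\<lambda>(k, y). f k y) ((\<lambda>(x, k). (k, x)) z)) \<in> borel_measurable (M \<Otimes>\<^sub>M count_space UNIV)"
      by measurable
    then show ?thesis by (simp add: split_def)
  qed
  then show ?thesis by (rule borel_measurable_nn_integral)
qed

lemma nn_integral_count_space_ge_single:
  fixes f :: "'k \<Rightarrow> ennreal"
  shows "f k \<le> (\<integral>\<^sup>+i. f i \<partial>count_space UNIV)"
proof -
  have "(\<integral>\<^sup>+i. f i * indicator {k} i \<partial>count_space UNIV) \<le> (\<integral>\<^sup>+i. f i \<partial>count_space UNIV)"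
    by (rule nn_integral_mono) (auto simp: indicator_def)
  then show ?thesis by (simp add: nn_integral_count_space_indicator[symmetric] nn_integral_count_space_finite)
qed

section \<open>Diagonal parabolic evolution\<close>

lemma nn_set_integral_sq:
  fixes h :: "real \<Rightarrow> real"
  assumes "h \<in> borel_measurable borel" "(\<integral>\<^sup>+s. indicator {0..t} s * ennreal ((h s)\<^sup>2) \<partial>lborel) < \<infinity>"
  shows "set_integrable lborel {0..t} (\<lambda>s. (h s)\<^sup>2)" "set_integrable lborel {0..t} h"
proof -
  have 1: "(\<lambda>s. indicator {0..t} s * h s) \<in> sq_int lborel"
  proof -
    have "(\<integral>\<^sup>+s. ennreal ((indicator {0..t} s * h s)\<^sup>2) \<partial>lborel) = (\<integral>\<^sup>+s. indicator {0..t} s * ennreal ((h s)\<^sup>2) \<partial>lborel)"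
      by (rule nn_integral_cong) (auto simp: indicator_def)
    then show ?thesis using assms by (auto simp: sq_int_iff_nn_integral)
  qed
  have eq: "(indicator {0..t} s * h s)\<^sup>2 = indicator {0..t} s * (h s)\<^sup>2" for s by (auto simp: indicator_def)
  show "set_integrable lborel {0..t} (\<lambda>s. (h s)\<^sup>2)"
    using sq_int_integrable[OF 1] unfolding set_integrable_real eq .
  have 2: "(\<lambda>s. indicator {0..t} s) \<in> sq_int (lborel :: real measure)"
    by (auto simp: sq_int_def power2_eq_square indicator_inter_arith[symmetric] simp: emeasure_lborel_Icc_eq)
  have "integrable lborel (\<lambda>s. indicator {0..t} s * (indicator {0..t} s * h s))"
    using sq_int_mult_integrable[OF 2 1] by simp
  moreover have "indicator {0..t} s * (indicator {0..t} s * h s) = indicator {0..t} s * h s" for s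
    by (auto simp: indicator_def)
  ultimately show "set_integrable lborel {0..t} h" unfolding set_integrable_real by simp
qed

lemma mode_energy:
  fixes z h :: "real \<Rightarrow> real"
  assumes t: "0 \<le> t" and [measurable]: "z \<in> borel_measurable borel" "h \<in> borel_measurable borel"
    and int: "set_integrable lborel {0..t} (\<lambda>s. h s - a * z s)"
    and eq: "\<And>s. s \<in> {0..t} \<Longrightarrow> z s = z0 + (LINT r:{0..s}|lborel. h r - a * z r)"
  shows "set_integrable lborel {0..t} (\<lambda>s. 2 * z s * (h s - a * z s))"
    and "(z t)\<^sup>2 = z0\<^sup>2 + (LINT s:{0..t}|lborel. 2 * z s * (h s - a * z s))"
proof -
  have m: "(\<lambda>s. h s - a * z s) \<in> borel_measurable borel" by measurable
  have c: "(h s - a * z s) * z s + z s * (h s - a * z s) = 2 * z s * (h s - a * z s)" for s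
    by simp
  show "set_integrable lborel {0..t} (\<lambda>s. 2 * z s * (h s - a * z s))"
    using absolutely_continuous_prod(1)[OF t m m int int eq eq] unfolding c .
  show "(z t)\<^sup>2 = z0\<^sup>2 + (LINT s:{0..t}|lborel. 2 * z s * (h s - a * z s))"
    using absolutely_continuous_prod(2)[OF t m m int int eq eq] unfolding c by (simp add: power2_eq_square)
qed

text \<open>Testing the scalar equation with 2 a z leaves the identity h^2 - 2 a z (h - a z) = (h -
  a z)^2 + (a z)^2, whose first square is dropped. Working in \<open>ennreal\<close> allows the
  estimate to be summed over the modes before any finiteness is known.\<close>

lemma mode_energy_le:
  fixes z h :: "real \<Rightarrow> real"
  assumes t: "0 \<le> t" and [measurable]: "z \<in> borel_measurable borel" "h \<in> borel_measurable borel"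
    and a: "a > 0"
    and int: "set_integrable lborel {0..t} (\<lambda>s. h s - a * z s)"
    and eq: "\<And>s. s \<in> {0..t} \<Longrightarrow> z s = z0 + (LINT r:{0..s}|lborel. h r - a * z r)"
  shows "ennreal (a * (z t)\<^sup>2) + (\<integral>\<^sup>+s. indicator {0..t} s * ennreal ((a * z s)\<^sup>2) \<partial>lborel)
    \<le> ennreal (a * z0\<^sup>2) + (\<integral>\<^sup>+s. indicator {0..t} s * ennreal ((h s)\<^sup>2) \<partial>lborel)"
proof (cases "(\<integral>\<^sup>+s. indicator {0..t} s * ennreal ((h s)\<^sup>2) \<partial>lborel) < \<infinity>")
  case False
  then have "(\<integral>\<^sup>+s. indicator {0..t} s * ennreal ((h s)\<^sup>2) \<partial>lborel) = \<infinity>"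
    by (simp add: less_top[symmetric])
  then show ?thesis by simp
next
  case True
  note h2 = nn_set_integral_sq[OF assms(3) True]
  note E = mode_energy[OF t assms(2,3) int eq]
  have z2: "set_integrable lborel {0..t} (\<lambda>s. (a * z s)\<^sup>2)"
  proof (rule set_integrable_bound)
    show "set_integrable lborel {0..t} (\<lambda>s. (h s)\<^sup>2 - a * (2 * z s * (h s - a * z s)))"
      using h2(1) E(1) by (intro set_integral_diff set_integrable_mult_right)
    show "set_borel_measurable lborel {0..t} (\<lambda>s. (a * z s)\<^sup>2)"
      unfolding set_borel_measurable_def by measurable
    show "AE s in lborel. s \<in> {0..t} \<longrightarrow> norm ((a * z s)\<^sup>2) \<le> norm ((h s)\<^sup>2 - a * (2 * z s * (h s - a * z s)))"
    proof (rule AE_I2, rule impI)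
      fix s
      have "(h s)\<^sup>2 - a * (2 * z s * (h s - a * z s)) = (h s - a * z s)\<^sup>2 + (a * z s)\<^sup>2"
        by (simp add: power2_eq_square algebra_simps)
      then show "norm ((a * z s)\<^sup>2) \<le> norm ((h s)\<^sup>2 - a * (2 * z s * (h s - a * z s)))"
        by simp
    qed
  qed
  have conv: "(\<integral>\<^sup>+s. indicator {0..t} s * ennreal (g s) \<partial>lborel) = ennreal (LINT s:{0..t}|lborel. g s)"
    if "set_integrable lborel {0..t} g" "\<And>s. g s \<ge> 0" for g :: "real \<Rightarrow> real"
  proof -
    have "(\<integral>\<^sup>+s. indicator {0..t} s * ennreal (g s) \<partial>lborel) = (\<integral>\<^sup>+s. ennreal (indicator {0..t} s * g s) \<partial>lborel)"
      by (rule nn_integral_cong) (auto simp: indicator_def)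
    also have "\<dots> = ennreal (\<integral>s. indicator {0..t} s * g s \<partial>lborel)"
      using that by (intro nn_integral_eq_integral) (auto simp: set_integrable_real)
    finally show ?thesis by (simp add: set_lebesgue_integral_real)
  qed
  have nn: "(LINT s:{0..t}|lborel. g s) \<ge> 0" if "\<And>s. g s \<ge> 0" for g :: "real \<Rightarrow> real"
    unfolding set_lebesgue_integral_real by (rule integral_nonneg_AE) (use that in auto)
  have "a * (LINT s:{0..t}|lborel. 2 * z s * (h s - a * z s)) = (LINT s:{0..t}|lborel. a * (2 * z s * (h s - a * z s)))"
    by simp
  also have "\<dots> \<le> (LINT s:{0..t}|lborel. (h s)\<^sup>2 - (a * z s)\<^sup>2)"
  proof (rule set_integral_mono)
    fix s
    have "0 \<le> (h s - a * z s)\<^sup>2" by simp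
    then show "a * (2 * z s * (h s - a * z s)) \<le> (h s)\<^sup>2 - (a * z s)\<^sup>2"
      by (simp add: power2_eq_square algebra_simps)
  qed (use E(1) h2(1) z2 in \<open>auto intro!: set_integral_diff\<close>)
  also have "\<dots> = (LINT s:{0..t}|lborel. (h s)\<^sup>2) - (LINT s:{0..t}|lborel. (a * z s)\<^sup>2)"
    using h2(1) z2 by (rule set_integral_diff)
  finally have "a * (z t)\<^sup>2 + (LINT s:{0..t}|lborel. (a * z s)\<^sup>2) \<le> a * z0\<^sup>2 + (LINT s:{0..t}|lborel. (h s)\<^sup>2)"
    using E(2) by (simp add: algebra_simps)
  then show ?thesis using a conv[OF z2] conv[OF h2(1)] nn[of "\<lambda>s. (a * z s)\<^sup>2"] nn[of "\<lambda>s. (h s)\<^sup>2"]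
    by (simp add: ennreal_plus[symmetric] ennreal_leI del: ennreal_plus)
qed

text \<open>The three energies correspond to the norms of $H$, $V$ and $\mathrm{D}(A)$ when
  \<open>lam\<close> lists the eigenvalues of $-\Delta+\mathbf{1}$.\<close>

locale evolution =
  fixes lam :: "'k::countable \<Rightarrow> real" and nu :: real
  assumes lam_ge: "\<And>k. lam k \<ge> 1" and nu_pos: "nu > 0"
begin

text \<open>With extended values every family has an energy; lying in H, V or D(A) is finiteness of
  \<open>E0\<close>, \<open>E2\<close> or \<open>E4\<close>, and sums over modes can be exchanged
  with time integrals freely.\<close>

definition E0 :: "('k \<Rightarrow> real) \<Rightarrow> ennreal" where
  "E0 c = (\<integral>\<^sup>+k. ennreal ((c k)\<^sup>2) \<partial>count_space UNIV)"
definition E2 :: "('k \<Rightarrow> real) \<Rightarrow> ennreal" where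
  "E2 c = (\<integral>\<^sup>+k. ennreal ((lam k * c k)\<^sup>2) \<partial>count_space UNIV)"
definition E4 :: "('k \<Rightarrow> real) \<Rightarrow> ennreal" where
  "E4 c = (\<integral>\<^sup>+k. ennreal (((lam k)\<^sup>2 * c k)\<^sup>2) \<partial>count_space UNIV)"

text \<open>The equation z' + A z = h, z(0) = c, tested with each basis function and integrated in
  time. The modes are uncoupled because A is diagonal; coupling enters only when \<open>h\<close> is
  made to depend on \<open>z\<close>.\<close>

definition modes :: "real \<Rightarrow> ('k \<Rightarrow> real) \<Rightarrow> (real \<Rightarrow> 'k \<Rightarrow> real) \<Rightarrow> (real \<Rightarrow> 'k \<Rightarrow> real) \<Rightarrow> bool" where
  "modes T c h z \<longleftrightarrow> (\<forall>k. (\<lambda>t. z t k) \<in> borel_measurable borel \<and> (\<lambda>t. h t k) \<in> borel_measurable borel \<and>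
     set_integrable lborel {0..T} (\<lambda>s. h s k - nu * (lam k)\<^sup>2 * z s k) \<and>
     (\<forall>t\<in>{0..T}. z t k = c k + (LINT s:{0..t}|lborel. h s k - nu * (lam k)\<^sup>2 * z s k)))"

lemma lam_pos: "lam k > 0" using lam_ge[of k] by linarith

lemma measurable_E [measurable (raw)]:
  assumes "\<And>k. (\<lambda>t. z t k) \<in> borel_measurable M"
  shows "(\<lambda>t. E0 (z t)) \<in> borel_measurable M" "(\<lambda>t. E2 (z t)) \<in> borel_measurable M"
    "(\<lambda>t. E4 (z t)) \<in> borel_measurable M"
proof -
  note [measurable] = assms
  show "(\<lambda>t. E0 (z t)) \<in> borel_measurable M" "(\<lambda>t. E2 (z t)) \<in> borel_measurable M"
    "(\<lambda>t. E4 (z t)) \<in> borel_measurable M"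
    unfolding E0_def E2_def E4_def by (intro borel_measurable_nn_integral_count_space; measurable)+
qed

lemma E0_le_E2: "E0 c \<le> E2 c"
  unfolding E0_def E2_def
proof (intro nn_integral_mono ennreal_leI)
  fix k
  have "\<bar>c k\<bar> \<le> lam k * \<bar>c k\<bar>" using mult_right_mono[OF lam_ge[of k], of "\<bar>c k\<bar>"] by simp
  then show "(c k)\<^sup>2 \<le> (lam k * c k)\<^sup>2" using lam_pos[of k]
    by (intro abs_le_square_iff[THEN iffD1]) (simp add: abs_mult)
qed

lemma E2_le_E4: "E2 c \<le> E4 c"
proof -
  have "E2 c = E0 (\<lambda>k. lam k * c k)" "E4 c = E2 (\<lambda>k. lam k * c k)"
    by (simp_all add: E0_def E2_def E4_def power2_eq_square mult.assoc)
  then show ?thesis using E0_le_E2 by simp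
qed

lemma E2_diff_le: "E2 (\<lambda>k. c k - d k) \<le> 2 * (E2 c + E2 d)"
proof -
  have "E2 (\<lambda>k. c k - d k) \<le> (\<integral>\<^sup>+k. 2 * (ennreal ((lam k * c k)\<^sup>2) + ennreal ((lam k * d k)\<^sup>2)) \<partial>count_space UNIV)"
    unfolding E2_def
  proof (rule nn_integral_mono)
    fix k
    have "(x - y)\<^sup>2 \<le> 2 * (x\<^sup>2 + y\<^sup>2)" for x y :: real
      using sum_squares_bound[of x "-y"] by (simp add: power2_diff)
    from this[of "lam k * c k" "lam k * d k"]
    have "ennreal ((lam k * (c k - d k))\<^sup>2) \<le> ennreal (2 * (lam k * c k)\<^sup>2 + 2 * (lam k * d k)\<^sup>2)"
      by (intro ennreal_leI) (simp add: right_diff_distrib)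
    also have "\<dots> = 2 * (ennreal ((lam k * c k)\<^sup>2) + ennreal ((lam k * d k)\<^sup>2))"
      by (simp add: ennreal_plus ennreal_mult distrib_left)
    finally show "ennreal ((lam k * (c k - d k))\<^sup>2) \<le> 2 * (ennreal ((lam k * c k)\<^sup>2) + ennreal ((lam k * d k)\<^sup>2))" .
  qed
  also have "\<dots> = 2 * (E2 c + E2 d)"
    unfolding E2_def by (simp add: nn_integral_cmult nn_integral_add)
  finally show ?thesis .
qed

text \<open>Maximal regularity: data in V and forcing in L2(0,t;H) put z(t) in V and z in
  L2(0,t;D(A)). It is \<open>mode_energy_le\<close> with a = nu * lam^2, summed over the modes, the
  sum being exchanged with time by Tonelli.\<close>

lemma modes_energy_le:
  assumes t: "0 \<le> t" "t \<le> T" and m: "modes T c h z"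
  shows "ennreal nu * E2 (z t) + ennreal (nu\<^sup>2) * (\<integral>\<^sup>+s. indicator {0..t} s * E4 (z s) \<partial>lborel)
     \<le> ennreal nu * E2 c + (\<integral>\<^sup>+s. indicator {0..t} s * E0 (h s) \<partial>lborel)"
proof -
  note [measurable] = m[unfolded modes_def, rule_format, THEN conjunct1] m[unfolded modes_def, rule_format, THEN conjunct2, THEN conjunct1]
  let ?a = "\<lambda>k. nu * (lam k)\<^sup>2"
  have a: "?a k > 0" for k using nu_pos lam_pos[of k] by simp
  have each: "ennreal (?a k * (z t k)\<^sup>2) + (\<integral>\<^sup>+s. indicator {0..t} s * ennreal ((?a k * z s k)\<^sup>2) \<partial>lborel)
    \<le> ennreal (?a k * (c k)\<^sup>2) + (\<integral>\<^sup>+s. indicator {0..t} s * ennreal ((h s k)\<^sup>2) \<partial>lborel)" for k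
  proof (rule mode_energy_le[OF t(1) _ _ a])
    show "set_integrable lborel {0..t} (\<lambda>s. h s k - nu * (lam k)\<^sup>2 * z s k)"
      by (rule set_integrable_subset[of _ "{0..T}"]) (use m t in \<open>auto simp: modes_def\<close>)
  qed (use m t in \<open>auto simp: modes_def\<close>)
  have sw: "(\<integral>\<^sup>+k. \<integral>\<^sup>+s. indicator {0..t} s * ennreal (g s k) \<partial>lborel \<partial>count_space UNIV)
     = (\<integral>\<^sup>+s. indicator {0..t} s * (\<integral>\<^sup>+k. ennreal (g s k) \<partial>count_space UNIV) \<partial>lborel)"
    if "\<And>k. (\<lambda>s. g s k) \<in> borel_measurable borel" for g :: "real \<Rightarrow> 'k \<Rightarrow> real"
  proof -
    note [measurable] = that
    show ?thesis
      by (subst nn_integral_count_space_nn_integral[symmetric]) (auto intro!: nn_integral_cong nn_integral_cmult)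
  qed
  have "(\<integral>\<^sup>+k. ennreal (?a k * (z t k)\<^sup>2) + (\<integral>\<^sup>+s. indicator {0..t} s * ennreal ((?a k * z s k)\<^sup>2) \<partial>lborel) \<partial>count_space UNIV)
    \<le> (\<integral>\<^sup>+k. ennreal (?a k * (c k)\<^sup>2) + (\<integral>\<^sup>+s. indicator {0..t} s * ennreal ((h s k)\<^sup>2) \<partial>lborel) \<partial>count_space UNIV)"
    by (rule nn_integral_mono) (rule each)
  moreover have "(\<integral>\<^sup>+k. ennreal (?a k * (c k)\<^sup>2) \<partial>count_space UNIV) = ennreal nu * E2 c" for c
    unfolding E2_def using nu_pos by (simp add: nn_integral_cmult[symmetric] ennreal_mult[symmetric] power_mult_distrib mult.assoc)
  moreover have "(\<integral>\<^sup>+k. \<integral>\<^sup>+s. indicator {0..t} s * ennreal ((?a k * z s k)\<^sup>2) \<partial>lborel \<partial>count_space UNIV)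
      = ennreal (nu\<^sup>2) * (\<integral>\<^sup>+s. indicator {0..t} s * E4 (z s) \<partial>lborel)"
  proof -
    have "(\<integral>\<^sup>+k. ennreal ((?a k * z s k)\<^sup>2) \<partial>count_space UNIV) = ennreal (nu\<^sup>2) * E4 (z s)" for s
      unfolding E4_def by (simp add: nn_integral_cmult[symmetric] ennreal_mult[symmetric] power_mult_distrib mult.assoc)
    moreover have "(\<integral>\<^sup>+s. indicator {0..t} s * (ennreal (nu\<^sup>2) * E4 (z s)) \<partial>lborel) = ennreal (nu\<^sup>2) * (\<integral>\<^sup>+s. indicator {0..t} s * E4 (z s) \<partial>lborel)"
      by (subst nn_integral_cmult[symmetric]) (auto simp: ac_simps)
    ultimately show ?thesis by (subst sw) auto
  qed
  moreover have "(\<integral>\<^sup>+k. \<integral>\<^sup>+s. indicator {0..t} s * ennreal ((h s k)\<^sup>2) \<partial>lborel \<partial>count_space UNIV)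
      = (\<integral>\<^sup>+s. indicator {0..t} s * E0 (h s) \<partial>lborel)"
    by (subst sw) (auto simp: E0_def)
  ultimately show ?thesis by (simp add: nn_integral_add)
qed

lemma modes_diff:
  assumes "modes T c h z" "modes T d g w"
  shows "modes T (\<lambda>k. c k - d k) (\<lambda>t k. h t k - g t k) (\<lambda>t k. z t k - w t k)"
  unfolding modes_def
proof (intro allI conjI ballI)
  fix k
  note z = assms(1)[unfolded modes_def, rule_format, of k] and w = assms(2)[unfolded modes_def, rule_format, of k]
  show "(\<lambda>t. z t k - w t k) \<in> borel_measurable borel" "(\<lambda>t. h t k - g t k) \<in> borel_measurable borel"
    using z w by auto
  have eq: "h s k - g s k - nu * (lam k)\<^sup>2 * (z s k - w s k) = (h s k - nu * (lam k)\<^sup>2 * z s k) - (g s k - nu * (lam k)\<^sup>2 * w s k)" for s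
    by (simp add: algebra_simps)
  show "set_integrable lborel {0..T} (\<lambda>s. h s k - g s k - nu * (lam k)\<^sup>2 * (z s k - w s k))"
    unfolding eq by (rule set_integral_diff(1)) (use z w in blast)+
  fix t assume t: "t \<in> {0..T}"
  have i: "set_integrable lborel {0..t} (\<lambda>s. h s k - nu * (lam k)\<^sup>2 * z s k)"
          "set_integrable lborel {0..t} (\<lambda>s. g s k - nu * (lam k)\<^sup>2 * w s k)"
    using z w t by (auto intro: set_integrable_subset[of lborel "{0..T}"])
  have "(LINT s:{0..t}|lborel. h s k - g s k - nu * (lam k)\<^sup>2 * (z s k - w s k))
    = (LINT s:{0..t}|lborel. h s k - nu * (lam k)\<^sup>2 * z s k) - (LINT s:{0..t}|lborel. g s k - nu * (lam k)\<^sup>2 * w s k)"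
    unfolding eq using i by (rule set_integral_diff)
  then show "z t k - w t k = c k - d k + (LINT s:{0..t}|lborel. h s k - g s k - nu * (lam k)\<^sup>2 * (z s k - w s k))"
    using z w t by auto
qed

lemma modes_exist:
  assumes meas: "\<And>k. (\<lambda>t. h t k) \<in> borel_measurable borel"
    and fin: "\<And>t. t \<ge> 0 \<Longrightarrow> (\<integral>\<^sup>+s. indicator {0..t} s * E0 (h s) \<partial>lborel) < \<infinity>"
  shows "\<exists>z. (\<forall>T\<ge>0. modes T c h z) \<and> (\<forall>t\<le>0. z t = c) \<and> (\<forall>k. continuous_on UNIV (\<lambda>t. z t k))"
proof -
  have int: "set_integrable lborel {0..t} (\<lambda>s. h s k)" if "t \<ge> 0" for t k
  proof (rule nn_set_integral_sq(2))
    have "(\<integral>\<^sup>+s. indicator {0..t} s * ennreal ((h s k)\<^sup>2) \<partial>lborel) \<le> (\<integral>\<^sup>+s. indicator {0..t} s * E0 (h s) \<partial>lborel)"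
      unfolding E0_def by (intro nn_integral_mono mult_left_mono nn_integral_count_space_ge_single) auto
    then show "(\<integral>\<^sup>+s. indicator {0..t} s * ennreal ((h s k)\<^sup>2) \<partial>lborel) < \<infinity>"
      using fin[OF that] by (rule le_less_trans)
  qed (rule meas)
  have "\<exists>z. (\<forall>t\<le>0. z t = c k) \<and> continuous_on UNIV z \<and>
     (\<forall>t\<ge>0. set_integrable lborel {0..t} (\<lambda>s. h s k - nu * (lam k)\<^sup>2 * z s)) \<and>
     (\<forall>t\<ge>0. z t = c k + (LINT s:{0..t}|lborel. h s k - nu * (lam k)\<^sup>2 * z s))" for k
    by (rule mode_solution[OF meas[where k = k] int[where k = k], where ?z0.0 = "c k" and a = "nu * (lam k)\<^sup>2"]) blast+
  from choice[OF allI, OF this] obtain z where z: "\<forall>k. (\<forall>t\<le>0. z k t = c k) \<and> continuous_on UNIV (z k) \<and>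
     (\<forall>t\<ge>0. set_integrable lborel {0..t} (\<lambda>s. h s k - nu * (lam k)\<^sup>2 * z k s)) \<and>
     (\<forall>t\<ge>0. z k t = c k + (LINT s:{0..t}|lborel. h s k - nu * (lam k)\<^sup>2 * z k s))" ..
  show ?thesis
  proof (intro exI[of _ "\<lambda>t k. z k t"] conjI allI impI)
    show "modes T c h (\<lambda>t k. z k t)" if "T \<ge> 0" for T
      unfolding modes_def using z that meas by (auto intro: borel_measurable_continuous_onI)
  qed (use z in auto)
qed

text \<open>The factor 1/\<kappa> gained from an exponential weight is what lets the Picard map
  contract on the whole half line rather than on short intervals.\<close>

lemma exp_weight_integral:
  assumes "t \<ge> 0" "\<kappa> > 0" "D \<ge> 0" "K \<ge> 0"
    and le: "AE s in lborel. s \<in> {0..t} \<longrightarrow> F s \<le> ennreal K * ennreal (D * exp (\<kappa> * s))"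
  shows "(\<integral>\<^sup>+s. indicator {0..t} s * F s \<partial>lborel) \<le> ennreal (K * D * exp (\<kappa> * t) / \<kappa>)"
proof -
  have "(\<integral>\<^sup>+s. indicator {0..t} s * F s \<partial>lborel) \<le> (\<integral>\<^sup>+s. ennreal (K * D * exp (\<kappa> * s)) * indicator {0..t} s \<partial>lborel)"
    using le by (intro nn_integral_mono_AE) (auto elim!: eventually_mono simp: indicator_def ennreal_mult[symmetric] assms mult.assoc)
  also have "\<dots> = ennreal (K * D * exp (\<kappa> * t) / \<kappa> - K * D * exp (\<kappa> * 0) / \<kappa>)"
    using assms by (intro nn_integral_FTC_Icc) (auto intro!: derivative_eq_intros)
  also have "\<dots> \<le> ennreal (K * D * exp (\<kappa> * t) / \<kappa>)"
    using assms by (intro ennreal_leI) simp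
  finally show ?thesis .
qed

text \<open>The weight exp(4 K t / nu) is chosen so that K divided by its rate is nu/4. After
  division by nu the squared distance shrinks by the factor 1/4, so the distance itself is
  halved.\<close>

lemma modes_contraction:
  assumes t: "t \<ge> 0" "t \<le> T" and K: "K > 0" and D: "D \<ge> 0"
    and m: "modes T c h z" "modes T c g w"
    and le: "AE s in lborel. s \<in> {0..t} \<longrightarrow> E0 (\<lambda>k. h s k - g s k) \<le> ennreal K * ennreal (D * exp (4 * K / nu * s))"
  shows "E2 (\<lambda>k. z t k - w t k) \<le> ennreal (D / 4 * exp (4 * K / nu * t))"
proof -
  let ?d = "\<lambda>t k. z t k - w t k"
  have "ennreal nu * E2 (?d t) \<le> ennreal nu * E2 (?d t) + ennreal (nu\<^sup>2) * (\<integral>\<^sup>+s. indicator {0..t} s * E4 (?d s) \<partial>lborel)"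
    by (rule add_increasing2) auto
  also have "\<dots> \<le> ennreal nu * E2 (\<lambda>k. c k - c k) + (\<integral>\<^sup>+s. indicator {0..t} s * E0 (\<lambda>k. h s k - g s k) \<partial>lborel)"
    by (rule modes_energy_le[OF t modes_diff[OF m]])
  also have "\<dots> = (\<integral>\<^sup>+s. indicator {0..t} s * E0 (\<lambda>k. h s k - g s k) \<partial>lborel)"
    by (simp add: E2_def)
  also have "\<dots> \<le> ennreal (K * D * exp (4 * K / nu * t) / (4 * K / nu))"
    by (rule exp_weight_integral) (use t K D nu_pos le in auto)
  also have "K * D * exp (4 * K / nu * t) / (4 * K / nu) = nu * (D / 4 * exp (4 * K / nu * t))"
    using K nu_pos by (simp add: field_simps)
  also have "ennreal \<dots> = ennreal nu * ennreal (D / 4 * exp (4 * K / nu * t))"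
    using nu_pos D by (intro ennreal_mult) auto
  finally show ?thesis
    using nu_pos by (simp add: ennreal_mult_le_mult_iff)
qed

lemma E2_zero_imp_eq:
  assumes "\<And>n. E2 (\<lambda>k. c k - d k) \<le> ennreal (B * (1/4)^n)"
  shows "c = d"
proof
  fix k
  have "(\<lambda>n. B * (1/4)^n) \<longlonglongrightarrow> B * 0"
    by (intro tendsto_intros LIMSEQ_realpow_zero) auto
  moreover have "(lam k * (c k - d k))\<^sup>2 \<le> max 0 (B * (1/4)^n)" for n
  proof -
    have "ennreal ((lam k * (c k - d k))\<^sup>2) \<le> ennreal (B * (1/4)^n)"
      using nn_integral_count_space_ge_single[of "\<lambda>k. ennreal ((lam k * (c k - d k))\<^sup>2)" k] assms[of n]
      unfolding E2_def by (rule order_trans)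
    then show ?thesis by (cases "B * (1/4)^n \<ge> 0") (auto simp: ennreal_neg)
  qed
  ultimately have "(lam k * (c k - d k))\<^sup>2 \<le> max 0 (B * 0)"
    by (intro tendsto_lowerbound[OF tendsto_max[OF tendsto_const]]) auto
  then show "c k = d k" using lam_pos[of k] by simp
qed

text \<open>Iterating the contraction on one fixed pair of solutions multiplies a crude bound
  \<open>B\<close> by 4^-n. The Lipschitz inequality is asked only along the two curves and only for
  almost every time, because the forcing of a given strong solution is identified only up to null
  sets of times.\<close>

lemma modes_unique:
  assumes K: "K > 0" and m: "modes T c h z" "modes T c g w"
    and lip: "AE s in lborel. s \<in> {0..T} \<longrightarrow> E0 (\<lambda>k. h s k - g s k) \<le> ennreal K * E2 (\<lambda>k. z s k - w s k)"
    and B: "B \<ge> 0" "\<And>s. s \<in> {0..T} \<Longrightarrow> E2 (\<lambda>k. z s k - w s k) \<le> ennreal B"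
    and t: "t \<in> {0..T}"
  shows "z t = w t"
proof (rule E2_zero_imp_eq)
  have main: "E2 (\<lambda>k. z t k - w t k) \<le> ennreal (B * (1/4)^n * exp (4 * K / nu * t))" if "t \<in> {0..T}" for t n
    using that
  proof (induction n arbitrary: t)
    case 0
    have "B * 1 \<le> B * exp (4 * K / nu * t)" using B 0 K nu_pos by (intro mult_left_mono) auto
    then show ?case using B(2)[OF 0] by (auto intro: order_trans ennreal_leI)
  next
    case (Suc n)
    have "E2 (\<lambda>k. z t k - w t k) \<le> ennreal ((B * (1/4)^n) / 4 * exp (4 * K / nu * t))"
    proof (rule modes_contraction[OF _ _ K _ m])
      show "AE s in lborel. s \<in> {0..t} \<longrightarrow> E0 (\<lambda>k. h s k - g s k) \<le> ennreal K * ennreal ((B * (1/4)^n) * exp (4 * K / nu * s))"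
        using lip
      proof eventually_elim
        case (elim s)
        show ?case
        proof
          assume s: "s \<in> {0..t}"
          then have "E0 (\<lambda>k. h s k - g s k) \<le> ennreal K * E2 (\<lambda>k. z s k - w s k)" using elim Suc.prems by auto
          also have "\<dots> \<le> ennreal K * ennreal ((B * (1/4)^n) * exp (4 * K / nu * s))"
            using Suc.IH[of s] s Suc.prems by (intro mult_left_mono) auto
          finally show "E0 (\<lambda>k. h s k - g s k) \<le> ennreal K * ennreal ((B * (1/4)^n) * exp (4 * K / nu * s))" .
        qed
      qed
    qed (use Suc.prems B in auto)
    then show ?case by simp
  qed
  show "E2 (\<lambda>k. z t k - w t k) \<le> ennreal (B * exp (4 * K / nu * t) * (1/4)^n)" for n
    using main[OF t, of n] by (simp add: mult_ac)
qed

text \<open>The energy identities of the single modes are summed to one for the square of the V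
  norm, which makes it an indefinite integral; the dissipation inequality then enters under the
  integral and \<open>exp_decay_of_integral_inequality\<close> concludes. Dissipation is demanded
  only where z(s) lies in D(A) and h(s) in H, which holds for almost every s.\<close>

lemma modes_decay:
  assumes m: "\<And>T. T \<ge> 0 \<Longrightarrow> modes T c h z" and c: "E2 c < \<infinity>"
    and hfin: "\<And>t. t \<ge> 0 \<Longrightarrow> (\<integral>\<^sup>+s. indicator {0..t} s * E0 (h s) \<partial>lborel) < \<infinity>"
    and \<mu>: "\<mu> \<ge> 0"
    and dis: "\<And>s. s \<ge> 0 \<Longrightarrow> E4 (z s) < \<infinity> \<Longrightarrow> E0 (h s) < \<infinity> \<Longrightarrow>
       (\<integral>k. 2 * (lam k)\<^sup>2 * z s k * (h s k - nu * (lam k)\<^sup>2 * z s k) \<partial>count_space UNIV)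
         \<le> - \<mu> * (\<integral>k. (lam k * z s k)\<^sup>2 \<partial>count_space UNIV)"
    and st: "0 \<le> s" "s \<le> t"
  shows "(\<integral>k. (lam k * z t k)\<^sup>2 \<partial>count_space UNIV) \<le> exp (- \<mu> * (t - s)) * (\<integral>k. (lam k * z s k)\<^sup>2 \<partial>count_space UNIV)"
proof -
  note [measurable] = m[OF order_refl, unfolded modes_def, rule_format, THEN conjunct1] m[OF order_refl, unfolded modes_def, rule_format, THEN conjunct2, THEN conjunct1]
  define \<phi> where "\<phi> t = (\<integral>k. (lam k * z t k)\<^sup>2 \<partial>count_space UNIV)" for t
  define g where "g s k = 2 * (lam k)\<^sup>2 * z s k * (h s k - nu * (lam k)\<^sup>2 * z s k)" for s k
  have [measurable]: "(\<lambda>s. g s k) \<in> borel_measurable borel" for k unfolding g_def by measurable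
  have en: "ennreal nu * E2 (z t) < \<infinity>" "ennreal (nu\<^sup>2) * (\<integral>\<^sup>+s. indicator {0..t} s * E4 (z s) \<partial>lborel) < \<infinity>" if "t \<ge> 0" for t
  proof -
    have "ennreal nu * E2 c + (\<integral>\<^sup>+s. indicator {0..t} s * E0 (h s) \<partial>lborel) < \<infinity>"
      using c hfin[OF that] by (simp add: ennreal_mult_less_top)
    with modes_energy_le[OF that order_refl m[OF that]]
    have "ennreal nu * E2 (z t) + ennreal (nu\<^sup>2) * (\<integral>\<^sup>+s. indicator {0..t} s * E4 (z s) \<partial>lborel) < \<infinity>"
      by (rule le_less_trans)
    then show "ennreal nu * E2 (z t) < \<infinity>" "ennreal (nu\<^sup>2) * (\<integral>\<^sup>+s. indicator {0..t} s * E4 (z s) \<partial>lborel) < \<infinity>"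
      by (auto simp: less_top)
  qed
  have E2fin: "E2 (z t) < \<infinity>" if "t \<ge> 0" for t
    using en(1)[OF that] nu_pos by (auto simp: ennreal_mult_less_top)
  have E4fin: "(\<integral>\<^sup>+s. indicator {0..t} s * E4 (z s) \<partial>lborel) < \<infinity>" if "t \<ge> 0" for t
    using en(2)[OF that] nu_pos by (auto simp: ennreal_mult_less_top)
  have \<phi>: "ennreal (\<phi> t) = E2 (z t)" "integrable (count_space UNIV) (\<lambda>k. (lam k * z t k)\<^sup>2)" if "t \<ge> 0" for t
  proof -
    show i: "integrable (count_space UNIV) (\<lambda>k. (lam k * z t k)\<^sup>2)"
      using E2fin[OF that] by (auto simp: integrable_iff_bounded E2_def)
    show "ennreal (\<phi> t) = E2 (z t)"
      unfolding \<phi>_def E2_def by (rule nn_integral_eq_integral[symmetric]) (use i in auto)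
  qed
  have \<phi>_nn: "\<phi> t \<ge> 0" for t unfolding \<phi>_def by (rule integral_nonneg_AE) auto
  \<comment> \<open>Nothing is known of the energy at negative times, so \<phi> is cut off there
    before it is compared with \<open>E2\<close>.\<close>
  have \<phi>_meas [measurable]: "(\<lambda>t. if t \<ge> 0 then \<phi> t else 0) \<in> borel_measurable borel"
  proof -
    have "(\<lambda>t. if t \<ge> 0 then \<phi> t else 0) = (\<lambda>t. if t \<ge> 0 then enn2real (E2 (z t)) else 0)"
      by (auto simp: fun_eq_iff \<phi>(1)[symmetric] \<phi>_nn)
    also have "\<dots> \<in> borel_measurable borel" by measurable
    finally show ?thesis .
  qed
  have \<phi>int: "set_integrable lborel {0..t} \<phi>" if "t \<ge> 0" for t
  proof -
    have "integrable lborel (\<lambda>s. indicator {0..t} s * (if s \<ge> 0 then \<phi> s else 0))"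
    proof (rule integrableI_nonneg)
      have "(\<integral>\<^sup>+s. ennreal (indicator {0..t} s * (if s \<ge> 0 then \<phi> s else 0)) \<partial>lborel)
         \<le> (\<integral>\<^sup>+s. indicator {0..t} s * E4 (z s) \<partial>lborel)"
        using E2_le_E4 \<phi>(1) by (intro nn_integral_mono) (auto simp: indicator_def)
      then show "(\<integral>\<^sup>+s. ennreal (indicator {0..t} s * (if s \<ge> 0 then \<phi> s else 0)) \<partial>lborel) < \<infinity>"
        using E4fin[OF that] by (rule le_less_trans)
    qed (auto simp: \<phi>_def intro!: AE_I2 integral_nonneg_AE)
    then show ?thesis unfolding set_integrable_real
      by (rule Bochner_Integration.integrable_cong[THEN iffD1, rotated -1]) (auto simp: indicator_def)
  qed
  interpret P: pair_sigma_finite lborel "count_space (UNIV :: 'k set)"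
    by (intro pair_sigma_finite.intro sigma_finite_measure_count_space lborel.sigma_finite_measure_axioms)
  have ineq: "\<phi> t \<le> \<phi> s - \<mu> * (LINT r:{s..t}|lborel. \<phi> r)" if st: "0 \<le> s" "s \<le> t" for s t
  proof -
    have t0: "t \<ge> 0" using st by simp
    let ?G = "\<lambda>(r, k). indicator {s<..t} r * g r k"
    have Gm [measurable]: "?G \<in> borel_measurable (lborel \<Otimes>\<^sub>M count_space UNIV)"
    proof -
      have [measurable]: "(\<lambda>x. case x of (k, r) \<Rightarrow> indicator {s<..t} r * g r k) \<in> borel_measurable (count_space UNIV \<Otimes>\<^sub>M lborel)"
        by (rule measurable_pair_measure_countable1) auto
      have "(\<lambda>w. (\<lambda>(k, r). indicator {s<..t} r * g r k) ((\<lambda>(r, k). (k, r)) w)) \<in> borel_measurable (lborel \<Otimes>\<^sub>M count_space UNIV)"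
        by measurable
      then show ?thesis by (simp add: split_def)
    qed
    \<comment> \<open>The exchange of sum and integral now concerns terms of both signs; this
      majorant, built from the D(A) energy of z and the H energy of h, makes the double integral
      absolutely convergent.\<close>
    have gb: "\<bar>g r k\<bar> \<le> (1 + 2 * nu) * ((lam k)\<^sup>2 * z r k)\<^sup>2 + (h r k)\<^sup>2" for r k
    proof -
      have *: "\<bar>2 * (x * y) - 2 * nu * x\<^sup>2\<bar> \<le> (1 + 2 * nu) * x\<^sup>2 + y\<^sup>2" for x y :: real
      proof -
        have 1: "\<bar>2 * (x * y)\<bar> \<le> x\<^sup>2 + y\<^sup>2"
          using sum_squares_bound[of "\<bar>x\<bar>" "\<bar>y\<bar>"] by (simp add: abs_mult)
        have 2: "\<bar>2 * nu * x\<^sup>2\<bar> = 2 * nu * x\<^sup>2" using nu_pos by simp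
        have "\<bar>2 * (x * y) - 2 * nu * x\<^sup>2\<bar> \<le> \<bar>2 * (x * y)\<bar> + \<bar>2 * nu * x\<^sup>2\<bar>"
          by (rule abs_triangle_ineq4)
        also have "\<dots> \<le> (x\<^sup>2 + y\<^sup>2) + 2 * nu * x\<^sup>2" using 1 unfolding 2 by (rule add_right_mono)
        also have "\<dots> = (1 + 2 * nu) * x\<^sup>2 + y\<^sup>2" by (simp add: algebra_simps)
        finally show ?thesis .
      qed
      have "g r k = 2 * ((lam k)\<^sup>2 * z r k * h r k) - 2 * nu * ((lam k)\<^sup>2 * z r k)\<^sup>2"
        by (simp add: g_def power2_eq_square algebra_simps)
      then show ?thesis using *[of "(lam k)\<^sup>2 * z r k" "h r k"] by simp
    qed
    have Gint: "integrable (lborel \<Otimes>\<^sub>M count_space UNIV) ?G"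
      unfolding integrable_iff_bounded
    proof (intro conjI Gm)
      have "(\<integral>\<^sup>+x. ennreal (norm (?G x)) \<partial>(lborel \<Otimes>\<^sub>M count_space UNIV))
         = (\<integral>\<^sup>+r. \<integral>\<^sup>+k. ennreal (norm (?G (r, k))) \<partial>count_space UNIV \<partial>lborel)"
        by (rule P.M2.nn_integral_fst[symmetric]) measurable
      also have "\<dots> \<le> (\<integral>\<^sup>+r. ennreal (1 + 2 * nu) * (indicator {0..t} r * E4 (z r)) + indicator {0..t} r * E0 (h r) \<partial>lborel)"
      proof (rule nn_integral_mono)
        fix r
        show "(\<integral>\<^sup>+k. ennreal (norm (?G (r, k))) \<partial>count_space UNIV) \<le> ennreal (1 + 2 * nu) * (indicator {0..t} r * E4 (z r)) + indicator {0..t} r * E0 (h r)"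
        proof (cases "r \<in> {s<..t}")
          case True
          have "(\<integral>\<^sup>+k. ennreal (norm (?G (r, k))) \<partial>count_space UNIV) \<le> (\<integral>\<^sup>+k. ennreal (1 + 2 * nu) * ennreal (((lam k)\<^sup>2 * z r k)\<^sup>2) + ennreal ((h r k)\<^sup>2) \<partial>count_space UNIV)"
            using gb nu_pos True by (intro nn_integral_mono) (auto simp: ennreal_mult[symmetric] ennreal_plus[symmetric] simp del: ennreal_plus intro!: ennreal_leI)
          also have "\<dots> = ennreal (1 + 2 * nu) * E4 (z r) + E0 (h r)"
            unfolding E4_def E0_def by (simp add: nn_integral_add nn_integral_cmult)
          finally show ?thesis using True st by (auto simp: indicator_def)
        qed simp
      qed
      also have "\<dots> = ennreal (1 + 2 * nu) * (\<integral>\<^sup>+r. indicator {0..t} r * E4 (z r) \<partial>lborel) + (\<integral>\<^sup>+r. indicator {0..t} r * E0 (h r) \<partial>lborel)"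
        by (subst nn_integral_add) (auto simp: nn_integral_cmult)
      also have "\<dots> < \<infinity>" using E4fin[OF t0] hfin[OF t0] by (simp add: ennreal_mult_less_top)
      finally show "(\<integral>\<^sup>+x. ennreal (norm (?G x)) \<partial>(lborel \<Otimes>\<^sub>M count_space UNIV)) < \<infinity>" .
    qed
    have mode: "(lam k * z t k)\<^sup>2 - (lam k * z s k)\<^sup>2 = (\<integral>r. ?G (r, k) \<partial>lborel)" for k
    proof -
      have *: "set_integrable lborel {0..\<tau>} (\<lambda>s. 2 * z s k * (h s k - nu * (lam k)\<^sup>2 * z s k)) \<and>
         (z \<tau> k)\<^sup>2 = (c k)\<^sup>2 + (LINT s:{0..\<tau>}|lborel. 2 * z s k * (h s k - nu * (lam k)\<^sup>2 * z s k))" if "\<tau> \<ge> 0" for \<tau>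
        using mode_energy[OF that, of "\<lambda>t. z t k" "\<lambda>t. h t k" "nu * (lam k)\<^sup>2" "c k"] m[OF that]
        unfolding modes_def by blast
      let ?f = "\<lambda>s. 2 * z s k * (h s k - nu * (lam k)\<^sup>2 * z s k)"
      have un: "{0..t} = {0..s} \<union> {s<..t}" using st by auto
      have sub: "set_integrable lborel {s<..t} ?f"
        by (rule set_integrable_subset[OF *[OF t0, THEN conjunct1]]) (use st in auto)
      have "(LINT r:{0..t}|lborel. ?f r) = (LINT r:{0..s}|lborel. ?f r) + (LINT r:{s<..t}|lborel. ?f r)"
        unfolding un by (rule set_integral_Un[OF _ *[OF st(1), THEN conjunct1] sub]) auto
      then have "(z t k)\<^sup>2 - (z s k)\<^sup>2 = (LINT r:{s<..t}|lborel. ?f r)"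
        using *[OF t0] *[OF st(1)] by simp
      then have "(lam k)\<^sup>2 * ((z t k)\<^sup>2 - (z s k)\<^sup>2) = (\<integral>r. (lam k)\<^sup>2 * (indicator {s<..t} r * ?f r) \<partial>lborel)"
        by (simp add: set_lebesgue_integral_real)
      also have "\<dots> = (\<integral>r. ?G (r, k) \<partial>lborel)"
        by (rule Bochner_Integration.integral_cong) (auto simp: g_def)
      finally show ?thesis by (simp add: power_mult_distrib right_diff_distrib)
    qed
    have "\<phi> t - \<phi> s = (\<integral>k. (lam k * z t k)\<^sup>2 - (lam k * z s k)\<^sup>2 \<partial>count_space UNIV)"
      unfolding \<phi>_def using \<phi>(2)[OF t0] \<phi>(2)[OF st(1)] by (rule Bochner_Integration.integral_diff[symmetric])
    also have "\<dots> = (\<integral>k. (\<integral>r. ?G (r, k) \<partial>lborel) \<partial>count_space UNIV)"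
      unfolding mode ..
    also have "\<dots> = (\<integral>x. ?G x \<partial>(lborel \<Otimes>\<^sub>M count_space UNIV))"
      using P.integral_snd[of "\<lambda>r k. indicator {s<..t} r * g r k"] Gint by simp
    also have "\<dots> = (\<integral>r. (\<integral>k. ?G (r, k) \<partial>count_space UNIV) \<partial>lborel)"
      by (rule P.integral_fst'[OF Gint, symmetric])
    also have "\<dots> \<le> (\<integral>r. - \<mu> * (indicator {s..t} r * \<phi> r) \<partial>lborel)"
    proof (rule integral_mono_AE)
      show "integrable lborel (\<lambda>r. \<integral>k. ?G (r, k) \<partial>count_space UNIV)"
        by (rule P.integrable_fst'[OF Gint])
      have "set_integrable lborel {s..t} \<phi>"
        by (rule set_integrable_subset[OF \<phi>int[OF t0]]) (use st in auto)
      then show "integrable lborel (\<lambda>r. - \<mu> * (indicator {s..t} r * \<phi> r))"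
        unfolding set_integrable_real by (rule integrable_mult_right)
      have "AE r in lborel. indicator {0..t} r * E4 (z r) \<noteq> \<infinity>"
        by (rule nn_integral_noteq_infinite) (use E4fin[OF t0] in auto)
      moreover have "AE r in lborel. indicator {0..t} r * E0 (h r) \<noteq> \<infinity>"
        by (rule nn_integral_noteq_infinite) (use hfin[OF t0] in auto)
      \<comment> \<open>\<open>?G\<close> lives on the half open interval, the bound on the closed
        one; they differ at the point s.\<close>
      moreover have "AE r in lborel. r \<noteq> s" by (rule AE_lborel_singleton)
      ultimately show "AE r in lborel. (\<integral>k. ?G (r, k) \<partial>count_space UNIV) \<le> - \<mu> * (indicator {s..t} r * \<phi> r)"
      proof eventually_elim
        case (elim r)
        show ?case
        proof (cases "r \<in> {s<..t}")
          case True
          then have "r \<ge> 0" "E4 (z r) < \<infinity>" "E0 (h r) < \<infinity>" using st elim by (auto simp: indicator_def less_top split: if_splits)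
          from dis[OF this] show ?thesis using True by (simp add: g_def \<phi>_def)
        qed (use elim in \<open>auto simp: indicator_def\<close>)
      qed
    qed
    finally show ?thesis by (simp add: set_lebesgue_integral_real)
  qed
  show ?thesis
    using exp_decay_of_integral_inequality[of \<phi> \<mu> s t] ineq \<phi>int \<mu> st unfolding \<phi>_def by (simp add: integral_nonneg_AE)
qed

end

section \<open>Lipschitz perturbations\<close>

text \<open>\<open>N\<close> is a time dependent map from V to H that is globally Lipschitz,
  uniformly in time. The energies are squared norms, so \<open>K\<close> is the square of a
  Lipschitz constant. Measurability is asked along curves with values in V, where the radial
  truncation can be handled.\<close>

locale evolution_rhs = evolution lam nu for lam :: "'k::countable \<Rightarrow> real" and nu +
  fixes N :: "real \<Rightarrow> ('k \<Rightarrow> real) \<Rightarrow> 'k \<Rightarrow> real" and K :: real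
  assumes K_pos: "K > 0"
    and N_lip: "\<And>t c d. E2 c < \<infinity> \<Longrightarrow> E2 d < \<infinity> \<Longrightarrow>
      E0 (\<lambda>k. N t c k - N t d k) \<le> ennreal K * E2 (\<lambda>k. c k - d k)"
    and N_zero: "\<And>t k. N t (\<lambda>k. 0) k = 0"
    and N_meas: "\<And>Z k. (\<And>k. (\<lambda>t. Z t k) \<in> borel_measurable borel) \<Longrightarrow> (\<And>t. E2 (Z t) < \<infinity>) \<Longrightarrow>
      (\<lambda>t. N t (Z t) k) \<in> borel_measurable borel"
begin

text \<open>One Picard step: the forcing is frozen along \<open>Z\<close> and the linear problem is
  solved. A solution of the nonlinear problem is a fixed point \<open>is_step c Z Z\<close>.\<close>

definition is_step :: "('k \<Rightarrow> real) \<Rightarrow> (real \<Rightarrow> 'k \<Rightarrow> real) \<Rightarrow> (real \<Rightarrow> 'k \<Rightarrow> real) \<Rightarrow> bool" where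
  "is_step c Z z \<longleftrightarrow> (\<forall>T\<ge>0. modes T c (\<lambda>t. N t (Z t)) z) \<and> (\<forall>t\<le>0. z t = c) \<and> (\<forall>k. continuous_on UNIV (\<lambda>t. z t k))"

definition growth :: "real \<Rightarrow> real" where "growth t = exp (4 * K / nu * max 0 t)"

text \<open>A bound that reproduces itself under a Picard step: with e the energy of the datum, the
  step gives at most e + e * growth / 2, and growth \<ge> 1 brings this below 2 e * growth.\<close>

definition admissible :: "('k \<Rightarrow> real) \<Rightarrow> (real \<Rightarrow> 'k \<Rightarrow> real) \<Rightarrow> bool" where
  "admissible c Z \<longleftrightarrow> (\<forall>k. (\<lambda>t. Z t k) \<in> borel_measurable borel) \<and>
     (\<forall>t. E2 (Z t) \<le> ennreal (2 * enn2real (E2 c) * growth t))"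

lemma growth_ge: "growth t \<ge> 1"
  using K_pos nu_pos by (simp add: growth_def)

lemma admissible_fin: "admissible c Z \<Longrightarrow> E2 (Z t) < \<infinity>"
  unfolding admissible_def by (metis ennreal_less_top infinity_ennreal_def le_less_trans)

lemma N_bound: "E2 u < \<infinity> \<Longrightarrow> E0 (N t u) \<le> ennreal K * E2 u"
  using N_lip[of u "\<lambda>k. 0" t] by (simp add: N_zero E2_def)

lemma admissible_integral:
  assumes "admissible c Z" "t \<ge> 0"
  shows "(\<integral>\<^sup>+s. indicator {0..t} s * E0 (N s (Z s)) \<partial>lborel) \<le> ennreal (nu * (enn2real (E2 c) * growth t / 2))"
proof -
  let ?e = "enn2real (E2 c)"
  have "(\<integral>\<^sup>+s. indicator {0..t} s * E0 (N s (Z s)) \<partial>lborel) \<le> ennreal (K * (2 * ?e) * exp (4 * K / nu * t) / (4 * K / nu))"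
  proof (rule exp_weight_integral)
    show "AE s in lborel. s \<in> {0..t} \<longrightarrow> E0 (N s (Z s)) \<le> ennreal K * ennreal (2 * ?e * exp (4 * K / nu * s))"
    proof (rule AE_I2, rule impI)
      fix s assume "s \<in> {0..t}"
      then have "growth s = exp (4 * K / nu * s)" by (simp add: growth_def)
      then show "E0 (N s (Z s)) \<le> ennreal K * ennreal (2 * ?e * exp (4 * K / nu * s))"
        using assms(1) N_bound[OF admissible_fin[OF assms(1)], of s s]
        unfolding admissible_def by (metis mult_left_mono order_trans zero_le)
    qed
  qed (use assms K_pos nu_pos in auto)
  also have "K * (2 * ?e) * exp (4 * K / nu * t) / (4 * K / nu) = nu * (?e * growth t / 2)"
    using K_pos nu_pos assms(2) by (simp add: growth_def field_simps)
  finally show ?thesis .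
qed

lemma is_step_exists:
  assumes "admissible c Z"
  shows "\<exists>z. is_step c Z z"
  unfolding is_step_def
proof (rule modes_exist)
  show "(\<lambda>t. N t (Z t) k) \<in> borel_measurable borel" for k
    using assms admissible_fin[OF assms] by (intro N_meas) (auto simp: admissible_def)
  show "(\<integral>\<^sup>+s. indicator {0..t} s * E0 (N s (Z s)) \<partial>lborel) < \<infinity>" if "t \<ge> 0" for t
    using admissible_integral[OF assms that] by (auto intro: le_less_trans)
qed

lemma admissible_step:
  assumes c: "E2 c < \<infinity>" and Z: "admissible c Z" and z: "is_step c Z z"
  shows "admissible c z"
  unfolding admissible_def
proof (intro conjI allI)
  show "(\<lambda>t. z t k) \<in> borel_measurable borel" for k
    using z by (auto simp: is_step_def intro: borel_measurable_continuous_onI)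
  fix t
  let ?e = "enn2real (E2 c)"
  have e: "E2 c = ennreal ?e" using c by (simp add: less_top)
  show "E2 (z t) \<le> ennreal (2 * ?e * growth t)"
  proof (cases "t \<le> 0")
    case True
    then have "E2 (z t) = ennreal ?e" using z e by (simp add: is_step_def)
    also have "\<dots> \<le> ennreal (2 * ?e * growth t)"
      using mult_mono[of 1 2 1 "growth t"] growth_ge[of t] mult_left_mono[of 1 "2 * growth t" ?e]
      by (intro ennreal_leI) (simp add: mult_ac)
    finally show ?thesis .
  next
    case False
    then have t: "t \<ge> 0" by simp
    have "ennreal nu * E2 (z t) \<le> ennreal nu * E2 (z t) + ennreal (nu\<^sup>2) * (\<integral>\<^sup>+s. indicator {0..t} s * E4 (z s) \<partial>lborel)"
      by (rule add_increasing2) auto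
    also have "\<dots> \<le> ennreal nu * E2 c + (\<integral>\<^sup>+s. indicator {0..t} s * E0 (N s (Z s)) \<partial>lborel)"
      by (rule modes_energy_le[OF t order_refl]) (use z t in \<open>auto simp: is_step_def\<close>)
    also have "\<dots> \<le> ennreal nu * ennreal ?e + ennreal (nu * (?e * growth t / 2))"
      using admissible_integral[OF Z t] e by (intro add_mono) auto
    also have "\<dots> = ennreal (nu * ?e + nu * (?e * growth t / 2))"
      using nu_pos growth_ge[of t] by (simp add: ennreal_mult ennreal_plus)
    also have "\<dots> \<le> ennreal (nu * (2 * ?e * growth t))"
    proof (rule ennreal_leI)
      have 1: "nu * ?e \<le> nu * (?e * growth t)"
        using mult_left_mono[OF growth_ge[of t], of "nu * ?e"] nu_pos by (simp add: mult.assoc)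
      have 2: "nu * (?e * growth t / 2) = nu * (?e * growth t) / 2" by simp
      have 3: "nu * (2 * ?e * growth t) = 2 * (nu * (?e * growth t))" by simp
      have 4: "0 \<le> nu * (?e * growth t)" using nu_pos growth_ge[of t] by simp
      show "nu * ?e + nu * (?e * growth t / 2) \<le> nu * (2 * ?e * growth t)"
        unfolding 2 3 using 1 4 by linarith
    qed
    also have "\<dots> = ennreal nu * ennreal (2 * ?e * growth t)"
      using nu_pos growth_ge[of t] by (intro ennreal_mult) auto
    finally show ?thesis using nu_pos by (simp add: ennreal_mult_le_mult_iff)
  qed
qed

lemma step_contraction:
  assumes D: "D \<ge> 0" and Z: "admissible c Z" "admissible c W" and z: "is_step c Z z" "is_step c W w"
    and le: "\<And>t. E2 (\<lambda>k. Z t k - W t k) \<le> ennreal (D * growth t)"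
  shows "E2 (\<lambda>k. z t k - w t k) \<le> ennreal (D / 4 * growth t)"
proof (cases "t \<le> 0")
  case True
  then show ?thesis using z by (simp add: is_step_def E2_def)
next
  case False
  then have t: "t \<ge> 0" by simp
  have "E2 (\<lambda>k. z t k - w t k) \<le> ennreal (D / 4 * exp (4 * K / nu * t))"
  proof (rule modes_contraction[OF t order_refl K_pos D])
    show "modes t c (\<lambda>t. N t (Z t)) z" "modes t c (\<lambda>t. N t (W t)) w"
      using z t by (auto simp: is_step_def)
    show "AE s in lborel. s \<in> {0..t} \<longrightarrow> E0 (\<lambda>k. N s (Z s) k - N s (W s) k) \<le> ennreal K * ennreal (D * exp (4 * K / nu * s))"
    proof (rule AE_I2, rule impI)
      fix s assume "s \<in> {0..t}"
      then have g: "growth s = exp (4 * K / nu * s)" by (simp add: growth_def)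
      have "E0 (\<lambda>k. N s (Z s) k - N s (W s) k) \<le> ennreal K * E2 (\<lambda>k. Z s k - W s k)"
        by (rule N_lip[OF admissible_fin[OF Z(1)] admissible_fin[OF Z(2)]])
      also have "\<dots> \<le> ennreal K * ennreal (D * exp (4 * K / nu * s))"
        using le[of s] unfolding g by (intro mult_left_mono) auto
      finally show "E0 (\<lambda>k. N s (Z s) k - N s (W s) k) \<le> ennreal K * ennreal (D * exp (4 * K / nu * s))" .
    qed
  qed
  then show ?thesis using t by (simp add: growth_def)
qed

text \<open>Picard iteration without a complete space of curves: each coefficient converges
  pointwise at a geometric rate, and Fatou carries the energy bounds and the distance estimates over
  to the limit.\<close>

theorem evolution_solution:
  assumes c: "E2 c < \<infinity>"
  shows "\<exists>Z. is_step c Z Z \<and> admissible c Z"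
proof -
  let ?e = "enn2real (E2 c)"
  have e: "E2 c = ennreal ?e" using c by (simp add: less_top)
  define step where "step Z = (SOME z. is_step c Z z)" for Z
  have step: "is_step c Z (step Z)" if "admissible c Z" for Z
    unfolding step_def by (rule someI_ex[OF is_step_exists[OF that]])
  define Y where "Y n = (step ^^ n) (\<lambda>t. c)" for n
  have Y_Suc: "Y (Suc n) = step (Y n)" for n by (simp add: Y_def)
  have adm: "admissible c (Y n)" for n
  proof (induction n)
    case 0
    have "?e * 1 \<le> 2 * ?e * growth t" for t
      using mult_mono[of 1 2 1 "growth t"] growth_ge[of t] mult_left_mono[of 1 "2 * growth t" ?e] by (simp add: mult_ac)
    then have "ennreal ?e \<le> ennreal (2 * ?e * growth t)" for t by (intro ennreal_leI) simp
    then show ?case unfolding admissible_def Y_def using e by simp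
  next
    case (Suc n)
    show ?case unfolding Y_Suc by (rule admissible_step[OF c Suc step[OF Suc]])
  qed
  \<comment> \<open>8 = 2 * (2 + 2): two admissible curves are compared by
    \<open>E2_diff_le\<close>; every further step divides by 4.\<close>
  have cauchy: "E2 (\<lambda>k. Y (n + m) t k - Y n t k) \<le> ennreal (8 * ?e * (1/4)^n * growth t)" for n m t
  proof (induction n arbitrary: t)
    case 0
    have "E2 (\<lambda>k. Y (0 + m) t k - Y 0 t k) \<le> 2 * (E2 (Y m t) + E2 (Y 0 t))"
      using E2_diff_le by simp
    also have "\<dots> \<le> 2 * (ennreal (2 * ?e * growth t) + ennreal (2 * ?e * growth t))"
      using adm by (intro mult_left_mono add_mono) (auto simp: admissible_def)
    also have "\<dots> = ennreal (8 * ?e * growth t)"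
    proof -
      have "2 * (ennreal x + ennreal x) = ennreal (4 * x)" if "x \<ge> 0" for x
        using that by (simp add: ennreal_mult mult_2[symmetric] mult.assoc[symmetric])
      from this[of "2 * ?e * growth t"] show ?thesis using growth_ge[of t] by (simp add: mult.assoc)
    qed
    finally show ?case by simp
  next
    case (Suc n)
    have "E2 (\<lambda>k. Y (Suc n + m) t k - Y (Suc n) t k) \<le> ennreal ((8 * ?e * (1/4)^n) / 4 * growth t)"
      unfolding add_Suc Y_Suc
      by (rule step_contraction[OF _ adm adm step[OF adm] step[OF adm] Suc.IH]) simp
    then show ?case by simp
  qed
  \<comment> \<open>Since lam \<ge> 1, the energy dominates each squared coefficient; taking roots
    turns the rate 1/4 into 1/2.\<close>
  have pt: "\<bar>Y (n + m) t k - Y n t k\<bar> \<le> sqrt (8 * ?e * growth t) * (1/2)^n" for n m t k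
  proof -
    have "ennreal ((lam k * (Y (n + m) t k - Y n t k))\<^sup>2) \<le> ennreal (8 * ?e * (1/4)^n * growth t)"
      using nn_integral_count_space_ge_single[of "\<lambda>k. ennreal ((lam k * (Y (n + m) t k - Y n t k))\<^sup>2)" k] cauchy[of n m t]
      unfolding E2_def by (rule order_trans)
    then have "(lam k * (Y (n + m) t k - Y n t k))\<^sup>2 \<le> 8 * ?e * growth t * (1/4)^n"
      using growth_ge[of t] by (simp add: ennreal_le_iff mult_ac)
    also have "\<dots> = (sqrt (8 * ?e * growth t) * (1/2)^n)\<^sup>2"
      using growth_ge[of t] by (simp add: power_mult_distrib power_divide power_mult[symmetric] mult.commute[of _ 2] power_mult)
    finally have "\<bar>lam k * (Y (n + m) t k - Y n t k)\<bar> \<le> sqrt (8 * ?e * growth t) * (1/2)^n"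
      using growth_ge[of t] by (intro abs_le_square_iff[THEN iffD2, THEN order_trans[OF _ eq_refl[OF abs_of_nonneg]]]) auto
    moreover have "\<bar>Y (n + m) t k - Y n t k\<bar> \<le> \<bar>lam k * (Y (n + m) t k - Y n t k)\<bar>"
      using mult_right_mono[OF lam_ge[of k], of "\<bar>Y (n + m) t k - Y n t k\<bar>"] lam_pos[of k] by (simp add: abs_mult)
    ultimately show ?thesis by linarith
  qed
  have "Cauchy (\<lambda>n. Y n t k)" for t k
  proof (rule metric_CauchyI)
    fix \<epsilon> :: real assume "\<epsilon> > 0"
    have "(\<lambda>n. sqrt (8 * ?e * growth t) * (1/2)^n) \<longlonglongrightarrow> sqrt (8 * ?e * growth t) * 0"
      by (intro tendsto_intros LIMSEQ_realpow_zero) auto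
    then have "\<forall>\<^sub>F n in sequentially. sqrt (8 * ?e * growth t) * (1/2)^n < \<epsilon> / 2"
      using \<open>\<epsilon> > 0\<close> by (intro order_tendstoD) auto
    then obtain n where n: "sqrt (8 * ?e * growth t) * (1/2)^n < \<epsilon> / 2" by (auto simp: eventually_sequentially)
    have "\<bar>Y i t k - Y n t k\<bar> < \<epsilon> / 2" if "i \<ge> n" for i
      using pt[of n "i - n" t k] n that by simp
    then show "\<exists>M. \<forall>i\<ge>M. \<forall>j\<ge>M. dist (Y i t k) (Y j t k) < \<epsilon>"
    proof (intro exI[of _ n] allI impI)
      fix i j assume "i \<ge> n" "j \<ge> n"
      then have "\<bar>Y i t k - Y n t k\<bar> < \<epsilon> / 2" "\<bar>Y j t k - Y n t k\<bar> < \<epsilon> / 2"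
        using \<open>\<And>i. n \<le> i \<Longrightarrow> \<bar>Y i t k - Y n t k\<bar> < \<epsilon> / 2\<close> by blast+
      then show "dist (Y i t k) (Y j t k) < \<epsilon>" unfolding dist_real_def by linarith
    qed
  qed
  then have "\<exists>l. (\<lambda>n. Y n t k) \<longlonglongrightarrow> l" for t k
    by (simp add: Cauchy_convergent_iff convergent_def)
  then obtain Z where Z: "\<And>t k. (\<lambda>n. Y n t k) \<longlonglongrightarrow> Z t k" by metis
  have Zadm: "admissible c Z"
    unfolding admissible_def
  proof (intro conjI allI)
    show "(\<lambda>t. Z t k) \<in> borel_measurable borel" for k
      by (rule borel_measurable_LIMSEQ_metric[OF _ Z]) (use adm in \<open>auto simp: admissible_def\<close>)
    show "E2 (Z t) \<le> ennreal (2 * ?e * growth t)" for t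
    proof -
      have 1: "AE k in count_space UNIV. (\<lambda>n. lam k * Y n t k) \<longlonglongrightarrow> lam k * Z t k"
        by (intro AE_I2 tendsto_intros Z)
      have 2: "(\<integral>\<^sup>+ k. ennreal ((lam k * Y n t k)\<^sup>2) \<partial>count_space UNIV) \<le> ennreal (2 * ?e * growth t)" for n
        using adm[of n] unfolding admissible_def E2_def by blast
      show ?thesis unfolding E2_def[of "Z t"] by (rule sq_int_Fatou[OF _ _ 1 2]) auto
    qed
  qed
  have dist: "E2 (\<lambda>k. Z t k - Y n t k) \<le> ennreal (8 * ?e * (1/4)^n * growth t)" for n t
  proof -
    have 1: "AE k in count_space UNIV. (\<lambda>m. lam k * (Y (n + m) t k - Y n t k)) \<longlonglongrightarrow> lam k * (Z t k - Y n t k)"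
      using LIMSEQ_ignore_initial_segment[OF Z, of n] by (intro AE_I2 tendsto_intros) (simp add: add.commute)
    have 2: "(\<integral>\<^sup>+ k. ennreal ((lam k * (Y (n + m) t k - Y n t k))\<^sup>2) \<partial>count_space UNIV) \<le> ennreal (8 * ?e * (1/4)^n * growth t)" for m
      using cauchy[of n m t] unfolding E2_def .
    show ?thesis unfolding E2_def[of "\<lambda>k. Z t k - Y n t k"] by (rule sq_int_Fatou[OF _ _ 1 2]) auto
  qed
  \<comment> \<open>\<open>step Z\<close> and \<open>Z\<close> are both within a multiple of 4^-n,
    in energy, of the same iterate \<open>Y (Suc n)\<close>.\<close>
  have fix_eq: "step Z t = Z t" for t
  proof (rule E2_zero_imp_eq)
    fix n
    have 1: "E2 (\<lambda>k. step Z t k - Y (Suc n) t k) \<le> ennreal ((8 * ?e * (1/4)^n) / 4 * growth t)"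
      unfolding Y_Suc by (rule step_contraction[OF _ Zadm adm step[OF Zadm] step[OF adm] dist]) simp
    have 2: "E2 (\<lambda>k. Z t k - Y (Suc n) t k) \<le> ennreal ((8 * ?e * (1/4)^n) / 4 * growth t)"
      using dist[of t "Suc n"] by simp
    have "E2 (\<lambda>k. step Z t k - Z t k) = E2 (\<lambda>k. (step Z t k - Y (Suc n) t k) - (Z t k - Y (Suc n) t k))"
      by simp
    also have "\<dots> \<le> 2 * (E2 (\<lambda>k. step Z t k - Y (Suc n) t k) + E2 (\<lambda>k. Z t k - Y (Suc n) t k))"
      by (rule E2_diff_le)
    also have "\<dots> \<le> 2 * (ennreal ((8 * ?e * (1/4)^n) / 4 * growth t) + ennreal ((8 * ?e * (1/4)^n) / 4 * growth t))"
      using 1 2 by (intro mult_left_mono add_mono) auto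
    also have "\<dots> = ennreal (4 * ((8 * ?e * (1/4)^n) / 4 * growth t))"
    proof -
      have "2 * (ennreal x + ennreal x) = ennreal (4 * x)" if "x \<ge> 0" for x
        using that by (simp add: ennreal_mult mult_2[symmetric] mult.assoc[symmetric])
      then show ?thesis using growth_ge[of t] by simp
    qed
    finally show "E2 (\<lambda>k. step Z t k - Z t k) \<le> ennreal (8 * ?e * growth t * (1/4)^n)"
      by (simp add: mult_ac)
  qed
  have "is_step c Z Z" using step[OF Zadm] fix_eq by (metis ext)
  with Zadm show ?thesis by blast
qed

end

section \<open>Lebesgue measure and translations on the torus\<close>

lemma integral_lborel_shift:
  fixes g :: "'a::euclidean_space \<Rightarrow> real"
  assumes [measurable]: "g \<in> borel_measurable borel"
  shows "(\<integral>x. g (c + x) \<partial>lborel) = (\<integral>x. g x \<partial>lborel)"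
proof -
  have "(\<integral>x. g x \<partial>lborel) = (\<integral>x. g x \<partial>(distr lborel borel ((+) c)))"
    by (simp add: lborel_distr_plus)
  also have "\<dots> = (\<integral>x. g (c + x) \<partial>lborel)"
    by (rule integral_distr) measurable
  finally show ?thesis by simp
qed

lemma integrable_lborel_shift:
  fixes g :: "'a::euclidean_space \<Rightarrow> real"
  assumes [measurable]: "g \<in> borel_measurable borel" and "integrable lborel g"
  shows "integrable lborel (\<lambda>x. g (c + x))"
proof -
  have "integrable (distr lborel borel ((+) c)) g"
    using assms(2) by (simp add: lborel_distr_plus)
  then show ?thesis by (subst (asm) integrable_distr_eq) auto
qed

lemma axis_plus: "axis i a + axis i b = (axis i (a + b) :: real^'n)"
  by (simp add: Finite_Cartesian_Product.vec_eq_iff axis_def)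

lemma axis_zero [simp]: "axis i 0 = (0 :: real^'n)"
  by (simp add: Finite_Cartesian_Product.vec_eq_iff axis_def)

lemma axis_scaleR: "axis i s = s *\<^sub>R (axis i 1 :: real^'n)"
  by (simp add: Finite_Cartesian_Product.vec_eq_iff axis_def)

locale torus =
  fixes L :: "real^'n"
  assumes L_pos: "\<And>i. L $ i > 0"
begin

abbreviation T :: "(real^'n) set" where "T \<equiv> Torus L"
abbreviation TM :: "(real^'n) measure" where "TM \<equiv> lebesgue_on T"

definition vol :: real where "vol = measure lebesgue T"

lemma Torus_borel [measurable, simp]: "T \<in> sets borel"
proof -
  have "T = (\<Inter>i\<in>UNIV. {x. 0 \<le> x $ i} \<inter> {x. x $ i < L $ i})" by (auto simp: Torus_def)
  also have "\<dots> \<in> sets borel"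
    by (intro sets.finite_INT sets.Int borel_closed borel_open closed_Collect_le open_Collect_less continuous_intros) auto
  finally show ?thesis .
qed

lemma Torus_lebesgue [simp]: "T \<in> sets lebesgue"
  using Torus_borel by simp

lemma Torus_subset_cbox: "T \<subseteq> cbox 0 L"
  by (auto simp: Torus_def mem_box_cart less_imp_le)

lemma box_subset_Torus: "box 0 L \<subseteq> T"
  by (auto simp: Torus_def mem_box_cart less_imp_le)

lemma space_TM [simp]: "space TM = T" by simp

lemma emeasure_T_finite: "emeasure lebesgue T < \<infinity>"
proof -
  have "emeasure lebesgue T \<le> emeasure lebesgue (cbox 0 L)"
    by (rule emeasure_mono) (auto simp: Torus_subset_cbox)
  also have "\<dots> < \<infinity>" using emeasure_lborel_cbox_finite[of 0 L] by (simp add: less_top)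
  finally show ?thesis .
qed

lemma emeasure_TM: "emeasure TM T = ennreal vol"
proof -
  have "emeasure TM T = emeasure lebesgue T" by (subst emeasure_restrict_space) auto
  also have "\<dots> = ennreal vol" unfolding vol_def
    by (rule emeasure_eq_ennreal_measure) (use emeasure_T_finite in auto)
  finally show ?thesis .
qed

lemma vol_pos: "vol > 0"
proof -
  have "box 0 L \<noteq> {}" using L_pos by (simp add: interval_ne_empty_cart(2))
  then have "0 < emeasure lebesgue (box 0 L)"
    using open_not_negligible[of "box 0 L"] by (metis completion.complete2 negligible_iff_emeasure0 not_gr_zero open_box lmeasurable_box fmeasurableD)
  also have "\<dots> \<le> emeasure lebesgue T" by (rule emeasure_mono) (auto simp: box_subset_Torus)
  finally show ?thesis using emeasure_T_finite unfolding vol_def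
    by (metis emeasure_eq_ennreal_measure ennreal_less_zero_iff infinity_ennreal_def less_irrefl)
qed

sublocale TM: finite_measure TM
  by standard (simp add: emeasure_TM[simplified])

lemma integral_TM: "f \<in> borel_measurable borel \<Longrightarrow> (\<integral>x. f x \<partial>TM) = (\<integral>x. indicator T x * f x \<partial>lborel)" for f :: "real^'n \<Rightarrow> real"
  by (subst integral_restrict_space) (auto simp: integral_completion)

lemma integrable_TM: "f \<in> borel_measurable borel \<Longrightarrow> integrable TM f \<longleftrightarrow> integrable lborel (\<lambda>x. indicator T x * f x)" for f :: "real^'n \<Rightarrow> real"
  by (subst integrable_restrict_space) (auto simp: integrable_completion)

lemma borel_measurable_TM: "f \<in> borel_measurable borel \<Longrightarrow> f \<in> borel_measurable TM"
  by (intro measurable_restrict_space1 measurable_completion) simp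

lemma bounded_integrable_TM:
  fixes f :: "real^'n \<Rightarrow> real"
  assumes "f \<in> borel_measurable TM" "\<And>x. x \<in> T \<Longrightarrow> \<bar>f x\<bar> \<le> B"
  shows "integrable TM f"
  by (rule TM.integrable_const_bound[where B = B]) (use assms in auto)

lemma bounded_sq_int_TM:
  fixes f :: "real^'n \<Rightarrow> real"
  assumes "f \<in> borel_measurable TM" "\<And>x. x \<in> T \<Longrightarrow> \<bar>f x\<bar> \<le> B"
  shows "f \<in> sq_int TM"
proof -
  have "\<bar>(f x)\<^sup>2\<bar> \<le> B\<^sup>2" if "x \<in> T" for x
    using assms(2)[OF that] by (simp add: abs_le_square_iff[symmetric])
  then show ?thesis using assms(1) by (auto simp: sq_int_def intro!: bounded_integrable_TM[where B = "B\<^sup>2"])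
qed

lemma continuous_bounded_T:
  fixes f :: "real^'n \<Rightarrow> real"
  assumes "continuous_on UNIV f"
  obtains B where "\<And>x. x \<in> T \<Longrightarrow> \<bar>f x\<bar> \<le> B"
proof -
  have "bounded (f ` cbox 0 L)"
    by (intro compact_imp_bounded compact_continuous_image continuous_on_subset[OF assms] compact_cbox) auto
  then obtain B where "\<forall>x\<in>cbox 0 L. norm (f x) \<le> B" by (auto simp: bounded_iff)
  then show ?thesis using Torus_subset_cbox by (intro that[of B]) auto
qed

lemma continuous_sq_int:
  fixes f :: "real^'n \<Rightarrow> real"
  assumes "continuous_on UNIV f" shows "f \<in> sq_int TM"
  using continuous_bounded_T[OF assms] bounded_sq_int_TM borel_measurable_TM[OF borel_measurable_continuous_onI[OF assms]] by metis

lemma sq_int_integrable_TM: "u \<in> sq_int TM \<Longrightarrow> integrable TM u"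
  using sq_int_mult_integrable[of u TM "\<lambda>x. 1"] continuous_sq_int[of "\<lambda>x. 1"] by simp

lemma continuous_integrable_TM:
  fixes f :: "real^'n \<Rightarrow> real"
  assumes "continuous_on UNIV f" shows "integrable TM f"
  by (rule sq_int_integrable_TM[OF continuous_sq_int[OF assms]])

section \<open>Periodic functions\<close>

text \<open>The cell T moved by h along axis i consists of the slab x_i \<ge> h of T and of the slab
  x_i < h moved by one period; \<open>key\<close> says this for indicators. Periodicity of f and
  translation invariance of the measure put the second slab back.\<close>

lemma integral_periodic_shift:
  assumes per: "periodic L f" and cont: "continuous_on UNIV f" and h: "0 \<le> h" "h \<le> L $ i"
  shows "(\<integral>x. f (x + axis i h) \<partial>TM) = (\<integral>x. f x \<partial>TM)"
proof -
  have [measurable]: "f \<in> borel_measurable borel" using cont by (rule borel_measurable_continuous_onI)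
  have [measurable]: "(\<lambda>x. x $ i) \<in> borel_measurable (borel :: (real^'n) measure)"
    by (intro borel_measurable_continuous_onI continuous_intros)
  define A where "A x = (indicator {x \<in> T. x $ i \<ge> h} x :: real)" for x
  define B where "B x = (indicator {x \<in> T. x $ i < h} x :: real)" for x
  have ABm [measurable]: "A \<in> borel_measurable borel" "B \<in> borel_measurable borel"
    unfolding A_def B_def by measurable
  have ABT: "A x + B x = indicator T x" for x by (auto simp: A_def B_def indicator_def)
  obtain C where C: "\<And>x. x \<in> T \<Longrightarrow> \<bar>f x\<bar> \<le> C" using continuous_bounded_T[OF cont] by blast
  have fi: "integrable lborel (\<lambda>x. indicator T x * f x)"
    using continuous_integrable_TM[OF cont] by (subst (asm) integrable_TM) auto
  have Ai: "integrable lborel (\<lambda>x. A x * f x)" "integrable lborel (\<lambda>x. B x * f x)"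
    by (rule Bochner_Integration.integrable_bound[OF fi]; auto simp: A_def B_def indicator_def)+
  have key: "indicator T (x + axis i (- h)) = A x + B (x + axis i (- (L $ i)))" for x
  proof -
    have x1: "(x + axis i a) $ j = (if j = i then x $ j + a else x $ j)" for a j by (simp add: axis_def)
    have T1: "x + axis i (- h) \<in> T \<longleftrightarrow> (\<forall>j. j \<noteq> i \<longrightarrow> 0 \<le> x $ j \<and> x $ j < L $ j) \<and> h \<le> x $ i \<and> x $ i < L $ i + h"
      unfolding Torus_def mem_Collect_eq x1 by (auto split: if_splits)
    have T2: "x \<in> T \<longleftrightarrow> (\<forall>j. j \<noteq> i \<longrightarrow> 0 \<le> x $ j \<and> x $ j < L $ j) \<and> 0 \<le> x $ i \<and> x $ i < L $ i"
      unfolding Torus_def mem_Collect_eq by (metis)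
    have T3: "x + axis i (- (L $ i)) \<in> T \<longleftrightarrow> (\<forall>j. j \<noteq> i \<longrightarrow> 0 \<le> x $ j \<and> x $ j < L $ j) \<and> L $ i \<le> x $ i \<and> x $ i < L $ i + L $ i"
      unfolding Torus_def mem_Collect_eq x1 by (auto split: if_splits)
    show ?thesis unfolding A_def B_def indicator_def mem_Collect_eq T1 T2 T3 x1 using h by auto
  qed
  have "(\<integral>x. f (x + axis i h) \<partial>TM) = (\<integral>x. indicator T x * f (x + axis i h) \<partial>lborel)"
    by (rule integral_TM) measurable
  also have "\<dots> = (\<integral>x. (\<lambda>y. indicator T (y + axis i (- h)) * f y) (axis i h + x) \<partial>lborel)"
  proof -
    have "axis i h + x + axis i (- h) = x" for x :: "real^'n"
      by (simp add: add.assoc add.left_commute[of x] axis_plus)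
    then show ?thesis by (simp only: add.commute[of _ "axis i h"])
  qed
  also have "\<dots> = (\<integral>y. indicator T (y + axis i (- h)) * f y \<partial>lborel)"
    by (rule integral_lborel_shift) measurable
  also have "\<dots> = (\<integral>y. A y * f y + B (axis i (- (L $ i)) + y) * f (axis i (- (L $ i)) + y) \<partial>lborel)"
  proof (rule Bochner_Integration.integral_cong[OF refl])
    fix y
    have "axis i (- (L $ i)) + y + axis i (L $ i) = y"
      by (simp add: add.assoc add.left_commute[of y] axis_plus)
    then have "f (axis i (- (L $ i)) + y) = f y"
      using per[unfolded periodic_def, rule_format, of "axis i (- (L $ i)) + y" i] by (simp only:)
    then show "indicator T (y + axis i (- h)) * f y = A y * f y + B (axis i (- (L $ i)) + y) * f (axis i (- (L $ i)) + y)"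
      unfolding key by (simp add: distrib_right add.commute)
  qed
  also have "\<dots> = (\<integral>y. A y * f y \<partial>lborel) + (\<integral>y. (\<lambda>y. B y * f y) (axis i (- (L $ i)) + y) \<partial>lborel)"
    using Ai integrable_lborel_shift[OF _ Ai(2), of "axis i (- (L $ i))"] by (subst Bochner_Integration.integral_add) auto
  also have "(\<integral>y. (\<lambda>y. B y * f y) (axis i (- (L $ i)) + y) \<partial>lborel) = (\<integral>y. B y * f y \<partial>lborel)"
    by (rule integral_lborel_shift) measurable
  also have "(\<integral>y. A y * f y \<partial>lborel) + (\<integral>y. B y * f y \<partial>lborel) = (\<integral>y. A y * f y + B y * f y \<partial>lborel)"
    using Ai by (subst Bochner_Integration.integral_add) auto
  also have "\<dots> = (\<integral>x. f x \<partial>TM)"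
    by (subst integral_TM) (auto simp: ABT[symmetric] distrib_right)
  finally show ?thesis .
qed

lemma has_real_derivative_along_axis:
  assumes "F differentiable (at (x + axis i s))"
  shows "((\<lambda>s. F (x + axis i s)) has_real_derivative partial_deriv i F (x + axis i s)) (at s)"
proof -
  have 1: "(F has_derivative frechet_derivative F (at (x + axis i s))) (at (x + axis i s))"
    using assms by (simp add: frechet_derivative_works)
  have ax: "(\<lambda>s. x + axis i s) = (\<lambda>s. x + s *\<^sub>R axis i 1)"
    by (rule ext) (subst axis_scaleR, rule refl)
  have 2: "((\<lambda>s. x + axis i s) has_derivative (\<lambda>h. h *\<^sub>R axis i 1)) (at s)"
    unfolding ax by (auto intro!: derivative_eq_intros)
  have 3: "((\<lambda>s. F (x + axis i s)) has_derivative (\<lambda>h. frechet_derivative F (at (x + axis i s)) (h *\<^sub>R axis i 1))) (at s)"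
    by (rule has_derivative_compose[OF 2 1])
  have 4: "(\<lambda>h. frechet_derivative F (at (x + axis i s)) (h *\<^sub>R axis i 1)) = (*) (partial_deriv i F (x + axis i s))"
    using linear_cmul[OF linear_frechet_derivative[OF assms], of _ "axis i 1"]
    by (intro ext) (simp add: partial_deriv_def)
  show ?thesis using 3 unfolding has_field_derivative_def 4 .
qed

text \<open>Difference quotients of a periodic function integrate to 0 by shift invariance and
  converge boundedly to the derivative. Applied to products, this is integration by parts without
  boundary terms.\<close>

lemma integral_partial_deriv_zero:
  assumes per: "periodic L F" and diff: "\<And>x. F differentiable (at x)"
    and cont: "continuous_on UNIV (partial_deriv i F)"
  shows "(\<integral>x. partial_deriv i F x \<partial>TM) = 0"
proof -
  have Fc: "continuous_on UNIV F"
    using diff by (intro continuous_at_imp_continuous_on) (auto intro: differentiable_imp_continuous_within)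
  define h where "h n = L $ i / (real n + 1)" for n
  have h: "0 < h n" "h n \<le> L $ i" for n
    using L_pos[of i] by (auto simp: h_def field_simps)
  have "(\<lambda>n. L $ i * inverse (real (Suc n))) \<longlonglongrightarrow> L $ i * 0"
    by (intro tendsto_intros LIMSEQ_inverse_real_of_nat)
  then have h0: "h \<longlonglongrightarrow> 0" by (simp add: h_def[abs_def] divide_inverse add.commute)
  let ?q = "\<lambda>n x. (F (x + axis i (h n)) - F x) / h n"
  \<comment> \<open>A segment of length at most one period starting in T may leave T, but stays in
    the doubled box, so the mean value theorem bounds all difference quotients uniformly.\<close>
  have "bounded (partial_deriv i F ` cbox 0 (2 *\<^sub>R L))"
    by (intro compact_imp_bounded compact_continuous_image continuous_on_subset[OF cont] compact_cbox) auto
  then obtain B where B: "\<And>x. x \<in> cbox 0 (2 *\<^sub>R L) \<Longrightarrow> \<bar>partial_deriv i F x\<bar> \<le> B" by (auto simp: bounded_iff)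
  have qb: "\<bar>?q n x\<bar> \<le> B" if x: "x \<in> T" for n x
  proof -
    obtain \<xi> where \<xi>: "0 < \<xi>" "\<xi> < h n" "F (x + axis i (h n)) - F (x + axis i 0) = (h n - 0) * partial_deriv i F (x + axis i \<xi>)"
      using MVT2[OF h(1)[of n], of "\<lambda>s. F (x + axis i s)" "\<lambda>s. partial_deriv i F (x + axis i s)"]
        has_real_derivative_along_axis[OF diff] by blast
    have "x + axis i \<xi> \<in> cbox 0 (2 *\<^sub>R L)"
      unfolding mem_box_cart
    proof
      fix j
      have "0 \<le> x $ j" "x $ j < L $ j" "L $ j > 0" using x L_pos by (auto simp: Torus_def)
      then show "0 $ j \<le> (x + axis i \<xi>) $ j \<and> (x + axis i \<xi>) $ j \<le> (2 *\<^sub>R L) $ j"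
        using \<xi>(1,2) h(2)[of n] by (auto simp: axis_def)
    qed
    moreover have "axis i 0 = (0 :: real^'n)" by (simp add: axis_zero)
    ultimately show ?thesis using B \<xi> h(1)[of n] by simp
  qed
  have qlim: "(\<lambda>n. ?q n x) \<longlonglongrightarrow> partial_deriv i F x" for x
  proof -
    have ax0: "axis i 0 = (0 :: real^'n)" by (simp add: axis_zero)
    have "((\<lambda>k. (F (x + axis i (0 + k)) - F (x + axis i 0)) / k) \<longlongrightarrow> partial_deriv i F (x + axis i 0)) (at 0)"
      using has_real_derivative_along_axis[OF diff, where i = i and x = x and s = 0] unfolding DERIV_def .
    moreover have "filterlim h (at 0) sequentially"
      unfolding filterlim_at using h0 h(1) by (auto intro!: always_eventually simp: less_imp_neq[symmetric])
    ultimately have "(\<lambda>n. (F (x + axis i (0 + h n)) - F (x + axis i 0)) / h n) \<longlonglongrightarrow> partial_deriv i F (x + axis i 0)"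
      by (rule filterlim_compose)
    then show ?thesis by (simp add: ax0)
  qed
  have shc: "continuous_on UNIV (\<lambda>x. F (x + axis i (h n)))" for n
    by (intro continuous_on_compose2[OF Fc] continuous_intros) auto
  have qc: "continuous_on UNIV (?q n)" for n
    using h(1)[of n] by (intro continuous_intros shc Fc) auto
  have "(\<lambda>n. \<integral>x. ?q n x \<partial>TM) \<longlonglongrightarrow> (\<integral>x. partial_deriv i F x \<partial>TM)"
  proof (rule integral_dominated_convergence[where w = "\<lambda>x. B"])
    show "partial_deriv i F \<in> borel_measurable TM"
      by (intro borel_measurable_TM borel_measurable_continuous_onI cont)
    show "?q n \<in> borel_measurable TM" for n
      by (intro borel_measurable_TM borel_measurable_continuous_onI qc)
    show "AE x in TM. norm (?q n x) \<le> B" for n using qb by (intro AE_I2) simp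
  qed (use qlim in auto)
  moreover have z: "(\<integral>x. ?q n x \<partial>TM) = 0" for n
  proof -
    have "(\<integral>x. ?q n x \<partial>TM) = ((\<integral>x. F (x + axis i (h n)) \<partial>TM) - (\<integral>x. F x \<partial>TM)) / h n"
      using continuous_integrable_TM[OF shc] continuous_integrable_TM[OF Fc] by simp
    also have "\<dots> = 0" using integral_periodic_shift[OF per Fc, of "h n" i] h[of n] by simp
    finally show ?thesis .
  qed
  ultimately show ?thesis unfolding z by (simp add: LIMSEQ_const_iff)
qed

end

no_notation Matrix.scalar_prod (infix \<open>\<bullet>\<close> 70)

context torus
begin

section \<open>The Hartley basis\<close>

definition kap :: "int^'n \<Rightarrow> real^'n" where
  "kap k = (\<chi> i. 2 * pi * of_int (k $ i) / L $ i)"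

text \<open>One real function for each integer vector, the zero vector included, and a partial
  derivative sends index k to -k. This keeps the single index set of the complex exponentials while
  all functions stay real.\<close>

definition ebas :: "int^'n \<Rightarrow> real^'n \<Rightarrow> real" where
  "ebas k x = cos (kap k \<bullet> x) + sin (kap k \<bullet> x)"

lemma kap_add: "kap (k + l) = kap k + kap l"
  by (simp add: kap_def Finite_Cartesian_Product.vec_eq_iff distrib_left add_divide_distrib)

lemma kap_minus: "kap (- k) = - kap k"
  by (simp add: kap_def Finite_Cartesian_Product.vec_eq_iff)

lemma kap_diff: "kap (k - l) = kap k - kap l"
  by (simp add: kap_def Finite_Cartesian_Product.vec_eq_iff right_diff_distrib diff_divide_distrib)

lemma kap_zero [simp]: "kap 0 = 0"
  by (simp add: kap_def Finite_Cartesian_Product.vec_eq_iff)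

lemma kap_nth: "kap k $ i = 2 * pi * of_int (k $ i) / L $ i"
  by (simp add: kap_def)

lemma kap_shift: "kap k \<bullet> (x + axis i (L $ i)) = kap k \<bullet> x + of_int (k $ i) * (2 * pi)"
  using L_pos[of i] by (simp add: inner_add_right inner_axis kap_nth)

lemma trig_shift: "cos (a + of_int m * (2 * pi)) = cos a" "sin (a + of_int m * (2 * pi)) = sin a"
  using sin_cos_eq_iff[of "a + of_int m * (2 * pi)" a] by (auto intro!: exI[of _ m])

lemma periodic_cos: "periodic L (\<lambda>x. cos (kap k \<bullet> x))" and periodic_sin: "periodic L (\<lambda>x. sin (kap k \<bullet> x))"
  by (simp_all add: periodic_def kap_shift trig_shift)

lemma periodic_ebas: "periodic L (ebas k)"
  by (simp add: periodic_def ebas_def kap_shift trig_shift)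

lemma continuous_ebas: "continuous_on S (ebas k)"
  unfolding ebas_def by (intro continuous_intros)

lemma ebas_bound: "\<bar>ebas k x\<bar> \<le> 2"
  unfolding ebas_def using abs_cos_le_one[of "kap k \<bullet> x"] abs_sin_le_one[of "kap k \<bullet> x"] by linarith

lemma ebas_has_derivative:
  "((\<lambda>x. c * ebas k x) has_derivative (\<lambda>h. (c * (kap k \<bullet> h)) * ebas (- k) x)) (at x)"
  unfolding ebas_def by (auto intro!: derivative_eq_intros simp: kap_minus algebra_simps)

lemma partial_deriv_ebas: "partial_deriv i (\<lambda>x. c * ebas k x) = (\<lambda>x. (c * kap k $ i) * ebas (- k) x)"
proof
  fix x
  show "partial_deriv i (\<lambda>x. c * ebas k x) x = (c * kap k $ i) * ebas (- k) x"
    unfolding partial_deriv_def frechet_derivative_at[OF ebas_has_derivative, symmetric]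
    by (simp add: inner_axis)
qed

text \<open>The iterated derivative of order \<open>is\<close> maps \<open>ebas k\<close> to \<open>dcoef is k * ebas (dind is k)\<close>.\<close>

definition dind :: "'n list \<Rightarrow> int^'n \<Rightarrow> int^'n" where
  "dind is k = (if even (length is) then k else - k)"

primrec dcoef :: "'n list \<Rightarrow> int^'n \<Rightarrow> real" where
  "dcoef [] k = 1"
| "dcoef (i # is) k = dcoef is k * kap (dind is k) $ i"

lemma iter_partial_ebas: "iter_partial is (\<lambda>x. c * ebas k x) = (\<lambda>x. (c * dcoef is k) * ebas (dind is k) x)"
proof (induction "is")
  case (Cons i "is")
  have "iter_partial (i # is) (\<lambda>x. c * ebas k x) = partial_deriv i (iter_partial is (\<lambda>x. c * ebas k x))"
    by (simp add: iter_partial_def)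
  also have "\<dots> = (\<lambda>x. (c * dcoef is k * kap (dind is k) $ i) * ebas (- dind is k) x)"
    unfolding Cons by (rule partial_deriv_ebas)
  finally show ?case by (simp add: dind_def mult.assoc)
qed (simp add: iter_partial_def dind_def)

lemma ebas_test: "(\<lambda>x. c * ebas k x) \<in> test_functions L"
  unfolding test_functions_def mem_Collect_eq
proof (intro conjI allI)
  show "periodic L (\<lambda>x. c * ebas k x)" using periodic_ebas[of k] by (simp add: periodic_def)
  show "iter_partial is (\<lambda>x. c * ebas k x) differentiable at x" for "is" x
    unfolding iter_partial_ebas by (rule differentiableI[OF ebas_has_derivative])
qed

lemma sgn_dcoef: "\<bar>dcoef is k\<bar> \<le> norm (kap k) ^ length is"
proof (induction "is")
  case (Cons i "is")
  have "norm (kap (dind is k)) = norm (kap k)" by (simp add: dind_def kap_minus)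
  then have "\<bar>kap (dind is k) $ i\<bar> \<le> norm (kap k)"
    using component_le_norm_cart[of "kap (dind is k)" i] by simp
  with Cons have "\<bar>dcoef is k\<bar> * \<bar>kap (dind is k) $ i\<bar> \<le> norm (kap k) ^ length is * norm (kap k)"
    by (intro mult_mono) auto
  then show ?case by (simp add: abs_mult mult.commute)
qed simp

section \<open>Orthogonality\<close>

lemma ebas_mult: "ebas k x * ebas l x = cos (kap (k - l) \<bullet> x) + sin (kap (k + l) \<bullet> x)"
  unfolding ebas_def kap_diff kap_add inner_diff_left inner_add_left cos_diff sin_add
  by (simp add: algebra_simps)

text \<open>Along an axis with k_i nonzero, a shift by half a wave length reverses the sign of both
  functions, so each integral equals its own negative. As |k_i| \<ge> 1, this shift stays within one
  period of the torus.\<close>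

lemma integral_trig_zero:
  assumes "k \<noteq> 0"
  shows "(\<integral>x. cos (kap k \<bullet> x) \<partial>TM) = 0" "(\<integral>x. sin (kap k \<bullet> x) \<partial>TM) = 0"
proof -
  obtain i where i: "k $ i \<noteq> 0" using assms by (auto simp: Finite_Cartesian_Product.vec_eq_iff)
  define h where "h = L $ i / (2 * \<bar>of_int (k $ i)\<bar>)"
  have k1: "1 \<le> \<bar>of_int (k $ i) :: real\<bar>" using i by linarith
  have h: "0 \<le> h" "h \<le> L $ i"
  proof -
    show "0 \<le> h" using L_pos[of i] by (simp add: h_def)
    have "L $ i * 1 \<le> L $ i * (2 * \<bar>of_int (k $ i)\<bar>)" using k1 L_pos[of i] by (intro mult_left_mono) auto
    then show "h \<le> L $ i" using k1 by (simp add: h_def field_simps)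
  qed
  have sh: "kap k \<bullet> (x + axis i h) = kap k \<bullet> x + sgn (of_int (k $ i)) * pi" for x
    using L_pos[of i] i by (simp add: inner_add_right inner_axis kap_nth h_def sgn_if field_simps)
  have neg: "cos (a + sgn (of_int (k $ i)) * pi) = - cos a" "sin (a + sgn (of_int (k $ i)) * pi) = - sin a" for a :: real
    using i by (auto simp: sgn_if)
  have c: "continuous_on UNIV (\<lambda>x. cos (kap k \<bullet> x))" "continuous_on UNIV (\<lambda>x. sin (kap k \<bullet> x))"
    by (intro continuous_intros)+
  show "(\<integral>x. cos (kap k \<bullet> x) \<partial>TM) = 0"
    using integral_periodic_shift[OF periodic_cos c(1) h] unfolding sh neg by simp
  show "(\<integral>x. sin (kap k \<bullet> x) \<partial>TM) = 0"
    using integral_periodic_shift[OF periodic_sin c(2) h] unfolding sh neg by simp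
qed

lemma integral_one: "(\<integral>x. 1 \<partial>TM) = vol"
  using emeasure_TM vol_pos by (simp add: measure_def)

lemma ebas_orth: "(\<integral>x. ebas k x * ebas l x \<partial>TM) = (if k = l then vol else 0)"
proof -
  have c: "integrable TM (\<lambda>x. cos (kap m \<bullet> x))" "integrable TM (\<lambda>x. sin (kap m \<bullet> x))" for m
    by (intro continuous_integrable_TM continuous_intros)+
  have s: "(\<integral>x. sin (kap (k + l) \<bullet> x) \<partial>TM) = 0"
    by (cases "k + l = 0") (use integral_trig_zero(2) in auto)
  have "(\<integral>x. ebas k x * ebas l x \<partial>TM) = (\<integral>x. cos (kap (k - l) \<bullet> x) \<partial>TM) + (\<integral>x. sin (kap (k + l) \<bullet> x) \<partial>TM)"
    unfolding ebas_mult using c by (simp add: Bochner_Integration.integral_add)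
  also have "\<dots> = (if k = l then vol else 0)"
    using s integral_trig_zero(1)[of "k - l"] integral_one by auto
  finally show ?thesis .
qed

section \<open>Completeness\<close>

inductive_set trig_poly :: "(real^'n \<Rightarrow> real) set" where
  ebas: "ebas k \<in> trig_poly"
| add: "f \<in> trig_poly \<Longrightarrow> g \<in> trig_poly \<Longrightarrow> (\<lambda>x. f x + g x) \<in> trig_poly"
| scale: "f \<in> trig_poly \<Longrightarrow> (\<lambda>x. c * f x) \<in> trig_poly"

lemma trig_poly_cos: "(\<lambda>x. cos (kap k \<bullet> x)) \<in> trig_poly"
proof -
  have "(\<lambda>x. (1/2) * ebas k x + (1/2) * ebas (- k) x) \<in> trig_poly" by (intro trig_poly.intros)
  then show ?thesis by (simp add: ebas_def kap_minus add_divide_distrib diff_divide_distrib)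
qed

lemma trig_poly_sin: "(\<lambda>x. sin (kap k \<bullet> x)) \<in> trig_poly"
proof -
  have "(\<lambda>x. (1/2) * ebas k x + (-1/2) * ebas (- k) x) \<in> trig_poly" by (intro trig_poly.intros)
  then show ?thesis by (simp add: ebas_def kap_minus add_divide_distrib diff_divide_distrib)
qed

lemma trig_poly_mult:
  assumes "f \<in> trig_poly" "g \<in> trig_poly" shows "(\<lambda>x. f x * g x) \<in> trig_poly"
  using assms
proof (induction f rule: trig_poly.induct)
  case (ebas k)
  from ebas show ?case
  proof (induction g rule: trig_poly.induct)
    case (ebas l)
    show ?case unfolding ebas_mult by (intro trig_poly.add trig_poly_cos trig_poly_sin)
  next
    case (add f g)
    then have "(\<lambda>x. ebas k x * f x + ebas k x * g x) \<in> trig_poly" by (intro trig_poly.add)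
    then show ?case by (simp add: distrib_left)
  next
    case (scale f c)
    then have "(\<lambda>x. c * (ebas k x * f x)) \<in> trig_poly" by (intro trig_poly.scale)
    then show ?case by (simp add: mult_ac)
  qed
next
  case (add f1 f2)
  then have "(\<lambda>x. f1 x * g x + f2 x * g x) \<in> trig_poly" by (intro trig_poly.add)
  then show ?case by (simp add: distrib_right)
next
  case (scale f c)
  then have "(\<lambda>x. c * (f x * g x)) \<in> trig_poly" by (intro trig_poly.scale)
  then show ?case by (simp add: mult_ac)
qed

lemma trig_poly_const: "(\<lambda>x. c) \<in> trig_poly"
proof -
  have "(\<lambda>x. c * ebas 0 x) \<in> trig_poly" by (intro trig_poly.intros)
  then show ?thesis by (simp add: ebas_def)
qed

lemma trig_poly_sum: "(\<And>i. i \<in> A \<Longrightarrow> f i \<in> trig_poly) \<Longrightarrow> (\<lambda>x. \<Sum>i\<in>A. f i x) \<in> trig_poly"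
  by (induction A rule: infinite_finite_induct) (auto intro: trig_poly.add trig_poly_const)

lemma trig_poly_continuous: "f \<in> trig_poly \<Longrightarrow> continuous_on UNIV f"
  by (induction rule: trig_poly.induct) (auto intro!: continuous_intros continuous_ebas)

text \<open>T is mapped injectively into a product of circles. The coordinates of the map are
  trigonometric polynomials, and so are polynomials in them; Stone-Weierstrass on the compact image
  of the closed box therefore provides approximation by trigonometric polynomials.\<close>

definition emb :: "real^'n \<Rightarrow> (real^'n) \<times> (real^'n)" where
  "emb x = ((\<chi> i. cos (2 * pi * x $ i / L $ i)), (\<chi> i. sin (2 * pi * x $ i / L $ i)))"

lemma continuous_emb: "continuous_on S emb"
  unfolding emb_def by (intro continuous_intros continuous_on_vec_lambda) (use L_pos in \<open>auto simp: less_imp_neq[symmetric]\<close>)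

lemma inj_on_emb: "inj_on emb T"
proof (rule inj_onI)
  fix x y assume xy: "x \<in> T" "y \<in> T" "emb x = emb y"
  show "x = y" unfolding Finite_Cartesian_Product.vec_eq_iff
  proof
    fix i
    have "cos (2 * pi * x $ i / L $ i) = cos (2 * pi * y $ i / L $ i)" "sin (2 * pi * x $ i / L $ i) = sin (2 * pi * y $ i / L $ i)"
      using xy(3) by (auto simp: emb_def Finite_Cartesian_Product.vec_eq_iff)
    then obtain m :: int where m: "2 * pi * x $ i / L $ i = 2 * pi * y $ i / L $ i + 2 * pi * m"
      using sin_cos_eq_iff by blast
    have Li: "L $ i > 0" by (rule L_pos)
    have "2 * pi * (x $ i / L $ i) = 2 * pi * (y $ i / L $ i + m)" using m by (simp add: distrib_left)
    then have m': "x $ i / L $ i = y $ i / L $ i + m" by (subst (asm) mult_cancel_left) simp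
    have "0 \<le> x $ i / L $ i" "x $ i / L $ i < 1" "0 \<le> y $ i / L $ i" "y $ i / L $ i < 1"
      using xy(1,2) Li by (auto simp: Torus_def)
    then have "\<bar>of_int m :: real\<bar> < 1" using m' by linarith
    then have "m = 0" by linarith
    then show "x $ i = y $ i" using m' Li by simp
  qed
qed

lemma trig_poly_emb_Basis:
  assumes "b \<in> Basis" shows "(\<lambda>x. emb x \<bullet> b) \<in> trig_poly"
proof -
  have k: "kap (axis i 1) \<bullet> x = 2 * pi * x $ i / L $ i" for i and x :: "real^'n"
  proof -
    have "kap (axis i 1) = axis i (2 * pi / L $ i)"
      by (simp add: kap_def Finite_Cartesian_Product.vec_eq_iff axis_def)
    then show ?thesis by (simp add: inner_axis' )
  qed
  from assms consider i where "b = (axis i 1, 0)" | i where "b = (0, axis i 1)"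
    by (auto simp: Basis_prod_def Basis_vec_def)
  then show ?thesis
  proof cases
    case 1
    then have "(\<lambda>x. emb x \<bullet> b) = (\<lambda>x. cos (kap (axis i 1) \<bullet> x))"
      unfolding k by (simp add: emb_def inner_axis)
    then show ?thesis using trig_poly_cos by simp
  next
    case 2
    then have "(\<lambda>x. emb x \<bullet> b) = (\<lambda>x. sin (kap (axis i 1) \<bullet> x))"
      unfolding k by (simp add: emb_def inner_axis)
    then show ?thesis using trig_poly_sin by simp
  qed
qed

lemma trig_poly_polynomial:
  "real_polynomial_function p \<Longrightarrow> (\<lambda>x. p (emb x)) \<in> trig_poly"
proof (induction rule: real_polynomial_function.induct)
  case (linear f)
  have eqf: "f y = (\<Sum>b\<in>Basis. (y \<bullet> b) * f b)" for y
  proof -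
    interpret f: bounded_linear f by fact
    have "f y = f (\<Sum>b\<in>Basis. (y \<bullet> b) *\<^sub>R b)" by (simp only: euclidean_representation)
    also have "\<dots> = (\<Sum>b\<in>Basis. (y \<bullet> b) * f b)" by (simp add: f.sum f.scaleR)
    finally show ?thesis .
  qed
  have "(\<lambda>x. f (emb x)) = (\<lambda>x. \<Sum>b\<in>Basis. f b * (emb x \<bullet> b))"
    by (rule ext, subst eqf) (simp only: mult.commute)
  also have "\<dots> \<in> trig_poly" by (intro trig_poly_sum trig_poly.scale trig_poly_emb_Basis)
  finally show ?case .
qed (auto intro: trig_poly_const trig_poly.add trig_poly_mult)

lemma orthogonal_trig_poly:
  assumes u: "u \<in> sq_int TM" and orth: "\<And>k. (\<integral>x. u x * ebas k x \<partial>TM) = 0" and f: "f \<in> trig_poly"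
  shows "(\<integral>x. u x * f x \<partial>TM) = 0"
  using f
proof (induction rule: trig_poly.induct)
  case (add f g)
  then show ?case
    using sq_int_mult_integrable[OF u continuous_sq_int[OF trig_poly_continuous[OF add.hyps(1)]]]
      sq_int_mult_integrable[OF u continuous_sq_int[OF trig_poly_continuous[OF add.hyps(2)]]]
    by (simp add: distrib_left)
next
  case (scale f c)
  then show ?case by (simp add: mult.left_commute)
qed (rule orth)

lemma orthogonal_continuous_emb:
  assumes u: "u \<in> sq_int TM" and orth: "\<And>k. (\<integral>x. u x * ebas k x \<partial>TM) = 0"
    and F: "continuous_on UNIV F"
  shows "(\<integral>x. u x * F (emb x) \<partial>TM) = 0"
proof -
  have ui: "integrable TM (\<lambda>x. \<bar>u x\<bar>)" using sq_int_integrable_TM[OF u] by simp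
  have Fc: "continuous_on UNIV (\<lambda>x. F (emb x))"
    by (intro continuous_on_compose2[OF F] continuous_emb) auto
  have "\<bar>\<integral>x. u x * F (emb x) \<partial>TM\<bar> \<le> e * (\<integral>x. \<bar>u x\<bar> \<partial>TM)" if e: "e > 0" for e
  proof -
    obtain p where p: "real_polynomial_function p" "\<And>y. y \<in> emb ` cbox 0 L \<Longrightarrow> \<bar>F y - p y\<bar> < e"
      using Stone_Weierstrass_real_polynomial_function[OF compact_continuous_image[OF continuous_emb compact_cbox[of 0 L]] continuous_on_subset[OF F subset_UNIV] e]
      by metis
    have pc: "continuous_on UNIV (\<lambda>x. p (emb x))" by (rule trig_poly_continuous[OF trig_poly_polynomial[OF p(1)]])
    have i: "integrable TM (\<lambda>x. u x * F (emb x))" "integrable TM (\<lambda>x. u x * p (emb x))"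
      by (rule sq_int_mult_integrable[OF u continuous_sq_int[OF Fc]], rule sq_int_mult_integrable[OF u continuous_sq_int[OF pc]])
    have "(\<integral>x. u x * F (emb x) \<partial>TM) = (\<integral>x. u x * F (emb x) \<partial>TM) - (\<integral>x. u x * p (emb x) \<partial>TM)"
      using orthogonal_trig_poly[OF u orth trig_poly_polynomial[OF p(1)]] by simp
    also have "\<dots> = (\<integral>x. u x * F (emb x) - u x * p (emb x) \<partial>TM)" using i by simp
    also have "\<bar>\<dots>\<bar> \<le> (\<integral>x. \<bar>u x * F (emb x) - u x * p (emb x)\<bar> \<partial>TM)" by (rule integral_abs_bound)
    also have "\<dots> \<le> (\<integral>x. e * \<bar>u x\<bar> \<partial>TM)"
    proof (rule integral_mono)
      fix x assume "x \<in> space TM"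
      then have "\<bar>F (emb x) - p (emb x)\<bar> < e" using p(2)[of "emb x"] Torus_subset_cbox by auto
      then have "\<bar>u x\<bar> * \<bar>F (emb x) - p (emb x)\<bar> \<le> \<bar>u x\<bar> * e" by (intro mult_left_mono) auto
      then show "\<bar>u x * F (emb x) - u x * p (emb x)\<bar> \<le> e * \<bar>u x\<bar>"
        by (simp add: right_diff_distrib[symmetric] abs_mult mult.commute)
    qed (use i ui in auto)
    also have "\<dots> = e * (\<integral>x. \<bar>u x\<bar> \<partial>TM)" by simp
    finally show ?thesis .
  qed
  note le = this
  let ?I = "\<integral>x. \<bar>u x\<bar> \<partial>TM"
  have I0: "?I \<ge> 0" by (rule integral_nonneg_AE) auto
  have "\<bar>\<integral>x. u x * F (emb x) \<partial>TM\<bar> \<le> 0"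
  proof (rule field_le_epsilon)
    fix e :: real assume e: "e > 0"
    have "\<bar>\<integral>x. u x * F (emb x) \<partial>TM\<bar> \<le> (e / (?I + 1)) * ?I" using le[of "e / (?I + 1)"] e I0 by simp
    also have "\<dots> = e * (?I / (?I + 1))" by simp
    also have "\<dots> \<le> e * 1"
    proof (rule mult_left_mono)
      have "?I + 1 > 0" using I0 by linarith
      then show "?I / (?I + 1) \<le> 1" by (subst divide_le_eq_1_pos) linarith+
    qed (use e in simp)
    finally show "\<bar>\<integral>x. u x * F (emb x) \<partial>TM\<bar> \<le> 0 + e" by simp
  qed
  then show ?thesis by simp
qed

text \<open>On T the indicator of C is the bounded pointwise limit of continuous functions of
  \<open>emb x\<close>, namely cut-offs of the distance to the image of C; injectivity of
  \<open>emb\<close> on T makes the limit vanish off C.\<close>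

lemma orthogonal_compact:
  assumes u: "u \<in> sq_int TM" and orth: "\<And>k. (\<integral>x. u x * ebas k x \<partial>TM) = 0"
    and C: "compact C" "C \<subseteq> T"
  shows "(\<integral>x. u x * indicator C x \<partial>TM) = 0"
proof (cases "C = {}")
  case False
  define F where "F n y = max 0 (1 - real n * infdist y (emb ` C))" for n y
  have Fc: "continuous_on UNIV (F n)" for n unfolding F_def by (intro continuous_intros)
  have cl: "closed (emb ` C)" by (intro compact_imp_closed compact_continuous_image continuous_emb C)
  have ne: "emb ` C \<noteq> {}" using False by simp
  have lim: "(\<lambda>n. u x * F n (emb x)) \<longlonglongrightarrow> u x * indicator C x" if x: "x \<in> T" for x
  proof (cases "x \<in> C")
    case True
    then have "F n (emb x) = 1" for n by (simp add: F_def)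
    then show ?thesis using True by simp
  next
    case False
    then have "emb x \<notin> emb ` C" using inj_on_emb C(2) x by (metis inj_on_image_mem_iff)
    then have d: "infdist (emb x) (emb ` C) > 0"
      using in_closed_iff_infdist_zero[OF cl ne] infdist_nonneg[of "emb x" "emb ` C"] by (metis less_eq_real_def)
    obtain N where N: "1 < real N * infdist (emb x) (emb ` C)" using reals_Archimedean3[OF d] by blast
    have "F n (emb x) = 0" if "n \<ge> N" for n
    proof -
      have "real N * infdist (emb x) (emb ` C) \<le> real n * infdist (emb x) (emb ` C)"
        using that d by (intro mult_right_mono) auto
      then show ?thesis using N by (simp add: F_def)
    qed
    then have "\<forall>\<^sub>F n in sequentially. u x * F n (emb x) = u x * indicator C x"
      using False by (auto simp: eventually_sequentially intro!: exI[of _ N])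
    then show ?thesis by (rule tendsto_eventually)
  qed
  have "(\<lambda>n. \<integral>x. u x * F n (emb x) \<partial>TM) \<longlonglongrightarrow> (\<integral>x. u x * indicator C x \<partial>TM)"
  proof (rule integral_dominated_convergence[where w = "\<lambda>x. \<bar>u x\<bar>"])
    have um: "u \<in> borel_measurable TM" using u by (rule sq_int_measurable)
    have "(indicator C :: _ \<Rightarrow> real) \<in> borel_measurable TM"
      by (rule borel_measurable_TM) (use compact_imp_closed[OF C(1)] in auto)
    then show "(\<lambda>x. u x * indicator C x) \<in> borel_measurable TM" using um by auto
    have "continuous_on UNIV (\<lambda>x. F n (emb x))" for n
      by (intro continuous_on_compose2[OF Fc] continuous_emb) auto
    then have "(\<lambda>x. F n (emb x)) \<in> borel_measurable TM" for n
      by (intro borel_measurable_TM borel_measurable_continuous_onI)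
    then show "(\<lambda>x. u x * F n (emb x)) \<in> borel_measurable TM" for n using um by auto
    show "integrable TM (\<lambda>x. \<bar>u x\<bar>)" using sq_int_integrable_TM[OF u] by simp
    show "AE x in TM. (\<lambda>n. u x * F n (emb x)) \<longlonglongrightarrow> u x * indicator C x" using lim by (intro AE_I2) simp
    show "AE x in TM. norm (u x * F n (emb x)) \<le> \<bar>u x\<bar>" for n
    proof (rule AE_I2)
      fix x
      have "\<bar>F n (emb x)\<bar> \<le> 1" using infdist_nonneg[of "emb x" "emb ` C"] by (simp add: F_def)
      then show "norm (u x * F n (emb x)) \<le> \<bar>u x\<bar>" using mult_left_mono[of "\<bar>F n (emb x)\<bar>" 1 "\<bar>u x\<bar>"] by (simp add: abs_mult)
    qed
  qed
  then show ?thesis using orthogonal_continuous_emb[OF u orth Fc] by (simp add: LIMSEQ_const_iff)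
qed simp

text \<open>If u were positive on a set of positive measure, inner regularity would give a compact
  subset of positive measure on which u > 0, and the integral of u over it could not vanish.\<close>

lemma orthogonal_imp_nonpos:
  assumes u: "u \<in> sq_int TM" and orth: "\<And>k. (\<integral>x. u x * ebas k x \<partial>TM) = 0"
  shows "AE x in TM. u x \<le> 0"
proof (rule ccontr)
  assume neg: "\<not> (AE x in TM. u x \<le> 0)"
  have um: "u \<in> borel_measurable TM" using u by (rule sq_int_measurable)
  define P where "P = {x \<in> T. u x > 0}"
  have Ps: "P \<in> sets TM" unfolding P_def using um by (metis (no_types) borel_measurable_iff_greater space_TM)
  then have Pl: "P \<in> sets lebesgue" by (auto simp: sets_restrict_space)
  have pos: "emeasure TM P > 0"
  proof (rule ccontr)
    assume "\<not> emeasure TM P > 0"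
    then have "P \<in> null_sets TM" using Ps by auto
    then have "AE x in TM. x \<notin> P" by (rule AE_not_in)
    then have "AE x in TM. u x \<le> 0" by (rule AE_mp) (auto simp: P_def intro!: AE_I2)
    with neg show False by simp
  qed
  have PT: "P \<subseteq> T" by (auto simp: P_def)
  have pos': "emeasure lebesgue P > 0" using pos PT by (subst (asm) emeasure_restrict_space) auto
  have fin: "emeasure lebesgue P < \<infinity>"
    using emeasure_mono[OF PT, of lebesgue] emeasure_T_finite by (auto intro: le_less_trans)
  \<comment> \<open>Half of the measure of \<open>P\<close>: removing less than all of
    \<open>P\<close> leaves a closed part of positive measure.\<close>
  define e where "e = measure lebesgue P / 2"
  have eP: "emeasure lebesgue P = ennreal (measure lebesgue P)"
    using fin by (intro emeasure_eq_ennreal_measure) auto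
  have e: "e > 0" "ennreal e < emeasure lebesgue P"
    using pos' unfolding e_def eP by (simp_all add: ennreal_less_iff)
  obtain C where C: "closed C" "C \<subseteq> P" "emeasure lebesgue (P - C) < ennreal e"
    using sets_lebesgue_inner_closed[OF Pl e(1)] by metis
  have Cc: "compact C"
    using C(1,2) PT Torus_subset_cbox bounded_subset[OF bounded_cbox] by (metis compact_eq_bounded_closed order_trans)
  have Cs: "C \<in> sets TM" using C(1,2) PT by (auto simp: sets_restrict_space intro!: image_eqI[of _ _ C])
  have "emeasure lebesgue C > 0"
  proof (rule ccontr)
    assume "\<not> emeasure lebesgue C > 0"
    then have z: "emeasure lebesgue C = 0" by simp
    have Cl: "C \<in> sets lebesgue" using C(1) by simp
    have "emeasure lebesgue ((P - C) \<union> C) \<le> emeasure lebesgue (P - C) + emeasure lebesgue C"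
      using Pl Cl by (intro emeasure_subadditive) auto
    moreover have "(P - C) \<union> C = P" using C(2) by auto
    ultimately show False using z C(3) e(2) by (simp add: leD less_trans)
  qed
  then have Cpos: "emeasure TM C > 0" using C(2) PT by (subst emeasure_restrict_space) auto
  have i: "integrable TM (\<lambda>x. u x * indicator C x)"
    using integrable_mult_indicator[OF Cs sq_int_integrable_TM[OF u]] by (simp add: mult.commute)
  have "(\<integral>x. u x * indicator C x \<partial>TM) = 0" by (rule orthogonal_compact[OF u orth Cc]) (use C(2) PT in auto)
  then have "AE x in TM. u x * indicator C x = 0"
    by (subst (asm) integral_nonneg_eq_0_iff_AE[OF i]) (use C(2) in \<open>auto simp: P_def indicator_def intro!: AE_I2\<close>)
  then have "AE x in TM. x \<notin> C" by (rule AE_mp) (use C(2) in \<open>auto simp: P_def indicator_def intro!: AE_I2\<close>)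
  then have "C \<in> null_sets TM" using AE_iff_null_sets[OF Cs] by blast
  then have "emeasure TM C = 0" by auto
  with Cpos show False by simp
qed

theorem ebas_complete:
  assumes u: "u \<in> sq_int TM" and orth: "\<And>k. (\<integral>x. u x * ebas k x \<partial>TM) = 0"
  shows "AE x in TM. u x = 0"
proof -
  have "(\<lambda>x. - u x) \<in> sq_int TM" using sq_int_scale[OF u, of "-1"] by simp
  then have "AE x in TM. - u x \<le> 0" by (rule orthogonal_imp_nonpos) (simp add: orth)
  with orthogonal_imp_nonpos[OF u orth] show ?thesis by eventually_elim simp
qed

end

section \<open>Exhausting a countable index type by finite sets\<close>

definition fin_idx :: "nat \<Rightarrow> 'k::countable set" where "fin_idx n = {k. to_nat k < n}"

lemma finite_fin_idx [simp]: "finite (fin_idx n :: 'k::countable set)"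
proof -
  have "inj_on to_nat (fin_idx n :: 'k set)" by (rule inj_on_subset[OF inj_to_nat]) auto
  moreover have "to_nat ` (fin_idx n :: 'k set) \<subseteq> {..<n}" by (auto simp: fin_idx_def)
  ultimately show ?thesis by (metis finite_imageD finite_lessThan finite_subset)
qed

lemma fin_idx_mono: "m \<le> n \<Longrightarrow> fin_idx m \<subseteq> fin_idx n"
  by (auto simp: fin_idx_def)

lemma eventually_fin_idx: "\<forall>\<^sub>F n in sequentially. k \<in> fin_idx n"
  by (auto simp: fin_idx_def eventually_sequentially intro!: exI[of _ "Suc (to_nat k)"])

lemma nn_integral_count_space_finite_set:
  "finite A \<Longrightarrow> (\<integral>\<^sup>+k. f k * indicator A k \<partial>count_space UNIV) = (\<Sum>k\<in>A. f k)"
  by (simp add: nn_integral_count_space_indicator[symmetric] nn_integral_count_space_finite)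

lemma nn_integral_count_space_LIMSEQ:
  fixes f :: "'k::countable \<Rightarrow> ennreal"
  shows "(\<lambda>n. \<Sum>k\<in>fin_idx n. f k) \<longlonglongrightarrow> (\<integral>\<^sup>+k. f k \<partial>count_space UNIV)"
proof -
  have "(\<lambda>n. \<integral>\<^sup>+k. f k * indicator (fin_idx n) k \<partial>count_space UNIV) \<longlonglongrightarrow> (\<integral>\<^sup>+k. f k \<partial>count_space UNIV)"
  proof (rule nn_integral_LIMSEQ)
    show "incseq (\<lambda>n k. f k * indicator (fin_idx n) k)"
      by (auto simp: incseq_def le_fun_def indicator_def fin_idx_def)
    show "(\<lambda>n. f k * indicator (fin_idx n) k) \<longlonglongrightarrow> f k" for k
      by (rule tendsto_eventually) (use eventually_fin_idx[of k] in \<open>auto elim!: eventually_mono\<close>)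
  qed auto
  then show ?thesis by (simp add: nn_integral_count_space_finite_set)
qed

lemma nn_integral_count_space_le:
  fixes f :: "'k::countable \<Rightarrow> ennreal"
  assumes "\<And>A. finite A \<Longrightarrow> (\<Sum>k\<in>A. f k) \<le> B"
  shows "(\<integral>\<^sup>+k. f k \<partial>count_space UNIV) \<le> B"
  by (rule LIMSEQ_le_const2[OF nn_integral_count_space_LIMSEQ]) (use assms in auto)

lemma nn_integral_count_space_tail:
  fixes f :: "'k::countable \<Rightarrow> ennreal"
  assumes "(\<integral>\<^sup>+k. f k \<partial>count_space UNIV) < \<infinity>"
  shows "(\<lambda>n. \<integral>\<^sup>+k. f k * indicator (- fin_idx n) k \<partial>count_space UNIV) \<longlonglongrightarrow> 0"
proof -
  have "(\<lambda>n. \<integral>\<^sup>+k. f k * indicator (- fin_idx n) k \<partial>count_space UNIV) \<longlonglongrightarrow> (\<integral>\<^sup>+(k::'k). 0 \<partial>count_space UNIV)"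
  proof (rule nn_integral_dominated_convergence[where w = f])
    show "AE k in count_space UNIV. (\<lambda>n. f k * indicator (- fin_idx n) k) \<longlonglongrightarrow> 0"
    proof (intro AE_I2 tendsto_eventually)
      fix k :: 'k
      show "\<forall>\<^sub>F n in sequentially. f k * indicator (- fin_idx n) k = 0"
        using eventually_fin_idx[of k] by eventually_elim auto
    qed
  qed (use assms in \<open>auto simp: indicator_def\<close>)
  then show ?thesis by simp
qed

lemma sq_int_sum_LIMSEQ:
  fixes f :: "'k::countable \<Rightarrow> real"
  assumes "integrable (count_space UNIV) f"
  shows "(\<lambda>n. \<Sum>k\<in>fin_idx n. f k) \<longlonglongrightarrow> (\<integral>k. f k \<partial>count_space UNIV)"
proof -
  have "(\<lambda>n. \<integral>k. f k * indicator (fin_idx n) k \<partial>count_space UNIV) \<longlonglongrightarrow> (\<integral>k. f k \<partial>count_space UNIV)"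
  proof (rule integral_dominated_convergence[where w = "\<lambda>k. \<bar>f k\<bar>"])
    show "AE k in count_space UNIV. (\<lambda>n. f k * indicator (fin_idx n) k) \<longlonglongrightarrow> f k"
    proof (intro AE_I2 tendsto_eventually)
      fix k :: 'k
      show "\<forall>\<^sub>F n in sequentially. f k * indicator (fin_idx n) k = f k"
        using eventually_fin_idx[of k] by eventually_elim auto
    qed
  qed (use assms in \<open>auto simp: indicator_def\<close>)
  moreover have "(\<integral>k. f k * indicator A k \<partial>count_space UNIV) = (\<Sum>k\<in>A. f k)" if "finite A" for A
  proof -
    have "finite {a. f a * indicator A a \<noteq> 0}" by (rule finite_subset[OF _ that]) (auto simp: indicator_def)
    then have "(\<integral>k. f k * indicator A k \<partial>count_space UNIV) = (\<Sum>k | f k * indicator A k \<noteq> 0. f k * indicator A k)"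
      using lebesgue_integral_count_space_finite_support[of UNIV "\<lambda>k. f k * indicator A k"] by simp
    also have "\<dots> = (\<Sum>k\<in>A. f k)"
      using that by (intro sum.mono_neutral_cong_left) (auto simp: indicator_def)
    finally show ?thesis .
  qed
  ultimately show ?thesis by simp
qed

context torus
begin

section \<open>Fourier coefficients\<close>

abbreviation CM :: "(int^'n) measure" where "CM \<equiv> count_space UNIV"

definition bas :: "int^'n \<Rightarrow> real^'n \<Rightarrow> real" where "bas k x = ebas k x / sqrt vol"

definition fc :: "(real^'n \<Rightarrow> real) \<Rightarrow> int^'n \<Rightarrow> real" where
  "fc u k = (\<integral>x. u x * bas k x \<partial>TM)"

definition tsum :: "(int^'n) set \<Rightarrow> (int^'n \<Rightarrow> real) \<Rightarrow> real^'n \<Rightarrow> real" where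
  "tsum A c x = (\<Sum>k\<in>A. c k * bas k x)"

lemma L2_space_eq: "L2_space L = sq_int TM"
  by (simp add: L2_space_def sq_int_def)

lemma L2_inner_self: "L2_inner L u u = (nrm TM u)\<^sup>2"
  unfolding L2_inner_def nrm_sq by (simp add: power2_eq_square)

lemma L2_norm_eq: "L2_norm L u = nrm TM u"
  by (simp add: L2_norm_def L2_inner_self)

lemma fc_eq: "fc u k = L2_inner L u (bas k)"
  by (simp add: fc_def L2_inner_def)

lemma continuous_bas: "continuous_on S (bas k)"
  unfolding bas_def using vol_pos by (intro continuous_intros continuous_ebas) auto

lemma bas_measurable [measurable]: "bas k \<in> borel_measurable borel"
  by (intro borel_measurable_continuous_onI continuous_bas)

lemma bas_sq_int [simp]: "bas k \<in> sq_int TM"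
  by (rule continuous_sq_int[OF continuous_bas])

lemma bas_bound: "\<bar>bas k x\<bar> \<le> 2 / sqrt vol"
  using ebas_bound[of k x] vol_pos by (simp add: bas_def divide_right_mono)

lemma bas_orth: "(\<integral>x. bas k x * bas l x \<partial>TM) = (if k = l then 1 else 0)"
proof -
  have "(\<integral>x. bas k x * bas l x \<partial>TM) = (\<integral>x. ebas k x * ebas l x / vol \<partial>TM)"
    using vol_pos by (intro Bochner_Integration.integral_cong) (auto simp: bas_def)
  also have "\<dots> = (if k = l then 1 else 0)" using ebas_orth vol_pos by simp
  finally show ?thesis .
qed

lemma nrm_bas: "nrm TM (bas k) = 1"
  using bas_orth[of k k] by (simp add: nrm_def power2_eq_square)

lemma fc_add: "u \<in> sq_int TM \<Longrightarrow> w \<in> sq_int TM \<Longrightarrow> fc (\<lambda>x. u x + w x) k = fc u k + fc w k"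
  using sq_int_mult_integrable[of u TM "bas k"] sq_int_mult_integrable[of w TM "bas k"]
  by (simp add: fc_def distrib_right)

lemma fc_diff: "u \<in> sq_int TM \<Longrightarrow> w \<in> sq_int TM \<Longrightarrow> fc (\<lambda>x. u x - w x) k = fc u k - fc w k"
  using sq_int_mult_integrable[of u TM "bas k"] sq_int_mult_integrable[of w TM "bas k"]
  by (simp add: fc_def left_diff_distrib)

lemma fc_scale: "fc (\<lambda>x. a * u x) k = a * fc u k"
  by (simp add: fc_def mult.assoc)

lemma fc_sum: "(\<And>i. i \<in> A \<Longrightarrow> u i \<in> sq_int TM) \<Longrightarrow> fc (\<lambda>x. \<Sum>i\<in>A. u i x) k = (\<Sum>i\<in>A. fc (u i) k)"
proof (induction A rule: infinite_finite_induct)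
  case (insert a A)
  then show ?case using fc_add[of "u a" "\<lambda>x. \<Sum>i\<in>A. u i x" k] sq_int_sum[of A u TM] by simp
qed (simp_all add: fc_def)

lemma fc_cong_AE:
  assumes "u \<in> borel_measurable TM" "w \<in> borel_measurable TM" "AE x in TM. u x = w x"
  shows "fc u = fc w"
proof
  fix k
  have "bas k \<in> borel_measurable TM" by (rule sq_int_measurable) simp
  then show "fc u k = fc w k" unfolding fc_def
    using assms by (intro integral_cong_AE) auto
qed

lemma fc_le: "u \<in> sq_int TM \<Longrightarrow> \<bar>fc u k\<bar> \<le> nrm TM u"
  using Cauchy_Schwarz_integral[of u TM "bas k"] by (simp add: fc_def nrm_bas)

lemma tsum_continuous: "continuous_on S (tsum A c)"
  unfolding tsum_def by (intro continuous_intros continuous_bas)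

lemma tsum_sq_int [simp]: "tsum A c \<in> sq_int TM"
  by (rule continuous_sq_int[OF tsum_continuous])

lemma fc_tsum:
  assumes "finite A" shows "fc (tsum A c) k = (if k \<in> A then c k else 0)"
proof -
  have "fc (tsum A c) k = (\<Sum>l\<in>A. c l * fc (bas l) k)"
    unfolding tsum_def by (subst fc_sum) (auto simp: fc_scale intro: sq_int_scale)
  also have "\<dots> = (\<Sum>l\<in>A. if l = k then c l else 0)"
    by (rule sum.cong) (auto simp: fc_def bas_orth)
  also have "\<dots> = (if k \<in> A then c k else 0)" using assms by simp
  finally show ?thesis .
qed

lemma inner_tsum:
  assumes "finite A" "u \<in> sq_int TM"
  shows "(\<integral>x. u x * tsum A c x \<partial>TM) = (\<Sum>k\<in>A. c k * fc u k)"
proof -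
  have "(\<integral>x. u x * tsum A c x \<partial>TM) = (\<integral>x. (\<Sum>k\<in>A. c k * (u x * bas k x)) \<partial>TM)"
    unfolding tsum_def by (rule Bochner_Integration.integral_cong) (auto simp: sum_distrib_left mult_ac)
  also have "\<dots> = (\<Sum>k\<in>A. c k * fc u k)"
    using sq_int_mult_integrable[OF assms(2) bas_sq_int] by (simp add: fc_def)
  finally show ?thesis .
qed

lemma nrm_tsum: "finite A \<Longrightarrow> (nrm TM (tsum A c))\<^sup>2 = (\<Sum>k\<in>A. (c k)\<^sup>2)"
  unfolding nrm_sq using inner_tsum[of A "tsum A c" c] by (simp add: power2_eq_square fc_tsum)

lemma Bessel:
  assumes "finite A" "u \<in> sq_int TM"
  shows "(\<Sum>k\<in>A. (fc u k)\<^sup>2) \<le> (nrm TM u)\<^sup>2"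
proof -
  have "0 \<le> (\<integral>x. (u x - tsum A (fc u) x)\<^sup>2 \<partial>TM)" by simp
  also have "\<dots> = (\<integral>x. (u x)\<^sup>2 - 2 * (u x * tsum A (fc u) x) + (tsum A (fc u) x)\<^sup>2 \<partial>TM)"
    by (rule Bochner_Integration.integral_cong) (auto simp: power2_diff)
  also have "\<dots> = (nrm TM u)\<^sup>2 - 2 * (\<integral>x. u x * tsum A (fc u) x \<partial>TM) + (nrm TM (tsum A (fc u)))\<^sup>2"
    using assms sq_int_mult_integrable[OF assms(2) tsum_sq_int] tsum_sq_int[of A "fc u"]
    unfolding nrm_sq sq_int_def by simp
  also have "\<dots> = (nrm TM u)\<^sup>2 - (\<Sum>k\<in>A. (fc u k)\<^sup>2)"
    using assms by (simp add: inner_tsum nrm_tsum) (simp add: power2_eq_square)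
  finally show ?thesis by simp
qed

lemma fc_l2:
  assumes "u \<in> sq_int TM" shows "fc u \<in> sq_int CM" "nrm CM (fc u) \<le> nrm TM u"
proof -
  have "(\<integral>\<^sup>+k. ennreal ((fc u k)\<^sup>2) \<partial>CM) \<le> ennreal ((nrm TM u)\<^sup>2)"
  proof (rule nn_integral_count_space_le)
    fix A :: "(int^'n) set" assume "finite A"
    then show "(\<Sum>k\<in>A. ennreal ((fc u k)\<^sup>2)) \<le> ennreal ((nrm TM u)\<^sup>2)"
      using Bessel[OF _ assms] by (simp add: sum_ennreal ennreal_leI)
  qed
  from sq_int_nn_integral_le[OF _ this] show "fc u \<in> sq_int CM" "nrm CM (fc u) \<le> nrm TM u" by auto
qed

lemma quarter_power: "(1/4 :: real)^j = ((1/2)^j)\<^sup>2"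
  by (simp add: power2_eq_square power_mult_distrib[symmetric])

section \<open>Synthesis\<close>

text \<open>The partial sums are taken along the first indices at which the tail drops below \<open>4^-j\<close>; this
  makes the series converge almost everywhere and \<open>syn c x\<close> jointly measurable in \<open>x\<close> and in any
  parameter on which \<open>c\<close> depends measurably.\<close>

definition tail :: "(int^'n \<Rightarrow> real) \<Rightarrow> nat \<Rightarrow> ennreal" where
  "tail c n = (\<integral>\<^sup>+k. ennreal ((c k)\<^sup>2) * indicator (- fin_idx n) k \<partial>CM)"

definition ncut :: "(int^'n \<Rightarrow> real) \<Rightarrow> nat \<Rightarrow> nat" where
  "ncut c j = (LEAST n. tail c n \<le> ennreal ((1/4)^j))"

definition syn :: "(int^'n \<Rightarrow> real) \<Rightarrow> real^'n \<Rightarrow> real" where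
  "syn c x = lim (\<lambda>j. tsum (fin_idx (ncut c j)) c x)"

lemma tail_cut:
  assumes "c \<in> sq_int CM" shows "tail c (ncut c j) \<le> ennreal ((1/4)^j)"
  unfolding ncut_def
proof (rule LeastI_ex)
  have "(\<integral>\<^sup>+k. ennreal ((c k)\<^sup>2) \<partial>CM) < \<infinity>" using assms by (simp add: sq_int_iff_nn_integral)
  then have "(\<lambda>n. tail c n) \<longlonglongrightarrow> 0" unfolding tail_def by (rule nn_integral_count_space_tail)
  then have "\<forall>\<^sub>F n in sequentially. tail c n < ennreal ((1/4)^j)" by (rule order_tendstoD) simp
  then show "\<exists>n. tail c n \<le> ennreal ((1/4)^j)" by (auto simp: eventually_sequentially intro: less_imp_le)
qed

lemma cut_mono:
  assumes "c \<in> sq_int CM" "i \<le> j" shows "ncut c i \<le> ncut c j"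
  unfolding ncut_def[of c i]
proof (rule Least_le)
  have "tail c (ncut c j) \<le> ennreal ((1/4)^j)" by (rule tail_cut[OF assms(1)])
  also have "\<dots> \<le> ennreal ((1/4)^i)" using assms(2) by (intro ennreal_leI power_decreasing) auto
  finally show "tail c (ncut c j) \<le> ennreal ((1/4)^i)" .
qed

lemma tsum_cut_diff:
  assumes c: "c \<in> sq_int CM" and "i \<le> j"
  shows "nrm TM (\<lambda>x. tsum (fin_idx (ncut c j)) c x - tsum (fin_idx (ncut c i)) c x) \<le> (1/2)^i"
proof -
  let ?D = "fin_idx (ncut c j) - fin_idx (ncut c i) :: (int^'n) set"
  have sub: "fin_idx (ncut c i) \<subseteq> (fin_idx (ncut c j) :: (int^'n) set)"
    by (rule fin_idx_mono[OF cut_mono[OF assms]])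
  have eq: "(\<lambda>x. tsum (fin_idx (ncut c j)) c x - tsum (fin_idx (ncut c i)) c x) = tsum ?D c"
    unfolding tsum_def by (rule ext) (simp add: sum_diff[OF _ sub])
  have "ennreal ((nrm TM (tsum ?D c))\<^sup>2) \<le> ennreal ((1/4)^i)"
  proof -
    have "ennreal ((nrm TM (tsum ?D c))\<^sup>2) = (\<integral>\<^sup>+k. ennreal ((c k)\<^sup>2) * indicator ?D k \<partial>CM)"
      by (simp add: nrm_tsum nn_integral_count_space_finite_set sum_ennreal)
    also have "\<dots> \<le> tail c (ncut c i)" unfolding tail_def
      by (intro nn_integral_mono) (auto simp: indicator_def)
    also have "\<dots> \<le> ennreal ((1/4)^i)" by (rule tail_cut[OF c])
    finally show ?thesis .
  qed
  then have "(nrm TM (tsum ?D c))\<^sup>2 \<le> ((1/2)^i)\<^sup>2" by (simp add: ennreal_le_iff quarter_power)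
  then have "nrm TM (tsum ?D c) \<le> (1/2)^i" by (rule power2_le_imp_le) simp
  then show ?thesis by (simp only: eq)
qed

lemma nrm_L1: "u \<in> sq_int TM \<Longrightarrow> (\<integral>x. \<bar>u x\<bar> \<partial>TM) \<le> sqrt vol * nrm TM u"
proof -
  assume u: "u \<in> sq_int TM"
  have "(\<lambda>x. \<bar>u x\<bar>) \<in> sq_int TM" using u by (auto simp: sq_int_def)
  from Cauchy_Schwarz_integral[OF this continuous_sq_int[of "\<lambda>x. 1"]]
  show ?thesis using integral_one by (simp add: nrm_def mult.commute)
qed

text \<open>The increments between consecutive cuts have L1 norms at most sqrt vol * 2^-j, so the
  sum of their absolute values is finite almost everywhere. Convergence of all partial sums would be
  a far deeper statement.\<close>

lemma syn_AE_LIMSEQ: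
  assumes c: "c \<in> sq_int CM"
  shows "AE x in TM. (\<lambda>j. tsum (fin_idx (ncut c j)) c x) \<longlonglongrightarrow> syn c x"
proof -
  let ?s = "\<lambda>j. tsum (fin_idx (ncut c j)) c"
  let ?d = "\<lambda>j x. \<bar>?s (Suc j) x - ?s j x\<bar>"
  have sq: "(\<lambda>x. ?s (Suc j) x - ?s j x) \<in> sq_int TM" for j by (intro sq_int_diff) auto
  have i: "integrable TM (?d j)" for j using sq_int_integrable_TM[OF sq] by simp
  have m [measurable]: "?d j \<in> borel_measurable TM" for j using i by auto
  have "(\<integral>\<^sup>+x. (\<Sum>j. ennreal (?d j x)) \<partial>TM) = (\<Sum>j. \<integral>\<^sup>+x. ennreal (?d j x) \<partial>TM)"
    by (rule nn_integral_suminf) measurable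
  also have "\<dots> \<le> (\<Sum>j. ennreal (sqrt vol * (1/2)^j))"
  proof (rule suminf_le)
    fix j
    have "(\<integral>\<^sup>+x. ennreal (?d j x) \<partial>TM) = ennreal (\<integral>x. ?d j x \<partial>TM)"
      by (rule nn_integral_eq_integral[OF i]) auto
    also have "\<dots> \<le> ennreal (sqrt vol * (1/2)^j)"
      using nrm_L1[OF sq, of j] tsum_cut_diff[OF c, of j "Suc j"] vol_pos
      by (intro ennreal_leI) (auto elim!: order_trans intro!: mult_left_mono)
    finally show "(\<integral>\<^sup>+x. ennreal (?d j x) \<partial>TM) \<le> ennreal (sqrt vol * (1/2)^j)" .
  qed auto
  also have "\<dots> = ennreal (\<Sum>j. sqrt vol * (1/2)^j)"
    using vol_pos by (intro suminf_ennreal2 summable_mult summable_geometric) auto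
  also have "\<dots> < \<infinity>" by simp
  finally have fin: "(\<integral>\<^sup>+x. (\<Sum>j. ennreal (?d j x)) \<partial>TM) \<noteq> \<infinity>" by simp
  have "AE x in TM. (\<Sum>j. ennreal (?d j x)) \<noteq> \<infinity>"
    by (rule nn_integral_noteq_infinite[OF _ fin]) measurable
  then show ?thesis
  proof eventually_elim
    case (elim x)
    then have "summable (\<lambda>j. ?d j x)" by (intro summable_suminf_not_top) auto
    then have "summable (\<lambda>j. ?s (Suc j) x - ?s j x)" by (rule summable_rabs_cancel)
    then have "convergent (\<lambda>n. \<Sum>j<n. ?s (Suc j) x - ?s j x)" by (simp add: summable_iff_convergent)
    then have "convergent (\<lambda>n. ?s n x - ?s 0 x)" by (simp only: sum_lessThan_telescope[of "\<lambda>n. ?s n x"])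
    then have "convergent (\<lambda>n. (?s n x - ?s 0 x) + ?s 0 x)" by (intro convergent_add convergent_const)
    then show ?case by (simp add: convergent_LIMSEQ_iff syn_def)
  qed
qed

lemma syn_measurable: "syn c \<in> borel_measurable borel"
  unfolding syn_def[abs_def] tsum_def by measurable

text \<open>Riesz-Fischer: Fatou turns the distance between two stages into the distance between
  stage j and the limit.\<close>

lemma syn_close:
  assumes c: "c \<in> sq_int CM"
  shows "syn c \<in> sq_int TM" "nrm TM (\<lambda>x. syn c x - tsum (fin_idx (ncut c j)) c x) \<le> (1/2)^j"
proof -
  let ?s = "\<lambda>j. tsum (fin_idx (ncut c j)) c"
  have sm: "?s j \<in> borel_measurable TM" for j using tsum_sq_int by (rule sq_int_measurable)
  have ym: "syn c \<in> borel_measurable TM" by (rule borel_measurable_TM[OF syn_measurable])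
  have le: "(\<integral>\<^sup>+x. ennreal ((syn c x - ?s j x)\<^sup>2) \<partial>TM) \<le> ennreal (((1/2)^j)\<^sup>2)" for j
  proof (rule sq_int_Fatou[where F = "\<lambda>m x. ?s m x - ?s j x" and m = j])
    show "AE x in TM. (\<lambda>m. ?s m x - ?s j x) \<longlonglongrightarrow> syn c x - ?s j x"
      using syn_AE_LIMSEQ[OF c] by eventually_elim (intro tendsto_intros)
    show "(\<integral>\<^sup>+x. ennreal ((?s m x - ?s j x)\<^sup>2) \<partial>TM) \<le> ennreal (((1/2)^j)\<^sup>2)" if "m \<ge> j" for m
    proof -
      have "(\<lambda>x. ?s m x - ?s j x) \<in> sq_int TM" by (intro sq_int_diff) auto
      then show ?thesis using tsum_cut_diff[OF c that] by (simp only: nn_integral_sq) (intro ennreal_leI power_mono; simp)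
    qed
  qed (use sm ym in auto)
  have m: "(\<lambda>x. syn c x - ?s j x) \<in> borel_measurable TM" for j using sm ym by auto
  show "nrm TM (\<lambda>x. syn c x - ?s j x) \<le> (1/2)^j"
    by (rule sq_int_nn_integral_le(2)[OF m le]) simp
  have "(\<lambda>x. (syn c x - ?s 0 x) + ?s 0 x) \<in> sq_int TM"
    by (intro sq_int_add sq_int_nn_integral_le(1)[OF m le] tsum_sq_int) simp
  then show "syn c \<in> sq_int TM" by simp
qed

lemma fc_syn:
  assumes c: "c \<in> sq_int CM" shows "fc (syn c) = c"
proof
  fix k
  let ?s = "\<lambda>j. tsum (fin_idx (ncut c j)) c"
  \<comment> \<open>One 2^-j is the distance of \<open>syn c\<close> from stage j; the other bounds
    a coefficient left out at stage j, whose square is part of the tail.\<close>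
  have le: "\<bar>fc (syn c) k - c k\<bar> \<le> 2 * (1/2)^j" for j
  proof -
    have "\<bar>fc (syn c) k - fc (?s j) k\<bar> \<le> (1/2)^j"
      using fc_le[OF sq_int_diff[OF syn_close(1)[OF c] tsum_sq_int[of "fin_idx (ncut c j)" c]], of k] syn_close(2)[OF c, of j]
        fc_diff[OF syn_close(1)[OF c] tsum_sq_int[of "fin_idx (ncut c j)" c], of k] by simp
    moreover have "\<bar>fc (?s j) k - c k\<bar> \<le> (1/2)^j"
    proof (cases "k \<in> fin_idx (ncut c j)")
      case False
      have "ennreal ((c k)\<^sup>2) \<le> tail c (ncut c j)"
        using nn_integral_count_space_ge_single[of "\<lambda>k. ennreal ((c k)\<^sup>2) * indicator (- fin_idx (ncut c j)) k" k] False
        by (simp add: tail_def)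
      also have "\<dots> \<le> ennreal ((1/4)^j)" by (rule tail_cut[OF c])
      finally have "(c k)\<^sup>2 \<le> (1/4)^j" by (simp add: ennreal_le_iff)
      also note quarter_power
      finally have "\<bar>c k\<bar> \<le> \<bar>(1/2)^j\<bar>" by (simp only: abs_le_square_iff)
      then show ?thesis using False by (simp add: fc_tsum)
    qed (simp add: fc_tsum)
    ultimately show ?thesis by linarith
  qed
  have "(\<lambda>j. 2 * (1/2::real)^j) \<longlonglongrightarrow> 2 * 0" by (intro tendsto_intros LIMSEQ_realpow_zero) auto
  then have "\<bar>fc (syn c) k - c k\<bar> \<le> 2 * 0" by (rule LIMSEQ_le_const) (use le in blast)
  then show "fc (syn c) k = c k" by simp
qed

lemma fc_inj:
  assumes "u \<in> sq_int TM" "w \<in> sq_int TM" "\<And>k. fc u k = fc w k"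
  shows "AE x in TM. u x = w x"
proof -
  have d: "(\<lambda>x. u x - w x) \<in> sq_int TM" by (rule sq_int_diff[OF assms(1,2)])
  have "(\<integral>x. (u x - w x) * ebas k x \<partial>TM) = 0" for k
  proof -
    have "fc (\<lambda>x. u x - w x) k = 0" using fc_diff[OF assms(1,2)] assms(3) by simp
    moreover have "(\<integral>x. (u x - w x) * ebas k x \<partial>TM) = sqrt vol * fc (\<lambda>x. u x - w x) k"
      using vol_pos by (simp add: fc_def bas_def)
    ultimately show ?thesis by simp
  qed
  from ebas_complete[OF d this] show ?thesis by eventually_elim simp
qed

lemma syn_fc: "u \<in> sq_int TM \<Longrightarrow> AE x in TM. syn (fc u) x = u x"
  by (rule fc_inj) (use fc_syn[OF fc_l2(1)] syn_close(1)[OF fc_l2(1)] in auto)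

lemma nrm_syn:
  assumes c: "c \<in> sq_int CM" shows "nrm TM (syn c) = nrm CM c"
proof (rule antisym)
  show "nrm CM c \<le> nrm TM (syn c)" using fc_l2(2)[OF syn_close(1)[OF c]] by (simp add: fc_syn[OF c])
  let ?s = "\<lambda>j. tsum (fin_idx (ncut c j)) c"
  have s: "nrm TM (?s j) \<le> nrm CM c" for j
  proof -
    have "ennreal ((nrm TM (?s j))\<^sup>2) = (\<integral>\<^sup>+k. ennreal ((c k)\<^sup>2) * indicator (fin_idx (ncut c j)) k \<partial>CM)"
      by (simp add: nrm_tsum nn_integral_count_space_finite_set sum_ennreal)
    also have "\<dots> \<le> (\<integral>\<^sup>+k. ennreal ((c k)\<^sup>2) \<partial>CM)" by (intro nn_integral_mono) (auto simp: indicator_def)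
    also have "\<dots> = ennreal ((nrm CM c)\<^sup>2)" by (rule nn_integral_sq[OF c])
    finally have "(nrm TM (?s j))\<^sup>2 \<le> (nrm CM c)\<^sup>2" by (simp add: ennreal_le_iff)
    then show ?thesis by (rule power2_le_imp_le) simp
  qed
  have le: "nrm TM (syn c) \<le> nrm CM c + (1/2)^j" for j
  proof -
    have "nrm TM (\<lambda>x. (syn c x - ?s j x) + ?s j x) \<le> nrm TM (\<lambda>x. syn c x - ?s j x) + nrm TM (?s j)"
      by (rule nrm_triangle[OF sq_int_diff[OF syn_close(1)[OF c] tsum_sq_int] tsum_sq_int])
    then show ?thesis using syn_close(2)[OF c, of j] s[of j] by simp
  qed
  have "(\<lambda>j. nrm CM c + (1/2::real)^j) \<longlonglongrightarrow> nrm CM c + 0" by (intro tendsto_intros LIMSEQ_realpow_zero) auto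
  then have "nrm TM (syn c) \<le> nrm CM c + 0" by (rule LIMSEQ_le_const) (use le in blast)
  then show "nrm TM (syn c) \<le> nrm CM c" by simp
qed

theorem Parseval_nrm:
  assumes u: "u \<in> sq_int TM" shows "nrm TM u = nrm CM (fc u)"
proof -
  have "nrm TM (syn (fc u)) = nrm TM u"
    by (rule nrm_cong_AE[OF _ _ syn_fc[OF u]]) (use u syn_close(1)[OF fc_l2(1)[OF u]] in \<open>auto intro: sq_int_measurable\<close>)
  then show ?thesis using nrm_syn[OF fc_l2(1)[OF u]] by simp
qed

theorem Parseval:
  assumes u: "u \<in> sq_int TM" and w: "w \<in> sq_int TM"
  shows "(\<integral>x. u x * w x \<partial>TM) = (\<integral>k. fc u k * fc w k \<partial>CM)"
proof -
  have pol: "(\<integral>x. f x * g x \<partial>M) = ((nrm M (\<lambda>x. f x + g x))\<^sup>2 - (nrm M (\<lambda>x. f x - g x))\<^sup>2) / 4"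
    if "f \<in> sq_int M" "g \<in> sq_int M" for f g :: "'z \<Rightarrow> real" and M
  proof -
    have "(nrm M (\<lambda>x. f x + g x))\<^sup>2 - (nrm M (\<lambda>x. f x - g x))\<^sup>2 = (\<integral>x. (f x + g x)\<^sup>2 - (f x - g x)\<^sup>2 \<partial>M)"
      unfolding nrm_sq using sq_int_integrable[OF sq_int_add[OF that]] sq_int_integrable[OF sq_int_diff[OF that]] by simp
    also have "\<dots> = (\<integral>x. 4 * (f x * g x) \<partial>M)"
      by (rule Bochner_Integration.integral_cong) (auto simp: power2_eq_square algebra_simps)
    finally show ?thesis by simp
  qed
  show ?thesis
    unfolding pol[OF u w] pol[OF fc_l2(1)[OF u] fc_l2(1)[OF w]] Parseval_nrm[OF sq_int_add[OF u w]] Parseval_nrm[OF sq_int_diff[OF u w]]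
    using fc_add[OF u w] fc_diff[OF u w] by presburger
qed

end

context torus
begin

section \<open>Smooth periodic test functions\<close>

lemma bas_test: "bas k \<in> test_functions L"
proof -
  have eq: "bas k = (\<lambda>x. (1 / sqrt vol) * ebas k x)" by (auto simp: bas_def)
  show ?thesis unfolding eq by (rule ebas_test)
qed

lemma partial_deriv_bas: "partial_deriv i (bas k) = (\<lambda>x. kap k $ i * bas (- k) x)"
proof -
  have eq: "bas k = (\<lambda>x. (1 / sqrt vol) * ebas k x)" by (auto simp: bas_def)
  show ?thesis unfolding eq partial_deriv_ebas by (simp add: bas_def fun_eq_iff)
qed

lemma iter_partial_bas: "iter_partial is (bas k) = (\<lambda>x. dcoef is k * bas (dind is k) x)"
proof -
  have eq: "bas k = (\<lambda>x. (1 / sqrt vol) * ebas k x)" by (auto simp: bas_def)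
  show ?thesis unfolding eq iter_partial_ebas by (simp add: bas_def fun_eq_iff)
qed

lemma test_differentiable: "\<phi> \<in> test_functions L \<Longrightarrow> iter_partial is \<phi> differentiable (at x)"
  by (simp add: test_functions_def)

lemma test_differentiable0: "\<phi> \<in> test_functions L \<Longrightarrow> \<phi> differentiable (at x)"
  using test_differentiable[of \<phi> "[]"] by (simp add: iter_partial_def)

lemma test_continuous: "\<phi> \<in> test_functions L \<Longrightarrow> continuous_on S \<phi>"
  by (intro continuous_at_imp_continuous_on ballI) (auto intro: differentiable_imp_continuous_within test_differentiable0)

lemma test_periodic: "\<phi> \<in> test_functions L \<Longrightarrow> periodic L \<phi>"
  by (simp add: test_functions_def)

lemma partial_deriv_periodic:
  assumes per: "periodic L \<phi>" and diff: "\<And>x. \<phi> differentiable (at x)"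
  shows "periodic L (partial_deriv i \<phi>)"
  unfolding periodic_def
proof (intro allI)
  fix x j
  let ?a = "axis j (L $ j)"
  have 1: "(\<phi> has_derivative frechet_derivative \<phi> (at (x + ?a))) (at (x + ?a))"
    using diff by (simp add: frechet_derivative_works)
  have "((\<lambda>y. y + ?a) has_derivative (\<lambda>h. h)) (at x)" by (auto intro!: derivative_eq_intros)
  from has_derivative_compose[OF this 1]
  have "((\<lambda>y. \<phi> (y + ?a)) has_derivative frechet_derivative \<phi> (at (x + ?a))) (at x)" by simp
  then have "(\<phi> has_derivative frechet_derivative \<phi> (at (x + ?a))) (at x)"
    using per by (simp add: periodic_def)
  from frechet_derivative_at[OF this]
  show "partial_deriv i \<phi> (x + ?a) = partial_deriv i \<phi> x" by (simp add: partial_deriv_def)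
qed

lemma test_partial_deriv:
  assumes "\<phi> \<in> test_functions L" shows "partial_deriv i \<phi> \<in> test_functions L"
  unfolding test_functions_def mem_Collect_eq
proof (intro conjI allI)
  show "periodic L (partial_deriv i \<phi>)"
    by (intro partial_deriv_periodic test_periodic test_differentiable0 assms)
  fix "is" x
  have "iter_partial is (partial_deriv i \<phi>) = iter_partial (is @ [i]) \<phi>" by (simp add: iter_partial_def)
  then show "iter_partial is (partial_deriv i \<phi>) differentiable at x" using test_differentiable[OF assms] by simp
qed

lemma test_iter_partial: "\<phi> \<in> test_functions L \<Longrightarrow> iter_partial is \<phi> \<in> test_functions L"
  by (induction "is") (auto simp: iter_partial_def intro: test_partial_deriv)

lemma partial_deriv_mult:
  assumes "\<phi> differentiable (at x)" "\<psi> differentiable (at x)"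
  shows "partial_deriv i (\<lambda>x. \<phi> x * \<psi> x) x = partial_deriv i \<phi> x * \<psi> x + \<phi> x * partial_deriv i \<psi> x"
proof -
  have "((\<lambda>x. \<phi> x * \<psi> x) has_derivative (\<lambda>h. \<phi> x * frechet_derivative \<psi> (at x) h + frechet_derivative \<phi> (at x) h * \<psi> x)) (at x)"
    using assms by (intro has_derivative_mult) (simp_all add: frechet_derivative_works)
  from frechet_derivative_at[OF this, symmetric] show ?thesis by (simp add: partial_deriv_def)
qed

lemma integration_by_parts_test:
  assumes \<phi>: "\<phi> \<in> test_functions L" and \<psi>: "\<psi> \<in> test_functions L"
  shows "(\<integral>x. partial_deriv i \<phi> x * \<psi> x \<partial>TM) = - (\<integral>x. \<phi> x * partial_deriv i \<psi> x \<partial>TM)"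
proof -
  let ?F = "\<lambda>x. \<phi> x * \<psi> x"
  have eq: "partial_deriv i ?F = (\<lambda>x. partial_deriv i \<phi> x * \<psi> x + \<phi> x * partial_deriv i \<psi> x)"
    using partial_deriv_mult test_differentiable0 \<phi> \<psi> by (intro ext) blast
  have c: "continuous_on UNIV (\<lambda>x. partial_deriv i \<phi> x * \<psi> x)" "continuous_on UNIV (\<lambda>x. \<phi> x * partial_deriv i \<psi> x)"
    by (intro continuous_intros test_continuous test_partial_deriv \<phi> \<psi>)+
  have "(\<integral>x. partial_deriv i ?F x \<partial>TM) = 0"
  proof (rule integral_partial_deriv_zero)
    show "periodic L ?F" using test_periodic[OF \<phi>] test_periodic[OF \<psi>] by (simp add: periodic_def)
    show "?F differentiable at x" for x
      using test_differentiable0[OF \<phi>] test_differentiable0[OF \<psi>] by (rule differentiable_mult)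
    show "continuous_on UNIV (partial_deriv i ?F)" unfolding eq by (rule continuous_on_add[OF c])
  qed
  then show ?thesis unfolding eq using continuous_integrable_TM[OF c(1)] continuous_integrable_TM[OF c(2)] by simp
qed

lemma dcoef_minus: "dcoef is (- k) = (-1) ^ length is * dcoef is k"
  by (induction "is") (auto simp: dind_def kap_minus)

lemma fc_iter_partial:
  assumes \<phi>: "\<phi> \<in> test_functions L"
  shows "fc (iter_partial is \<phi>) k = (-1) ^ length is * dcoef is k * fc \<phi> (dind is k)"
proof (induction "is" arbitrary: k)
  case (Cons i "is")
  have "fc (iter_partial (i # is) \<phi>) k = (\<integral>x. partial_deriv i (iter_partial is \<phi>) x * bas k x \<partial>TM)"
    by (simp add: fc_def iter_partial_def)
  also have "\<dots> = - (\<integral>x. iter_partial is \<phi> x * partial_deriv i (bas k) x \<partial>TM)"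
    by (rule integration_by_parts_test[OF test_iter_partial[OF \<phi>] bas_test])
  also have "\<dots> = - (\<integral>x. kap k $ i * (iter_partial is \<phi> x * bas (- k) x) \<partial>TM)"
    unfolding partial_deriv_bas by (simp add: mult_ac)
  also have "\<dots> = - (kap k $ i * fc (iter_partial is \<phi>) (- k))" by (simp add: fc_def)
  also have "\<dots> = (-1) ^ length (i # is) * dcoef (i # is) k * fc \<phi> (dind (i # is) k)"
    unfolding Cons by (auto simp: dcoef_minus dind_def kap_minus)
  finally show ?case .
qed (simp add: iter_partial_def dind_def)

section \<open>Weak derivatives and Fourier coefficients\<close>

lemma fc_weak_deriv:
  assumes "weak_deriv L is u g"
  shows "fc g k = (-1) ^ length is * dcoef is k * fc u (dind is k)"
proof -
  have "L2_inner L u (iter_partial is (bas k)) = (-1) ^ length is * L2_inner L g (bas k)"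
    using assms bas_test by (auto simp: weak_deriv_def)
  moreover have "L2_inner L u (iter_partial is (bas k)) = dcoef is k * fc u (dind is k)"
  proof -
    have "L2_inner L u (iter_partial is (bas k)) = (\<integral>x. dcoef is k * (u x * bas (dind is k) x) \<partial>TM)"
      unfolding iter_partial_bas L2_inner_def by (rule Bochner_Integration.integral_cong) auto
    then show ?thesis by (simp add: fc_def)
  qed
  ultimately have "dcoef is k * fc u (dind is k) = (-1) ^ length is * fc g k" by (simp add: fc_eq)
  then have "(-1) ^ length is * (dcoef is k * fc u (dind is k)) = (-1) ^ length is * ((-1) ^ length is * fc g k)" by simp
  also have "\<dots> = fc g k" by (simp add: mult.assoc[symmetric] power_mult_distrib[symmetric])
  finally show ?thesis by (simp add: mult.assoc)
qed

lemma bij_dind: "bij (dind is)"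
  unfolding dind_def by (cases "even (length is)") (auto intro: bij_uminus simp: bij_betw_def inj_on_def surj_def intro!: exI[of _ "- _"])

lemma dind_dind: "dind is (dind is k) = k"
  by (simp add: dind_def)

lemma sq_int_reindex:
  assumes "bij \<pi>" and "c \<in> sq_int CM" shows "(\<lambda>k. c (\<pi> k)) \<in> sq_int CM"
  using assms integrable_bij_count_space[OF assms(1), of "\<lambda>k. (c k)\<^sup>2"] by (simp add: sq_int_def)

text \<open>Parseval moves the test identity to the coefficients, where a derivative acts by the
  multiplier \<open>dcoef\<close> and the reflection \<open>dind\<close>. Reindexing the sum by this
  reflection transfers the derivative from the test function to u; the sign changes of
  \<open>dcoef\<close> under reflection give the factor (-1)^length.\<close>

lemma weak_derivI:
  assumes u: "u \<in> sq_int TM" and c: "(\<lambda>k. dcoef is k * fc u (dind is k)) \<in> sq_int CM"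
  shows "weak_deriv L is u (syn (\<lambda>k. (-1) ^ length is * (dcoef is k * fc u (dind is k))))"
  unfolding weak_deriv_def
proof (intro conjI ballI)
  let ?s = "(-1) ^ length is :: real" and ?c = "\<lambda>k. (-1) ^ length is * (dcoef is k * fc u (dind is k))"
  have c': "?c \<in> sq_int CM" by (rule sq_int_scale[OF c])
  show "syn ?c \<in> L2_space L" using syn_close(1)[OF c'] by (simp add: L2_space_eq)
  fix \<phi> assume \<phi>: "\<phi> \<in> test_functions L"
  have \<phi>s: "\<phi> \<in> sq_int TM" "iter_partial is \<phi> \<in> sq_int TM"
    by (intro continuous_sq_int test_continuous test_iter_partial \<phi>)+
  have ss: "?s * (?s * a) = a" for a by (simp add: mult.assoc[symmetric] power_mult_distrib[symmetric])
  have "L2_inner L u (iter_partial is \<phi>) = (\<integral>k. fc u k * fc (iter_partial is \<phi>) k \<partial>CM)"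
    unfolding L2_inner_def by (rule Parseval[OF u \<phi>s(2)])
  also have "\<dots> = (\<integral>k. fc u (dind is k) * fc (iter_partial is \<phi>) (dind is k) \<partial>CM)"
    by (rule integral_bij_count_space[OF bij_dind, symmetric])
  also have "\<dots> = (\<integral>k. ?s * (?c k * fc \<phi> k) \<partial>CM)"
  proof (rule Bochner_Integration.integral_cong[OF refl])
    fix k
    have "dcoef is (dind is k) = ?s * dcoef is k" by (auto simp: dind_def dcoef_minus)
    then show "fc u (dind is k) * fc (iter_partial is \<phi>) (dind is k) = ?s * (?c k * fc \<phi> k)"
      unfolding fc_iter_partial[OF \<phi>] dind_dind by (simp add: mult_ac)
  qed
  also have "\<dots> = ?s * (\<integral>k. fc (syn ?c) k * fc \<phi> k \<partial>CM)" unfolding fc_syn[OF c'] by simp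
  also have "\<dots> = ?s * L2_inner L (syn ?c) \<phi>"
    unfolding L2_inner_def by (subst Parseval[OF syn_close(1)[OF c'] \<phi>s(1)]) simp
  finally show "L2_inner L u (iter_partial is \<phi>) = ?s * L2_inner L (syn ?c) \<phi>" .
qed

definition lam :: "int^'n \<Rightarrow> real" where "lam k = 1 + (norm (kap k))\<^sup>2"

lemma lam_ge1: "lam k \<ge> 1" by (simp add: lam_def)
lemma lam_gt0: "lam k > 0" using lam_ge1[of k] by linarith
lemma lam_minus: "lam (- k) = lam k" by (simp add: lam_def kap_minus)

lemma norm_kap_sq: "(norm (kap k))\<^sup>2 = (\<Sum>i\<in>UNIV. (kap k $ i)\<^sup>2)"
  by (simp add: norm_vec_def L2_set_def sum_nonneg)

lemma lam_eq: "lam k = 1 + (\<Sum>i\<in>UNIV. (kap k $ i)\<^sup>2)"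
  by (simp add: lam_def norm_kap_sq)

text \<open>Coefficient form of W^(2,2), as \<open>H4\<close> below is of W^(4,2); see
  \<open>Sobolev2_iff\<close> and \<open>Sobolev4_iff\<close>.\<close>

definition H2 :: "(int^'n \<Rightarrow> real) set" where "H2 = {c. (\<lambda>k. lam k * c k) \<in> sq_int CM}"
definition H4 :: "(int^'n \<Rightarrow> real) set" where "H4 = {c. (\<lambda>k. (lam k)\<^sup>2 * c k) \<in> sq_int CM}"

lemma H4_subset_H2: "c \<in> H4 \<Longrightarrow> c \<in> H2"
  unfolding H4_def H2_def mem_Collect_eq
proof (erule sq_int_bound(1))
  show "\<bar>lam k * c k\<bar> \<le> \<bar>(lam k)\<^sup>2 * c k\<bar>" for k
    using mult_right_mono[OF lam_ge1[of k] abs_ge_zero[of "lam k * c k"]] lam_gt0[of k]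
    by (simp add: abs_mult power2_eq_square mult.assoc)
qed simp

lemma H2_l2: "c \<in> H2 \<Longrightarrow> c \<in> sq_int CM"
  unfolding H2_def mem_Collect_eq
proof (erule sq_int_bound(1))
  show "\<bar>c k\<bar> \<le> \<bar>lam k * c k\<bar>" for k
    using mult_right_mono[OF lam_ge1[of k] abs_ge_zero[of "c k"]] lam_gt0[of k] by (simp add: abs_mult)
qed simp

lemma weak_deriv_wD:
  assumes "u \<in> Sobolev L m" "length is \<le> m" shows "weak_deriv L is u (wD L is u)"
  unfolding wD_def by (rule someI_ex[of "weak_deriv L is u"]) (use assms in \<open>auto simp: Sobolev_def\<close>)

lemma wD_sq_int: "u \<in> Sobolev L m \<Longrightarrow> length is \<le> m \<Longrightarrow> wD L is u \<in> sq_int TM"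
  using weak_deriv_wD[of u m "is"] by (simp add: weak_deriv_def L2_space_eq)

lemma fc_wD: "u \<in> Sobolev L m \<Longrightarrow> length is \<le> m \<Longrightarrow> fc (wD L is u) k = (-1) ^ length is * dcoef is k * fc u (dind is k)"
  by (rule fc_weak_deriv[OF weak_deriv_wD])

lemma fc_wD1: "u \<in> Sobolev L 2 \<Longrightarrow> fc (wD L [i] u) k = - (kap k $ i) * fc u (- k)"
  by (subst fc_wD[of u 2]) (auto simp: dind_def)

lemma fc_wD2: "u \<in> Sobolev L 2 \<Longrightarrow> fc (wD L [i, i] u) k = - (kap k $ i)\<^sup>2 * fc u k"
  by (subst fc_wD[of u 2]) (auto simp: dind_def kap_minus power2_eq_square)

lemma Sobolev_sq_int: "u \<in> Sobolev L m \<Longrightarrow> u \<in> sq_int TM"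
  by (simp add: Sobolev_def L2_space_eq)

lemma dcoef_le_lam:
  assumes "length is \<le> 2 * m" shows "\<bar>dcoef is k\<bar> \<le> lam k ^ m"
proof -
  have "norm (kap k) \<le> sqrt (lam k)" by (rule real_le_rsqrt) (simp add: lam_def)
  then have "norm (kap k) ^ length is \<le> sqrt (lam k) ^ length is" by (rule power_mono) simp
  also have "\<dots> \<le> sqrt (lam k) ^ (2 * m)" using assms lam_ge1 by (intro power_increasing) auto
  also have "\<dots> = lam k ^ m" using lam_gt0[of k] by (simp add: power_mult)
  finally show ?thesis using sgn_dcoef[of "is" k] by linarith
qed

lemma SobolevI:
  assumes u: "u \<in> sq_int TM" and c: "(\<lambda>k. lam k ^ m * fc u k) \<in> sq_int CM"
  shows "u \<in> Sobolev L (2 * m)"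
  unfolding Sobolev_def mem_Collect_eq L2_space_eq
proof (intro conjI allI impI u)
  fix "is" :: "'n list" assume len: "length is \<le> 2 * m"
  have ld: "lam (dind is k) = lam k" for k by (simp add: dind_def lam_minus)
  have "(\<lambda>k. lam (dind is k) ^ m * fc u (dind is k)) \<in> sq_int CM"
    by (rule sq_int_reindex[OF bij_dind c])
  then have "(\<lambda>k. dcoef is k * fc u (dind is k)) \<in> sq_int CM"
    by (rule sq_int_bound(1)) (use dcoef_le_lam[OF len] lam_gt0 in \<open>auto simp: ld abs_mult less_imp_le intro!: mult_right_mono\<close>)
  then show "\<exists>g. weak_deriv L is u g" using weak_derivI[OF u] by blast
qed

text \<open>One direction reads lam * c off the pure second derivatives, because lam is 1 plus the
  squares of the components of \<open>kap\<close>. The other bounds every multiplier of order at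
  most 2 by lam.\<close>

lemma Sobolev2_iff: "u \<in> Sobolev L 2 \<longleftrightarrow> u \<in> sq_int TM \<and> fc u \<in> H2"
proof
  assume u: "u \<in> Sobolev L 2"
  have "(\<lambda>k. fc u k - (\<Sum>i\<in>UNIV. fc (wD L [i, i] u) k)) \<in> sq_int CM"
    using u by (intro sq_int_diff sq_int_sum fc_l2(1) Sobolev_sq_int[OF u] wD_sq_int[of _ 2]) auto
  also have "(\<lambda>k. fc u k - (\<Sum>i\<in>UNIV. fc (wD L [i, i] u) k)) = (\<lambda>k. lam k * fc u k)"
    by (simp add: fc_wD2[OF u] lam_eq distrib_right sum_distrib_right sum_negf)
  finally show "u \<in> sq_int TM \<and> fc u \<in> H2" using Sobolev_sq_int[OF u] by (simp add: H2_def)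
next
  assume "u \<in> sq_int TM \<and> fc u \<in> H2"
  then show "u \<in> Sobolev L 2" using SobolevI[of u 1] by (simp add: H2_def)
qed

lemma Sobolev_mono: "u \<in> Sobolev L 4 \<Longrightarrow> u \<in> Sobolev L 2"
  by (auto simp: Sobolev_def)

lemma laplacian_fc:
  assumes u: "u \<in> Sobolev L 2"
  shows "laplacian L u \<in> sq_int TM" "fc (laplacian L u) k = - (norm (kap k))\<^sup>2 * fc u k"
proof -
  have w: "wD L [i, i] u \<in> sq_int TM" for i using u by (rule wD_sq_int) simp
  have eq: "laplacian L u = (\<lambda>x. \<Sum>i\<in>UNIV. wD L [i, i] u x)" by (rule ext) (simp add: laplacian_def)
  show "laplacian L u \<in> sq_int TM" unfolding eq by (rule sq_int_sum) (rule w)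
  show "fc (laplacian L u) k = - (norm (kap k))\<^sup>2 * fc u k"
    unfolding eq by (subst fc_sum) (auto simp: w fc_wD2[OF u] norm_kap_sq sum_distrib_right sum_negf)
qed

lemma shifted_lap_fc:
  assumes u: "u \<in> Sobolev L 2"
  shows "shifted_lap L u \<in> sq_int TM" "fc (shifted_lap L u) k = lam k * fc u k"
proof -
  have eq: "shifted_lap L u = (\<lambda>x. u x - laplacian L u x)" by (rule ext) (simp add: shifted_lap_def)
  show "shifted_lap L u \<in> sq_int TM" unfolding eq
    by (intro sq_int_diff Sobolev_sq_int[OF u] laplacian_fc[OF u])
  show "fc (shifted_lap L u) k = lam k * fc u k"
    unfolding eq by (simp add: fc_diff[OF Sobolev_sq_int[OF u] laplacian_fc(1)[OF u]] laplacian_fc(2)[OF u] lam_def distrib_right)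
qed

lemma dcoef4: "dcoef [i, i, j, j] k = (kap k $ i)\<^sup>2 * (kap k $ j)\<^sup>2"
  by (simp add: dind_def kap_minus power2_eq_square)

lemma Sobolev4_iff: "u \<in> Sobolev L 4 \<longleftrightarrow> u \<in> sq_int TM \<and> fc u \<in> H4"
proof
  assume u: "u \<in> Sobolev L 4"
  note u2 = Sobolev_mono[OF u]
  have f: "fc (wD L [i, i, j, j] u) k = (kap k $ i)\<^sup>2 * (kap k $ j)\<^sup>2 * fc u k" for i j k
    by (subst fc_wD[OF u]) (simp_all add: dcoef4[unfolded dcoef.simps] dind_def kap_minus power2_eq_square)
  \<comment> \<open>With K = norm (kap k) one has lam^2 = 2 lam - 1 + K^4, and K^4 is the double sum
    of kap_i^2 kap_j^2, the multiplier of the derivatives [i,i,j,j].\<close>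
  have "(\<lambda>k. 2 * (lam k * fc u k) - fc u k + (\<Sum>i\<in>UNIV. \<Sum>j\<in>UNIV. fc (wD L [i, i, j, j] u) k)) \<in> sq_int CM"
    using u Sobolev2_iff[of u] u2
    by (intro sq_int_diff sq_int_add sq_int_scale sq_int_sum fc_l2(1) Sobolev_sq_int[OF u] wD_sq_int[of _ 4]) (auto simp: H2_def)
  also have "(\<lambda>k. 2 * (lam k * fc u k) - fc u k + (\<Sum>i\<in>UNIV. \<Sum>j\<in>UNIV. fc (wD L [i, i, j, j] u) k)) = (\<lambda>k. (lam k)\<^sup>2 * fc u k)"
  proof
    fix k
    let ?S = "\<Sum>i\<in>UNIV. (kap k $ i)\<^sup>2"
    have "(\<Sum>i\<in>UNIV. \<Sum>j\<in>UNIV. fc (wD L [i, i, j, j] u) k) = ?S * ?S * fc u k"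
      unfolding f by (subst sum_product) (simp only: sum_distrib_right)
    moreover have "2 * ((1 + S) * a) - a + S * S * a = (1 + S)\<^sup>2 * a" for S a :: real
      by (simp add: power2_eq_square algebra_simps)
    ultimately show "2 * (lam k * fc u k) - fc u k + (\<Sum>i\<in>UNIV. \<Sum>j\<in>UNIV. fc (wD L [i, i, j, j] u) k) = (lam k)\<^sup>2 * fc u k"
      by (simp only: lam_eq)
  qed
  finally show "u \<in> sq_int TM \<and> fc u \<in> H4" using Sobolev_sq_int[OF u] by (simp add: H4_def)
next
  assume "u \<in> sq_int TM \<and> fc u \<in> H4"
  then show "u \<in> Sobolev L 4" using SobolevI[of u 2] by (simp add: H4_def)
qed

lemma Sobolev4_laplacian:
  assumes u: "u \<in> Sobolev L 4"
  shows "laplacian L u \<in> Sobolev L 2" "shifted_lap L u \<in> Sobolev L 2"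
proof -
  note u2 = Sobolev_mono[OF u]
  have c: "(\<lambda>k. (lam k)\<^sup>2 * fc u k) \<in> sq_int CM" using u by (simp add: Sobolev4_iff H4_def)
  have "(\<lambda>k. lam k * fc (shifted_lap L u) k) = (\<lambda>k. (lam k)\<^sup>2 * fc u k)"
    by (simp add: shifted_lap_fc(2)[OF u2] power2_eq_square mult.assoc)
  then show s: "shifted_lap L u \<in> Sobolev L 2"
    using c shifted_lap_fc(1)[OF u2] by (simp add: Sobolev2_iff H2_def)
  have "(\<lambda>k. lam k * fc u k - lam k * fc (shifted_lap L u) k) \<in> sq_int CM"
    using s u2 by (intro sq_int_diff) (auto simp: Sobolev2_iff H2_def)
  also have "(\<lambda>k. lam k * fc u k - lam k * fc (shifted_lap L u) k) = (\<lambda>k. lam k * fc (laplacian L u) k)"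
    by (simp add: shifted_lap_fc(2)[OF u2] laplacian_fc(2)[OF u2] lam_def algebra_simps)
  finally show "laplacian L u \<in> Sobolev L 2"
    using laplacian_fc(1)[OF u2] by (simp add: Sobolev2_iff H2_def)
qed

lemma A_op_fc:
  assumes u: "u \<in> Sobolev L 4"
  shows "A_op L nu u \<in> sq_int TM" "fc (A_op L nu u) k = nu * ((lam k)\<^sup>2 * fc u k)"
proof -
  have eq: "A_op L nu u = (\<lambda>x. nu * shifted_lap L (shifted_lap L u) x)" by (rule ext) (simp add: A_op_def)
  note s = Sobolev4_laplacian(2)[OF u]
  show "A_op L nu u \<in> sq_int TM" unfolding eq by (rule sq_int_scale[OF shifted_lap_fc(1)[OF s]])
  show "fc (A_op L nu u) k = nu * ((lam k)\<^sup>2 * fc u k)"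
    unfolding eq by (simp add: fc_scale shifted_lap_fc(2)[OF s] shifted_lap_fc(2)[OF Sobolev_mono[OF u]] power2_eq_square mult.assoc)
qed

lemma V_norm_eq:
  assumes "u \<in> Sobolev L 2" shows "V_norm L nu u = sqrt nu * nrm CM (\<lambda>k. lam k * fc u k)"
proof -
  have "fc (shifted_lap L u) = (\<lambda>k. lam k * fc u k)" by (rule ext) (rule shifted_lap_fc(2)[OF assms])
  then show ?thesis by (simp add: V_norm_def L2_norm_eq Parseval_nrm[OF shifted_lap_fc(1)[OF assms]])
qed

lemma DA_norm_eq:
  assumes "u \<in> Sobolev L 4" shows "DA_norm L nu u = \<bar>nu\<bar> * nrm CM (\<lambda>k. (lam k)\<^sup>2 * fc u k)"
proof -
  have "fc (A_op L nu u) = (\<lambda>k. nu * ((lam k)\<^sup>2 * fc u k))" by (rule ext) (rule A_op_fc(2)[OF assms])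
  then show ?thesis by (simp add: DA_norm_def L2_norm_eq Parseval_nrm[OF A_op_fc(1)[OF assms]] nrm_scale)
qed

end

section \<open>Summability of the inverse eigenvalues\<close>

text \<open>The exponent 2/3 is a third of 2, so that three coordinates can share the power lam^-2.
  The terms behave like m^(-4/3), which is still summable.\<close>

lemma sum_int_powr_bounded:
  fixes b :: real assumes b: "b > 0"
  shows "\<exists>B. \<forall>N::nat. (\<Sum>m\<in>{- int N..int N}. (1 + (b * of_int m)\<^sup>2) powr (-2/3)) \<le> B"
proof -
  define g where "g m = (1 + (b * of_int m)\<^sup>2) powr (-2/3)" for m :: int
  have g0: "g m \<ge> 0" for m by (simp add: g_def)
  have gm: "g (- m) = g m" for m by (simp add: g_def)
  have "summable (\<lambda>n. b powr (-4/3) * (of_nat n powr (-4/3) :: real))"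
    by (intro summable_mult) (simp add: summable_real_powr_iff)
  then have sm: "summable (\<lambda>n. g (int n))"
  proof (rule summable_comparison_test_ev[rotated])
    show "\<forall>\<^sub>F n in sequentially. norm (g (int n)) \<le> b powr (-4/3) * (of_nat n powr (-4/3))"
      using eventually_ge_at_top[of 1]
    proof eventually_elim
      case (elim n)
      have p: "b * real n > 0" using b elim by simp
      have "g (int n) \<le> ((b * real n)\<^sup>2) powr (-2/3)"
        unfolding g_def using zero_less_power[OF p, of 2] by (intro powr_mono2') (auto simp: power_mult_distrib)
      also have "(b * real n)\<^sup>2 = (b * real n) powr 2" using p by (simp add: powr_numeral)
      also have "\<dots> powr (-2/3) = (b * real n) powr (-4/3)" by (simp add: powr_powr)
      also have "\<dots> = b powr (-4/3) * (of_nat n powr (-4/3))" using b by (simp add: powr_mult)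
      finally show ?case using g0 by simp
    qed
  qed
  have "(\<Sum>m\<in>{- int N..int N}. g m) \<le> 2 * (\<Sum>n. g (int n))" for N
  proof -
    let ?P = "int ` {..N}" and ?M = "(\<lambda>n. - int n) ` {..N}"
    have sub: "{- int N..int N} \<subseteq> ?P \<union> ?M"
    proof
      fix m :: int assume "m \<in> {- int N..int N}"
      then show "m \<in> ?P \<union> ?M" by (cases "m \<ge> 0") (auto simp: image_iff intro!: bexI[of _ "nat \<bar>m\<bar>"])
    qed
    have "(\<Sum>m\<in>{- int N..int N}. g m) \<le> (\<Sum>m\<in>?P \<union> ?M. g m)" by (rule sum_mono2[OF _ sub]) (auto simp: g0)
    also have "\<dots> \<le> (\<Sum>m\<in>?P. g m) + (\<Sum>m\<in>?M. g m)"
      using sum.union_inter[of ?P ?M g] sum_nonneg[of "?P \<inter> ?M" g] g0 by simp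
    also have "\<dots> = 2 * (\<Sum>n\<le>N. g (int n))"
      by (subst (1 2) sum.reindex) (auto simp: inj_on_def gm)
    also have "\<dots> \<le> 2 * (\<Sum>n. g (int n))"
      using sum_le_suminf[OF sm, of "{..N}"] g0 by simp
    finally show ?thesis .
  qed
  then show ?thesis unfolding g_def by blast
qed

locale torus3 = torus L for L :: "real^'n" +
  assumes dim3: "CARD('n) \<le> 3"
begin

text \<open>Here d \<le> 3 enters: the product of the factors 1 + kap_i^2 is at most lam^d \<le>
  lam^3, and raising to the power -2/3 reverses this into a bound of lam^-2 by a product of
  one-dimensional terms.\<close>

lemma lam_powr_le: "1 / (lam k)\<^sup>2 \<le> (\<Prod>i\<in>UNIV. (1 + (kap k $ i)\<^sup>2) powr (-2/3))"
proof -
  have f: "1 + (kap k $ i)\<^sup>2 \<le> lam k" "1 + (kap k $ i)\<^sup>2 > 0" for i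
    unfolding lam_eq using member_le_sum[of i UNIV "\<lambda>i. (kap k $ i)\<^sup>2"] by (auto simp: add_pos_nonneg)
  have "(\<Prod>i\<in>UNIV. 1 + (kap k $ i)\<^sup>2) \<le> (\<Prod>i\<in>(UNIV::'n set). lam k)"
    by (rule prod_mono) (use f less_imp_le in auto)
  also have "\<dots> = lam k ^ CARD('n)" by simp
  also have "\<dots> \<le> lam k ^ 3" by (rule power_increasing[OF dim3 lam_ge1])
  finally have le: "(\<Prod>i\<in>UNIV. 1 + (kap k $ i)\<^sup>2) \<le> lam k ^ 3" .
  have "(lam k ^ 3) powr (-2/3) \<le> (\<Prod>i\<in>UNIV. 1 + (kap k $ i)\<^sup>2) powr (-2/3)"
    by (rule powr_mono2'[OF _ _ le]) (auto intro!: prod_pos f(2))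
  also have "\<dots> = (\<Prod>i\<in>UNIV. (1 + (kap k $ i)\<^sup>2) powr (-2/3))"
    by (rule prod_powr_distrib)
  also have "(lam k ^ 3) powr (-2/3) = 1 / (lam k)\<^sup>2"
  proof -
    have "(lam k ^ 3) powr (-2/3) = (lam k powr 3) powr (-2/3)" using lam_gt0[of k] by (simp add: powr_numeral)
    also have "\<dots> = lam k powr (-2)" by (simp add: powr_powr)
    also have "\<dots> = 1 / (lam k)\<^sup>2" using lam_gt0[of k] by (simp add: powr_minus_divide powr_numeral)
    finally show ?thesis .
  qed
  finally show ?thesis .
qed

text \<open>A finite set of frequencies lies in a cube, over which the majorant of
  \<open>lam_powr_le\<close> factors into one-dimensional sums bounded independently of the
  cube.\<close>

lemma inv_lam_sq_int: "(\<lambda>k. 1 / lam k) \<in> sq_int CM"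
proof -
  define g where "g i m = (1 + (2 * pi / L $ i * of_int m)\<^sup>2) powr (-2/3)" for i and m :: int
  have g0: "g i m \<ge> 0" for i m by (simp add: g_def)
  have "\<exists>B. \<forall>N::nat. (\<Sum>m\<in>{- int N..int N}. g i m) \<le> B" for i
    unfolding g_def by (rule sum_int_powr_bounded) (use L_pos in simp)
  then obtain B where B: "\<And>i N. (\<Sum>m\<in>{- int N..int N}. g i m) \<le> B i" by metis
  have "(\<integral>\<^sup>+k. ennreal ((1 / lam k)\<^sup>2) \<partial>CM) \<le> ennreal (\<Prod>i\<in>UNIV. B i)"
  proof (rule nn_integral_count_space_le)
    fix A :: "(int^'n) set" assume A: "finite A"
    let ?R = "\<lambda>(k, i). nat \<bar>k $ i\<bar>"
    obtain N where N: "\<And>k i. k \<in> A \<Longrightarrow> nat \<bar>k $ i\<bar> \<le> N"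
      using finite_imageI[of "A \<times> (UNIV :: 'n set)" ?R] A
      by (metis (mono_tags, lifting) SigmaI UNIV_I case_prod_conv finite_SigmaI finite_class.finite_UNIV finite_nat_set_iff_bounded_le image_eqI)
    let ?I = "{- int N..int N}"
    have inj: "inj_on (($) :: int^'n \<Rightarrow> 'n \<Rightarrow> int) A" by (auto simp: inj_on_def Finite_Cartesian_Product.vec_eq_iff)
    have im: "($) ` A \<subseteq> PiE UNIV (\<lambda>_. ?I)"
    proof
      fix f assume "f \<in> ($) ` A"
      then obtain k where k: "k \<in> A" "f = ($) k" by auto
      have "f i \<in> ?I" for i using N[OF k(1), of i] k(2) by auto
      then show "f \<in> PiE UNIV (\<lambda>_. ?I)" by auto
    qed
    have "(\<Sum>k\<in>A. (1 / lam k)\<^sup>2) \<le> (\<Sum>k\<in>A. \<Prod>i\<in>UNIV. g i (k $ i))"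
      using lam_powr_le by (intro sum_mono) (simp add: g_def kap_nth power_divide)
    also have "\<dots> = (\<Sum>f\<in>($) ` A. \<Prod>i\<in>UNIV. g i (f i))"
      by (subst sum.reindex[OF inj]) simp
    also have "\<dots> \<le> (\<Sum>f\<in>PiE UNIV (\<lambda>_. ?I). \<Prod>i\<in>UNIV. g i (f i))"
      by (rule sum_mono2[OF _ im]) (auto intro!: finite_PiE prod_nonneg g0)
    also have "\<dots> = (\<Prod>i\<in>UNIV. \<Sum>m\<in>?I. g i m)"
      by (rule prod_sum_PiE[symmetric]) auto
    also have "\<dots> \<le> (\<Prod>i\<in>UNIV. B i)" by (rule prod_mono) (auto intro!: sum_nonneg g0 B)
    finally show "(\<Sum>k\<in>A. ennreal ((1 / lam k)\<^sup>2)) \<le> ennreal (\<Prod>i\<in>UNIV. B i)"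
      by (simp add: sum_ennreal ennreal_leI)
  qed
  then show ?thesis by (auto simp: sq_int_iff_nn_integral intro: le_less_trans)
qed

definition S0 :: real where "S0 = nrm CM (\<lambda>k. 1 / lam k)"

text \<open>The V norm without its factor sqrt nu2, read off the coefficients; compare
  \<open>V_norm_eq\<close>.\<close>

definition vn :: "(int^'n \<Rightarrow> real) \<Rightarrow> real" where "vn c = nrm CM (\<lambda>k. lam k * c k)"

lemma vn_nonneg [simp]: "vn c \<ge> 0" by (simp add: vn_def)
lemma S0_nonneg [simp]: "S0 \<ge> 0" by (simp add: S0_def)

text \<open>Cauchy-Schwarz for c = (1/lam) * (lam * c). Functions in W^(2,2) thus have absolutely
  convergent series, which is the embedding into the continuous functions with \<open>S0\<close> as
  its constant up to normalisation.\<close>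

lemma H2_abs_summable:
  assumes c: "c \<in> H2"
  shows "integrable CM c" "(\<integral>k. \<bar>c k\<bar> \<partial>CM) \<le> S0 * vn c"
proof -
  have cs: "(\<lambda>k. lam k * c k) \<in> sq_int CM" using c by (simp add: H2_def)
  have eq: "1 / lam k * (lam k * c k) = c k" for k using lam_gt0[of k] by simp
  show "integrable CM c" using sq_int_mult_integrable[OF inv_lam_sq_int cs] unfolding eq .
  have ca: "(\<lambda>k. \<bar>lam k * c k\<bar>) \<in> sq_int CM" using cs by (simp add: sq_int_def)
  have eq': "1 / lam k * \<bar>lam k * c k\<bar> = \<bar>c k\<bar>" for k using lam_gt0[of k] by (simp add: abs_mult)
  have "(\<integral>k. \<bar>c k\<bar> \<partial>CM) \<le> nrm CM (\<lambda>k. 1 / lam k) * nrm CM (\<lambda>k. \<bar>lam k * c k\<bar>)"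
    using Cauchy_Schwarz_integral[OF inv_lam_sq_int ca] unfolding eq' by (simp add: abs_le_iff)
  then show "(\<integral>k. \<bar>c k\<bar> \<partial>CM) \<le> S0 * vn c" by (simp add: S0_def vn_def nrm_def)
qed

section \<open>Continuous representatives\<close>

text \<open>Unlike \<open>syn\<close>, which converges almost everywhere, this is the value of the
  series at every point; for absolutely summable coefficients it is the continuous
  representative.\<close>

definition crep :: "(int^'n \<Rightarrow> real) \<Rightarrow> real^'n \<Rightarrow> real" where
  "crep c x = (\<integral>k. c k * bas k x \<partial>CM)"

lemma mult_bas_bound: "\<bar>a * bas k x\<bar> \<le> (2 / sqrt vol) * \<bar>a\<bar>"
  using mult_left_mono[OF bas_bound[of k x] abs_ge_zero[of a]] by (simp add: abs_mult mult.commute)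

lemma crep_integrable: "integrable CM c \<Longrightarrow> integrable CM (\<lambda>k. c k * bas k x)"
proof (rule Bochner_Integration.integrable_bound[of CM "\<lambda>k. (2 / sqrt vol) * \<bar>c k\<bar>"])
  show "AE k in CM. norm (c k * bas k x) \<le> norm (2 / sqrt vol * \<bar>c k\<bar>)"
  proof (rule AE_I2)
    fix k
    show "norm (c k * bas k x) \<le> norm (2 / sqrt vol * \<bar>c k\<bar>)"
      using mult_bas_bound[of "c k" k x] vol_pos by (simp only: real_norm_def)
  qed
qed auto

lemma crep_bound: "integrable CM c \<Longrightarrow> \<bar>crep c x\<bar> \<le> (2 / sqrt vol) * (\<integral>k. \<bar>c k\<bar> \<partial>CM)"
proof -
  assume c: "integrable CM c"
  have "\<bar>crep c x\<bar> \<le> (\<integral>k. \<bar>c k * bas k x\<bar> \<partial>CM)" unfolding crep_def by (rule integral_abs_bound)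
  also have "\<dots> \<le> (\<integral>k. (2 / sqrt vol) * \<bar>c k\<bar> \<partial>CM)"
  proof (rule integral_mono)
    show "integrable CM (\<lambda>k. \<bar>c k * bas k x\<bar>)" using crep_integrable[OF c, of x] by (rule integrable_abs)
  qed (use c mult_bas_bound in auto)
  finally show ?thesis by simp
qed

lemma crep_continuous:
  assumes c: "integrable CM c" shows "continuous_on S (crep c)"
  unfolding continuous_on_sequentially o_def
proof (intro allI ballI impI)
  fix y :: "nat \<Rightarrow> real^'n" and x assume y: "(\<forall>n. y n \<in> S) \<and> y \<longlonglongrightarrow> x"
  show "(\<lambda>n. crep c (y n)) \<longlonglongrightarrow> crep c x"
    unfolding crep_def
  proof (rule integral_dominated_convergence[where w = "\<lambda>k. (2 / sqrt vol) * \<bar>c k\<bar>"])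
    show "AE k in CM. (\<lambda>n. c k * bas k (y n)) \<longlonglongrightarrow> c k * bas k x"
    proof (intro AE_I2 tendsto_mult tendsto_const)
      fix k
      have "isCont (bas k) x" using continuous_bas[of UNIV k] by (simp add: continuous_on_eq_continuous_at)
      then show "(\<lambda>n. bas k (y n)) \<longlonglongrightarrow> bas k x" using y by (auto intro: isCont_tendsto_compose)
    qed
    show "AE k in CM. norm (c k * bas k (y n)) \<le> (2 / sqrt vol) * \<bar>c k\<bar>" for n
      unfolding real_norm_def by (intro AE_I2 mult_bas_bound)
  qed (use c in auto)
qed

lemma crep_periodic: "periodic L (crep c)"
  using test_periodic[OF bas_test] by (simp add: periodic_def crep_def)

lemma crep_diff: "integrable CM c \<Longrightarrow> integrable CM d \<Longrightarrow> crep (\<lambda>k. c k - d k) x = crep c x - crep d x"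
  unfolding crep_def using crep_integrable[of c x] crep_integrable[of d x] by (simp add: left_diff_distrib)

lemma crep_LIMSEQ: "integrable CM c \<Longrightarrow> (\<lambda>n. tsum (fin_idx n) c x) \<longlonglongrightarrow> crep c x"
  unfolding tsum_def crep_def by (rule sq_int_sum_LIMSEQ[OF crep_integrable])

lemma fc_crep:
  assumes c: "integrable CM c" shows "fc (crep c) = c"
proof
  fix k
  let ?B = "(2 / sqrt vol) * (\<integral>k. \<bar>c k\<bar> \<partial>CM)"
  have b: "\<bar>tsum (fin_idx n) c x\<bar> \<le> ?B" for n x
  proof -
    have "\<bar>tsum (fin_idx n) c x\<bar> \<le> (\<Sum>k\<in>fin_idx n. \<bar>c k * bas k x\<bar>)" unfolding tsum_def by (rule sum_abs)
    also have "\<dots> \<le> (\<Sum>k\<in>fin_idx n. (2 / sqrt vol) * \<bar>c k\<bar>)"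
      by (intro sum_mono mult_bas_bound)
    also have "\<dots> = (2 / sqrt vol) * (\<Sum>k\<in>fin_idx n. \<bar>c k\<bar>)" by (simp add: sum_distrib_left)
    also have "\<dots> \<le> ?B"
    proof (rule mult_left_mono)
      have "incseq (\<lambda>n. \<Sum>k\<in>fin_idx n. \<bar>c k\<bar>)" by (auto simp: incseq_def intro!: sum_mono2 fin_idx_mono)
      then show "(\<Sum>k\<in>fin_idx n. \<bar>c k\<bar>) \<le> (\<integral>k. \<bar>c k\<bar> \<partial>CM)"
        using sq_int_sum_LIMSEQ[of "\<lambda>k. \<bar>c k\<bar>"] c by (intro incseq_le) auto
    qed (use vol_pos in simp)
    finally show ?thesis .
  qed
  have B0: "?B \<ge> 0" using b[of 0 0] by linarith
  have "(\<lambda>n. fc (tsum (fin_idx n) c) k) \<longlonglongrightarrow> fc (crep c) k"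
    unfolding fc_def
  proof (rule integral_dominated_convergence[where w = "\<lambda>x. ?B * (2 / sqrt vol)"])
    have bm: "bas k \<in> borel_measurable TM" by (rule borel_measurable_TM) simp
    show "(\<lambda>x. crep c x * bas k x) \<in> borel_measurable TM"
      using borel_measurable_TM[OF borel_measurable_continuous_onI[OF crep_continuous[OF c]]] bm by auto
    show "(\<lambda>x. tsum (fin_idx n) c x * bas k x) \<in> borel_measurable TM" for n
      using sq_int_measurable[OF tsum_sq_int] bm by auto
    show "AE x in TM. (\<lambda>n. tsum (fin_idx n) c x * bas k x) \<longlonglongrightarrow> crep c x * bas k x"
      by (intro AE_I2 tendsto_mult crep_LIMSEQ c tendsto_const)
    show "AE x in TM. norm (tsum (fin_idx n) c x * bas k x) \<le> ?B * (2 / sqrt vol)" for n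
    proof (rule AE_I2)
      fix x
      show "norm (tsum (fin_idx n) c x * bas k x) \<le> ?B * (2 / sqrt vol)"
        unfolding real_norm_def abs_mult by (rule mult_mono[OF b bas_bound B0]) simp
    qed
  qed simp
  moreover have "(\<lambda>n. fc (tsum (fin_idx n) c) k) \<longlonglongrightarrow> c k"
    by (rule tendsto_eventually) (use eventually_fin_idx[of k] in \<open>eventually_elim, simp add: fc_tsum\<close>)
  ultimately show "fc (crep c) k = c k" by (rule LIMSEQ_unique)
qed

lemma crep_sq_int: "integrable CM c \<Longrightarrow> crep c \<in> sq_int TM"
  by (rule continuous_sq_int[OF crep_continuous])

lemma AE_crep:
  assumes u: "u \<in> sq_int TM" and c: "integrable CM (fc u)"
  shows "AE x in TM. crep (fc u) x = u x"
  by (rule fc_inj[OF crep_sq_int[OF c] u]) (simp add: fc_crep[OF c])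

lemma periodic_shift_lattice:
  assumes per: "periodic L w"
  shows "w (x + (\<chi> i. of_int (m $ i) * L $ i)) = w x"
proof -
  have nat: "w (x + axis i (real n * L $ i)) = w x" for x i n
  proof (induction n)
    case (Suc n)
    have "x + axis i (real (Suc n) * L $ i) = (x + axis i (real n * L $ i)) + axis i (L $ i)"
      by (simp add: axis_plus add.assoc distrib_right add.commute[of "L $ i"])
    then have "w (x + axis i (real (Suc n) * L $ i)) = w (x + axis i (real n * L $ i))"
      using per by (simp only: periodic_def)
    then show ?case using Suc by simp
  qed simp
  have int: "w (x + axis i (of_int n * L $ i)) = w x" for x i and n :: int
  proof (cases "n \<ge> 0")
    case True
    then show ?thesis using nat[of x i "nat n"] by simp
  next
    case False
    have "x + axis i (of_int n * L $ i) + axis i (real (nat (- n)) * L $ i) = x"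
      using False by (simp add: add.assoc axis_plus)
    then show ?thesis using nat[of "x + axis i (of_int n * L $ i)" i "nat (- n)"] by (simp only:)
  qed
  have "w (x + (\<Sum>i\<in>A. axis i (of_int (m $ i) * L $ i))) = w x" if "finite A" for A :: "'n set"
    using that
  proof (induction A rule: finite_induct)
    case (insert a A)
    then show ?case using int[of "x + (\<Sum>i\<in>A. axis i (of_int (m $ i) * L $ i))" a "m $ a"]
      by (simp add: add_ac)
  qed simp
  from this[of UNIV] have "w (x + (\<Sum>i\<in>UNIV. axis i (of_int (m $ i) * L $ i))) = w x" by simp
  moreover have "(\<Sum>i\<in>UNIV. axis i (of_int (m $ i) * L $ i)) = (\<chi> i. of_int (m $ i) * L $ i)"
    unfolding Finite_Cartesian_Product.vec_eq_iff
  proof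
    fix j
    have "(\<Sum>i\<in>UNIV. axis i (of_int (m $ i) * L $ i)) $ j = (\<Sum>i\<in>UNIV. if i = j then of_int (m $ i) * L $ i else 0)"
      unfolding sum_component by (rule sum.cong) (auto simp: axis_def)
    then show "(\<Sum>i\<in>UNIV. axis i (of_int (m $ i) * L $ i)) $ j = (\<chi> i. of_int (m $ i) * L $ i) $ j"
      by simp
  qed
  ultimately show ?thesis by simp
qed

text \<open>The points of the open box where d does not vanish form an open null set, hence there
  are none; continuity adds the closed box and lattice translations the whole space. This is the
  uniqueness, on all of the space, that the \<open>THE\<close> in \<open>cont_rep\<close> asks
  for.\<close>

lemma periodic_continuous_AE_zero:
  assumes per: "periodic L d" and cont: "continuous_on UNIV d" and ae: "AE x in TM. d x = 0"
  shows "d x = 0"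
proof -
  let ?N = "{x \<in> box 0 L. d x \<noteq> 0}"
  have op: "open ?N"
  proof -
    have "open (d -` (- {0}))" using continuous_open_vimage[OF _ cont[unfolded continuous_on_eq_continuous_at[OF open_UNIV], rule_format]] by (intro open_vimage cont) auto
    moreover have "?N = box 0 L \<inter> d -` (- {0})" by auto
    ultimately show ?thesis by auto
  qed
  have "AE x in lebesgue. x \<in> T \<longrightarrow> d x = 0" using ae by (subst (asm) AE_restrict_space_iff) auto
  then have "AE x in lebesgue. x \<notin> ?N" by (rule AE_mp) (use box_subset_Torus in \<open>auto intro!: AE_I2\<close>)
  then have "negligible ?N" using op by (subst negligible_iff_null_sets, subst AE_iff_null_sets) auto
  then have e: "?N = {}" using open_not_negligible[OF op] by blast
  have "box 0 L \<noteq> {}" using L_pos by (simp add: interval_ne_empty_cart(2))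
  then have cl: "closure (box 0 L) = cbox 0 L" by (rule closure_box)
  have "closed {x. d x = 0}" using cont by (intro closed_Collect_eq) auto
  then have z: "d y = 0" if "y \<in> cbox 0 L" for y
    using closure_minimal[of "box 0 L" "{x. d x = 0}"] e that unfolding cl by auto
  define m :: "int^'n" where "m = (\<chi> i. - \<lfloor>x $ i / L $ i\<rfloor>)"
  have "x + (\<chi> i. of_int (m $ i) * L $ i) \<in> cbox 0 L"
    unfolding mem_box_cart
  proof
    fix i
    have Li: "L $ i > 0" by (rule L_pos)
    have f: "of_int \<lfloor>x $ i / L $ i\<rfloor> \<le> x $ i / L $ i" "x $ i / L $ i \<le> of_int \<lfloor>x $ i / L $ i\<rfloor> + 1" by linarith+
    have "of_int \<lfloor>x $ i / L $ i\<rfloor> * L $ i \<le> x $ i" "x $ i \<le> (of_int \<lfloor>x $ i / L $ i\<rfloor> + 1) * L $ i"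
      using f unfolding pos_le_divide_eq[OF Li] pos_divide_le_eq[OF Li] by blast+
    then show "0 $ i \<le> (x + (\<chi> i. of_int (m $ i) * L $ i)) $ i \<and> (x + (\<chi> i. of_int (m $ i) * L $ i)) $ i \<le> L $ i"
      by (simp add: m_def algebra_simps)
  qed
  from z[OF this] show ?thesis using periodic_shift_lattice[OF per] by simp
qed

lemma cont_rep_eq:
  assumes u: "u \<in> sq_int TM" and c: "integrable CM (fc u)"
  shows "cont_rep L u = crep (fc u)"
  unfolding cont_rep_def
proof (rule the_equality)
  show P: "continuous_on UNIV (crep (fc u)) \<and> periodic L (crep (fc u)) \<and> (AE x in TM. crep (fc u) x = u x)"
    using crep_continuous[OF c] crep_periodic AE_crep[OF u c] by auto
  fix w assume w: "continuous_on UNIV w \<and> periodic L w \<and> (AE x in TM. w x = u x)"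
  have "w x - crep (fc u) x = 0" for x
  proof (rule periodic_continuous_AE_zero[of "\<lambda>x. w x - crep (fc u) x"])
    show "periodic L (\<lambda>x. w x - crep (fc u) x)" using w P by (simp add: periodic_def)
    show "continuous_on UNIV (\<lambda>x. w x - crep (fc u) x)" using w P by (intro continuous_intros) auto
    have "AE x in TM. w x = u x" "AE x in TM. crep (fc u) x = u x" using w P by auto
    then show "AE x in TM. w x - crep (fc u) x = 0" by eventually_elim simp
  qed
  then show "w = crep (fc u)" by (intro ext) simp
qed

lemma cont_rep_Sobolev: "u \<in> Sobolev L 2 \<Longrightarrow> cont_rep L u = crep (fc u)"
  by (rule cont_rep_eq) (auto simp: Sobolev2_iff intro: H2_abs_summable(1))

lemma fc_bas: "fc (bas k) l = (if l = k then 1 else 0)"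
  by (auto simp: fc_def bas_orth)

lemma bas_Sobolev: "bas k \<in> Sobolev L 2"
proof -
  have "integrable CM (\<lambda>l. (lam l * fc (bas k) l)\<^sup>2)"
  proof -
    have "(\<lambda>l. (lam l * fc (bas k) l)\<^sup>2) = (\<lambda>l. (lam k)\<^sup>2 * indicator {k} l)" by (auto simp: fc_bas fun_eq_iff)
    then show ?thesis by simp
  qed
  then have "fc (bas k) \<in> H2" by (simp add: H2_def sq_int_def)
  then show ?thesis by (simp add: Sobolev2_iff)
qed

lemma cont_rep_bas: "cont_rep L (bas k) = bas k"
proof -
  have "continuous_on UNIV (bas k) \<and> periodic L (bas k)" using continuous_bas test_periodic[OF bas_test] by blast
  have "crep (fc (bas k)) x - bas k x = 0" for x
  proof (rule periodic_continuous_AE_zero[of "\<lambda>x. crep (fc (bas k)) x - bas k x"])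
    have c: "integrable CM (fc (bas k))" using bas_Sobolev by (auto simp: Sobolev2_iff intro: H2_abs_summable(1))
    show "periodic L (\<lambda>x. crep (fc (bas k)) x - bas k x)"
      using crep_periodic test_periodic[OF bas_test] by (simp add: periodic_def)
    show "continuous_on UNIV (\<lambda>x. crep (fc (bas k)) x - bas k x)"
      by (intro continuous_intros crep_continuous[OF c] continuous_bas)
    show "AE x in TM. crep (fc (bas k)) x - bas k x = 0"
      using AE_crep[OF bas_sq_int c] by eventually_elim simp
  qed
  then show ?thesis unfolding cont_rep_Sobolev[OF bas_Sobolev] by (intro ext) simp
qed

section \<open>The output injection\<close>

text \<open>The coefficients of $(-\Delta+1)^{-2}\mathcal{Z}^*v$.\<close>

definition ib :: "nat \<Rightarrow> (nat \<Rightarrow> real^'n) \<Rightarrow> real Matrix.vec \<Rightarrow> int^'n \<Rightarrow> real" where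
  "ib m p v k = (\<Sum>j<m. vec_index v j * bas k (p j)) / (lam k)\<^sup>2"

lemma ib_bound: "\<bar>\<Sum>j<m. vec_index v j * bas k (p j)\<bar> \<le> (2 / sqrt vol) * (\<Sum>j<m. \<bar>vec_index v j\<bar>)"
proof -
  have "\<bar>\<Sum>j<m. vec_index v j * bas k (p j)\<bar> \<le> (\<Sum>j<m. \<bar>vec_index v j\<bar> * (2 / sqrt vol))"
    using mult_bas_bound by (intro order_trans[OF sum_abs sum_mono]) (simp only: mult.commute[of _ "2 / sqrt vol"])
  then show ?thesis by (simp add: sum_distrib_left mult.commute)
qed

text \<open>lam * ib is a bounded family divided by lam, so the square summability of 1/lam places
  the feedback in V and not merely in H.\<close>

lemma ib_H2: "ib m p v \<in> H2" "vn (ib m p v) \<le> (2 / sqrt vol) * (\<Sum>j<m. \<bar>vec_index v j\<bar>) * S0"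
proof -
  define B where "B = (2 / sqrt vol) * (\<Sum>j<m. \<bar>vec_index v j\<bar>)"
  have bnd: "\<bar>\<Sum>j<m. vec_index v j * bas k (p j)\<bar> \<le> B" for k unfolding B_def by (rule ib_bound)
  have B: "B \<ge> 0" unfolding B_def using vol_pos by (auto intro!: mult_nonneg_nonneg sum_nonneg)
  have s: "(\<lambda>k. B * (1 / lam k)) \<in> sq_int CM" by (rule sq_int_scale[OF inv_lam_sq_int])
  have le: "\<bar>lam k * ib m p v k\<bar> \<le> \<bar>B * (1 / lam k)\<bar>" for k
  proof -
    have "lam k * ib m p v k = (\<Sum>j<m. vec_index v j * bas k (p j)) * (1 / lam k)"
      using lam_gt0[of k] by (simp add: ib_def power2_eq_square)
    then show ?thesis using bnd[of k] lam_gt0[of k] B by (simp add: abs_mult divide_right_mono)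
  qed
  from sq_int_bound[OF s _ le] have 1: "(\<lambda>k. lam k * ib m p v k) \<in> sq_int CM" "nrm CM (\<lambda>k. lam k * ib m p v k) \<le> nrm CM (\<lambda>k. B * (1 / lam k))"
    by auto
  show "ib m p v \<in> H2" using 1 by (simp add: H2_def)
  show "vn (ib m p v) \<le> (2 / sqrt vol) * (\<Sum>j<m. \<bar>vec_index v j\<bar>) * S0" unfolding B_def[symmetric] using 1(2) B unfolding vn_def S0_def nrm_scale by (simp only: abs_of_nonneg)
qed

lemma Z_adj_eq:
  assumes "h \<in> Sobolev L 2"
  shows "Z_adj L m p v h = (\<integral>k. (\<Sum>j<m. vec_index v j * bas k (p j)) * fc h k \<partial>CM)"
proof -
  have c: "integrable CM (fc h)" using assms by (auto simp: Sobolev2_iff intro: H2_abs_summable(1))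
  have "Z_adj L m p v h = (\<Sum>j<m. vec_index v j * (\<integral>k. fc h k * bas k (p j) \<partial>CM))"
    by (simp add: Z_adj_def delta_def cont_rep_Sobolev[OF assms] crep_def)
  also have "\<dots> = (\<integral>k. (\<Sum>j<m. vec_index v j * (fc h k * bas k (p j))) \<partial>CM)"
    using crep_integrable[OF c] by simp
  also have "\<dots> = (\<integral>k. (\<Sum>j<m. vec_index v j * bas k (p j)) * fc h k \<partial>CM)"
  proof (rule Bochner_Integration.integral_cong[OF refl])
    fix k
    show "(\<Sum>j<m. vec_index v j * (fc h k * bas k (p j))) = (\<Sum>j<m. vec_index v j * bas k (p j)) * fc h k"
      unfolding sum_distrib_right by (rule sum.cong) auto
  qed
  finally show ?thesis .
qed

lemma shifted_lap_inner:
  assumes "g \<in> Sobolev L 2" "h \<in> Sobolev L 2"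
  shows "L2_inner L (shifted_lap L g) (shifted_lap L h) = (\<integral>k. (lam k * fc g k) * (lam k * fc h k) \<partial>CM)"
  unfolding L2_inner_def Parseval[OF shifted_lap_fc(1)[OF assms(1)] shifted_lap_fc(1)[OF assms(2)]]
    shifted_lap_fc(2)[OF assms(1)] shifted_lap_fc(2)[OF assms(2)] ..

text \<open>The function with coefficients \<open>ib\<close> solves the weak problem, so the choice
  in \<open>inv_bilap\<close> is made among solutions; every solution has these coefficients, since
  testing with \<open>bas k\<close> isolates lam^2 times the k-th one.\<close>

lemma inv_bilap_fc:
  "inv_bilap L (Z_adj L m p v) \<in> Sobolev L 2" "fc (inv_bilap L (Z_adj L m p v)) = ib m p v"
proof -
  let ?P = "\<lambda>g. g \<in> Sobolev L 2 \<and> (\<forall>h\<in>Sobolev L 2. L2_inner L (shifted_lap L g) (shifted_lap L h) = Z_adj L m p v h)"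
  have l2: "ib m p v \<in> sq_int CM" by (rule H2_l2[OF ib_H2(1)])
  have g: "syn (ib m p v) \<in> Sobolev L 2"
    using syn_close(1)[OF l2] ib_H2(1) by (simp add: Sobolev2_iff fc_syn[OF l2])
  have ex: "?P (syn (ib m p v))"
  proof (intro conjI ballI g)
    fix h assume h: "h \<in> Sobolev L 2"
    show "L2_inner L (shifted_lap L (syn (ib m p v))) (shifted_lap L h) = Z_adj L m p v h"
      unfolding shifted_lap_inner[OF g h] Z_adj_eq[OF h] fc_syn[OF l2]
    proof (rule Bochner_Integration.integral_cong[OF refl])
      fix k
      show "lam k * ib m p v k * (lam k * fc h k) = (\<Sum>j<m. vec_index v j * bas k (p j)) * fc h k"
        using lam_gt0[of k] by (simp add: ib_def power2_eq_square)
    qed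
  qed
  have P: "?P (inv_bilap L (Z_adj L m p v))" unfolding inv_bilap_def by (rule someI[of ?P, OF ex])
  then show G: "inv_bilap L (Z_adj L m p v) \<in> Sobolev L 2" by blast
  show "fc (inv_bilap L (Z_adj L m p v)) = ib m p v"
  proof
    fix k
    let ?g = "inv_bilap L (Z_adj L m p v)"
    have "L2_inner L (shifted_lap L ?g) (shifted_lap L (bas k)) = Z_adj L m p v (bas k)"
      using P bas_Sobolev by blast
    moreover have "L2_inner L (shifted_lap L ?g) (shifted_lap L (bas k)) = (lam k)\<^sup>2 * fc ?g k"
    proof -
      have "(\<integral>l. (lam l * fc ?g l) * (lam l * fc (bas k) l) \<partial>CM) = (\<Sum>l | (lam l * fc ?g l) * (lam l * fc (bas k) l) \<noteq> 0. (lam l * fc ?g l) * (lam l * fc (bas k) l))"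
        using lebesgue_integral_count_space_finite_support[of UNIV "\<lambda>l. (lam l * fc ?g l) * (lam l * fc (bas k) l)"]
          finite_subset[of "{l. (lam l * fc ?g l) * (lam l * fc (bas k) l) \<noteq> 0}" "{k}"] by (auto simp: fc_bas)
      also have "\<dots> = (\<Sum>l\<in>{k}. (lam l * fc ?g l) * (lam l * fc (bas k) l))"
        by (rule sum.mono_neutral_left) (auto simp: fc_bas)
      finally show ?thesis unfolding shifted_lap_inner[OF G bas_Sobolev] by (simp add: fc_bas power2_eq_square)
    qed
    moreover have "Z_adj L m p v (bas k) = (\<Sum>j<m. vec_index v j * bas k (p j))"
      by (simp add: Z_adj_def delta_def cont_rep_bas)
    ultimately show "fc ?g k = ib m p v k" using lam_gt0[of k] by (simp add: ib_def field_simps)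
  qed
qed

end

context torus3
begin

section \<open>The quadratic nonlinearity\<close>

text \<open>A cosine is half the sum, a sine half the difference, of the Hartley functions with
  opposite indices. A product of two modes is therefore spread over four indices, and products of
  functions become four convolutions.\<close>

lemma bas_mult:
  "bas k x * bas l x = (1 / (2 * sqrt vol)) * (bas (k - l) x + bas (l - k) x + bas (k + l) x - bas (- (k + l)) x)"
proof -
  have 1: "cos (kap (k - l) \<bullet> x) = (ebas (k - l) x + ebas (l - k) x) / 2"
  proof -
    have "kap (l - k) = - kap (k - l)" by (simp add: kap_diff)
    then show ?thesis by (simp add: ebas_def)
  qed
  have 2: "sin (kap (k + l) \<bullet> x) = (ebas (k + l) x - ebas (- (k + l)) x) / 2"
    by (simp only: ebas_def kap_minus) simp
  have "bas k x * bas l x = (ebas k x * ebas l x) / (sqrt vol * sqrt vol)" by (simp add: bas_def)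
  also have "\<dots> = ((ebas (k - l) x + ebas (l - k) x) / 2 + (ebas (k + l) x - ebas (- (k + l)) x) / 2) / (sqrt vol * sqrt vol)"
    unfolding ebas_mult 1 2 ..
  also have "\<dots> = (1 / (2 * sqrt vol)) * (bas (k - l) x + bas (l - k) x + bas (k + l) x - bas (- (k + l)) x)"
    using vol_pos unfolding bas_def by (simp add: field_simps)
  finally show ?thesis .
qed

lemma finite_sum_le_nrm:
  fixes c :: "int^'n \<Rightarrow> real"
  assumes "finite A" "c \<in> sq_int CM" shows "(\<Sum>k\<in>A. (c k)\<^sup>2) \<le> (nrm CM c)\<^sup>2"
proof -
  have "ennreal (\<Sum>k\<in>A. (c k)\<^sup>2) = (\<integral>\<^sup>+k. ennreal ((c k)\<^sup>2) * indicator A k \<partial>CM)"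
    using assms by (simp add: nn_integral_count_space_finite_set sum_ennreal)
  also have "\<dots> \<le> (\<integral>\<^sup>+k. ennreal ((c k)\<^sup>2) \<partial>CM)" by (intro nn_integral_mono) (auto simp: indicator_def)
  also have "\<dots> = ennreal ((nrm CM c)\<^sup>2)" by (rule nn_integral_sq[OF assms(2)])
  finally show ?thesis by (simp add: ennreal_le_iff)
qed

text \<open>The m-th coefficient is a sum over the fibre \<tau>(k,l) = m. Cauchy-Schwarz with the
  weight lam_k lam_l leaves the sum of 1/(lam_k lam_l) over the fibre, at most half the sum of
  1/lam_k^2 + 1/lam_l^2. By the two injectivity assumptions either index determines the pair within
  a fibre, so each half is bounded by \<open>S0\<close> squared.\<close>

lemma convolution_bound:
  assumes A: "finite A" and B: "finite B"
    and inj1: "\<And>k. inj (\<tau> k)" and inj2: "\<And>l. inj (\<lambda>k. \<tau> k l)"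
  shows "(nrm TM (\<lambda>x. \<Sum>k\<in>A. \<Sum>l\<in>B. a k * b l * bas (\<tau> k l) x))\<^sup>2
    \<le> S0\<^sup>2 * ((\<Sum>k\<in>A. lam k * (a k)\<^sup>2) * (\<Sum>l\<in>B. lam l * (b l)\<^sup>2))"
proof -
  let ?P = "A \<times> B" and ?t = "\<lambda>p. \<tau> (fst p) (snd p)"
  let ?f = "\<lambda>p. a (fst p) * b (snd p)"
  let ?F = "\<lambda>p. (lam (fst p) * (a (fst p))\<^sup>2) * (lam (snd p) * (b (snd p))\<^sup>2)"
  let ?Pm = "\<lambda>m. {p \<in> ?P. ?t p = m}"
  define g where "g m = (\<Sum>p\<in>?Pm m. ?f p)" for m
  have P: "finite ?P" using A B by simp
  have eq: "(\<lambda>x. \<Sum>k\<in>A. \<Sum>l\<in>B. a k * b l * bas (\<tau> k l) x) = tsum (?t ` ?P) g"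
  proof
    fix x
    have "(\<Sum>k\<in>A. \<Sum>l\<in>B. a k * b l * bas (\<tau> k l) x) = (\<Sum>p\<in>?P. ?f p * bas (?t p) x)"
      by (simp add: sum.cartesian_product split_def)
    also have "\<dots> = (\<Sum>m\<in>?t ` ?P. \<Sum>p\<in>?Pm m. ?f p * bas (?t p) x)" by (rule sum.image_gen[OF P])
    also have "\<dots> = (\<Sum>m\<in>?t ` ?P. g m * bas m x)"
      unfolding g_def by (intro sum.cong refl) (auto simp: sum_distrib_right intro!: sum.cong)
    finally show "(\<Sum>k\<in>A. \<Sum>l\<in>B. a k * b l * bas (\<tau> k l) x) = tsum (?t ` ?P) g x" by (simp add: tsum_def)
  qed
  have half: "(\<Sum>p\<in>?Pm m. (1 / lam (fst p))\<^sup>2) \<le> S0\<^sup>2" "(\<Sum>p\<in>?Pm m. (1 / lam (snd p))\<^sup>2) \<le> S0\<^sup>2" for m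
  proof -
    have i: "inj_on fst (?Pm m)" using inj1 by (auto simp: inj_on_def inj_def prod_eq_iff)
    have j: "inj_on snd (?Pm m)" using inj2 by (auto simp: inj_on_def inj_def prod_eq_iff)
    have fin: "finite (?Pm m)" using P by simp
    show "(\<Sum>p\<in>?Pm m. (1 / lam (fst p))\<^sup>2) \<le> S0\<^sup>2"
      using sum.reindex[OF i, of "\<lambda>k. (1 / lam k)\<^sup>2"] finite_sum_le_nrm[OF finite_imageI[OF fin] inv_lam_sq_int, of fst]
      unfolding S0_def o_def by linarith
    show "(\<Sum>p\<in>?Pm m. (1 / lam (snd p))\<^sup>2) \<le> S0\<^sup>2"
      using sum.reindex[OF j, of "\<lambda>k. (1 / lam k)\<^sup>2"] finite_sum_le_nrm[OF finite_imageI[OF fin] inv_lam_sq_int, of snd]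
      unfolding S0_def o_def by linarith
  qed
  have gm: "(g m)\<^sup>2 \<le> S0\<^sup>2 * (\<Sum>p\<in>?Pm m. ?F p)" for m
  proof -
    let ?w = "\<lambda>p. sqrt (lam (fst p) * lam (snd p))"
    have ln: "lam k \<noteq> 0" for k using lam_gt0[of k] by simp
    have "g m = (\<Sum>p\<in>?Pm m. (1 / ?w p) * (?w p * ?f p))"
      unfolding g_def by (rule sum.cong) (simp_all add: ln)
    then have "(g m)\<^sup>2 \<le> (\<Sum>p\<in>?Pm m. (1 / ?w p)\<^sup>2) * (\<Sum>p\<in>?Pm m. (?w p * ?f p)\<^sup>2)"
      by (simp only: Cauchy_Schwarz_ineq_sum)
    also have "(\<Sum>p\<in>?Pm m. (?w p * ?f p)\<^sup>2) = (\<Sum>p\<in>?Pm m. ?F p)"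
      by (rule sum.cong) (use lam_gt0 in \<open>auto simp: power_mult_distrib less_imp_le mult_ac\<close>)
    also have "(\<Sum>p\<in>?Pm m. (1 / ?w p)\<^sup>2) * (\<Sum>p\<in>?Pm m. ?F p) \<le> S0\<^sup>2 * (\<Sum>p\<in>?Pm m. ?F p)"
    proof (rule mult_right_mono)
      show "0 \<le> (\<Sum>p\<in>?Pm m. ?F p)" using lam_gt0 by (auto intro!: sum_nonneg simp: less_imp_le)
      have "(1 / ?w p)\<^sup>2 \<le> ((1 / lam (fst p))\<^sup>2 + (1 / lam (snd p))\<^sup>2) / 2" for p
      proof -
        have "(1 / ?w p)\<^sup>2 = (1 / lam (fst p)) * (1 / lam (snd p))"
          using lam_gt0 by (simp add: power_divide less_imp_le)
        then show ?thesis using sum_squares_bound[of "1 / lam (fst p)" "1 / lam (snd p)"] by simp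
      qed
      then have "(\<Sum>p\<in>?Pm m. (1 / ?w p)\<^sup>2) \<le> (\<Sum>p\<in>?Pm m. ((1 / lam (fst p))\<^sup>2 + (1 / lam (snd p))\<^sup>2) / 2)"
        by (intro sum_mono)
      also have "\<dots> = ((\<Sum>p\<in>?Pm m. (1 / lam (fst p))\<^sup>2) + (\<Sum>p\<in>?Pm m. (1 / lam (snd p))\<^sup>2)) / 2"
        by (simp only: sum_divide_distrib[symmetric] sum.distrib)
      also have "\<dots> \<le> S0\<^sup>2" using half[of m] by simp
      finally show "(\<Sum>p\<in>?Pm m. (1 / ?w p)\<^sup>2) \<le> S0\<^sup>2" .
    qed
    finally show ?thesis .
  qed
  have "(nrm TM (tsum (?t ` ?P) g))\<^sup>2 = (\<Sum>m\<in>?t ` ?P. (g m)\<^sup>2)" using P by (intro nrm_tsum) simp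
  also have "\<dots> \<le> (\<Sum>m\<in>?t ` ?P. S0\<^sup>2 * (\<Sum>p\<in>?Pm m. ?F p))" by (intro sum_mono gm)
  also have "\<dots> = S0\<^sup>2 * (\<Sum>p\<in>?P. ?F p)" unfolding sum.image_gen[OF P, of ?F ?t] by (simp add: sum_distrib_left)
  also have "(\<Sum>p\<in>?P. ?F p) = (\<Sum>k\<in>A. lam k * (a k)\<^sup>2) * (\<Sum>l\<in>B. lam l * (b l)\<^sup>2)"
    by (simp add: sum_product sum.cartesian_product split_def)
  finally show ?thesis unfolding eq .
qed

text \<open>The norm of W^(1,2), with \<open>H1\<close> as its space of coefficients: the level at
  which the partial derivatives of elements of V live and at which their products are estimated in
  H.\<close>

definition w1 :: "(int^'n \<Rightarrow> real) \<Rightarrow> real" where "w1 c = nrm CM (\<lambda>k. sqrt (lam k) * c k)"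
definition H1 :: "(int^'n \<Rightarrow> real) set" where "H1 = {c. (\<lambda>k. sqrt (lam k) * c k) \<in> sq_int CM}"

lemma w1_nonneg [simp]: "w1 c \<ge> 0" by (simp add: w1_def)

lemma H1_l2: "c \<in> H1 \<Longrightarrow> c \<in> sq_int CM"
  unfolding H1_def mem_Collect_eq
proof (erule sq_int_bound(1))
  fix k
  have "1 \<le> sqrt (lam k)" using lam_ge1[of k] by simp
  then show "\<bar>c k\<bar> \<le> \<bar>sqrt (lam k) * c k\<bar>"
    using mult_right_mono[of 1 "sqrt (lam k)" "\<bar>c k\<bar>"] by (simp add: abs_mult)
qed simp

lemma H1_sum_le:
  assumes "c \<in> H1" "finite A" shows "(\<Sum>k\<in>A. lam k * (c k)\<^sup>2) \<le> (w1 c)\<^sup>2"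
  using finite_sum_le_nrm[OF assms(2), of "\<lambda>k. sqrt (lam k) * c k"] assms(1) lam_gt0
  by (simp add: H1_def w1_def power_mult_distrib less_imp_le)

text \<open>Four convolutions, each bounded with \<open>S0\<close>, times the factor 1/(2 sqrt vol)
  of \<open>bas_mult\<close>.\<close>

definition Cp :: real where "Cp = 2 * S0 / sqrt vol"

lemma Cp_nonneg [simp]: "Cp \<ge> 0" using vol_pos by (simp add: Cp_def)

lemma product_bound_finite:
  assumes A: "finite A" and B: "finite B" and a: "a \<in> H1" and b: "b \<in> H1"
  shows "nrm TM (\<lambda>x. tsum A a x * tsum B b x) \<le> Cp * w1 a * w1 b"
proof -
  let ?D = "\<lambda>\<tau> x. \<Sum>k\<in>A. \<Sum>l\<in>B. a k * b l * bas (\<tau> k l) x"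
  have D: "?D \<tau> \<in> sq_int TM" for \<tau> by (intro sq_int_sum sq_int_scale bas_sq_int)
  have Db: "nrm TM (?D \<tau>) \<le> S0 * (w1 a * w1 b)" if "\<And>k. inj (\<tau> k)" "\<And>l. inj (\<lambda>k. \<tau> k l)" for \<tau>
  proof (rule power2_le_imp_le)
    have "(nrm TM (?D \<tau>))\<^sup>2 \<le> S0\<^sup>2 * ((\<Sum>k\<in>A. lam k * (a k)\<^sup>2) * (\<Sum>l\<in>B. lam l * (b l)\<^sup>2))"
      by (rule convolution_bound[OF A B that])
    also have "\<dots> \<le> S0\<^sup>2 * ((w1 a)\<^sup>2 * (w1 b)\<^sup>2)"
      using lam_gt0 by (intro mult_left_mono mult_mono H1_sum_le a b A B) (auto intro!: sum_nonneg simp: less_imp_le)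
    finally show "(nrm TM (?D \<tau>))\<^sup>2 \<le> (S0 * (w1 a * w1 b))\<^sup>2" by (simp add: power_mult_distrib)
  qed simp
  let ?t1 = "\<lambda>k l. k - l" and ?t2 = "\<lambda>k l. l - k" and ?t3 = "\<lambda>k l. k + l" and ?t4 = "\<lambda>k l :: int^'n. - (k + l)"
  have eq: "tsum A a x * tsum B b x = (1 / (2 * sqrt vol)) * (((?D ?t1 x + ?D ?t2 x) + ?D ?t3 x) - ?D ?t4 x)" for x
  proof -
    have "tsum A a x * tsum B b x = (\<Sum>k\<in>A. \<Sum>l\<in>B. a k * b l * (bas k x * bas l x))"
      unfolding tsum_def sum_product by (intro sum.cong refl) (simp add: mult_ac)
    also have "\<dots> = (\<Sum>k\<in>A. \<Sum>l\<in>B. (1 / (2 * sqrt vol)) * (((a k * b l * bas (k - l) x + a k * b l * bas (l - k) x) + a k * b l * bas (k + l) x) - a k * b l * bas (- (k + l)) x))"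
      unfolding bas_mult by (intro sum.cong refl) (simp add: algebra_simps)
    finally show ?thesis by (simp only: sum_distrib_left[symmetric] sum.distrib sum_subtractf)
  qed
  have "nrm TM (\<lambda>x. tsum A a x * tsum B b x) = (1 / (2 * sqrt vol)) * nrm TM (\<lambda>x. ((?D ?t1 x + ?D ?t2 x) + ?D ?t3 x) - ?D ?t4 x)"
    unfolding eq nrm_scale using vol_pos by simp
  also have "\<dots> \<le> (1 / (2 * sqrt vol)) * (((nrm TM (?D ?t1) + nrm TM (?D ?t2)) + nrm TM (?D ?t3)) + nrm TM (?D ?t4))"
  proof (rule mult_left_mono)
    have "nrm TM (\<lambda>x. ((?D ?t1 x + ?D ?t2 x) + ?D ?t3 x) - ?D ?t4 x) \<le> nrm TM (\<lambda>x. (?D ?t1 x + ?D ?t2 x) + ?D ?t3 x) + nrm TM (?D ?t4)"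
      by (rule nrm_triangle_diff[OF sq_int_add[OF sq_int_add[OF D D] D] D])
    also have "nrm TM (\<lambda>x. (?D ?t1 x + ?D ?t2 x) + ?D ?t3 x) \<le> nrm TM (\<lambda>x. ?D ?t1 x + ?D ?t2 x) + nrm TM (?D ?t3)"
      by (rule nrm_triangle[OF sq_int_add[OF D D] D])
    also have "nrm TM (\<lambda>x. ?D ?t1 x + ?D ?t2 x) \<le> nrm TM (?D ?t1) + nrm TM (?D ?t2)"
      by (rule nrm_triangle[OF D D])
    finally show "nrm TM (\<lambda>x. ((?D ?t1 x + ?D ?t2 x) + ?D ?t3 x) - ?D ?t4 x) \<le> ((nrm TM (?D ?t1) + nrm TM (?D ?t2)) + nrm TM (?D ?t3)) + nrm TM (?D ?t4)"
      by simp
  qed (use vol_pos in simp)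
  also have "\<dots> \<le> (1 / (2 * sqrt vol)) * (((S0 * (w1 a * w1 b) + S0 * (w1 a * w1 b)) + S0 * (w1 a * w1 b)) + S0 * (w1 a * w1 b))"
    using vol_pos by (intro mult_left_mono add_mono Db) (auto simp: inj_def)
  also have "\<dots> = Cp * w1 a * w1 b" using vol_pos by (simp add: Cp_def field_simps)
  finally show ?thesis .
qed

text \<open>Both series are cut at the same stage j; the finite products converge almost everywhere
  to the product of the limits and obey a uniform bound, so Fatou applies.\<close>

lemma product_bound:
  assumes a: "a \<in> H1" and b: "b \<in> H1"
  shows "(\<lambda>x. syn a x * syn b x) \<in> sq_int TM" "nrm TM (\<lambda>x. syn a x * syn b x) \<le> Cp * w1 a * w1 b"
proof -
  let ?s = "\<lambda>c j. tsum (fin_idx (ncut c j)) c"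
  have sm: "?s c j \<in> borel_measurable TM" for c j using tsum_sq_int by (rule sq_int_measurable)
  have ym: "syn c \<in> borel_measurable TM" for c by (rule borel_measurable_TM[OF syn_measurable])
  have m: "(\<lambda>x. syn a x * syn b x) \<in> borel_measurable TM" using ym by auto
  have le: "(\<integral>\<^sup>+x. ennreal ((syn a x * syn b x)\<^sup>2) \<partial>TM) \<le> ennreal ((Cp * w1 a * w1 b)\<^sup>2)"
  proof (rule sq_int_Fatou[where F = "\<lambda>j x. ?s a j x * ?s b j x" and m = 0])
    show "(\<lambda>x. ?s a j x * ?s b j x) \<in> borel_measurable TM" for j using sm by auto
    show "AE x in TM. (\<lambda>j. ?s a j x * ?s b j x) \<longlonglongrightarrow> syn a x * syn b x"
      using syn_AE_LIMSEQ[OF H1_l2[OF a]] syn_AE_LIMSEQ[OF H1_l2[OF b]] by eventually_elim (intro tendsto_mult)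
    fix j :: nat
    have s: "(\<lambda>x. ?s a j x * ?s b j x) \<in> sq_int TM"
      by (intro continuous_sq_int continuous_intros tsum_continuous)
    show "(\<integral>\<^sup>+x. ennreal ((?s a j x * ?s b j x)\<^sup>2) \<partial>TM) \<le> ennreal ((Cp * w1 a * w1 b)\<^sup>2)"
      unfolding nn_integral_sq[OF s] by (intro ennreal_leI power_mono product_bound_finite a b) auto
  qed (rule m)
  from sq_int_nn_integral_le[OF m le] show "(\<lambda>x. syn a x * syn b x) \<in> sq_int TM" "nrm TM (\<lambda>x. syn a x * syn b x) \<le> Cp * w1 a * w1 b"
    by auto
qed

text \<open>The coefficients of the i-th partial derivative of the function with coefficients
  \<open>c\<close>; the reflected index comes from integrating by parts against
  \<open>bas k\<close>, compare \<open>fc_wD1\<close>.\<close>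

definition gr :: "'n \<Rightarrow> (int^'n \<Rightarrow> real) \<Rightarrow> int^'n \<Rightarrow> real" where
  "gr i c k = - (kap k $ i) * c (- k)"

lemma bij_uminus_vec: "bij (uminus :: int^'n \<Rightarrow> int^'n)"
  by (rule bij_uminus)

lemma nrm_reindex: "bij \<pi> \<Longrightarrow> nrm CM (\<lambda>k. c (\<pi> k)) = nrm CM c"
  unfolding nrm_def using integral_bij_count_space[of \<pi> UNIV UNIV "\<lambda>k. (c k)\<^sup>2"] by simp

lemma gr_H1:
  assumes c: "c \<in> H2" shows "gr i c \<in> H1" "w1 (gr i c) \<le> vn c"
proof -
  have s: "(\<lambda>k. lam (- k) * c (- k)) \<in> sq_int CM"
    using sq_int_reindex[OF bij_uminus_vec, of "\<lambda>k. lam k * c k"] c by (simp add: H2_def)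
  have le: "\<bar>sqrt (lam k) * gr i c k\<bar> \<le> \<bar>lam (- k) * c (- k)\<bar>" for k
  proof -
    have "\<bar>kap k $ i\<bar> \<le> norm (kap k)" by (rule component_le_norm_cart)
    also have "\<dots> \<le> sqrt (lam k)" by (rule real_le_rsqrt) (simp add: lam_def)
    finally have "sqrt (lam k) * \<bar>kap k $ i\<bar> \<le> sqrt (lam k) * sqrt (lam k)" using lam_gt0[of k] by (intro mult_left_mono) auto
    then have "sqrt (lam k) * \<bar>kap k $ i\<bar> * \<bar>c (- k)\<bar> \<le> lam k * \<bar>c (- k)\<bar>" using lam_gt0[of k] by (intro mult_right_mono) auto
    then show ?thesis using lam_gt0[of k] by (simp add: gr_def abs_mult lam_minus mult.assoc)
  qed
  from sq_int_bound[OF s _ le] have 1: "(\<lambda>k. sqrt (lam k) * gr i c k) \<in> sq_int CM"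
    "nrm CM (\<lambda>k. sqrt (lam k) * gr i c k) \<le> nrm CM (\<lambda>k. lam (- k) * c (- k))" by auto
  show "gr i c \<in> H1" using 1 by (simp add: H1_def)
  show "w1 (gr i c) \<le> vn c" using 1(2) nrm_reindex[OF bij_uminus_vec, of "\<lambda>k. lam k * c k"] by (simp add: w1_def vn_def)
qed

text \<open>\<open>BB c d\<close> is $\nabla u\cdot\nabla w$ for the functions \<open>u\<close>, \<open>w\<close> with coefficients \<open>c\<close>, \<open>d\<close>.\<close>

definition BB :: "(int^'n \<Rightarrow> real) \<Rightarrow> (int^'n \<Rightarrow> real) \<Rightarrow> real^'n \<Rightarrow> real" where
  "BB c d x = (\<Sum>i\<in>UNIV. syn (gr i c) x * syn (gr i d) x)"

definition Bf :: "(int^'n \<Rightarrow> real) \<Rightarrow> (int^'n \<Rightarrow> real) \<Rightarrow> int^'n \<Rightarrow> real" where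
  "Bf c d = fc (BB c d)"

definition CB :: real where "CB = real CARD('n) * Cp"

lemma CB_nonneg [simp]: "CB \<ge> 0" by (simp add: CB_def)

lemma BB_bound:
  assumes c: "c \<in> H2" and d: "d \<in> H2"
  shows "BB c d \<in> sq_int TM" "nrm TM (BB c d) \<le> CB * vn c * vn d"
proof -
  have s: "(\<lambda>x. syn (gr i c) x * syn (gr i d) x) \<in> sq_int TM" for i
    by (rule product_bound(1)[OF gr_H1(1)[OF c] gr_H1(1)[OF d]])
  have eq: "BB c d = (\<lambda>x. \<Sum>i\<in>UNIV. syn (gr i c) x * syn (gr i d) x)" by (rule ext) (simp add: BB_def)
  show "BB c d \<in> sq_int TM" unfolding eq by (rule sq_int_sum) (rule s)
  have "nrm TM (BB c d) \<le> (\<Sum>i\<in>UNIV. nrm TM (\<lambda>x. syn (gr i c) x * syn (gr i d) x))"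
    unfolding eq by (rule nrm_triangle_sum) (auto intro: s)
  also have "\<dots> \<le> (\<Sum>i\<in>(UNIV :: 'n set). Cp * vn c * vn d)"
  proof (rule sum_mono)
    fix i
    have "nrm TM (\<lambda>x. syn (gr i c) x * syn (gr i d) x) \<le> Cp * w1 (gr i c) * w1 (gr i d)"
      by (rule product_bound(2)[OF gr_H1(1)[OF c] gr_H1(1)[OF d]])
    also have "\<dots> \<le> Cp * vn c * vn d" by (intro mult_mono gr_H1(2) c d) auto
    finally show "nrm TM (\<lambda>x. syn (gr i c) x * syn (gr i d) x) \<le> Cp * vn c * vn d" .
  qed
  also have "\<dots> = CB * vn c * vn d" by (simp add: CB_def)
  finally show "nrm TM (BB c d) \<le> CB * vn c * vn d" .
qed

lemma Bf_bound:
  assumes c: "c \<in> H2" and d: "d \<in> H2"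
  shows "Bf c d \<in> sq_int CM" "nrm CM (Bf c d) \<le> CB * vn c * vn d"
  unfolding Bf_def using fc_l2(1)[OF BB_bound(1)[OF c d]] fc_l2(2)[OF BB_bound(1)[OF c d]] BB_bound(2)[OF c d] by auto

lemma Bf_commute: "Bf c d = Bf d c"
  by (simp add: Bf_def BB_def[abs_def] mult.commute)

text \<open>The cut indices in \<open>syn\<close> depend on the coefficients, so linearity is not
  visible from the defining limit; it follows, up to a null set, by comparing Fourier
  coefficients.\<close>

lemma syn_linear:
  assumes a: "a \<in> sq_int CM" and b: "b \<in> sq_int CM"
  shows "AE x in TM. syn (\<lambda>k. s * a k + r * b k) x = s * syn a x + r * syn b x"
proof (rule fc_inj)
  have ab: "(\<lambda>k. s * a k + r * b k) \<in> sq_int CM" by (intro sq_int_add sq_int_scale a b)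
  note sa = syn_close(1)[OF a] and sb = syn_close(1)[OF b]
  show "syn (\<lambda>k. s * a k + r * b k) \<in> sq_int TM" by (rule syn_close(1)[OF ab])
  show "(\<lambda>x. s * syn a x + r * syn b x) \<in> sq_int TM" by (intro sq_int_add sq_int_scale sa sb)
  show "fc (syn (\<lambda>k. s * a k + r * b k)) k = fc (\<lambda>x. s * syn a x + r * syn b x) k" for k
    unfolding fc_syn[OF ab] by (simp add: fc_add[OF sq_int_scale[OF sa] sq_int_scale[OF sb]] fc_scale fc_syn[OF a] fc_syn[OF b])
qed

lemma H2_lin: "c \<in> H2 \<Longrightarrow> d \<in> H2 \<Longrightarrow> (\<lambda>k. s * c k + r * d k) \<in> H2"
  using sq_int_add[OF sq_int_scale sq_int_scale, of "\<lambda>k. lam k * c k" CM "\<lambda>k. lam k * d k" s r]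
  by (simp add: H2_def distrib_left mult.left_commute)

lemma Bf_linear:
  assumes c: "c \<in> H2" and c': "c' \<in> H2" and d: "d \<in> H2"
  shows "Bf (\<lambda>k. s * c k + r * c' k) d k = s * Bf c d k + r * Bf c' d k"
proof -
  have "AE x in TM. \<forall>i\<in>UNIV. syn (gr i (\<lambda>k. s * c k + r * c' k)) x = s * syn (gr i c) x + r * syn (gr i c') x"
  proof (rule AE_finite_allI)
    fix i
    have "gr i (\<lambda>k. s * c k + r * c' k) = (\<lambda>k. s * gr i c k + r * gr i c' k)" by (auto simp: gr_def algebra_simps)
    then show "AE x in TM. syn (gr i (\<lambda>k. s * c k + r * c' k)) x = s * syn (gr i c) x + r * syn (gr i c') x"
      using syn_linear[OF H1_l2[OF gr_H1(1)[OF c]] H1_l2[OF gr_H1(1)[OF c']]] by simp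
  qed simp
  then have ae: "AE x in TM. BB (\<lambda>k. s * c k + r * c' k) d x = s * BB c d x + r * BB c' d x"
    by eventually_elim (simp add: BB_def distrib_right sum.distrib sum_distrib_left mult.assoc)
  note b = BB_bound(1)[OF c d] BB_bound(1)[OF c' d] BB_bound(1)[OF H2_lin[OF c c'] d]
  have "Bf (\<lambda>k. s * c k + r * c' k) d = fc (\<lambda>x. s * BB c d x + r * BB c' d x)"
    unfolding Bf_def using b by (intro fc_cong_AE ae sq_int_measurable sq_int_add sq_int_scale)
  then show ?thesis by (simp add: fc_add[OF sq_int_scale[OF b(1)] sq_int_scale[OF b(2)]] fc_scale Bf_def)
qed

lemma gr_cong: "(\<And>k. k \<noteq> 0 \<Longrightarrow> c k = d k) \<Longrightarrow> gr i c = gr i d"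
  by (rule ext) (metis gr_def kap_zero mult_zero_left neg_0_equal_iff_equal minus_zero zero_index)

text \<open>Gradients do not see the constant mode. This is why a bound on the zero mean part of the
  reference is enough.\<close>

lemma Bf_cong: "(\<And>k. k \<noteq> 0 \<Longrightarrow> c k = c' k) \<Longrightarrow> Bf c d = Bf c' d"
  using gr_cong[of c c'] by (simp add: Bf_def BB_def[abs_def])

lemma gradient_BB:
  assumes u: "u \<in> Sobolev L 2"
  shows "AE x in TM. (norm (gradient L u x))\<^sup>2 = BB (fc u) (fc u) x"
proof -
  have c: "fc u \<in> H2" using u by (simp add: Sobolev2_iff)
  have "AE x in TM. \<forall>i\<in>UNIV. wD L [i] u x = syn (gr i (fc u)) x"
  proof (rule AE_finite_allI)
    fix i
    show "AE x in TM. wD L [i] u x = syn (gr i (fc u)) x"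
    proof (rule fc_inj)
      show "wD L [i] u \<in> sq_int TM" using u by (rule wD_sq_int) simp
      show "syn (gr i (fc u)) \<in> sq_int TM" by (rule syn_close(1)[OF H1_l2[OF gr_H1(1)[OF c]]])
      show "fc (wD L [i] u) k = fc (syn (gr i (fc u))) k" for k
        unfolding fc_syn[OF H1_l2[OF gr_H1(1)[OF c]]] fc_wD1[OF u] by (simp add: gr_def)
    qed
  qed simp
  then show ?thesis
    by eventually_elim (simp add: gradient_def BB_def norm_vec_def L2_set_def sum_nonneg power2_eq_square)
qed

section \<open>Dependence on parameters\<close>

lemma tail_param_measurable:
  assumes "\<And>k. (\<lambda>t. c t k) \<in> borel_measurable M" shows "(\<lambda>t. tail (c t) n) \<in> borel_measurable M"
  unfolding tail_def
proof (rule borel_measurable_nn_integral_count_space)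
  note [measurable] = assms
  show "(\<lambda>t. ennreal ((c t k)\<^sup>2) * indicator (- fin_idx n) k) \<in> borel_measurable M" for k
    by (cases "k \<in> fin_idx n") simp_all
qed

lemma syn_param_measurable:
  assumes c: "\<And>k. (\<lambda>t. c t k) \<in> borel_measurable M"
  shows "(\<lambda>(t, x). syn (c t) x) \<in> borel_measurable (M \<Otimes>\<^sub>M borel)"
proof -
  note [measurable] = c tail_param_measurable[OF c]
  have [measurable]: "(\<lambda>t. ncut (c t) j) \<in> measurable M (count_space UNIV)" for j
    unfolding ncut_def by measurable
  have "(\<lambda>z. tsum (fin_idx (ncut (c (fst z)) j)) (c (fst z)) (snd z)) \<in> borel_measurable (M \<Otimes>\<^sub>M borel)" for j
  proof (rule measurable_compose_countable[where f = "\<lambda>n z. tsum (fin_idx n) (c (fst z)) (snd z)" and g = "\<lambda>z. ncut (c (fst z)) j"])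
    show "(\<lambda>z. tsum (fin_idx n) (c (fst z)) (snd z)) \<in> borel_measurable (M \<Otimes>\<^sub>M borel)" for n
      unfolding tsum_def by measurable
  qed measurable
  then show ?thesis unfolding syn_def split_def by (rule borel_measurable_lim_metric)
qed

text \<open>\<open>TM\<close> comes from the completed measure; rewriting the integral over Borel
  Lebesgue measure with an indicator makes the measurability theorem for product spaces
  applicable.\<close>

lemma integral_TM_param_measurable:
  fixes f :: "'t \<Rightarrow> real^'n \<Rightarrow> real"
  assumes [measurable]: "(\<lambda>(t, x). f t x) \<in> borel_measurable (M \<Otimes>\<^sub>M borel)"
  shows "(\<lambda>t. \<integral>x. f t x \<partial>TM) \<in> borel_measurable M"
proof (rule measurable_cong[THEN iffD2])
  fix t assume "t \<in> space M"
  then have "f t \<in> borel_measurable borel" using measurable_Pair2[OF assms, of t] by simp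
  then show "(\<integral>x. f t x \<partial>TM) = (\<integral>x. indicator T x * f t x \<partial>lborel)" by (rule integral_TM)
next
  have s: "sets (M \<Otimes>\<^sub>M lborel) = sets (M \<Otimes>\<^sub>M (borel :: (real^'n) measure))" by (rule sets_pair_measure_cong) auto
  have "(\<lambda>(t, x). indicator T x * f t x) \<in> borel_measurable (M \<Otimes>\<^sub>M (lborel :: (real^'n) measure))"
    unfolding measurable_cong_sets[OF s refl] by measurable
  then show "(\<lambda>t. \<integral>x. indicator T x * f t x \<partial>lborel) \<in> borel_measurable M"
    by (rule lborel.borel_measurable_lebesgue_integral)
qed

lemma Bf_measurable:
  assumes c: "\<And>k. (\<lambda>t. c t k) \<in> borel_measurable M" and d: "\<And>k. (\<lambda>t. d t k) \<in> borel_measurable M"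
  shows "(\<lambda>t. Bf (c t) (d t) k) \<in> borel_measurable M"
  unfolding Bf_def fc_def
proof (rule integral_TM_param_measurable)
  have [measurable]: "(\<lambda>(t, x). syn (gr i (e t)) x) \<in> borel_measurable (M \<Otimes>\<^sub>M borel)"
    if "\<And>k. (\<lambda>t. e t k) \<in> borel_measurable M" for e i
    by (rule syn_param_measurable) (use that in \<open>simp add: gr_def\<close>)
  note [measurable] = this[OF c] this[OF d]
  show "(\<lambda>(t, x). BB (c t) (d t) x * bas k x) \<in> borel_measurable (M \<Otimes>\<^sub>M borel)"
    unfolding BB_def by measurable
qed

end

section \<open>The smallest eigenvalue bounds the quadratic form\<close>

text \<open>The dimension \<open>m\<close> is a number, not a type, so vectors are sequences
  vanishing from \<open>m\<close> on. The sphere is a closed subset of a product of intervals,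
  compact by Tychonoff.\<close>

lemma compact_unit_sphere_fun:
  "compact {v :: nat \<Rightarrow> real. (\<forall>i\<ge>m. v i = 0) \<and> (\<Sum>i<m. (v i)\<^sup>2) = 1}" (is "compact ?S")
proof -
  have P: "compact (PiE UNIV (\<lambda>i::nat. {-1..1::real}))"
    using compactin_PiE[of "\<lambda>i::nat. euclidean :: real topology" UNIV "\<lambda>i. {-1..1::real}"]
    by (simp add: euclidean_product_topology)
  have cc: "continuous_on UNIV (\<lambda>v. v i)" for i :: nat by (rule continuous_on_product_coordinates)
  have "?S = (\<Inter>i\<in>{m..}. {v. v i = 0}) \<inter> {v. (\<Sum>i<m. (v i)\<^sup>2) = 1}" by auto
  moreover have "closed {v :: nat \<Rightarrow> real. v i = 0}" for i by (intro closed_Collect_eq cc continuous_on_const)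
  moreover have "closed {v :: nat \<Rightarrow> real. (\<Sum>i<m. (v i)\<^sup>2) = 1}"
    by (intro closed_Collect_eq continuous_on_sum continuous_on_power cc continuous_on_const)
  ultimately have "closed ?S" by (auto intro!: closed_Int closed_INT)
  moreover have "?S \<subseteq> PiE UNIV (\<lambda>i::nat. {-1..1::real})"
  proof
    fix v assume v: "v \<in> ?S"
    have "v i \<in> {-1..1}" for i
    proof (cases "i < m")
      case True
      have "(v i)\<^sup>2 \<le> (\<Sum>i<m. (v i)\<^sup>2)" using True by (intro member_le_sum) auto
      then have "\<bar>v i\<bar> \<le> 1" using v abs_square_le_1 by auto
      then show ?thesis by auto
    qed (use v in auto)
    then show "v \<in> PiE UNIV (\<lambda>i::nat. {-1..1::real})" by auto
  qed
  ultimately show ?thesis using closed_Int_compact[OF _ P, of ?S] by (simp only: Int_absorb2)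
qed

text \<open>The minimum of the quadratic form on the unit sphere is an eigenvalue: its first
  variation in the direction of the residual \<open>r\<close> of the minimiser would otherwise lower
  the Rayleigh quotient.\<close>

lemma symmetric_form_min_eigenvalue:
  fixes M :: "nat \<Rightarrow> nat \<Rightarrow> real"
  assumes m: "m > 0" and sym: "\<And>i j. M i j = M j i"
  obtains c v where "\<And>w. (\<Sum>i<m. w i * (\<Sum>j<m. M i j * w j)) \<ge> c * (\<Sum>i<m. (w i)\<^sup>2)"
    "(\<Sum>i<m. (v i)\<^sup>2) = 1" "\<And>i. i < m \<Longrightarrow> (\<Sum>j<m. M i j * v j) = c * v i"
proof -
  define S where "S = {v :: nat \<Rightarrow> real. (\<forall>i\<ge>m. v i = 0) \<and> (\<Sum>i<m. (v i)\<^sup>2) = 1}"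
  define q where "q w = (\<Sum>i<m. w i * (\<Sum>j<m. M i j * w j))" for w :: "nat \<Rightarrow> real"
  define n2 where "n2 w = (\<Sum>i<m. (w i)\<^sup>2)" for w :: "nat \<Rightarrow> real"
  have cc: "continuous_on A (\<lambda>v. v i)" for i :: nat and A :: "(nat \<Rightarrow> real) set"
    by (rule continuous_on_subset[OF continuous_on_product_coordinates]) auto
  have qc: "continuous_on S q" unfolding q_def
    by (intro continuous_on_sum continuous_on_mult cc continuous_on_const)
  have "(\<lambda>i. if i = 0 then 1 else 0) \<in> S" using m by (auto simp: S_def if_distrib[of "\<lambda>x. x\<^sup>2"] sum.delta cong: if_cong)
  then have "S \<noteq> {}" by blast
  then obtain v where v: "v \<in> S" "\<And>w. w \<in> S \<Longrightarrow> q v \<le> q w"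
    using continuous_attains_inf[OF compact_unit_sphere_fun[of m, folded S_def] _ qc] by blast
  define c where "c = q v"
  have n2v: "n2 v = 1" using v(1) by (simp add: S_def n2_def)
  have hom: "q (\<lambda>i. a * w i) = a\<^sup>2 * q w" "n2 (\<lambda>i. a * w i) = a\<^sup>2 * n2 w" for a w
    unfolding q_def n2_def by (simp_all add: sum_distrib_left power2_eq_square mult_ac)
  have low: "c * n2 w \<le> q w" for w
  proof (cases "n2 w = 0")
    case True
    then have "\<And>i. i < m \<Longrightarrow> w i = 0" unfolding n2_def by (subst (asm) sum_nonneg_eq_0_iff) auto
    then show ?thesis using True by (simp add: q_def)
  next
    case False
    then have p: "n2 w > 0" unfolding n2_def using sum_nonneg[of "{..<m}" "\<lambda>i. (w i)\<^sup>2"] by (simp add: less_le)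
    let ?a = "1 / sqrt (n2 w)"
    let ?w = "\<lambda>i. if i < m then ?a * w i else 0"
    have e: "q ?w = q (\<lambda>i. ?a * w i)" "n2 ?w = n2 (\<lambda>i. ?a * w i)" unfolding q_def n2_def by (auto intro!: sum.cong)
    have "n2 ?w = 1" unfolding e hom using p by (simp add: power_divide)
    then have "?w \<in> S" by (simp add: S_def n2_def)
    then have "c \<le> q ?w" unfolding c_def by (rule v(2))
    also have "\<dots> = q w / n2 w" unfolding e hom using p by (simp add: power_divide)
    finally show ?thesis using p by (simp add: pos_le_divide_eq)
  qed
  \<comment> \<open>The residual of the eigenvalue equation is the direction of steepest change of
    the Rayleigh quotient at \<open>v\<close>, so perturbing \<open>v\<close> along it tests
    minimality best.\<close>
  define r where "r i = (\<Sum>j<m. M i j * v j) - c * v i" for i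
  have cross: "(\<Sum>i<m. v i * (\<Sum>j<m. M i j * r j)) = (\<Sum>i<m. r i * (\<Sum>j<m. M i j * v j))"
  proof -
    have "(\<Sum>i<m. v i * (\<Sum>j<m. M i j * r j)) = (\<Sum>i<m. \<Sum>j<m. v i * (M i j * r j))" by (simp add: sum_distrib_left)
    also have "\<dots> = (\<Sum>j<m. \<Sum>i<m. v i * (M i j * r j))" by (rule sum.swap)
    also have "\<dots> = (\<Sum>j<m. r j * (\<Sum>i<m. M j i * v i))" by (simp add: sum_distrib_left sym[of _ _] mult_ac)
    finally show ?thesis .
  qed
  have q_exp: "q (\<lambda>i. v i + t * r i) = q v + 2 * t * (\<Sum>i<m. r i * (\<Sum>j<m. M i j * v j)) + t\<^sup>2 * q r" for t
  proof -
    have "q (\<lambda>i. v i + t * r i) = (\<Sum>i<m. v i * (\<Sum>j<m. M i j * v j) + t * (v i * (\<Sum>j<m. M i j * r j))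
        + t * (r i * (\<Sum>j<m. M i j * v j)) + t\<^sup>2 * (r i * (\<Sum>j<m. M i j * r j)))"
      unfolding q_def
    proof (rule sum.cong[OF refl])
      fix i
      have "(\<Sum>j<m. M i j * (v j + t * r j)) = (\<Sum>j<m. M i j * v j) + t * (\<Sum>j<m. M i j * r j)"
        by (simp add: distrib_left sum.distrib sum_distrib_left mult.left_commute)
      then show "(v i + t * r i) * (\<Sum>j<m. M i j * (v j + t * r j)) = v i * (\<Sum>j<m. M i j * v j) + t * (v i * (\<Sum>j<m. M i j * r j))
        + t * (r i * (\<Sum>j<m. M i j * v j)) + t\<^sup>2 * (r i * (\<Sum>j<m. M i j * r j))"
        by (simp add: power2_eq_square algebra_simps)
    qed
    also have "\<dots> = q v + t * (\<Sum>i<m. v i * (\<Sum>j<m. M i j * r j)) + t * (\<Sum>i<m. r i * (\<Sum>j<m. M i j * v j)) + t\<^sup>2 * q r"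
      unfolding q_def by (simp only: sum.distrib sum_distrib_left[symmetric])
    finally show ?thesis unfolding cross by simp
  qed
  have n_exp: "n2 (\<lambda>i. v i + t * r i) = n2 v + 2 * t * (\<Sum>i<m. r i * v i) + t\<^sup>2 * n2 r" for t
    unfolding n2_def by (simp add: power2_sum power_mult_distrib sum.distrib sum_distrib_left mult_ac)
  have rr: "(\<Sum>i<m. r i * (\<Sum>j<m. M i j * v j)) - c * (\<Sum>i<m. r i * v i) = n2 r"
  proof -
    have "n2 r = (\<Sum>i<m. r i * (\<Sum>j<m. M i j * v j) - c * (r i * v i))" unfolding n2_def
      by (rule sum.cong[OF refl]) (simp add: power2_eq_square, simp add: r_def algebra_simps)
    then show ?thesis by (simp add: sum_subtractf sum_distrib_left)
  qed
  have ineq: "0 \<le> 2 * t * n2 r + t\<^sup>2 * (q r - c * n2 r)" for t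
  proof -
    have "c * n2 (\<lambda>i. v i + t * r i) \<le> q (\<lambda>i. v i + t * r i)" by (rule low)
    then show ?thesis unfolding q_exp n_exp n2v using rr c_def by (simp add: algebra_simps flip: rr)
  qed
  have "n2 r = 0"
  proof (rule ccontr)
    assume "n2 r \<noteq> 0"
    then have p: "n2 r > 0" unfolding n2_def using sum_nonneg[of "{..<m}" "\<lambda>i. (r i)\<^sup>2"] by (simp add: less_le)
    define d where "d = \<bar>q r - c * n2 r\<bar> + 1"
    have d: "d > 0" "q r - c * n2 r < d" by (auto simp: d_def)
    \<comment> \<open>The step t = - n2 r / d minimises the quadratic 2 t n2 r + t^2 d, where
      \<open>d\<close> is a positive bound for the second order coefficient.\<close>
    have "0 \<le> 2 * (- n2 r / d) * n2 r + (- n2 r / d)\<^sup>2 * (q r - c * n2 r)" by (rule ineq)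
    also have "\<dots> \<le> 2 * (- n2 r / d) * n2 r + (- n2 r / d)\<^sup>2 * d"
      using d by (intro add_left_mono mult_left_mono) auto
    also have "\<dots> = - ((n2 r)\<^sup>2 / d)" using d by (simp add: power2_eq_square field_simps)
    also have "\<dots> < 0" using p d by simp
    finally show False by simp
  qed
  then have "r i = 0" if "i < m" for i using that unfolding n2_def by (subst (asm) sum_nonneg_eq_0_iff) auto
  then have eig: "(\<Sum>j<m. M i j * v j) = c * v i" if "i < m" for i using that by (simp add: r_def)
  show ?thesis by (rule that[of c v]) (use low eig n2v in \<open>auto simp: q_def n2_def\<close>)
qed

text \<open>The minimum of the form of \<Lambda> plus its transpose is one of its eigenvalues, hence
  at least 1, and this form takes the value 2 w . (\<Lambda> w) at w.\<close>

lemma smallest_eigenvalue_form: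
  fixes \<Lambda> :: "real mat"
  assumes \<Lambda>: "\<Lambda> \<in> carrier_mat m m" and m: "m > 0" and sm: "smallest_eigenvalue (\<Lambda> + transpose_mat \<Lambda>) 1"
    and w: "w \<in> carrier_vec m"
  shows "(\<Sum>i<m. (vec_index w i)\<^sup>2) \<le> 2 * (\<Sum>i<m. vec_index w i * vec_index (\<Lambda> *\<^sub>v w) i)"
proof -
  define M where "M i j = \<Lambda> $$ (i, j) + \<Lambda> $$ (j, i)" for i j
  have dim: "dim_row \<Lambda> = m" "dim_col \<Lambda> = m" "dim_vec w = m" using \<Lambda> w by auto
  obtain c v where low: "\<And>w. (\<Sum>i<m. w i * (\<Sum>j<m. M i j * w j)) \<ge> c * (\<Sum>i<m. (w i)\<^sup>2)"
    and v1: "(\<Sum>i<m. (v i)\<^sup>2) = 1" and eig: "\<And>i. i < m \<Longrightarrow> (\<Sum>j<m. M i j * v j) = c * v i"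
    by (rule symmetric_form_min_eigenvalue[OF m, of M]) (auto simp: M_def)
  let ?v = "Matrix.vec m v"
  have "eigenvector (\<Lambda> + transpose_mat \<Lambda>) ?v c"
    unfolding eigenvector_def
  proof (intro conjI)
    show "?v \<in> carrier_vec (dim_row (\<Lambda> + transpose_mat \<Lambda>))" using dim by simp
    show "?v \<noteq> 0\<^sub>v (dim_row (\<Lambda> + transpose_mat \<Lambda>))"
    proof
      assume "?v = 0\<^sub>v (dim_row (\<Lambda> + transpose_mat \<Lambda>))"
      then have "vec_index ?v i = 0" if "i < m" for i using that dim by simp
      then have "v i = 0" if "i < m" for i using that by simp
      then show False using v1 by simp
    qed
    show "(\<Lambda> + transpose_mat \<Lambda>) *\<^sub>v ?v = c \<cdot>\<^sub>v ?v"
    proof (rule eq_vecI)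
      fix i assume "i < dim_vec (c \<cdot>\<^sub>v ?v)"
      then have i: "i < m" by simp
      then have "vec_index ((\<Lambda> + transpose_mat \<Lambda>) *\<^sub>v ?v) i = (\<Sum>j<m. M i j * v j)"
        using dim by (simp add: scalar_prod_def M_def lessThan_atLeast0)
      then show "vec_index ((\<Lambda> + transpose_mat \<Lambda>) *\<^sub>v ?v) i = vec_index (c \<cdot>\<^sub>v ?v) i" using eig i by simp
    qed (use dim in simp)
  qed
  then have "1 \<le> c" using sm by (auto simp: smallest_eigenvalue_def eigenvalue_def)
  then have "(\<Sum>i<m. (vec_index w i)\<^sup>2) \<le> c * (\<Sum>i<m. (vec_index w i)\<^sup>2)"
    using mult_right_mono[of 1 c "\<Sum>i<m. (vec_index w i)\<^sup>2"] by (simp add: sum_nonneg)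
  also have "\<dots> \<le> (\<Sum>i<m. vec_index w i * (\<Sum>j<m. M i j * vec_index w j))" by (rule low)
  also have "\<dots> = 2 * (\<Sum>i<m. vec_index w i * vec_index (\<Lambda> *\<^sub>v w) i)"
  proof -
    have L: "vec_index (\<Lambda> *\<^sub>v w) i = (\<Sum>j<m. \<Lambda> $$ (i, j) * vec_index w j)" if "i < m" for i
      using that dim by (simp add: scalar_prod_def lessThan_atLeast0)
    have "(\<Sum>i<m. vec_index w i * (\<Sum>j<m. M i j * vec_index w j))
        = (\<Sum>i<m. \<Sum>j<m. vec_index w i * (\<Lambda> $$ (i, j) * vec_index w j)) + (\<Sum>i<m. \<Sum>j<m. vec_index w i * (\<Lambda> $$ (j, i) * vec_index w j))"
      unfolding sum.distrib[symmetric] sum_distrib_left by (intro sum.cong refl) (simp add: M_def algebra_simps)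
    also have "(\<Sum>i<m. \<Sum>j<m. vec_index w i * (\<Lambda> $$ (j, i) * vec_index w j)) = (\<Sum>i<m. \<Sum>j<m. vec_index w i * (\<Lambda> $$ (i, j) * vec_index w j))"
      by (subst sum.swap) (intro sum.cong refl, simp add: mult_ac)
    also have "(\<Sum>i<m. \<Sum>j<m. vec_index w i * (\<Lambda> $$ (i, j) * vec_index w j)) = (\<Sum>i<m. vec_index w i * vec_index (\<Lambda> *\<^sub>v w) i)"
      by (intro sum.cong refl) (simp add: L sum_distrib_left)
    finally show ?thesis by simp
  qed
  finally show ?thesis .
qed

context torus3
begin

section \<open>Sensor grids and observability\<close>

definition grid :: "nat \<Rightarrow> (real^'n) set" where
  "grid S = (\<lambda>k. \<chi> i. L $ i * real (k i) / real S) ` (PiE UNIV (\<lambda>_. {..<S}))"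

text \<open>Some enumeration of the grid; the order of the sensors is immaterial, because the sum of
  squared measurements and the eigenvalue condition make no use of it.\<close>

definition gpt :: "nat \<Rightarrow> nat \<Rightarrow> real^'n" where
  "gpt S = (SOME h. bij_betw h {..<S ^ CARD('n)} (grid S))"

lemma gpt_bij: "S \<ge> 1 \<Longrightarrow> bij_betw (gpt S) {..<S ^ CARD('n)} (grid S)"
proof -
  assume S: "S \<ge> 1"
  have inj: "inj_on (\<lambda>k. \<chi> i. L $ i * real (k i) / real S) (PiE UNIV (\<lambda>_ :: 'n. {..<S}))"
  proof (rule inj_onI)
    fix k l :: "'n \<Rightarrow> nat" assume eq: "(\<chi> i. L $ i * real (k i) / real S) = (\<chi> i. L $ i * real (l i) / real S)"
    have "real (k i) = real (l i)" for i
    proof -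
      have "L $ i * real (k i) / real S = L $ i * real (l i) / real S"
        using arg_cong[OF eq, of "\<lambda>v. v $ i"] by (simp only: vec_lambda_beta)
      then show ?thesis using L_pos[of i] S by simp
    qed
    then show "k = l" by (intro ext) simp
  qed
  have fin: "finite (PiE UNIV (\<lambda>_ :: 'n. {..<S}))" by (rule finite_PiE) auto
  have "card (grid S) = S ^ CARD('n)"
    unfolding grid_def card_image[OF inj] by (simp add: card_PiE)
  moreover have "finite (grid S)" unfolding grid_def using fin by simp
  ultimately have "\<exists>h. bij_betw h {..<S ^ CARD('n)} (grid S)"
    using ex_bij_betw_nat_finite[of "grid S"] by (auto simp: lessThan_atLeast0)
  then show ?thesis unfolding gpt_def by (rule someI_ex)
qed

lemma grid_subset: "S \<ge> 1 \<Longrightarrow> grid S \<subseteq> T"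
proof
  assume S: "S \<ge> 1"
  fix x assume "x \<in> grid S"
  then obtain k where x: "x = (\<chi> i. L $ i * real (k i) / real S)" and k: "\<And>i. k i < S" by (auto simp: grid_def)
  have "0 \<le> x $ i \<and> x $ i < L $ i" for i
  proof -
    have "L $ i * real (k i) < L $ i * real S" using k[of i] L_pos[of i] by simp
    then show ?thesis using L_pos[of i] S by (simp add: x pos_divide_less_eq)
  qed
  then show "x \<in> T" by (simp add: Torus_def)
qed

definition diam :: real where "diam = (\<Sum>i\<in>UNIV. L $ i)"

text \<open>Rounding each coordinate down to the grid costs at most \<open>L $ i / S\<close>; the
  sum of the coordinate errors bounds the norm.\<close>

lemma grid_dense:
  assumes S: "S \<ge> 1" and x: "x \<in> T"
  obtains j where "j < S ^ CARD('n)" "norm (x - gpt S j) \<le> diam / real S"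
proof -
  define k where "k i = nat \<lfloor>x $ i * real S / L $ i\<rfloor>" for i
  have b: "real (k i) \<le> x $ i * real S / L $ i" "x $ i * real S / L $ i \<le> real (k i) + 1" "k i < S" for i
  proof -
    have n: "0 \<le> x $ i" "x $ i < L $ i" "L $ i > 0" using x L_pos by (auto simp: Torus_def)
    have n0: "0 \<le> x $ i * real S / L $ i" using n by simp
    have "x $ i * real S < L $ i * real S" using n S by simp
    then have n1: "x $ i * real S / L $ i < real S" using n by (simp add: pos_divide_less_eq mult.commute)
    have e: "real (k i) = of_int \<lfloor>x $ i * real S / L $ i\<rfloor>" using n0 unfolding k_def by simp
    show "real (k i) \<le> x $ i * real S / L $ i" "x $ i * real S / L $ i \<le> real (k i) + 1" unfolding e by linarith+
    then show "k i < S" using n1 by linarith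
  qed
  define y where "y = (\<chi> i. L $ i * real (k i) / real S)"
  have "y \<in> grid S" unfolding grid_def y_def using b(3) by auto
  then have "y \<in> gpt S ` {..<S ^ CARD('n)}" using gpt_bij[OF S] by (simp add: bij_betw_def)
  then obtain j where j: "j < S ^ CARD('n)" "gpt S j = y" by auto
  have "norm (x - y) \<le> (\<Sum>i\<in>UNIV. \<bar>(x - y) $ i\<bar>)" by (rule norm_le_l1_cart)
  also have "\<dots> \<le> (\<Sum>i\<in>UNIV. L $ i / real S)"
  proof (rule sum_mono)
    fix i
    have Li: "L $ i > 0" and Sp: "real S > 0" using L_pos S by auto
    have "x $ i = (x $ i * real S / L $ i) * (L $ i / real S)" using Li Sp by simp
    moreover have "real (k i) * (L $ i / real S) \<le> (x $ i * real S / L $ i) * (L $ i / real S)"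
      "(x $ i * real S / L $ i) * (L $ i / real S) \<le> (real (k i) + 1) * (L $ i / real S)"
      using b[of i] Li Sp by (intro mult_right_mono; simp)+
    ultimately have "real (k i) * (L $ i / real S) \<le> x $ i" "x $ i \<le> (real (k i) + 1) * (L $ i / real S)" by simp_all
    then show "\<bar>(x - y) $ i\<bar> \<le> L $ i / real S" by (simp add: y_def algebra_simps abs_le_iff add_divide_distrib)
  qed
  also have "\<dots> = diam / real S" by (simp add: diam_def sum_divide_distrib)
  finally show ?thesis using that[OF j(1)] j(2) by simp
qed

text \<open>The D(A) norm without its factor nu2, read off the coefficients; compare
  \<open>DA_norm_eq\<close>.\<close>

definition an :: "(int^'n \<Rightarrow> real) \<Rightarrow> real" where "an c = nrm CM (\<lambda>k. (lam k)\<^sup>2 * c k)"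

lemma an_nonneg [simp]: "an c \<ge> 0" by (simp add: an_def)

text \<open>The frequency norm is enlarged to lam, so that the Lipschitz constant of a series is a
  sum of lam * |c|, which \<open>H2_abs_summable\<close> controls by the D(A) norm.\<close>

lemma bas_Lipschitz: "\<bar>bas k x - bas k y\<bar> \<le> (2 / sqrt vol) * lam k * norm (x - y)"
proof -
  have trig: "\<bar>cos a - cos b\<bar> \<le> \<bar>a - b\<bar>" "\<bar>sin a - sin b\<bar> \<le> \<bar>a - b\<bar>" for a b :: real
  proof -
    have "\<bar>sin ((b - a) / 2)\<bar> \<le> \<bar>(b - a) / 2\<bar>" "\<bar>sin ((a - b) / 2)\<bar> \<le> \<bar>(a - b) / 2\<bar>" by (rule abs_sin_x_le_abs_x)+
    moreover have "\<bar>sin ((a + b) / 2)\<bar> * \<bar>sin ((b - a) / 2)\<bar> \<le> 1 * \<bar>sin ((b - a) / 2)\<bar>"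
      "\<bar>sin ((a - b) / 2)\<bar> * \<bar>cos ((a + b) / 2)\<bar> \<le> \<bar>sin ((a - b) / 2)\<bar> * 1"
      by (intro mult_right_mono mult_left_mono abs_sin_le_one abs_cos_le_one abs_ge_zero)+
    moreover have "\<bar>b - a\<bar> = \<bar>a - b\<bar>" by (rule abs_minus_commute)
    ultimately show "\<bar>cos a - cos b\<bar> \<le> \<bar>a - b\<bar>" "\<bar>sin a - sin b\<bar> \<le> \<bar>a - b\<bar>"
      unfolding cos_diff_cos sin_diff_sin abs_mult mult.assoc abs_divide by simp_all
  qed
  have "\<bar>kap k \<bullet> x - kap k \<bullet> y\<bar> \<le> norm (kap k) * norm (x - y)"
    using Cauchy_Schwarz_ineq2[of "kap k" "x - y"] by (simp add: inner_diff_right)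
  also have "\<dots> \<le> lam k * norm (x - y)"
  proof (rule mult_right_mono)
    have "2 * norm (kap k) \<le> 1 + (norm (kap k))\<^sup>2" using sum_squares_bound[of 1 "norm (kap k)"] by simp
    then show "norm (kap k) \<le> lam k" using norm_ge_zero[of "kap k"] unfolding lam_def by linarith
  qed simp
  finally have K: "\<bar>kap k \<bullet> x - kap k \<bullet> y\<bar> \<le> lam k * norm (x - y)" .
  have "\<bar>ebas k x - ebas k y\<bar> \<le> \<bar>cos (kap k \<bullet> x) - cos (kap k \<bullet> y)\<bar> + \<bar>sin (kap k \<bullet> x) - sin (kap k \<bullet> y)\<bar>"
    unfolding ebas_def by linarith
  also have "\<dots> \<le> 2 * (lam k * norm (x - y))"
    using trig[of "kap k \<bullet> x" "kap k \<bullet> y"] K by linarith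
  finally have "\<bar>ebas k x - ebas k y\<bar> / sqrt vol \<le> 2 * (lam k * norm (x - y)) / sqrt vol"
    using vol_pos by (intro divide_right_mono) auto
  moreover have "\<bar>bas k x - bas k y\<bar> = \<bar>ebas k x - ebas k y\<bar> / sqrt vol"
    using vol_pos by (simp add: bas_def diff_divide_distrib[symmetric])
  ultimately show ?thesis by (simp add: mult_ac)
qed

lemma H4_lam: "c \<in> H4 \<Longrightarrow> (\<lambda>k. lam k * c k) \<in> H2" "vn (\<lambda>k. lam k * c k) = an c"
  by (simp_all add: H4_def H2_def vn_def an_def power2_eq_square mult.assoc)

lemma crep_Lipschitz:
  assumes c: "c \<in> H4"
  shows "\<bar>crep c x - crep c y\<bar> \<le> (2 / sqrt vol) * S0 * an c * norm (x - y)"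
proof -
  have ci: "integrable CM c" by (rule H2_abs_summable(1)[OF H4_subset_H2[OF c]])
  note li = H2_abs_summable[OF H4_lam(1)[OF c]]
  have i: "integrable CM (\<lambda>k. c k * (bas k x - bas k y))"
    using crep_integrable[OF ci, of x] crep_integrable[OF ci, of y] by (simp add: right_diff_distrib)
  have "crep c x - crep c y = (\<integral>k. c k * (bas k x - bas k y) \<partial>CM)"
    unfolding crep_def using crep_integrable[OF ci, of x] crep_integrable[OF ci, of y] by (simp add: right_diff_distrib)
  also have "\<bar>\<dots>\<bar> \<le> (\<integral>k. \<bar>c k * (bas k x - bas k y)\<bar> \<partial>CM)" by (rule integral_abs_bound)
  also have "\<dots> \<le> (\<integral>k. ((2 / sqrt vol) * norm (x - y)) * \<bar>lam k * c k\<bar> \<partial>CM)"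
  proof (rule integral_mono)
    fix k
    have "\<bar>c k\<bar> * \<bar>bas k x - bas k y\<bar> \<le> \<bar>c k\<bar> * ((2 / sqrt vol) * lam k * norm (x - y))"
      by (rule mult_left_mono[OF bas_Lipschitz]) simp
    then show "\<bar>c k * (bas k x - bas k y)\<bar> \<le> ((2 / sqrt vol) * norm (x - y)) * \<bar>lam k * c k\<bar>"
      using lam_gt0[of k] by (simp add: abs_mult mult_ac)
  qed (use i li(1) in auto)
  also have "\<dots> = ((2 / sqrt vol) * norm (x - y)) * (\<integral>k. \<bar>lam k * c k\<bar> \<partial>CM)" by simp
  also have "\<dots> \<le> ((2 / sqrt vol) * norm (x - y)) * (S0 * an c)"
    using li(2) vol_pos unfolding H4_lam(2) by (intro mult_left_mono) auto
  finally show ?thesis by (simp add: mult_ac)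
qed

text \<open>Every point is within the mesh size of a sensor, so the value there is a measurement up
  to the Lipschitz constant times the mesh size. This pointwise bound is squared and integrated over
  T.\<close>

lemma sensor_L2_bound:
  assumes S: "S \<ge> 1" and c: "c \<in> H4"
  shows "nrm CM c \<le> sqrt vol * (sqrt (\<Sum>j<S ^ CARD('n). (crep c (gpt S j))\<^sup>2) + (2 / sqrt vol) * S0 * an c * (diam / real S))"
proof -
  have ci: "integrable CM c" by (rule H2_abs_summable(1)[OF H4_subset_H2[OF c]])
  let ?Z = "sqrt (\<Sum>j<S ^ CARD('n). (crep c (gpt S j))\<^sup>2)" and ?K = "(2 / sqrt vol) * S0 * an c"
  let ?B = "?Z + ?K * (diam / real S)"
  have K: "?K \<ge> 0" using vol_pos by simp
  have pt: "\<bar>crep c x\<bar> \<le> ?B" if x: "x \<in> T" for x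
  proof -
    obtain j where j: "j < S ^ CARD('n)" "norm (x - gpt S j) \<le> diam / real S" by (rule grid_dense[OF S x])
    have "(crep c (gpt S j))\<^sup>2 \<le> (\<Sum>j<S ^ CARD('n). (crep c (gpt S j))\<^sup>2)"
      using j(1) by (intro member_le_sum) auto
    then have "\<bar>crep c (gpt S j)\<bar> \<le> ?Z" by (rule real_le_rsqrt[of "\<bar>_\<bar>", simplified])
    moreover have "\<bar>crep c x - crep c (gpt S j)\<bar> \<le> ?K * (diam / real S)"
      by (rule order_trans[OF crep_Lipschitz[OF c] mult_left_mono[OF j(2) K]])
    ultimately show ?thesis by linarith
  qed
  obtain x0 where "x0 \<in> T" using box_subset_Torus L_pos interval_ne_empty_cart(2)[of 0 L] by auto
  then have B: "?B \<ge> 0" using pt[of x0] by linarith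
  have "(nrm TM (crep c))\<^sup>2 = (\<integral>x. (crep c x)\<^sup>2 \<partial>TM)" by (rule nrm_sq)
  also have "\<dots> \<le> (\<integral>x. ?B\<^sup>2 \<partial>TM)"
  proof (rule integral_mono)
    show "(crep c x)\<^sup>2 \<le> ?B\<^sup>2" if "x \<in> space TM" for x
      using pt[of x] that B by (intro abs_le_square_iff[THEN iffD1]) auto
  qed (use sq_int_integrable[OF crep_sq_int[OF ci]] in auto)
  also have "\<dots> = vol * ?B\<^sup>2" using integral_one by simp
  also have "\<dots> = (sqrt vol * ?B)\<^sup>2" using vol_pos by (simp add: power_mult_distrib)
  finally have "nrm TM (crep c) \<le> sqrt vol * ?B" by (rule power2_le_imp_le) (use B vol_pos in auto)
  then show ?thesis using Parseval_nrm[OF crep_sq_int[OF ci]] by (simp add: fc_crep[OF ci])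
qed

lemma vn_interpolation:
  assumes c: "c \<in> H4" shows "(vn c)\<^sup>2 \<le> nrm CM c * an c"
proof -
  have s: "(\<lambda>k. (lam k)\<^sup>2 * c k) \<in> sq_int CM" using c by (simp add: H4_def)
  have "(vn c)\<^sup>2 = (\<integral>k. c k * ((lam k)\<^sup>2 * c k) \<partial>CM)"
    unfolding vn_def nrm_sq by (rule Bochner_Integration.integral_cong) (auto simp: power2_eq_square mult_ac)
  also have "\<dots> \<le> nrm CM c * an c"
    using Cauchy_Schwarz_integral[OF H2_l2[OF H4_subset_H2[OF c]] s] by (simp add: an_def abs_le_iff)
  finally show ?thesis .
qed

text \<open>Interpolate the V norm between H and D(A), insert \<open>sensor_L2_bound\<close>, and
  make the grid so fine that the D(A) part costs only half of the square of \<open>an\<close>.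
  Young's inequality spends the other half on the measurements and produces the constant M^2 vol /
  2.\<close>

theorem observability:
  assumes M: "M > 0"
  obtains S where "S \<ge> 1" "\<And>c. c \<in> H4 \<Longrightarrow>
    M * (vn c)\<^sup>2 \<le> (an c)\<^sup>2 + (M\<^sup>2 * vol / 2) * (\<Sum>j<S ^ CARD('n). (crep c (gpt S j))\<^sup>2)"
proof -
  have dm: "diam > 0" unfolding diam_def using L_pos by (intro sum_pos) auto
  \<comment> \<open>This threshold makes 2 * S0 * diam / S at most 1/(2 M), so that after
    multiplication by M the factor 1/2 remains.\<close>
  obtain n :: nat where n: "real n > 4 * M * S0 * diam" using reals_Archimedean2 by blast
  define S where "S = Suc n"
  have S: "S \<ge> 1" and Sr: "real S > 4 * M * S0 * diam" using n by (auto simp: S_def)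
  have "M * (vn c)\<^sup>2 \<le> (an c)\<^sup>2 + (M\<^sup>2 * vol / 2) * (\<Sum>j<S ^ CARD('n). (crep c (gpt S j))\<^sup>2)" if c: "c \<in> H4" for c
  proof -
    let ?Q = "\<Sum>j<S ^ CARD('n). (crep c (gpt S j))\<^sup>2"
    have Q: "?Q \<ge> 0" by (rule sum_nonneg) simp
    have small: "2 * S0 * (diam / real S) \<le> 1 / (2 * M)"
      using Sr M S by (simp add: field_simps)
    have "nrm CM c \<le> sqrt vol * sqrt ?Q + 2 * S0 * (diam / real S) * an c"
      using sensor_L2_bound[OF S c] vol_pos by (simp add: distrib_left mult_ac)
    also have "\<dots> \<le> sqrt vol * sqrt ?Q + 1 / (2 * M) * an c"
      using small by (intro add_left_mono mult_right_mono) auto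
    finally have "nrm CM c * an c \<le> (sqrt vol * sqrt ?Q + 1 / (2 * M) * an c) * an c"
      by (intro mult_right_mono) auto
    with vn_interpolation[OF c] have "(vn c)\<^sup>2 \<le> (sqrt vol * sqrt ?Q + 1 / (2 * M) * an c) * an c" by linarith
    then have "M * (vn c)\<^sup>2 \<le> M * ((sqrt vol * sqrt ?Q + 1 / (2 * M) * an c) * an c)"
      using M by (intro mult_left_mono) auto
    also have "\<dots> = (M * (sqrt vol * sqrt ?Q)) * an c + (an c)\<^sup>2 / 2"
      using M by (simp add: field_simps power2_eq_square)
    also have "\<dots> \<le> ((M * (sqrt vol * sqrt ?Q))\<^sup>2 + (an c)\<^sup>2) / 2 + (an c)\<^sup>2 / 2"
      using sum_squares_bound[of "M * (sqrt vol * sqrt ?Q)" "an c"] by simp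
    also have "\<dots> = (an c)\<^sup>2 + (M\<^sup>2 * vol / 2) * ?Q"
      using vol_pos Q by (simp add: power_mult_distrib field_simps)
    finally show ?thesis .
  qed
  with S show ?thesis by (rule that)
qed

end

section \<open>Lebesgue measurability up to null sets\<close>

lemma borel_measurable_completion_AE:
  fixes f g :: "'a \<Rightarrow> real"
  assumes g: "g \<in> borel_measurable (completion M)" and ae: "AE x in M. f x = g x"
  shows "f \<in> borel_measurable (completion M)"
  unfolding borel_measurable_iff_greater
proof
  fix a
  have 1: "{x \<in> space (completion M). a < g x} \<in> sets (completion M)"
    using g unfolding borel_measurable_iff_greater by blast
  have "AE x in M. \<not> (f x \<noteq> g x)" "AE x in M. \<not> (f x \<noteq> g x \<and> a < f x)"
    using ae by (auto elim!: eventually_mono)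
  from this[THEN sets_completion_AE]
  have 2: "{x \<in> space (completion M). f x \<noteq> g x} \<in> sets (completion M)"
    "{x \<in> space (completion M). f x \<noteq> g x \<and> a < f x} \<in> sets (completion M)"
    by (simp_all add: pred_def)
  have "{x \<in> space (completion M). a < f x} = ({x \<in> space (completion M). a < g x} - {x \<in> space (completion M). f x \<noteq> g x})
     \<union> {x \<in> space (completion M). f x \<noteq> g x \<and> a < f x}" by auto
  then show "{x \<in> space (completion M). a < f x} \<in> sets (completion M)"
    using 1 2 by (simp only: sets.Un sets.Diff)
qed

lemma borel_measurable_lebesgue_on_AE:
  fixes f g :: "'a::euclidean_space \<Rightarrow> real"
  assumes A: "A \<in> sets lebesgue" and g: "g \<in> borel_measurable (lebesgue_on A)"
    and ae: "AE x in lebesgue_on A. f x = g x"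
  shows "f \<in> borel_measurable (lebesgue_on A)"
proof -
  have A': "A \<inter> space lebesgue \<in> sets lebesgue" using A by simp
  have "(\<lambda>x. g x * indicator A x) \<in> borel_measurable lebesgue"
    using g by (subst (asm) borel_measurable_restrict_space_iff[OF A']) (simp add: mult.commute)
  moreover have "AE x in lebesgue. x \<in> A \<longrightarrow> f x = g x" using ae by (simp add: AE_restrict_space_iff[OF A'])
  then have "AE x in lborel. f x * indicator A x = g x * indicator A x"
    unfolding AE_completion_iff by (auto elim!: eventually_mono simp: indicator_def)
  ultimately have "(\<lambda>x. f x * indicator A x) \<in> borel_measurable lebesgue" by (rule borel_measurable_completion_AE)
  then show ?thesis by (subst borel_measurable_restrict_space_iff[OF A']) (simp add: mult.commute)
qed

context torus
begin

section \<open>Functions of time and space\<close>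

lemma id_measurable_TM: "(\<lambda>x. x) \<in> measurable TM borel"
  by (intro measurable_restrict_space1 measurable_completion) simp

lemma measurable_lborel_TM:
  fixes W :: "real \<times> (real^'n) \<Rightarrow> real"
  assumes "W \<in> borel_measurable (borel \<Otimes>\<^sub>M borel)" shows "W \<in> borel_measurable (lborel \<Otimes>\<^sub>M TM)"
proof -
  have "snd \<in> measurable (lborel \<Otimes>\<^sub>M TM) borel"
    by (rule measurable_compose[OF measurable_snd id_measurable_TM])
  then have "(\<lambda>z. (fst z, snd z)) \<in> measurable (lborel \<Otimes>\<^sub>M TM) (borel \<Otimes>\<^sub>M borel)"
    by (intro measurable_Pair) auto
  from measurable_compose[OF this assms] show ?thesis by simp
qed

text \<open>A curve that is square integrable in time and space has a time integral in H, by
  Cauchy-Schwarz in time, and its Fourier coefficients are the time integrals of the coefficients,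
  by Fubini. This connects the pointwise formulation of \<open>time_deriv\<close> with the scalar
  equations.\<close>

lemma time_integral_fc:
  fixes W :: "real \<Rightarrow> real^'n \<Rightarrow> real"
  assumes W: "(\<lambda>(\<tau>, x). W \<tau> x) \<in> borel_measurable (borel \<Otimes>\<^sub>M borel)" and t: "t \<ge> 0"
    and fin: "(\<integral>\<^sup>+\<tau>. indicator {0..t} \<tau> * (\<integral>\<^sup>+x. ennreal ((W \<tau> x)\<^sup>2) \<partial>TM) \<partial>lborel) < \<infinity>"
  shows "(\<lambda>x. \<integral>\<tau>. indicator {0..t} \<tau> * W \<tau> x \<partial>lborel) \<in> sq_int TM"
    and "fc (\<lambda>x. \<integral>\<tau>. indicator {0..t} \<tau> * W \<tau> x \<partial>lborel) k = (LINT \<tau>:{0..t}|lborel. fc (W \<tau>) k)"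
    and "set_integrable lborel {0..t} (\<lambda>\<tau>. fc (W \<tau>) k)"
    and "AE x in TM. integrable lborel (\<lambda>\<tau>. indicator {0..t} \<tau> * W \<tau> x)"
proof -
  interpret P: pair_sigma_finite lborel TM
    by (intro pair_sigma_finite.intro lborel.sigma_finite_measure_axioms TM.sigma_finite_measure_axioms)
  interpret Q: pair_sigma_finite TM lborel
    by (intro pair_sigma_finite.intro lborel.sigma_finite_measure_axioms TM.sigma_finite_measure_axioms)
  define F where "F \<tau> x = indicator {0..t} \<tau> * W \<tau> x" for \<tau> x
  define I where "I x = (\<integral>\<tau>. F \<tau> x \<partial>lborel)" for x
  have [measurable]: "(\<lambda>(\<tau>, x). W \<tau> x) \<in> borel_measurable (lborel \<Otimes>\<^sub>M TM)" by (rule measurable_lborel_TM[OF W])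
  have bm [measurable]: "bas k \<in> borel_measurable TM" by (rule borel_measurable_TM) simp
  have Fm [measurable]: "(\<lambda>(\<tau>, x). F \<tau> x) \<in> borel_measurable (lborel \<Otimes>\<^sub>M TM)" unfolding F_def by measurable
  have Fm' [measurable]: "(\<lambda>(x, \<tau>). F \<tau> x) \<in> borel_measurable (TM \<Otimes>\<^sub>M lborel)"
    using measurable_compose[OF measurable_pair_swap' Fm] by (simp add: split_def)
  have Fs: "(\<lambda>(\<tau>, x). F \<tau> x) \<in> sq_int (lborel \<Otimes>\<^sub>M TM)"
    unfolding sq_int_iff_nn_integral
  proof
    have "(\<integral>\<^sup>+z. ennreal ((case z of (\<tau>, x) \<Rightarrow> F \<tau> x)\<^sup>2) \<partial>(lborel \<Otimes>\<^sub>M TM)) = (\<integral>\<^sup>+\<tau>. \<integral>\<^sup>+x. ennreal ((F \<tau> x)\<^sup>2) \<partial>TM \<partial>lborel)"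
      by (subst TM.nn_integral_fst[symmetric]) auto
    also have "\<dots> = (\<integral>\<^sup>+\<tau>. indicator {0..t} \<tau> * (\<integral>\<^sup>+x. ennreal ((W \<tau> x)\<^sup>2) \<partial>TM) \<partial>lborel)"
      by (rule nn_integral_cong) (auto simp: F_def indicator_def)
    finally show "(\<integral>\<^sup>+z. ennreal ((case z of (\<tau>, x) \<Rightarrow> F \<tau> x)\<^sup>2) \<partial>(lborel \<Otimes>\<^sub>M TM)) < \<infinity>" using fin by simp
  qed (rule Fm)
  have finx: "(\<integral>\<^sup>+x. \<integral>\<^sup>+\<tau>. ennreal ((F \<tau> x)\<^sup>2) \<partial>lborel \<partial>TM) < \<infinity>"
  proof -
    have "(\<integral>\<^sup>+x. \<integral>\<^sup>+\<tau>. ennreal ((F \<tau> x)\<^sup>2) \<partial>lborel \<partial>TM) = (\<integral>\<^sup>+z. ennreal ((case z of (\<tau>, x) \<Rightarrow> F \<tau> x)\<^sup>2) \<partial>(lborel \<Otimes>\<^sub>M TM))"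
      using P.nn_integral_snd[of "\<lambda>z. ennreal ((case z of (\<tau>, x) \<Rightarrow> F \<tau> x)\<^sup>2)"] by simp
    then show ?thesis using Fs by (simp add: sq_int_iff_nn_integral)
  qed
  have tm [measurable]: "F \<tau> \<in> borel_measurable TM" "(\<lambda>\<tau>. F \<tau> x) \<in> borel_measurable lborel" if "x \<in> T" for \<tau> x
    using measurable_Pair2[OF Fm, of \<tau>] measurable_Pair1[OF Fm, of x] that by auto
  have ind: "(\<lambda>\<tau>. indicator {0..t} \<tau>) \<in> sq_int (lborel :: real measure)"
    by (auto simp: sq_int_def power2_eq_square indicator_inter_arith[symmetric] emeasure_lborel_Icc_eq)
  have indn: "(nrm lborel (\<lambda>\<tau>::real. indicator {0..t} \<tau>))\<^sup>2 = t"
  proof -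
    have "(indicator {0..t} \<tau>)\<^sup>2 = (indicator {0..t} \<tau> :: real)" for \<tau> by (simp add: indicator_def)
    then show ?thesis using t by (simp add: nrm_sq)
  qed
  have sec: "(AE x in TM. (\<lambda>\<tau>. F \<tau> x) \<in> sq_int lborel)"
  proof -
    have "AE x in TM. (\<integral>\<^sup>+\<tau>. ennreal ((F \<tau> x)\<^sup>2) \<partial>lborel) \<noteq> \<infinity>"
      by (rule nn_integral_noteq_infinite) (use finx in \<open>auto intro!: lborel.borel_measurable_nn_integral\<close>)
    moreover have "AE x in TM. x \<in> T" using AE_space[of TM] by simp
    ultimately show ?thesis by eventually_elim (auto simp: sq_int_iff_nn_integral less_top dest: tm(2))
  qed
  \<comment> \<open>Writing the integrand as indicator times itself lets Cauchy-Schwarz in time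
    bound the square of its integral by t times the integral of its square.\<close>
  have FI: "F \<tau> x = indicator {0..t} \<tau> * F \<tau> x" for \<tau> x by (simp add: F_def indicator_def)
  show ae: "AE x in TM. integrable lborel (\<lambda>\<tau>. indicator {0..t} \<tau> * W \<tau> x)"
    using sec
  proof eventually_elim
    case (elim x)
    show ?case using sq_int_mult_integrable[OF ind elim] unfolding FI[symmetric] by (simp add: F_def)
  qed
  have Im: "I \<in> borel_measurable TM"
    unfolding I_def by (rule lborel.borel_measurable_lebesgue_integral) (rule Fm')
  have Is: "I \<in> sq_int TM"
    unfolding sq_int_iff_nn_integral
  proof
    have "(\<integral>\<^sup>+x. ennreal ((I x)\<^sup>2) \<partial>TM) \<le> (\<integral>\<^sup>+x. ennreal t * (\<integral>\<^sup>+\<tau>. ennreal ((F \<tau> x)\<^sup>2) \<partial>lborel) \<partial>TM)"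
    proof (rule nn_integral_mono_AE, use sec in eventually_elim)
      fix x assume x: "(\<lambda>\<tau>. F \<tau> x) \<in> sq_int lborel"
      have "\<bar>I x\<bar> \<le> nrm lborel (\<lambda>\<tau>. indicator {0..t} \<tau>) * nrm lborel (\<lambda>\<tau>. F \<tau> x)"
        using Cauchy_Schwarz_integral[OF ind x] unfolding FI[symmetric] by (simp add: I_def)
      then have "\<bar>I x\<bar> \<le> \<bar>nrm lborel (\<lambda>\<tau>. indicator {0..t} \<tau>) * nrm lborel (\<lambda>\<tau>. F \<tau> x)\<bar>" by simp
      then have "(I x)\<^sup>2 \<le> (nrm lborel (\<lambda>\<tau>. indicator {0..t} \<tau>) * nrm lborel (\<lambda>\<tau>. F \<tau> x))\<^sup>2"
        by (rule abs_le_square_iff[THEN iffD1])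
      also have "\<dots> = t * (nrm lborel (\<lambda>\<tau>. F \<tau> x))\<^sup>2" by (simp only: power_mult_distrib indn)
      finally show "ennreal ((I x)\<^sup>2) \<le> ennreal t * (\<integral>\<^sup>+\<tau>. ennreal ((F \<tau> x)\<^sup>2) \<partial>lborel)"
        unfolding nn_integral_sq[OF x] using t by (simp add: ennreal_mult[symmetric] ennreal_leI)
    qed
    also have "\<dots> = ennreal t * (\<integral>\<^sup>+x. \<integral>\<^sup>+\<tau>. ennreal ((F \<tau> x)\<^sup>2) \<partial>lborel \<partial>TM)"
      by (rule nn_integral_cmult) (auto intro!: lborel.borel_measurable_nn_integral)
    also have "\<dots> < \<infinity>" using finx by (simp add: ennreal_mult_less_top)
    finally show "(\<integral>\<^sup>+x. ennreal ((I x)\<^sup>2) \<partial>TM) < \<infinity>" .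
  qed (rule Im)
  then show "(\<lambda>x. \<integral>\<tau>. indicator {0..t} \<tau> * W \<tau> x \<partial>lborel) \<in> sq_int TM"
    unfolding I_def[abs_def] F_def .
  have b2: "(\<lambda>(\<tau>, x). indicator {0..t} \<tau> * bas k x) \<in> sq_int (lborel \<Otimes>\<^sub>M TM)"
    unfolding sq_int_iff_nn_integral
  proof
    have "(\<integral>\<^sup>+z. ennreal ((case z of (\<tau>, x) \<Rightarrow> indicator {0..t} \<tau> * bas k x)\<^sup>2) \<partial>(lborel \<Otimes>\<^sub>M TM))
       = (\<integral>\<^sup>+\<tau>. \<integral>\<^sup>+x. ennreal ((indicator {0..t} \<tau> * bas k x)\<^sup>2) \<partial>TM \<partial>lborel)"
      by (subst TM.nn_integral_fst[symmetric]) auto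
    also have "\<dots> = (\<integral>\<^sup>+\<tau>. indicator {0..t} \<tau> * (\<integral>\<^sup>+x. ennreal ((bas k x)\<^sup>2) \<partial>TM) \<partial>lborel)"
      by (rule nn_integral_cong) (auto simp: indicator_def)
    also have "\<dots> = (\<integral>\<^sup>+\<tau>. indicator {0..t} \<tau> \<partial>lborel)" unfolding nn_integral_sq[OF bas_sq_int] nrm_bas by simp
    also have "\<dots> < \<infinity>" using t by simp
    finally show "(\<integral>\<^sup>+z. ennreal ((case z of (\<tau>, x) \<Rightarrow> indicator {0..t} \<tau> * bas k x)\<^sup>2) \<partial>(lborel \<Otimes>\<^sub>M TM)) < \<infinity>" .
  qed measurable
  have Fb: "integrable (lborel \<Otimes>\<^sub>M TM) (\<lambda>(\<tau>, x). F \<tau> x * bas k x)"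
  proof -
    have "(\<lambda>z. (case z of (\<tau>, x) \<Rightarrow> F \<tau> x) * (case z of (\<tau>, x) \<Rightarrow> indicator {0..t} \<tau> * bas k x)) = (\<lambda>(\<tau>, x). F \<tau> x * bas k x)"
      by (auto simp: F_def indicator_def fun_eq_iff)
    then show ?thesis using sq_int_mult_integrable[OF Fs b2] by simp
  qed
  have fcF: "(\<integral>x. F \<tau> x * bas k x \<partial>TM) = indicator {0..t} \<tau> * fc (W \<tau>) k" for \<tau>
    by (simp add: F_def fc_def mult.assoc)
  have "fc I k = (\<integral>x. (\<integral>\<tau>. F \<tau> x * bas k x \<partial>lborel) \<partial>TM)"
    unfolding fc_def I_def by simp
  also have "\<dots> = (\<integral>z. (\<lambda>(\<tau>, x). F \<tau> x * bas k x) z \<partial>(lborel \<Otimes>\<^sub>M TM))"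
    by (rule P.integral_snd[OF Fb])
  also have "\<dots> = (\<integral>\<tau>. (\<integral>x. F \<tau> x * bas k x \<partial>TM) \<partial>lborel)"
    using P.integral_fst'[OF Fb] by simp
  also have "\<dots> = (LINT \<tau>:{0..t}|lborel. fc (W \<tau>) k)" unfolding fcF set_lebesgue_integral_real ..
  finally show "fc (\<lambda>x. \<integral>\<tau>. indicator {0..t} \<tau> * W \<tau> x \<partial>lborel) k = (LINT \<tau>:{0..t}|lborel. fc (W \<tau>) k)"
    by (simp add: I_def[abs_def] F_def)
  show "set_integrable lborel {0..t} (\<lambda>\<tau>. fc (W \<tau>) k)"
    using P.integrable_fst'[OF Fb] unfolding set_integrable_real by (simp add: fcF)
qed

lemma fc_param_measurable:
  fixes W :: "real \<Rightarrow> real^'n \<Rightarrow> real"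
  assumes [measurable]: "(\<lambda>(\<tau>, x). W \<tau> x) \<in> borel_measurable (borel \<Otimes>\<^sub>M borel)"
  shows "(\<lambda>\<tau>. fc (W \<tau>) k) \<in> borel_measurable borel"
proof -
  have bm [measurable]: "bas k \<in> borel_measurable TM" by (rule borel_measurable_TM) simp
  have [measurable]: "(\<lambda>(\<tau>, x). W \<tau> x) \<in> borel_measurable (lborel \<Otimes>\<^sub>M TM)" by (rule measurable_lborel_TM[OF assms])
  have "(\<lambda>\<tau>. \<integral>x. W \<tau> x * bas k x \<partial>TM) \<in> borel_measurable lborel"
    by (rule TM.borel_measurable_lebesgue_integral) measurable
  then show ?thesis by (simp add: fc_def)
qed

text \<open>\<open>time_deriv\<close> integrates a Lebesgue measurable function over an open
  interval, while the scalar equations use Borel functions and closed intervals; the end points are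
  a null set.\<close>

lemma lebesgue_on_interval_integral:
  fixes f g :: "real \<Rightarrow> real"
  assumes [measurable]: "g \<in> borel_measurable borel" and ae: "AE \<tau> in lborel. \<tau> \<in> {0<..<t} \<longrightarrow> f \<tau> = g \<tau>"
  shows "(\<integral>\<tau>. f \<tau> \<partial>lebesgue_on {0<..<t}) = (\<integral>\<tau>. indicator {0..t} \<tau> * g \<tau> \<partial>lborel)"
proof -
  have A: "{0<..<t} \<inter> space lebesgue \<in> sets (lebesgue :: real measure)" by simp
  have gm: "g \<in> borel_measurable (lebesgue_on {0<..<t})"
    by (intro measurable_restrict_space1 measurable_completion) simp
  have ae': "AE \<tau> in lebesgue_on {0<..<t}. f \<tau> = g \<tau>"
    using ae by (simp add: AE_restrict_space_iff[OF A] AE_completion_iff)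
  have fm: "f \<in> borel_measurable (lebesgue_on {0<..<t})"
    by (rule borel_measurable_lebesgue_on_AE[OF _ gm ae']) simp
  have "(\<integral>\<tau>. f \<tau> \<partial>lebesgue_on {0<..<t}) = (\<integral>\<tau>. g \<tau> \<partial>lebesgue_on {0<..<t})"
    by (rule integral_cong_AE[OF fm gm ae'])
  also have "\<dots> = (\<integral>\<tau>. indicator {0<..<t} \<tau> *\<^sub>R g \<tau> \<partial>lebesgue)" by (rule integral_restrict_space[OF A])
  also have "\<dots> = (\<integral>\<tau>. indicator {0<..<t} \<tau> *\<^sub>R g \<tau> \<partial>lborel)" by (rule integral_completion) measurable
  also have "\<dots> = (\<integral>\<tau>. indicator {0..t} \<tau> * g \<tau> \<partial>lborel)"
  proof (rule integral_cong_AE)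
    show "AE \<tau> in lborel. indicator {0<..<t} \<tau> *\<^sub>R g \<tau> = indicator {0..t} \<tau> * g \<tau>"
      using AE_lborel_singleton[of 0] AE_lborel_singleton[of t] by eventually_elim (auto simp: indicator_def)
  qed measurable
  finally show ?thesis .
qed

lemma measurable_interval_times_T: "{0<..<t::real} \<times> T \<in> sets borel"
proof -
  have "{0<..<t} \<times> T \<in> sets (borel \<Otimes>\<^sub>M borel)" by (rule pair_measureI) (simp_all add: Torus_borel)
  then show ?thesis by (simp only: borel_prod)
qed

text \<open>The time derivative is only Lebesgue measurable on the strips, which says nothing about
  individual sections or about the coefficients as functions of time. A Borel version
  \<open>W\<close> on the product is chosen once, equal to it for almost every time and almost every
  point.\<close>

lemma time_deriv_modes:
  assumes td: "time_deriv L y v" and y: "\<And>t. t \<ge> 0 \<Longrightarrow> y t \<in> sq_int TM"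
  obtains W where "(\<lambda>(\<tau>, x). W \<tau> x) \<in> borel_measurable (borel \<Otimes>\<^sub>M borel)"
    "AE t in lborel. 0 < t \<longrightarrow> (AE x in TM. v t x = W t x)"
    "\<And>t. t \<ge> 0 \<Longrightarrow> (\<integral>\<^sup>+\<tau>. indicator {0..t} \<tau> * (\<integral>\<^sup>+x. ennreal ((W \<tau> x)\<^sup>2) \<partial>TM) \<partial>lborel) < \<infinity>"
    "\<And>t k. t \<ge> 0 \<Longrightarrow> fc (y t) k = fc (y 0) k + (LINT \<tau>:{0..t}|lborel. fc (W \<tau>) k)"
proof -
  have vm: "(\<lambda>(t, x). v t x) \<in> borel_measurable (lebesgue_on ({0<..<S} \<times> T))"
    and vi: "integrable (lebesgue_on ({0<..<S} \<times> T)) (\<lambda>(t, x). (v t x)\<^sup>2)" if "S > 0" for S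
    using td that unfolding time_deriv_def by auto
  have R: "{0<..<S} \<times> T \<inter> space lebesgue \<in> sets lebesgue" for S :: real
    using measurable_interval_times_T[of S] by simp
  \<comment> \<open>One function for all times: the strips of length n are glued, with value 0
    outside, so that a single Borel version serves every time horizon.\<close>
  define U where "U z = (case z of (t, x) \<Rightarrow> indicator ({0<..} \<times> T) z * v t x)" for z :: "real \<times> (real^'n)"
  have Un: "(\<lambda>z. indicator ({0<..<real (Suc n)} \<times> T) z * (case z of (t, x) \<Rightarrow> v t x)) \<in> borel_measurable lebesgue" for n
    using vm[OF of_nat_0_less_iff[THEN iffD2, OF zero_less_Suc[of n]]] by (subst (asm) borel_measurable_restrict_space_iff[OF R]) (simp add: mult.commute)
  have "U \<in> borel_measurable lebesgue"
  proof (rule borel_measurable_LIMSEQ_metric[OF Un])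
    fix z :: "real \<times> (real^'n)"
    obtain t x where z: "z = (t, x)" by (cases z)
    obtain N :: nat where N: "t < real N" using reals_Archimedean2 by blast
    show "(\<lambda>n. indicator ({0<..<real (Suc n)} \<times> T) z * (case z of (t, x) \<Rightarrow> v t x)) \<longlonglongrightarrow> U z"
      by (rule tendsto_eventually) (use N in \<open>auto simp: z U_def indicator_def intro!: eventually_sequentiallyI[of N]\<close>)
  qed
  from completion_ex_borel_measurable_real[OF this]
  obtain U' where U': "U' \<in> borel_measurable lborel" and UU: "AE z in lborel. U z = U' z" by blast
  define W where "W t x = U' (t, x)" for t x
  have Wm: "(\<lambda>(\<tau>, x). W \<tau> x) \<in> borel_measurable (borel \<Otimes>\<^sub>M borel)"
    using U' by (simp add: W_def borel_prod split_def)
  have "AE z in lborel \<Otimes>\<^sub>M lborel. U z = U' z" using UU unfolding lborel_prod .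
  from lborel_pair.AE_pair[OF this] have AE2: "AE t in lborel. AE x in lborel. U (t, x) = U' (t, x)" .
  have AEx: "(AE x in TM. Q x) \<longleftrightarrow> (AE x in lborel. x \<in> T \<longrightarrow> Q x)" for Q
    by (subst AE_restrict_space_iff) (auto simp: AE_completion_iff)
  have AEt: "AE t in lborel. 0 < t \<longrightarrow> (AE x in TM. v t x = W t x)"
    using AE2
  proof eventually_elim
    case (elim t)
    show ?case
    proof
      assume "0 < t"
      show "AE x in TM. v t x = W t x" unfolding AEx using elim
        by eventually_elim (use \<open>0 < t\<close> in \<open>auto simp: U_def W_def\<close>)
    qed
  qed
  have fin: "(\<integral>\<^sup>+\<tau>. indicator {0..t} \<tau> * (\<integral>\<^sup>+x. ennreal ((W \<tau> x)\<^sup>2) \<partial>TM) \<partial>lborel) < \<infinity>" if t: "t \<ge> 0" for t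
  proof -
    let ?R = "{0<..<t + 1} \<times> T"
    have "(\<integral>\<^sup>+\<tau>. indicator {0..t} \<tau> * (\<integral>\<^sup>+x. ennreal ((W \<tau> x)\<^sup>2) \<partial>TM) \<partial>lborel)
       \<le> (\<integral>\<^sup>+\<tau>. \<integral>\<^sup>+x. indicator ?R (\<tau>, x) * ennreal ((U' (\<tau>, x))\<^sup>2) \<partial>lborel \<partial>lborel)"
    proof (rule nn_integral_mono_AE)
      show "AE \<tau> in lborel. indicator {0..t} \<tau> * (\<integral>\<^sup>+x. ennreal ((W \<tau> x)\<^sup>2) \<partial>TM) \<le> (\<integral>\<^sup>+x. indicator ?R (\<tau>, x) * ennreal ((U' (\<tau>, x))\<^sup>2) \<partial>lborel)"
        using AE_lborel_singleton[of 0]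
      proof eventually_elim
        case (elim \<tau>)
        show ?case
        proof (cases "\<tau> \<in> {0..t}")
          case True
          have "(\<integral>\<^sup>+x. ennreal ((W \<tau> x)\<^sup>2) \<partial>TM) = (\<integral>\<^sup>+x. ennreal ((W \<tau> x)\<^sup>2) * indicator T x \<partial>lebesgue)"
            by (rule nn_integral_restrict_space) simp
          also have "\<dots> = (\<integral>\<^sup>+x. indicator ?R (\<tau>, x) * ennreal ((U' (\<tau>, x))\<^sup>2) \<partial>lborel)"
            unfolding nn_integral_completion using True elim
            by (intro nn_integral_cong) (auto simp: indicator_def W_def)
          finally show ?thesis using True by simp
        qed simp
      qed
    qed
    also have "\<dots> = (\<integral>\<^sup>+z. indicator ?R z * ennreal ((U' z)\<^sup>2) \<partial>(lborel \<Otimes>\<^sub>M lborel))"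
    proof (rule lborel.nn_integral_fst)
      have [measurable]: "U' \<in> borel_measurable (lborel \<Otimes>\<^sub>M lborel)" using U' by (simp add: lborel_prod)
      have [measurable]: "?R \<in> sets (lborel \<Otimes>\<^sub>M lborel)" using measurable_interval_times_T by (simp add: lborel_prod)
      show "(\<lambda>z. indicator ?R z * ennreal ((U' z)\<^sup>2)) \<in> borel_measurable (lborel \<Otimes>\<^sub>M lborel)" by measurable
    qed
    also have "\<dots> = (\<integral>\<^sup>+z. indicator ?R z * ennreal ((U' z)\<^sup>2) \<partial>lborel)" by (simp add: lborel_prod)
    also have "\<dots> = (\<integral>\<^sup>+z. ennreal ((case z of (t, x) \<Rightarrow> (v t x)\<^sup>2)) * indicator ?R z \<partial>lborel)"
      using UU by (intro nn_integral_cong_AE) (auto elim!: eventually_mono simp: U_def indicator_def split: if_splits)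
    also have "\<dots> = (\<integral>\<^sup>+z. ennreal ((case z of (t, x) \<Rightarrow> (v t x)\<^sup>2)) \<partial>lebesgue_on ?R)"
      by (subst nn_integral_restrict_space[OF R]) (simp add: nn_integral_completion)
    also have "\<dots> < \<infinity>"
    proof -
      have "(\<integral>\<^sup>+z. ennreal (norm (case z of (t, x) \<Rightarrow> (v t x)\<^sup>2)) \<partial>lebesgue_on ?R) < \<infinity>"
        using vi[of "t + 1"] t unfolding integrable_iff_bounded by auto
      then show ?thesis by (simp add: split_def)
    qed
    finally show ?thesis .
  qed
  have modes: "fc (y t) k = fc (y 0) k + (LINT \<tau>:{0..t}|lborel. fc (W \<tau>) k)" if t: "t \<ge> 0" for t k
  proof -
    let ?I = "\<lambda>x. \<integral>\<tau>. indicator {0..t} \<tau> * W \<tau> x \<partial>lborel"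
    note core = time_integral_fc[OF Wm t fin[OF t]]
    \<comment> \<open>The order of the two quantifiers can be exchanged only for a measurable
      exceptional set, hence the passage through a Borel null set \<open>N\<close>.\<close>
    have "AE x in lborel. AE t in lborel. U (t, x) = U' (t, x)"
    proof -
      from UU obtain N where N: "{z \<in> space lborel. \<not> U z = U' z} \<subseteq> N" "emeasure lborel N = 0" "N \<in> sets lborel"
        by (rule AE_E)
      have N': "N \<in> sets (lborel \<Otimes>\<^sub>M lborel)" using N(3) unfolding lborel_prod .
      have "AE z in lborel \<Otimes>\<^sub>M lborel. z \<notin> N"
        unfolding lborel_prod by (rule AE_not_in) (use N in auto)
      from lborel_pair.AE_pair[OF this] have 1: "AE t in lborel. AE x in lborel. (t, x) \<notin> N" .
      have "{z \<in> space (lborel \<Otimes>\<^sub>M lborel). (fst z, snd z) \<notin> N} \<in> sets (lborel \<Otimes>\<^sub>M lborel)"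
        using sets.compl_sets[OF N'] by (simp add: set_diff_eq)
      from lborel_pair.AE_commute[OF this] 1 have 2: "AE x in lborel. AE t in lborel. (t, x) \<notin> N" by simp
      have U: "U z = U' z" if "z \<notin> N" for z using N(1) that by auto
      show ?thesis using 2
      proof eventually_elim
        case (elim x)
        then show ?case by eventually_elim (rule U)
      qed
    qed
    then have sw: "AE x in TM. AE \<tau> in lborel. \<tau> \<in> {0<..<t} \<longrightarrow> v \<tau> x = W \<tau> x"
      unfolding AEx
    proof eventually_elim
      case (elim x)
      show ?case
      proof
        assume "x \<in> T"
        show "AE \<tau> in lborel. \<tau> \<in> {0<..<t} \<longrightarrow> v \<tau> x = W \<tau> x" using elim
          by eventually_elim (use \<open>x \<in> T\<close> in \<open>auto simp: U_def W_def\<close>)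
      qed
    qed
    have "AE x in TM. y t x = y 0 x + (\<integral>\<tau>. v \<tau> x \<partial>lebesgue_on {0<..<t})"
      using td t unfolding time_deriv_def by blast
    with sw have "AE x in TM. y t x - y 0 x = ?I x"
    proof eventually_elim
      case (elim x)
      have "(\<lambda>\<tau>. W \<tau> x) \<in> borel_measurable borel" using measurable_Pair1[OF Wm, of x] by simp
      from lebesgue_on_interval_integral[OF this elim(1)] elim(2) show ?case by simp
    qed
    moreover have d: "(\<lambda>x. y t x - y 0 x) \<in> sq_int TM" by (rule sq_int_diff[OF y[OF t] y[OF order_refl]])
    ultimately have "fc (\<lambda>x. y t x - y 0 x) = fc ?I"
      by (intro fc_cong_AE sq_int_measurable core(1)) auto
    then have "fc (\<lambda>x. y t x - y 0 x) k = fc ?I k" by simp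
    then show ?thesis unfolding core(2) fc_diff[OF y[OF t] y[OF order_refl]] by simp
  qed
  show ?thesis by (rule that[OF Wm AEt fin modes])
qed

end

section \<open>Passing from Lebesgue subspaces to Borel measure, and recovering time derivatives
  from modes\<close>

lemma AE_lebesgue_on_iff:
  fixes A :: "'a::euclidean_space set"
  assumes "A \<in> sets borel" shows "(AE t in lebesgue_on A. P t) \<longleftrightarrow> (AE t in lborel. t \<in> A \<longrightarrow> P t)"
  using assms by (subst AE_restrict_space_iff) (auto simp: AE_completion_iff)

lemma nn_integral_lebesgue_on:
  fixes A :: "'a::euclidean_space set"
  assumes "A \<in> sets borel" shows "(\<integral>\<^sup>+x. f x \<partial>lebesgue_on A) = (\<integral>\<^sup>+x. f x * indicator A x \<partial>lborel)"
  using assms by (subst nn_integral_restrict_space) (auto simp: nn_integral_completion)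

lemma nn_integral_sq_add_le:
  assumes [measurable]: "f \<in> borel_measurable M" "g \<in> borel_measurable M"
  shows "(\<integral>\<^sup>+x. ennreal ((f x + g x)\<^sup>2) \<partial>M) \<le> 2 * ((\<integral>\<^sup>+x. ennreal ((f x)\<^sup>2) \<partial>M) + (\<integral>\<^sup>+x. ennreal ((g x)\<^sup>2) \<partial>M))"
proof -
  have "(\<integral>\<^sup>+x. ennreal ((f x + g x)\<^sup>2) \<partial>M) \<le> (\<integral>\<^sup>+x. 2 * (ennreal ((f x)\<^sup>2) + ennreal ((g x)\<^sup>2)) \<partial>M)"
  proof (rule nn_integral_mono)
    fix x
    have "(f x + g x)\<^sup>2 \<le> 2 * ((f x)\<^sup>2 + (g x)\<^sup>2)"
      using zero_le_power2[of "f x - g x"] by (simp add: power2_eq_square algebra_simps)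
    then have "ennreal ((f x + g x)\<^sup>2) \<le> ennreal (2 * ((f x)\<^sup>2 + (g x)\<^sup>2))" by (rule ennreal_leI)
    then show "ennreal ((f x + g x)\<^sup>2) \<le> 2 * (ennreal ((f x)\<^sup>2) + ennreal ((g x)\<^sup>2))"
      by (simp add: ennreal_mult ennreal_plus)
  qed
  also have "\<dots> = 2 * ((\<integral>\<^sup>+x. ennreal ((f x)\<^sup>2) \<partial>M) + (\<integral>\<^sup>+x. ennreal ((g x)\<^sup>2) \<partial>M))"
    by (simp add: nn_integral_cmult nn_integral_add)
  finally show ?thesis .
qed

lemma AE_finite_of_nn_integral:
  fixes F :: "real \<Rightarrow> ennreal"
  assumes [measurable]: "F \<in> borel_measurable borel"
    and fin: "\<And>t. t \<ge> 0 \<Longrightarrow> (\<integral>\<^sup>+\<tau>. indicator {0..t} \<tau> * F \<tau> \<partial>lborel) < \<infinity>"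
  shows "AE \<tau> in lborel. 0 \<le> \<tau> \<longrightarrow> F \<tau> < \<infinity>"
proof -
  have "AE \<tau> in lborel. \<forall>n::nat. indicator {0..real n} \<tau> * F \<tau> \<noteq> \<infinity>"
    unfolding AE_all_countable
  proof
    fix n
    show "AE \<tau> in lborel. indicator {0..real n} \<tau> * F \<tau> \<noteq> \<infinity>"
      by (rule nn_integral_noteq_infinite) (use fin[of "real n"] in \<open>auto simp: less_top\<close>)
  qed
  then show ?thesis
  proof eventually_elim
    case (elim \<tau>)
    show ?case
    proof
      assume "0 \<le> \<tau>"
      moreover obtain n :: nat where "\<tau> \<le> real n" using real_arch_simple by blast
      ultimately show "F \<tau> < \<infinity>" using elim[rule_format, of n] by (simp add: less_top)
    qed
  qed
qed

context torus
begin

lemma nn_integral_fc_le: "u \<in> borel_measurable TM \<Longrightarrow> (\<integral>\<^sup>+k. ennreal ((fc u k)\<^sup>2) \<partial>CM) \<le> (\<integral>\<^sup>+x. ennreal ((u x)\<^sup>2) \<partial>TM)"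
proof (cases "(\<integral>\<^sup>+x. ennreal ((u x)\<^sup>2) \<partial>TM) < \<infinity>")
  case True
  assume "u \<in> borel_measurable TM"
  then have u: "u \<in> sq_int TM" using True by (simp add: sq_int_iff_nn_integral)
  show ?thesis unfolding nn_integral_sq[OF u] nn_integral_sq[OF fc_l2(1)[OF u]]
    by (intro ennreal_leI power_mono fc_l2(2) u) auto
next
  case False
  then show ?thesis by (simp add: not_less top_unique)
qed

text \<open>Converse of \<open>time_deriv_modes\<close>: for each t the increment of y and the time
  integral of \<open>W\<close> have the same Fourier coefficients, hence agree almost
  everywhere.\<close>

lemma time_deriv_of_modes:
  fixes W :: "real \<Rightarrow> real^'n \<Rightarrow> real"
  assumes Wm: "(\<lambda>(\<tau>, x). W \<tau> x) \<in> borel_measurable (borel \<Otimes>\<^sub>M borel)"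
    and fin: "\<And>t. t \<ge> 0 \<Longrightarrow> (\<integral>\<^sup>+\<tau>. indicator {0..t} \<tau> * (\<integral>\<^sup>+x. ennreal ((W \<tau> x)\<^sup>2) \<partial>TM) \<partial>lborel) < \<infinity>"
    and y: "\<And>t. t \<ge> 0 \<Longrightarrow> y t \<in> sq_int TM"
    and modes: "\<And>t k. t \<ge> 0 \<Longrightarrow> fc (y t) k = fc (y 0) k + (LINT \<tau>:{0..t}|lborel. fc (W \<tau>) k)"
  shows "time_deriv L y W"
  unfolding time_deriv_def
proof (intro conjI allI impI)
  fix S :: real assume S: "S > 0"
  let ?R = "{0<..<S} \<times> T"
  have R: "?R \<in> sets borel" by (rule measurable_interval_times_T)
  have Wb: "(\<lambda>(t, x). W t x) \<in> borel_measurable (borel :: (real \<times> (real^'n)) measure)" using Wm by (simp only: borel_prod)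
  show m: "(\<lambda>(t, x). W t x) \<in> borel_measurable (lebesgue_on ?R)"
    by (intro measurable_restrict_space1 measurable_completion) (use Wb in simp)
  show "integrable (lebesgue_on ?R) (\<lambda>(t, x). (W t x)\<^sup>2)"
  proof (rule integrableI_bounded)
    have "(\<lambda>z. (case z of (t, x) \<Rightarrow> W t x)\<^sup>2) \<in> borel_measurable (lebesgue_on ?R)" using m by (rule borel_measurable_power)
    then show "(\<lambda>(t, x). (W t x)\<^sup>2) \<in> borel_measurable (lebesgue_on ?R)" by (simp add: split_def)
    have [measurable]: "(\<lambda>(t, x). W t x) \<in> borel_measurable (lborel \<Otimes>\<^sub>M lborel)" unfolding lborel_prod using Wb by simp
    have [measurable]: "?R \<in> sets (lborel \<Otimes>\<^sub>M lborel)" unfolding lborel_prod using R by simp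
    have "(\<integral>\<^sup>+z. ennreal (norm (case z of (t, x) \<Rightarrow> (W t x)\<^sup>2)) \<partial>lebesgue_on ?R)
        = (\<integral>\<^sup>+z. ennreal ((case z of (t, x) \<Rightarrow> W t x)\<^sup>2) * indicator ?R z \<partial>(lborel \<Otimes>\<^sub>M lborel))"
      unfolding nn_integral_lebesgue_on[OF R] lborel_prod by (simp add: split_def)
    also have "\<dots> = (\<integral>\<^sup>+\<tau>. \<integral>\<^sup>+x. ennreal ((W \<tau> x)\<^sup>2) * indicator ?R (\<tau>, x) \<partial>lborel \<partial>lborel)"
      by (subst lborel.nn_integral_fst[symmetric]) auto
    also have "\<dots> \<le> (\<integral>\<^sup>+\<tau>. indicator {0..S} \<tau> * (\<integral>\<^sup>+x. ennreal ((W \<tau> x)\<^sup>2) \<partial>TM) \<partial>lborel)"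
      by (intro nn_integral_mono) (auto simp: nn_integral_lebesgue_on indicator_def intro!: nn_integral_mono)
    also have "\<dots> < \<infinity>" using S by (intro fin) simp
    finally show "(\<integral>\<^sup>+z. ennreal (norm (case z of (t, x) \<Rightarrow> (W t x)\<^sup>2)) \<partial>lebesgue_on ?R) < \<infinity>" .
  qed
next
  fix t :: real assume t: "0 \<le> t"
  let ?I = "\<lambda>x. \<integral>\<tau>. indicator {0..t} \<tau> * W \<tau> x \<partial>lborel"
  note core = time_integral_fc[OF Wm t fin[OF t]]
  have "AE x in TM. y t x - y 0 x = ?I x"
    by (rule fc_inj[OF sq_int_diff[OF y[OF t] y[OF order_refl]] core(1)])
       (simp add: core(2) modes[OF t] fc_diff[OF y[OF t] y[OF order_refl]])
  then show "AE x in TM. y t x = y 0 x + (\<integral>\<tau>. W \<tau> x \<partial>lebesgue_on {0<..<t})"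
  proof eventually_elim
    case (elim x)
    have "(\<lambda>\<tau>. W \<tau> x) \<in> borel_measurable borel" using measurable_Pair1[OF Wm, of x] by simp
    from lebesgue_on_interval_integral[OF this, of t "\<lambda>\<tau>. W \<tau> x"] elim show ?case by simp
  qed
qed

end

locale ks_torus = torus3 L for L :: "real^'n" +
  fixes nu0 nu1 nu2 :: real
  assumes nu0_pos: "nu0 > 0" and nu1_pos: "nu1 > 0" and nu2_pos: "nu2 > 0"

sublocale ks_torus \<subseteq> evolution lam nu2
  by unfold_locales (auto simp: lam_ge1 nu2_pos)

context ks_torus
begin

section \<open>Strong solutions in terms of Fourier coefficients\<close>

definition KSop :: "(real^'n \<Rightarrow> real) \<Rightarrow> real^'n \<Rightarrow> real" where
  "KSop u x = nu2 * laplacian L (laplacian L u) x + nu1 * laplacian L u x + nu0 / 2 * (norm (gradient L u x))\<^sup>2"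

text \<open>The Fourier multiplier of $\nu_2(-\Delta+1)^2-\nu_2\Delta^2-\nu_1\Delta$.\<close>

definition lin :: "int^'n \<Rightarrow> real" where "lin k = 2 * nu2 * lam k - nu2 + nu1 * (lam k - 1)"

lemma E2_finite_iff: "E2 c < \<infinity> \<longleftrightarrow> c \<in> H2"
  by (simp add: E2_def H2_def sq_int_iff_nn_integral)

lemma E4_finite_iff: "E4 c < \<infinity> \<longleftrightarrow> c \<in> H4"
  by (simp add: E4_def H4_def sq_int_iff_nn_integral)

lemma E0_finite_iff: "E0 c < \<infinity> \<longleftrightarrow> c \<in> sq_int CM"
  by (simp add: E0_def sq_int_iff_nn_integral)

lemma E2_vn: "c \<in> H2 \<Longrightarrow> E2 c = ennreal ((vn c)\<^sup>2)"
  unfolding E2_def vn_def by (rule nn_integral_sq) (simp add: H2_def)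

lemma E4_scale: "E0 (\<lambda>k. a * ((lam k)\<^sup>2 * c k)) = ennreal (a\<^sup>2) * E4 c"
  unfolding E0_def E4_def by (simp add: power_mult_distrib ennreal_mult nn_integral_cmult)

lemma E0_add_le: "E0 (\<lambda>k. a k + b k) \<le> 2 * (E0 a + E0 b)"
  unfolding E0_def by (rule nn_integral_sq_add_le) auto

lemma E0_minus: "E0 (\<lambda>k. - a k) = E0 a" by (simp add: E0_def)

lemma E0_diff_le: "E0 (\<lambda>k. a k - b k) \<le> 2 * (E0 a + E0 b)"
  using E0_add_le[of a "\<lambda>k. - b k"] by (simp add: E0_minus)

lemma KSop_fc:
  assumes u: "u \<in> Sobolev L 4"
  shows "KSop u \<in> sq_int TM"
    and "fc (KSop u) k = (nu2 * (lam k)\<^sup>2 - lin k) * fc u k + nu0 / 2 * Bf (fc u) (fc u) k"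
proof -
  have u2: "u \<in> Sobolev L 2" by (rule Sobolev_mono[OF u])
  have H: "fc u \<in> H2" using u2 by (simp add: Sobolev2_iff)
  note l = laplacian_fc[OF u2] laplacian_fc[OF Sobolev4_laplacian(1)[OF u]]
  have w: "wD L [i] u \<in> borel_measurable TM" for i by (intro sq_int_measurable wD_sq_int[OF u2]) simp
  have gm: "(\<lambda>x. (norm (gradient L u x))\<^sup>2) \<in> borel_measurable TM"
    unfolding norm_vec_def L2_set_def gradient_def using w
    by (intro borel_measurable_power borel_measurable_sqrt borel_measurable_sum) simp
  have g: "(\<lambda>x. (norm (gradient L u x))\<^sup>2) \<in> sq_int TM"
    by (rule sq_int_cong_AE[OF BB_bound(1)[OF H H] gm gradient_BB[OF u2]])
  have gf: "fc (\<lambda>x. (norm (gradient L u x))\<^sup>2) = Bf (fc u) (fc u)"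
    unfolding Bf_def by (rule fc_cong_AE[OF gm sq_int_measurable[OF BB_bound(1)[OF H H]] gradient_BB[OF u2]])
  show "KSop u \<in> sq_int TM" unfolding KSop_def[abs_def] by (intro sq_int_add sq_int_scale l g)
  have "fc (KSop u) k = nu2 * fc (laplacian L (laplacian L u)) k + nu1 * fc (laplacian L u) k + nu0 / 2 * Bf (fc u) (fc u) k"
    unfolding KSop_def[abs_def]
    by (simp only: fc_add sq_int_add sq_int_scale l g fc_scale gf)
  also have "\<dots> = (nu2 * (lam k)\<^sup>2 - lin k) * fc u k + nu0 / 2 * Bf (fc u) (fc u) k"
    by (simp add: l lin_def lam_def power2_eq_square algebra_simps)
  finally show "fc (KSop u) k = (nu2 * (lam k)\<^sup>2 - lin k) * fc u k + nu0 / 2 * Bf (fc u) (fc u) k" .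
qed

lemma KS_solution_iff:
  "KS_strong_solution L nu0 nu1 nu2 g y \<longleftrightarrow>
     (\<forall>t\<ge>0. y t \<in> Sobolev L 2) \<and> (\<forall>S>0. in_L2_DA L nu2 0 S y) \<and>
     (\<exists>v. time_deriv L y v \<and> (AE t in lborel. 0 < t \<longrightarrow> (AE x in TM. v t x + KSop (y t) x = g t x)))"
  unfolding KS_strong_solution_def KSop_def by (simp add: AE_lebesgue_on_iff algebra_simps)

text \<open>Unpacks a strong solution into the form used for energy estimates: a Borel velocity
  \<open>W\<close>, scalar integral equations, and square integrability in D(A). Coefficients are
  continuous as indefinite integrals; \<open>max 0 t\<close> is there because the values at negative
  times are unconstrained.\<close>

lemma KS_forward:
  assumes ks: "KS_strong_solution L nu0 nu1 nu2 g y"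
  obtains W where "(\<lambda>(\<tau>, x). W \<tau> x) \<in> borel_measurable (borel \<Otimes>\<^sub>M borel)"
    "AE t in lborel. 0 < t \<longrightarrow> y t \<in> Sobolev L 4 \<and> W t \<in> sq_int TM \<and> (AE x in TM. W t x + KSop (y t) x = g t x)"
    "\<And>t. t \<ge> 0 \<Longrightarrow> (\<integral>\<^sup>+\<tau>. indicator {0..t} \<tau> * (\<integral>\<^sup>+x. ennreal ((W \<tau> x)\<^sup>2) \<partial>TM) \<partial>lborel) < \<infinity>"
    "\<And>t k. t \<ge> 0 \<Longrightarrow> fc (y t) k = fc (y 0) k + (LINT \<tau>:{0..t}|lborel. fc (W \<tau>) k)"
    "\<And>t k. t \<ge> 0 \<Longrightarrow> set_integrable lborel {0..t} (\<lambda>\<tau>. fc (W \<tau>) k)"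
    "\<And>t. t \<ge> 0 \<Longrightarrow> (\<integral>\<^sup>+\<tau>. indicator {0..t} \<tau> * E4 (fc (y \<tau>)) \<partial>lborel) < \<infinity>"
    "\<And>k. continuous_on UNIV (\<lambda>t. fc (y (max 0 t)) k)"
proof -
  have y2: "y t \<in> Sobolev L 2" if "t \<ge> 0" for t using ks that by (simp add: KS_solution_iff)
  have DA: "in_L2_DA L nu2 0 S y" if "S > 0" for S using ks that by (simp add: KS_solution_iff)
  obtain v where td: "time_deriv L y v" and eq: "AE t in lborel. 0 < t \<longrightarrow> (AE x in TM. v t x + KSop (y t) x = g t x)"
    using ks by (auto simp: KS_solution_iff)
  obtain W where Wm: "(\<lambda>(\<tau>, x). W \<tau> x) \<in> borel_measurable (borel \<Otimes>\<^sub>M borel)"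
    and vW: "AE t in lborel. 0 < t \<longrightarrow> (AE x in TM. v t x = W t x)"
    and Wfin: "\<And>t. t \<ge> 0 \<Longrightarrow> (\<integral>\<^sup>+\<tau>. indicator {0..t} \<tau> * (\<integral>\<^sup>+x. ennreal ((W \<tau> x)\<^sup>2) \<partial>TM) \<partial>lborel) < \<infinity>"
    and Wmod: "\<And>t k. t \<ge> 0 \<Longrightarrow> fc (y t) k = fc (y 0) k + (LINT \<tau>:{0..t}|lborel. fc (W \<tau>) k)"
    using time_deriv_modes[OF td Sobolev_sq_int[OF y2]] by blast
  have WTM [measurable]: "(\<lambda>(\<tau>, x). W \<tau> x) \<in> borel_measurable (lborel \<Otimes>\<^sub>M TM)" by (rule measurable_lborel_TM[OF Wm])
  have "(\<lambda>\<tau>. \<integral>\<^sup>+x. ennreal ((W \<tau> x)\<^sup>2) \<partial>TM) \<in> borel_measurable lborel"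
    by (rule TM.borel_measurable_nn_integral) (use WTM in \<open>simp add: split_def\<close>)
  then have "AE \<tau> in lborel. 0 \<le> \<tau> \<longrightarrow> (\<integral>\<^sup>+x. ennreal ((W \<tau> x)\<^sup>2) \<partial>TM) < \<infinity>"
    by (intro AE_finite_of_nn_integral Wfin) simp_all
  moreover have "W t \<in> borel_measurable TM" for t using measurable_Pair2[OF WTM, of t] by simp
  ultimately have Wsq: "AE t in lborel. 0 \<le> t \<longrightarrow> W t \<in> sq_int TM"
    by (auto simp: sq_int_iff_nn_integral elim!: eventually_mono)
  have S4: "AE t in lborel. 0 < t \<and> t < S \<longrightarrow> y t \<in> Sobolev L 4" if "S > 0" for S
    using DA[OF that] by (simp add: in_L2_DA_def AE_lebesgue_on_iff)
  \<comment> \<open>The solution concept speaks of bounded time horizons; countably many of them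
    cover all positive times with one null set.\<close>
  then have "AE t in lborel. \<forall>n. 0 < t \<and> t < real (Suc n) \<longrightarrow> y t \<in> Sobolev L 4"
    unfolding AE_all_countable by (auto simp del: of_nat_Suc)
  then have S4': "AE t in lborel. 0 < t \<longrightarrow> y t \<in> Sobolev L 4"
  proof eventually_elim
    case (elim t)
    obtain n :: nat where "t < real n" using reals_Archimedean2 by blast
    then have "t < real (Suc n)" by simp
    then show ?case using elim by blast
  qed
  have A: "AE t in lborel. 0 < t \<longrightarrow> y t \<in> Sobolev L 4 \<and> W t \<in> sq_int TM \<and> (AE x in TM. W t x + KSop (y t) x = g t x)"
    using S4' Wsq vW eq
  proof eventually_elim
    case (elim t)
    show ?case
    proof (intro impI conjI)
      assume t: "0 < t"
      have "AE x in TM. v t x = W t x" "AE x in TM. v t x + KSop (y t) x = g t x" using elim t by auto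
      then show "AE x in TM. W t x + KSop (y t) x = g t x" by eventually_elim simp
    qed (use elim in auto)
  qed
  have Wint: "set_integrable lborel {0..t} (\<lambda>\<tau>. fc (W \<tau>) k)" if "t \<ge> 0" for t k
    by (rule time_integral_fc(3)[OF Wm that Wfin[OF that]])
  have cont: "continuous_on UNIV (\<lambda>t. fc (y (max 0 t)) k)" for k
  proof -
    have "(\<lambda>t. fc (y (max 0 t)) k) = (\<lambda>t. fc (y 0) k + (LINT \<tau>:{0..max 0 t}|lborel. fc (W \<tau>) k))"
      by (rule ext, rule Wmod) simp
    moreover have "continuous_on UNIV (\<lambda>t. LINT \<tau>:{0..max 0 t}|lborel. fc (W \<tau>) k)"
      by (rule continuous_on_compose2[OF continuous_indefinite_integral[OF Wint]]) (auto intro!: continuous_intros)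
    ultimately show ?thesis by (simp only: continuous_on_add continuous_on_const)
  qed
  have [measurable]: "(\<lambda>\<tau>. E4 (fc (y (max 0 \<tau>)))) \<in> borel_measurable borel"
    by (rule measurable_E) (rule borel_measurable_continuous_onI[OF cont])
  have fin4: "(\<integral>\<^sup>+\<tau>. indicator {0..t} \<tau> * E4 (fc (y \<tau>)) \<partial>lborel) < \<infinity>" if t: "t \<ge> 0" for t
  proof -
    let ?I = "\<integral>\<^sup>+\<tau>. ennreal ((DA_norm L nu2 (y \<tau>))\<^sup>2) * indicator {0<..<t+1} \<tau> \<partial>lborel"
    have "L2_DA_norm L nu2 0 (t + 1) y < \<infinity>" using DA[of "t + 1"] t by (simp add: in_L2_DA_def)
    then have I: "?I < \<infinity>"
      unfolding L2_DA_norm_def Let_def by (simp add: nn_integral_lebesgue_on less_top split: if_splits)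
    have e: "(\<integral>\<^sup>+\<tau>. indicator {0..t} \<tau> * E4 (fc (y \<tau>)) \<partial>lborel) = (\<integral>\<^sup>+\<tau>. indicator {0..t} \<tau> * E4 (fc (y (max 0 \<tau>))) \<partial>lborel)"
      by (rule nn_integral_cong) (auto simp: indicator_def)
    have "ennreal (nu2\<^sup>2) * (\<integral>\<^sup>+\<tau>. indicator {0..t} \<tau> * E4 (fc (y (max 0 \<tau>))) \<partial>lborel)
      = (\<integral>\<^sup>+\<tau>. ennreal (nu2\<^sup>2) * (indicator {0..t} \<tau> * E4 (fc (y (max 0 \<tau>)))) \<partial>lborel)"
      by (rule nn_integral_cmult[symmetric]) simp
    also have "\<dots> \<le> ?I"
    proof (rule nn_integral_mono_AE)
      show "AE \<tau> in lborel. ennreal (nu2\<^sup>2) * (indicator {0..t} \<tau> * E4 (fc (y (max 0 \<tau>))))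
         \<le> ennreal ((DA_norm L nu2 (y \<tau>))\<^sup>2) * indicator {0<..<t+1} \<tau>"
        using S4' AE_lborel_singleton[of 0]
      proof eventually_elim
        case (elim \<tau>)
        show ?case
        proof (cases "\<tau> \<in> {0..t}")
          case True
          then have y4: "y \<tau> \<in> Sobolev L 4" using elim by auto
          have "(DA_norm L nu2 (y \<tau>))\<^sup>2 = nu2\<^sup>2 * (nrm CM (\<lambda>k. (lam k)\<^sup>2 * fc (y \<tau>) k))\<^sup>2"
            unfolding DA_norm_eq[OF y4] by (simp add: power_mult_distrib)
          moreover have "E4 (fc (y \<tau>)) = ennreal ((nrm CM (\<lambda>k. (lam k)\<^sup>2 * fc (y \<tau>) k))\<^sup>2)"
            unfolding E4_def by (rule nn_integral_sq) (use y4 in \<open>simp add: Sobolev4_iff H4_def\<close>)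
          ultimately have "ennreal (nu2\<^sup>2) * E4 (fc (y \<tau>)) = ennreal ((DA_norm L nu2 (y \<tau>))\<^sup>2)"
            by (simp add: ennreal_mult[symmetric])
          then show ?thesis using True elim by auto
        qed simp
      qed
    qed
    also note I
    finally show ?thesis using nu2_pos unfolding e by (auto simp: ennreal_mult_less_top)
  qed
  show ?thesis by (rule that[OF Wm A Wfin Wmod Wint fin4 cont])
qed

text \<open>\<open>f\<close> is known only through the reference equation, so it is eliminated
  pointwise, almost everywhere, before coefficients are taken. The forcing \<open>h\<close> is the
  difference of the velocities with nu2 lam^2 times the error added back, so that the error
  satisfies \<open>modes\<close>; its H energy is integrable in time because the velocities lie in H
  and both curves in D(A).\<close>

lemma KS_difference:
  assumes yr: "KS_strong_solution L nu0 nu1 nu2 f yr"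
    and y: "KS_strong_solution L nu0 nu1 nu2 (\<lambda>t x. f t x - G t x) y"
    and G: "\<And>t. t \<ge> 0 \<Longrightarrow> G t \<in> sq_int TM"
  obtains h where
    "\<And>S. S \<ge> 0 \<Longrightarrow> modes S (\<lambda>k. fc (y 0) k - fc (yr 0) k) h (\<lambda>t k. fc (y (max 0 t)) k - fc (yr (max 0 t)) k)"
    "\<And>t. t \<ge> 0 \<Longrightarrow> (\<integral>\<^sup>+\<tau>. indicator {0..t} \<tau> * E0 (h \<tau>) \<partial>lborel) < \<infinity>"
    "AE t in lborel. 0 < t \<longrightarrow> (\<forall>k. h t k = lin k * (fc (y t) k - fc (yr t) k)
       - nu0 / 2 * (Bf (fc (y t)) (fc (y t)) k - Bf (fc (yr t)) (fc (yr t)) k) - fc (G t) k)"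
proof -
  obtain W where W: "(\<lambda>(\<tau>, x). W \<tau> x) \<in> borel_measurable (borel \<Otimes>\<^sub>M borel)"
    "AE t in lborel. 0 < t \<longrightarrow> y t \<in> Sobolev L 4 \<and> W t \<in> sq_int TM \<and> (AE x in TM. W t x + KSop (y t) x = f t x - G t x)"
    "\<And>t. t \<ge> 0 \<Longrightarrow> (\<integral>\<^sup>+\<tau>. indicator {0..t} \<tau> * (\<integral>\<^sup>+x. ennreal ((W \<tau> x)\<^sup>2) \<partial>TM) \<partial>lborel) < \<infinity>"
    "\<And>t k. t \<ge> 0 \<Longrightarrow> fc (y t) k = fc (y 0) k + (LINT \<tau>:{0..t}|lborel. fc (W \<tau>) k)"
    "\<And>t k. t \<ge> 0 \<Longrightarrow> set_integrable lborel {0..t} (\<lambda>\<tau>. fc (W \<tau>) k)"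
    "\<And>t. t \<ge> 0 \<Longrightarrow> (\<integral>\<^sup>+\<tau>. indicator {0..t} \<tau> * E4 (fc (y \<tau>)) \<partial>lborel) < \<infinity>"
    "\<And>k. continuous_on UNIV (\<lambda>t. fc (y (max 0 t)) k)"
    by (rule KS_forward[OF y]) blast
  obtain X where X: "(\<lambda>(\<tau>, x). X \<tau> x) \<in> borel_measurable (borel \<Otimes>\<^sub>M borel)"
    "AE t in lborel. 0 < t \<longrightarrow> yr t \<in> Sobolev L 4 \<and> X t \<in> sq_int TM \<and> (AE x in TM. X t x + KSop (yr t) x = f t x)"
    "\<And>t. t \<ge> 0 \<Longrightarrow> (\<integral>\<^sup>+\<tau>. indicator {0..t} \<tau> * (\<integral>\<^sup>+x. ennreal ((X \<tau> x)\<^sup>2) \<partial>TM) \<partial>lborel) < \<infinity>"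
    "\<And>t k. t \<ge> 0 \<Longrightarrow> fc (yr t) k = fc (yr 0) k + (LINT \<tau>:{0..t}|lborel. fc (X \<tau>) k)"
    "\<And>t k. t \<ge> 0 \<Longrightarrow> set_integrable lborel {0..t} (\<lambda>\<tau>. fc (X \<tau>) k)"
    "\<And>t. t \<ge> 0 \<Longrightarrow> (\<integral>\<^sup>+\<tau>. indicator {0..t} \<tau> * E4 (fc (yr \<tau>)) \<partial>lborel) < \<infinity>"
    "\<And>k. continuous_on UNIV (\<lambda>t. fc (yr (max 0 t)) k)"
    by (rule KS_forward[OF yr]) blast
  define w where "w t k = fc (y (max 0 t)) k - fc (yr (max 0 t)) k" for t k
  define q where "q t k = fc (W t) k - fc (X t) k" for t k
  define h where "h t k = q t k + nu2 * (lam k)\<^sup>2 * w t k" for t k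
  have wc: "continuous_on UNIV (\<lambda>t. w t k)" for k unfolding w_def by (intro continuous_on_diff W X)
  have [measurable]: "(\<lambda>t. w t k) \<in> borel_measurable borel" for k by (rule borel_measurable_continuous_onI[OF wc])
  have [measurable]: "(\<lambda>t. fc (W t) k) \<in> borel_measurable borel" "(\<lambda>t. fc (X t) k) \<in> borel_measurable borel" for k
    by (intro fc_param_measurable W X)+
  have qm [measurable]: "(\<lambda>t. q t k) \<in> borel_measurable borel" for k unfolding q_def by measurable
  have hm [measurable]: "(\<lambda>t. h t k) \<in> borel_measurable borel" for k unfolding h_def by measurable
  have m: "modes S (\<lambda>k. fc (y 0) k - fc (yr 0) k) h w" if S: "S \<ge> 0" for S
    unfolding modes_def
  proof (intro allI conjI ballI)
    fix k
    have i: "set_integrable lborel {0..t} (\<lambda>\<tau>. fc (W \<tau>) k - fc (X \<tau>) k)" if "t \<ge> 0" for t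
      by (intro set_integral_diff W X that)
    then show "set_integrable lborel {0..S} (\<lambda>s. h s k - nu2 * (lam k)\<^sup>2 * w s k)"
      using S by (simp add: h_def q_def)
    fix t assume t: "t \<in> {0..S}"
    then have t0: "t \<ge> 0" by simp
    have "w t k = fc (y t) k - fc (yr t) k" using t0 by (simp add: w_def)
    also have "\<dots> = fc (y 0) k - fc (yr 0) k + ((LINT \<tau>:{0..t}|lborel. fc (W \<tau>) k) - (LINT \<tau>:{0..t}|lborel. fc (X \<tau>) k))"
      using W(4)[OF t0, of k] X(4)[OF t0, of k] by linarith
    also have "(LINT \<tau>:{0..t}|lborel. fc (W \<tau>) k) - (LINT \<tau>:{0..t}|lborel. fc (X \<tau>) k) = (LINT s:{0..t}|lborel. h s k - nu2 * (lam k)\<^sup>2 * w s k)"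
      by (simp add: h_def q_def set_integral_diff(2)[OF W(5)[OF t0] X(5)[OF t0]])
    finally show "w t k = fc (y 0) k - fc (yr 0) k + (LINT s:{0..t}|lborel. h s k - nu2 * (lam k)\<^sup>2 * w s k)" .
  qed measurable
  have E0m: "(\<lambda>\<tau>. E0 (fc (W \<tau>))) \<in> borel_measurable lborel" "(\<lambda>\<tau>. E0 (fc (X \<tau>))) \<in> borel_measurable lborel"
    "(\<lambda>\<tau>. E4 (fc (y (max 0 \<tau>)))) \<in> borel_measurable lborel" "(\<lambda>\<tau>. E4 (fc (yr (max 0 \<tau>)))) \<in> borel_measurable lborel"
    by (intro measurable_E; simp add: borel_measurable_continuous_onI[OF W(7)] borel_measurable_continuous_onI[OF X(7)])+
  note [measurable] = E0m
  have hf: "(\<integral>\<^sup>+\<tau>. indicator {0..t} \<tau> * E0 (h \<tau>) \<partial>lborel) < \<infinity>" if t: "t \<ge> 0" for t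
  proof -
    let ?n = "ennreal (nu2\<^sup>2)"
    have 1: "E0 (h \<tau>) \<le> 4 * E0 (fc (W \<tau>)) + 4 * E0 (fc (X \<tau>)) + (4 * ?n * E4 (fc (y (max 0 \<tau>))) + 4 * ?n * E4 (fc (yr (max 0 \<tau>))))" for \<tau>
    proof -
      have h: "h \<tau> = (\<lambda>k. (fc (W \<tau>) k - fc (X \<tau>) k) + (nu2 * ((lam k)\<^sup>2 * fc (y (max 0 \<tau>)) k) - nu2 * ((lam k)\<^sup>2 * fc (yr (max 0 \<tau>)) k)))"
        by (simp add: fun_eq_iff h_def q_def w_def algebra_simps)
      have "E0 (h \<tau>) \<le> 2 * (E0 (\<lambda>k. fc (W \<tau>) k - fc (X \<tau>) k) + E0 (\<lambda>k. nu2 * ((lam k)\<^sup>2 * fc (y (max 0 \<tau>)) k) - nu2 * ((lam k)\<^sup>2 * fc (yr (max 0 \<tau>)) k)))"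
        unfolding h by (rule E0_add_le)
      also have "\<dots> \<le> 2 * (2 * (E0 (fc (W \<tau>)) + E0 (fc (X \<tau>))) + 2 * (?n * E4 (fc (y (max 0 \<tau>))) + ?n * E4 (fc (yr (max 0 \<tau>)))))"
        unfolding E4_scale[symmetric] by (intro mult_left_mono add_mono E0_diff_le) auto
      also have "\<dots> = 4 * E0 (fc (W \<tau>)) + 4 * E0 (fc (X \<tau>)) + (4 * ?n * E4 (fc (y (max 0 \<tau>))) + 4 * ?n * E4 (fc (yr (max 0 \<tau>))))"
        by (simp add: algebra_simps)
      finally show ?thesis .
    qed
    have 2: "(\<integral>\<^sup>+\<tau>. indicator {0..t} \<tau> * E4 (fc (y (max 0 \<tau>))) \<partial>lborel) < \<infinity>"
       "(\<integral>\<^sup>+\<tau>. indicator {0..t} \<tau> * E4 (fc (yr (max 0 \<tau>))) \<partial>lborel) < \<infinity>"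
    proof -
      have "(\<integral>\<^sup>+\<tau>. indicator {0..t} \<tau> * E4 (fc (u (max 0 \<tau>))) \<partial>lborel) = (\<integral>\<^sup>+\<tau>. indicator {0..t} \<tau> * E4 (fc (u \<tau>)) \<partial>lborel)" for u
        by (rule nn_integral_cong) (auto simp: indicator_def)
      then show "(\<integral>\<^sup>+\<tau>. indicator {0..t} \<tau> * E4 (fc (y (max 0 \<tau>))) \<partial>lborel) < \<infinity>"
       "(\<integral>\<^sup>+\<tau>. indicator {0..t} \<tau> * E4 (fc (yr (max 0 \<tau>))) \<partial>lborel) < \<infinity>"
        using W(6)[OF t] X(6)[OF t] by simp_all
    qed
    have 3: "(\<integral>\<^sup>+\<tau>. indicator {0..t} \<tau> * E0 (fc (W \<tau>)) \<partial>lborel) < \<infinity>"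
       "(\<integral>\<^sup>+\<tau>. indicator {0..t} \<tau> * E0 (fc (X \<tau>)) \<partial>lborel) < \<infinity>"
    proof -
      have "W \<tau> \<in> borel_measurable TM" "X \<tau> \<in> borel_measurable TM" for \<tau>
        using measurable_Pair2[OF measurable_lborel_TM[OF W(1)], of \<tau>] measurable_Pair2[OF measurable_lborel_TM[OF X(1)], of \<tau>] by simp_all
      note n = this[THEN nn_integral_fc_le]
      show "(\<integral>\<^sup>+\<tau>. indicator {0..t} \<tau> * E0 (fc (W \<tau>)) \<partial>lborel) < \<infinity>"
        unfolding E0_def by (rule le_less_trans[OF _ W(3)[OF t]]) (intro nn_integral_mono mult_left_mono n; simp)
      show "(\<integral>\<^sup>+\<tau>. indicator {0..t} \<tau> * E0 (fc (X \<tau>)) \<partial>lborel) < \<infinity>"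
        unfolding E0_def by (rule le_less_trans[OF _ X(3)[OF t]]) (intro nn_integral_mono mult_left_mono n; simp)
    qed
    have "(\<integral>\<^sup>+\<tau>. indicator {0..t} \<tau> * E0 (h \<tau>) \<partial>lborel) \<le> (\<integral>\<^sup>+\<tau>. 4 * (indicator {0..t} \<tau> * E0 (fc (W \<tau>))) + 4 * (indicator {0..t} \<tau> * E0 (fc (X \<tau>)))
       + (4 * ?n * (indicator {0..t} \<tau> * E4 (fc (y (max 0 \<tau>)))) + 4 * ?n * (indicator {0..t} \<tau> * E4 (fc (yr (max 0 \<tau>))))) \<partial>lborel)"
    proof (rule nn_integral_mono)
      fix \<tau>
      show "indicator {0..t} \<tau> * E0 (h \<tau>) \<le> 4 * (indicator {0..t} \<tau> * E0 (fc (W \<tau>))) + 4 * (indicator {0..t} \<tau> * E0 (fc (X \<tau>)))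
       + (4 * ?n * (indicator {0..t} \<tau> * E4 (fc (y (max 0 \<tau>)))) + 4 * ?n * (indicator {0..t} \<tau> * E4 (fc (yr (max 0 \<tau>)))))"
        using 1[of \<tau>] by (cases "\<tau> \<in> {0..t}") simp_all
    qed
    also have "\<dots> = 4 * (\<integral>\<^sup>+\<tau>. indicator {0..t} \<tau> * E0 (fc (W \<tau>)) \<partial>lborel) + 4 * (\<integral>\<^sup>+\<tau>. indicator {0..t} \<tau> * E0 (fc (X \<tau>)) \<partial>lborel)
       + (4 * ?n * (\<integral>\<^sup>+\<tau>. indicator {0..t} \<tau> * E4 (fc (y (max 0 \<tau>))) \<partial>lborel) + 4 * ?n * (\<integral>\<^sup>+\<tau>. indicator {0..t} \<tau> * E4 (fc (yr (max 0 \<tau>))) \<partial>lborel))"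
      by (simp add: nn_integral_add nn_integral_cmult)
    also have "\<dots> < \<infinity>" using 2 3 by (simp add: ennreal_mult_less_top)
    finally show ?thesis .
  qed
  have eq: "AE t in lborel. 0 < t \<longrightarrow> (\<forall>k. h t k = lin k * (fc (y t) k - fc (yr t) k)
       - nu0 / 2 * (Bf (fc (y t)) (fc (y t)) k - Bf (fc (yr t)) (fc (yr t)) k) - fc (G t) k)"
    using W(2) X(2)
  proof eventually_elim
    case (elim t)
    show ?case
    proof (intro impI allI)
      fix k assume t: "0 < t"
      have s: "W t \<in> sq_int TM" "X t \<in> sq_int TM" "y t \<in> Sobolev L 4" "yr t \<in> Sobolev L 4" "G t \<in> sq_int TM"
        using elim t G by auto
      note K = KSop_fc[OF s(3)] KSop_fc[OF s(4)]
      have "AE x in TM. W t x + KSop (y t) x = f t x - G t x" "AE x in TM. X t x + KSop (yr t) x = f t x" using elim t by auto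
      then have "AE x in TM. W t x + KSop (y t) x = (X t x + KSop (yr t) x) - G t x" by eventually_elim simp
      then have "fc (\<lambda>x. W t x + KSop (y t) x) = fc (\<lambda>x. (X t x + KSop (yr t) x) - G t x)"
        by (intro fc_cong_AE sq_int_measurable sq_int_add sq_int_diff s K)
      then have "fc (\<lambda>x. W t x + KSop (y t) x) k = fc (\<lambda>x. (X t x + KSop (yr t) x) - G t x) k" by simp
      then have "fc (W t) k + fc (KSop (y t)) k = fc (X t) k + fc (KSop (yr t)) k - fc (G t) k"
        by (simp only: fc_add fc_diff sq_int_add s K)
      then show "h t k = lin k * (fc (y t) k - fc (yr t) k)
       - nu0 / 2 * (Bf (fc (y t)) (fc (y t)) k - Bf (fc (yr t)) (fc (yr t)) k) - fc (G t) k"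
        using t by (simp add: K h_def q_def w_def algebra_simps)
    qed
  qed
  show ?thesis by (rule that[OF m[unfolded w_def] hf eq])
qed

text \<open>The way back from coefficients to a strong solution. The new curve inherits the
  regularity of the reference and of \<open>z\<close> separately, and \<open>f\<close> enters only
  through the equation of the reference, to which that of \<open>z\<close> is added.\<close>

lemma KS_build:
  assumes yr: "KS_strong_solution L nu0 nu1 nu2 f yr"
    and z: "\<And>S. S \<ge> 0 \<Longrightarrow> modes S c h z" and c: "c \<in> H2"
    and hfin: "\<And>t. t \<ge> 0 \<Longrightarrow> (\<integral>\<^sup>+\<tau>. indicator {0..t} \<tau> * E0 (h \<tau>) \<partial>lborel) < \<infinity>"
    and z2: "\<And>t. t \<ge> 0 \<Longrightarrow> z t \<in> H2"
    and z0: "z 0 = c"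
    and G: "\<And>t. t \<ge> 0 \<Longrightarrow> G t \<in> sq_int TM"
    and h: "AE t in lborel. 0 < t \<longrightarrow> (\<forall>k. h t k = lin k * z t k
       - nu0 / 2 * (Bf (fc (ye t)) (fc (ye t)) k - Bf (fc (yr t)) (fc (yr t)) k) - fc (G t) k)"
    and ye: "\<And>t. t \<ge> 0 \<Longrightarrow> ye t \<in> sq_int TM" "\<And>t k. t \<ge> 0 \<Longrightarrow> fc (ye t) k = fc (yr t) k + z t k"
  shows "KS_strong_solution L nu0 nu1 nu2 (\<lambda>t x. f t x - G t x) ye"
proof -
  obtain X where X: "(\<lambda>(\<tau>, x). X \<tau> x) \<in> borel_measurable (borel \<Otimes>\<^sub>M borel)"
    "AE t in lborel. 0 < t \<longrightarrow> yr t \<in> Sobolev L 4 \<and> X t \<in> sq_int TM \<and> (AE x in TM. X t x + KSop (yr t) x = f t x)"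
    "\<And>t. t \<ge> 0 \<Longrightarrow> (\<integral>\<^sup>+\<tau>. indicator {0..t} \<tau> * (\<integral>\<^sup>+x. ennreal ((X \<tau> x)\<^sup>2) \<partial>TM) \<partial>lborel) < \<infinity>"
    "\<And>t k. t \<ge> 0 \<Longrightarrow> fc (yr t) k = fc (yr 0) k + (LINT \<tau>:{0..t}|lborel. fc (X \<tau>) k)"
    "\<And>t k. t \<ge> 0 \<Longrightarrow> set_integrable lborel {0..t} (\<lambda>\<tau>. fc (X \<tau>) k)"
    "\<And>t. t \<ge> 0 \<Longrightarrow> (\<integral>\<^sup>+\<tau>. indicator {0..t} \<tau> * E4 (fc (yr \<tau>)) \<partial>lborel) < \<infinity>"
    "\<And>k. continuous_on UNIV (\<lambda>t. fc (yr (max 0 t)) k)"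
    by (rule KS_forward[OF yr]) blast
  have yr2: "yr t \<in> Sobolev L 2" if "t \<ge> 0" for t using yr that by (simp add: KS_solution_iff)
  have zm [measurable]: "(\<lambda>t. z t k) \<in> borel_measurable borel" and hm [measurable]: "(\<lambda>t. h t k) \<in> borel_measurable borel" for k
    using z[of 0] by (auto simp: modes_def)
  define q where "q t k = h t k - nu2 * (lam k)\<^sup>2 * z t k" for t k
  have qm [measurable]: "(\<lambda>t. q t k) \<in> borel_measurable borel" for k unfolding q_def by measurable
  have [measurable]: "(\<lambda>\<tau>. E4 (z \<tau>)) \<in> borel_measurable borel" "(\<lambda>\<tau>. E0 (h \<tau>)) \<in> borel_measurable borel" "(\<lambda>\<tau>. E0 (q \<tau>)) \<in> borel_measurable borel"
    by (intro measurable_E zm hm qm)+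
  have z4: "(\<integral>\<^sup>+\<tau>. indicator {0..t} \<tau> * E4 (z \<tau>) \<partial>lborel) < \<infinity>" if t: "t \<ge> 0" for t
  proof -
    have "ennreal (nu2\<^sup>2) * (\<integral>\<^sup>+s. indicator {0..t} s * E4 (z s) \<partial>lborel)
       \<le> ennreal nu2 * E2 (z t) + ennreal (nu2\<^sup>2) * (\<integral>\<^sup>+s. indicator {0..t} s * E4 (z s) \<partial>lborel)" by simp
    also have "\<dots> \<le> ennreal nu2 * E2 c + (\<integral>\<^sup>+s. indicator {0..t} s * E0 (h s) \<partial>lborel)"
      by (rule modes_energy_le[OF t order_refl z[OF t]])
    also have "\<dots> < \<infinity>" using hfin[OF t] c by (simp add: ennreal_mult_less_top E2_finite_iff[symmetric])
    finally show ?thesis using nu2_pos by (auto simp: ennreal_mult_less_top)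
  qed
  have qfin: "(\<integral>\<^sup>+\<tau>. indicator {0..t} \<tau> * E0 (q \<tau>) \<partial>lborel) < \<infinity>" if t: "t \<ge> 0" for t
  proof -
    have "E0 (q \<tau>) \<le> 2 * (E0 (h \<tau>) + ennreal (nu2\<^sup>2) * E4 (z \<tau>))" for \<tau>
      using E0_diff_le[of "h \<tau>" "\<lambda>k. nu2 * ((lam k)\<^sup>2 * z \<tau> k)"] unfolding E4_scale by (simp add: q_def[abs_def] mult.assoc)
    then have 1: "E0 (q \<tau>) \<le> 2 * E0 (h \<tau>) + 2 * ennreal (nu2\<^sup>2) * E4 (z \<tau>)" for \<tau>
      by (simp add: distrib_left mult.assoc)
    have "(\<integral>\<^sup>+\<tau>. indicator {0..t} \<tau> * E0 (q \<tau>) \<partial>lborel) \<le> (\<integral>\<^sup>+\<tau>. 2 * (indicator {0..t} \<tau> * E0 (h \<tau>)) + 2 * ennreal (nu2\<^sup>2) * (indicator {0..t} \<tau> * E4 (z \<tau>)) \<partial>lborel)"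
    proof (rule nn_integral_mono)
      show "indicator {0..t} \<tau> * E0 (q \<tau>) \<le> 2 * (indicator {0..t} \<tau> * E0 (h \<tau>)) + 2 * ennreal (nu2\<^sup>2) * (indicator {0..t} \<tau> * E4 (z \<tau>))" for \<tau>
        using 1[of \<tau>] by (cases "\<tau> \<in> {0..t}") simp_all
    qed
    also have "\<dots> = 2 * (\<integral>\<^sup>+\<tau>. indicator {0..t} \<tau> * E0 (h \<tau>) \<partial>lborel) + 2 * ennreal (nu2\<^sup>2) * (\<integral>\<^sup>+\<tau>. indicator {0..t} \<tau> * E4 (z \<tau>) \<partial>lborel)"
      by (simp add: nn_integral_add nn_integral_cmult)
    also have "\<dots> < \<infinity>" using hfin[OF t] z4[OF t] by (simp add: ennreal_mult_less_top)
    finally show ?thesis .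
  qed
  have qae: "AE t in lborel. 0 \<le> t \<longrightarrow> q t \<in> sq_int CM"
    unfolding E0_finite_iff[symmetric] by (rule AE_finite_of_nn_integral[OF _ qfin]) measurable
  have zae: "AE t in lborel. 0 \<le> t \<longrightarrow> z t \<in> H4"
    unfolding E4_finite_iff[symmetric] by (rule AE_finite_of_nn_integral[OF _ z4]) measurable
  have ye4: "AE t in lborel. 0 < t \<longrightarrow> ye t \<in> Sobolev L 4"
    using X(2) zae
  proof eventually_elim
    case (elim t)
    show ?case
    proof
      assume t: "0 < t"
      have "(\<lambda>k. (lam k)\<^sup>2 * fc (yr t) k + (lam k)\<^sup>2 * z t k) \<in> sq_int CM"
        by (rule sq_int_add) (use elim t in \<open>auto simp: Sobolev4_iff H4_def\<close>)
      then show "ye t \<in> Sobolev L 4" using t by (simp add: Sobolev4_iff H4_def ye distrib_left)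
    qed
  qed
  have ye2: "ye t \<in> Sobolev L 2" if t: "t \<ge> 0" for t
  proof -
    have "(\<lambda>k. lam k * fc (yr t) k + lam k * z t k) \<in> sq_int CM"
      by (rule sq_int_add) (use yr2[OF t] z2[OF t] in \<open>auto simp: Sobolev2_iff H2_def\<close>)
    then show ?thesis using t by (simp add: Sobolev2_iff H2_def ye distrib_left)
  qed
  \<comment> \<open>The velocity of the new curve: that of the reference plus the synthesis of the
    velocity \<open>q\<close> of \<open>z\<close>. The joint measurability of \<open>syn\<close>
    makes it a Borel function of time and space.\<close>
  define W where "W t x = X t x + syn (q t) x" for t x
  have synm: "(\<lambda>(t, x). syn (q t) x) \<in> borel_measurable (borel \<Otimes>\<^sub>M borel)" by (rule syn_param_measurable) measurable
  have Wm: "(\<lambda>(\<tau>, x). W \<tau> x) \<in> borel_measurable (borel \<Otimes>\<^sub>M borel)"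
    unfolding W_def split_def by (intro borel_measurable_add) (use X(1) synm in \<open>simp_all add: split_def\<close>)
  have meas: "X \<tau> \<in> borel_measurable TM" "syn (q \<tau>) \<in> borel_measurable TM" for \<tau>
    using measurable_Pair2[OF measurable_lborel_TM[OF X(1)], of \<tau>] borel_measurable_TM[OF syn_measurable] by simp_all
  have Wfin: "(\<integral>\<^sup>+\<tau>. indicator {0..t} \<tau> * (\<integral>\<^sup>+x. ennreal ((W \<tau> x)\<^sup>2) \<partial>TM) \<partial>lborel) < \<infinity>" if t: "t \<ge> 0" for t
  proof -
    let ?X = "\<lambda>\<tau>. \<integral>\<^sup>+x. ennreal ((X \<tau> x)\<^sup>2) \<partial>TM"
    have [measurable]: "?X \<in> borel_measurable lborel"
      by (rule TM.borel_measurable_nn_integral) (use measurable_lborel_TM[OF X(1)] in \<open>simp add: split_def\<close>)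
    have "(\<integral>\<^sup>+\<tau>. indicator {0..t} \<tau> * (\<integral>\<^sup>+x. ennreal ((W \<tau> x)\<^sup>2) \<partial>TM) \<partial>lborel)
       \<le> (\<integral>\<^sup>+\<tau>. 2 * (indicator {0..t} \<tau> * ?X \<tau>) + 2 * (indicator {0..t} \<tau> * E0 (q \<tau>)) \<partial>lborel)"
    proof (rule nn_integral_mono_AE, use qae in eventually_elim)
      fix \<tau> assume q: "0 \<le> \<tau> \<longrightarrow> q \<tau> \<in> sq_int CM"
      show "indicator {0..t} \<tau> * (\<integral>\<^sup>+x. ennreal ((W \<tau> x)\<^sup>2) \<partial>TM) \<le> 2 * (indicator {0..t} \<tau> * ?X \<tau>) + 2 * (indicator {0..t} \<tau> * E0 (q \<tau>))"
      proof (cases "\<tau> \<in> {0..t}")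
        case True
        then have q: "q \<tau> \<in> sq_int CM" using q by simp
        have "(\<integral>\<^sup>+x. ennreal ((syn (q \<tau>) x)\<^sup>2) \<partial>TM) = E0 (q \<tau>)"
          unfolding E0_def nn_integral_sq[OF q] nn_integral_sq[OF syn_close(1)[OF q]] nrm_syn[OF q] ..
        then have "(\<integral>\<^sup>+x. ennreal ((W \<tau> x)\<^sup>2) \<partial>TM) \<le> 2 * (?X \<tau> + E0 (q \<tau>))"
          using nn_integral_sq_add_le[OF meas, of \<tau> \<tau>] by (simp add: W_def)
        then show ?thesis using True by (simp add: distrib_left)
      qed simp
    qed
    also have "\<dots> = 2 * (\<integral>\<^sup>+\<tau>. indicator {0..t} \<tau> * ?X \<tau> \<partial>lborel) + 2 * (\<integral>\<^sup>+\<tau>. indicator {0..t} \<tau> * E0 (q \<tau>) \<partial>lborel)"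
      by (simp add: nn_integral_add nn_integral_cmult)
    also have "\<dots> < \<infinity>" using X(3)[OF t] qfin[OF t] by (simp add: ennreal_mult_less_top)
    finally show ?thesis .
  qed
  have fcW: "AE t in lborel. 0 < t \<longrightarrow> (\<forall>k. fc (W t) k = fc (X t) k + q t k)"
    using X(2) qae
  proof eventually_elim
    case (elim t)
    show ?case
    proof (intro impI allI)
      fix k assume "0 < t"
      then have s: "X t \<in> sq_int TM" "q t \<in> sq_int CM" using elim by auto
      show "fc (W t) k = fc (X t) k + q t k"
        unfolding W_def[abs_def] by (simp add: fc_add[OF s(1) syn_close(1)[OF s(2)]] fc_syn[OF s(2)])
    qed
  qed
  have Wmodes: "fc (ye t) k = fc (ye 0) k + (LINT \<tau>:{0..t}|lborel. fc (W \<tau>) k)" if t: "t \<ge> 0" for t k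
  proof -
    have i: "set_integrable lborel {0..t} (\<lambda>\<tau>. q \<tau> k)" and zt: "z t k = c k + (LINT \<tau>:{0..t}|lborel. q \<tau> k)"
      using z[OF t] t by (auto simp: modes_def q_def)
    have "fc (ye t) k = (fc (yr 0) k + (LINT \<tau>:{0..t}|lborel. fc (X \<tau>) k)) + (c k + (LINT \<tau>:{0..t}|lborel. q \<tau> k))"
      unfolding ye(2)[OF t] X(4)[OF t, symmetric] zt[symmetric] ..
    also have "\<dots> = fc (ye 0) k + (LINT \<tau>:{0..t}|lborel. fc (X \<tau>) k + q \<tau> k)"
      by (simp add: ye(2) z0 set_integral_add(2)[OF X(5)[OF t] i])
    also have "(LINT \<tau>:{0..t}|lborel. fc (X \<tau>) k + q \<tau> k) = (LINT \<tau>:{0..t}|lborel. fc (W \<tau>) k)"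
      unfolding set_lebesgue_integral_real
    proof (rule integral_cong_AE)
      show "AE \<tau> in lborel. indicator {0..t} \<tau> * (fc (X \<tau>) k + q \<tau> k) = indicator {0..t} \<tau> * fc (W \<tau>) k"
        using fcW AE_lborel_singleton[of 0] by eventually_elim (auto simp: indicator_def)
    qed (use fc_param_measurable[OF X(1), of k] fc_param_measurable[OF Wm, of k] in measurable)
    finally show ?thesis .
  qed
  have td: "time_deriv L ye W" by (rule time_deriv_of_modes[OF Wm Wfin ye(1) Wmodes])
  have eq: "AE t in lborel. 0 < t \<longrightarrow> (AE x in TM. W t x + KSop (ye t) x = f t x - G t x)"
    using X(2) qae ye4 h
  proof eventually_elim
    case (elim t)
    show ?case
    proof
      assume t: "0 < t"
      then have t': "0 \<le> t" by simp
      have s: "X t \<in> sq_int TM" "q t \<in> sq_int CM" "syn (q t) \<in> sq_int TM" "yr t \<in> Sobolev L 4" "ye t \<in> Sobolev L 4" "G t \<in> sq_int TM"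
        using elim t G[OF t'] by (auto intro: syn_close(1))
      note K = KSop_fc[OF s(4)] KSop_fc[OF s(5)]
      have "AE x in TM. syn (q t) x + KSop (ye t) x = KSop (yr t) x - G t x"
      proof (rule fc_inj)
        fix k
        have "h t k = lin k * z t k - nu0 / 2 * (Bf (fc (ye t)) (fc (ye t)) k - Bf (fc (yr t)) (fc (yr t)) k) - fc (G t) k"
          using elim t by blast
        then have "q t k + fc (KSop (ye t)) k = fc (KSop (yr t)) k - fc (G t) k"
          unfolding K(2,4) ye(2)[OF t'] q_def by (simp add: algebra_simps)
        then show "fc (\<lambda>x. syn (q t) x + KSop (ye t) x) k = fc (\<lambda>x. KSop (yr t) x - G t x) k"
          by (simp only: fc_add fc_diff s K(1,3) fc_syn[OF s(2)])
      qed (intro sq_int_add sq_int_diff s K)+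
      moreover have "AE x in TM. X t x + KSop (yr t) x = f t x" using elim t by blast
      ultimately show "AE x in TM. W t x + KSop (ye t) x = f t x - G t x" by eventually_elim (simp add: W_def)
    qed
  qed
  have "in_L2_DA L nu2 0 S ye" if S: "S > 0" for S
    unfolding in_L2_DA_def
  proof (intro conjI ballI)
    have DA: "in_L2_DA L nu2 0 S yr" using yr S by (simp add: KS_solution_iff)
    show "AE t in lebesgue_on {0<..<S}. ye t \<in> Sobolev L 4"
      using ye4 by (auto simp: AE_lebesgue_on_iff elim!: eventually_mono)
    show "(\<lambda>t. L2_inner L (A_op L nu2 (ye t)) g) \<in> borel_measurable (lebesgue_on {0<..<S})" if g: "g \<in> L2_space L" for g
    proof (rule borel_measurable_lebesgue_on_AE)
      \<comment> \<open>Weak measurability splits: for the reference it is part of the solution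
        concept, for \<open>z\<close> it is a Parseval sum of measurable coefficients.\<close>
      let ?Z = "\<lambda>t. \<integral>k. nu2 * ((lam k)\<^sup>2 * z t k) * fc g k \<partial>CM"
      have g': "g \<in> sq_int TM" using g by (simp add: L2_space_eq)
      interpret CM: sigma_finite_measure "CM :: (int^'n) measure" by (rule sigma_finite_measure_count_space)
      have "(\<lambda>(t, k). nu2 * ((lam k)\<^sup>2 * z t k) * fc g k) \<in> borel_measurable (borel \<Otimes>\<^sub>M CM)"
        unfolding split_def
        by (rule measurable_compose_countable[where f = "\<lambda>k p. nu2 * ((lam k)\<^sup>2 * z (fst p) k) * fc g k" and g = snd]) measurable
      then have Zm: "?Z \<in> borel_measurable borel"
        by (rule CM.borel_measurable_lebesgue_integral)
      show "(\<lambda>t. L2_inner L (A_op L nu2 (yr t)) g + ?Z t) \<in> borel_measurable (lebesgue_on {0<..<S})"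
      proof (rule borel_measurable_add)
        show "(\<lambda>t. L2_inner L (A_op L nu2 (yr t)) g) \<in> borel_measurable (lebesgue_on {0<..<S})"
          using DA g by (simp add: in_L2_DA_def)
        show "?Z \<in> borel_measurable (lebesgue_on {0<..<S})"
          by (intro measurable_restrict_space1 measurable_completion) (use Zm in simp)
      qed
      have "AE t in lborel. t \<in> {0<..<S} \<longrightarrow> L2_inner L (A_op L nu2 (ye t)) g = L2_inner L (A_op L nu2 (yr t)) g + ?Z t"
        using X(2) ye4 zae
      proof eventually_elim
        case (elim t)
        show ?case
        proof
          assume "t \<in> {0<..<S}"
          then have t: "0 \<le> t" and s: "yr t \<in> Sobolev L 4" "ye t \<in> Sobolev L 4" "z t \<in> H4" using elim by auto
          note A = A_op_fc[OF s(1), of nu2] A_op_fc[OF s(2), of nu2]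
          have fg: "fc g \<in> sq_int CM" by (rule fc_l2(1)[OF g'])
          have i1: "integrable CM (\<lambda>k. fc (A_op L nu2 (yr t)) k * fc g k)"
            by (rule sq_int_mult_integrable[OF fc_l2(1)[OF A(1)] fg])
          have i2: "integrable CM (\<lambda>k. nu2 * ((lam k)\<^sup>2 * z t k) * fc g k)"
            by (rule sq_int_mult_integrable[OF sq_int_scale fg]) (use s in \<open>simp add: H4_def\<close>)
          have "L2_inner L (A_op L nu2 (ye t)) g = (\<integral>k. fc (A_op L nu2 (ye t)) k * fc g k \<partial>CM)"
            unfolding L2_inner_def by (rule Parseval[OF A(3) g'])
          also have "\<dots> = (\<integral>k. fc (A_op L nu2 (yr t)) k * fc g k + nu2 * ((lam k)\<^sup>2 * z t k) * fc g k \<partial>CM)"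
            unfolding A(2,4) ye(2)[OF t] by (simp add: algebra_simps)
          also have "\<dots> = (\<integral>k. fc (A_op L nu2 (yr t)) k * fc g k \<partial>CM) + ?Z t"
            by (rule Bochner_Integration.integral_add[OF i1 i2])
          also have "(\<integral>k. fc (A_op L nu2 (yr t)) k * fc g k \<partial>CM) = L2_inner L (A_op L nu2 (yr t)) g"
            unfolding L2_inner_def by (rule Parseval[OF A(1) g', symmetric])
          finally show "L2_inner L (A_op L nu2 (ye t)) g = L2_inner L (A_op L nu2 (yr t)) g + ?Z t" .
        qed
      qed
      then show "AE t in lebesgue_on {0<..<S}. L2_inner L (A_op L nu2 (ye t)) g = L2_inner L (A_op L nu2 (yr t)) g + ?Z t"
        by (simp add: AE_lebesgue_on_iff)
    qed simp
    have "(\<integral>\<^sup>+t. ennreal ((DA_norm L nu2 (ye t))\<^sup>2) \<partial>lebesgue_on {0<..<S}) < \<infinity>"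
    proof -
      have e: "(\<integral>\<^sup>+\<tau>. indicator {0..S} \<tau> * E4 (fc (yr (max 0 \<tau>))) \<partial>lborel) = (\<integral>\<^sup>+\<tau>. indicator {0..S} \<tau> * E4 (fc (yr \<tau>)) \<partial>lborel)"
        by (rule nn_integral_cong) (auto simp: indicator_def)
      have [measurable]: "(\<lambda>\<tau>. E4 (fc (yr (max 0 \<tau>)))) \<in> borel_measurable borel"
        by (rule measurable_E) (rule borel_measurable_continuous_onI[OF X(7)])
      let ?n = "ennreal (nu2\<^sup>2)"
      have "(\<integral>\<^sup>+t. ennreal ((DA_norm L nu2 (ye t))\<^sup>2) \<partial>lebesgue_on {0<..<S})
        \<le> (\<integral>\<^sup>+\<tau>. 2 * ?n * (indicator {0..S} \<tau> * E4 (fc (yr (max 0 \<tau>)))) + 2 * ?n * (indicator {0..S} \<tau> * E4 (z \<tau>)) \<partial>lborel)"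
        unfolding nn_integral_lebesgue_on[OF borel_open[OF open_greaterThanLessThan]]
      proof (rule nn_integral_mono_AE, use ye4 in eventually_elim)
        fix t assume y4: "0 < t \<longrightarrow> ye t \<in> Sobolev L 4"
        show "ennreal ((DA_norm L nu2 (ye t))\<^sup>2) * indicator {0<..<S} t
          \<le> 2 * ?n * (indicator {0..S} t * E4 (fc (yr (max 0 t)))) + 2 * ?n * (indicator {0..S} t * E4 (z t))"
        proof (cases "t \<in> {0<..<S}")
          case True
          then have y4: "ye t \<in> Sobolev L 4" and t: "t \<ge> 0" using y4 by auto
          have "(\<lambda>k. nu2 * ((lam k)\<^sup>2 * fc (ye t) k)) \<in> sq_int CM"
            by (rule sq_int_scale) (use y4 in \<open>simp add: Sobolev4_iff H4_def\<close>)
          then have "ennreal ((DA_norm L nu2 (ye t))\<^sup>2) = E0 (\<lambda>k. nu2 * ((lam k)\<^sup>2 * fc (ye t) k))"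
            unfolding DA_norm_eq[OF y4] nrm_scale[symmetric] E0_def by (rule nn_integral_sq[symmetric])
          also have "\<dots> = E0 (\<lambda>k. nu2 * ((lam k)\<^sup>2 * fc (yr t) k) + nu2 * ((lam k)\<^sup>2 * z t k))"
            by (simp add: ye(2)[OF t] distrib_left)
          also have "\<dots> \<le> 2 * (?n * E4 (fc (yr t)) + ?n * E4 (z t))"
            unfolding E4_scale[symmetric] by (rule E0_add_le)
          finally show ?thesis using True by (simp add: distrib_left mult.assoc)
        qed simp
      qed
      also have "\<dots> = 2 * ?n * (\<integral>\<^sup>+\<tau>. indicator {0..S} \<tau> * E4 (fc (yr (max 0 \<tau>))) \<partial>lborel) + 2 * ?n * (\<integral>\<^sup>+\<tau>. indicator {0..S} \<tau> * E4 (z \<tau>) \<partial>lborel)"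
        by (simp add: nn_integral_add nn_integral_cmult)
      also have "\<dots> < \<infinity>" using X(6)[of S] z4[of S] S unfolding e by (simp add: ennreal_mult_less_top)
      finally show ?thesis .
    qed
    then show "L2_DA_norm L nu2 0 S ye < \<infinity>" unfolding L2_DA_norm_def Let_def by (auto simp: less_top)
  qed
  then show ?thesis unfolding KS_solution_iff using ye2 td eq by blast
qed

end

context torus3
begin

section \<open>The truncated error equation\<close>

lemma vn_scale: "vn (\<lambda>k. s * c k) = \<bar>s\<bar> * vn c"
proof -
  have "(\<lambda>k. lam k * (s * c k)) = (\<lambda>k. s * (lam k * c k))" by (simp add: fun_eq_iff)
  then show ?thesis by (simp add: vn_def nrm_scale)
qed

lemma H2_scale: "c \<in> H2 \<Longrightarrow> (\<lambda>k. s * c k) \<in> H2"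
  using H2_lin[of c c s 0] by simp

lemma H2_add: "c \<in> H2 \<Longrightarrow> d \<in> H2 \<Longrightarrow> (\<lambda>k. c k + d k) \<in> H2"
  using H2_lin[of c d 1 1] by simp

lemma H2_diff: "c \<in> H2 \<Longrightarrow> d \<in> H2 \<Longrightarrow> (\<lambda>k. c k - d k) \<in> H2"
  using H2_lin[of c d 1 "-1"] by simp

lemma vn_triangle: "c \<in> H2 \<Longrightarrow> d \<in> H2 \<Longrightarrow> vn (\<lambda>k. c k + d k) \<le> vn c + vn d"
  unfolding vn_def H2_def distrib_left by (rule nrm_triangle) auto

lemma vn_minus_commute: "vn (\<lambda>k. c k - d k) = vn (\<lambda>k. d k - c k)"
  unfolding vn_def right_diff_distrib by (rule nrm_minus_commute)

lemma vn_diff_abs: "c \<in> H2 \<Longrightarrow> d \<in> H2 \<Longrightarrow> \<bar>vn c - vn d\<bar> \<le> vn (\<lambda>k. c k - d k)"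
  using vn_triangle[OF H2_diff[of c d], of d] vn_triangle[OF H2_diff[of d c], of c] vn_minus_commute[of c d] by simp

lemma nrm_le_vn: "c \<in> H2 \<Longrightarrow> nrm CM c \<le> vn c"
proof -
  assume "c \<in> H2"
  then have "(\<lambda>k. lam k * c k) \<in> sq_int CM" by (simp add: H2_def)
  moreover have "\<bar>c k\<bar> \<le> \<bar>lam k * c k\<bar>" for k
    using mult_right_mono[OF lam_ge1[of k], of "\<bar>c k\<bar>"] lam_gt0[of k] by (simp add: abs_mult)
  ultimately show ?thesis unfolding vn_def by (intro sq_int_bound(2)) auto
qed

lemma crep_vn_bound: "c \<in> H2 \<Longrightarrow> \<bar>crep c x\<bar> \<le> (2 / sqrt vol * S0) * vn c"
proof -
  assume c: "c \<in> H2"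
  have "\<bar>crep c x\<bar> \<le> (2 / sqrt vol) * (\<integral>k. \<bar>c k\<bar> \<partial>CM)" by (rule crep_bound[OF H2_abs_summable(1)[OF c]])
  also have "\<dots> \<le> (2 / sqrt vol) * (S0 * vn c)"
    using vol_pos by (intro mult_left_mono H2_abs_summable(2) c) auto
  finally show ?thesis by (simp add: mult.assoc)
qed

definition rad :: "real \<Rightarrow> (int^'n \<Rightarrow> real) \<Rightarrow> int^'n \<Rightarrow> real" where
  "rad b c k = b / max b (vn c) * c k"

lemma rad_id: "b > 0 \<Longrightarrow> vn c \<le> b \<Longrightarrow> rad b c = c"
  by (simp add: rad_def fun_eq_iff max_def)

lemma rad_H2: "c \<in> H2 \<Longrightarrow> rad b c \<in> H2"
  unfolding rad_def[abs_def] by (rule H2_scale)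

lemma rad_bound:
  assumes b: "b > 0" shows "vn (rad b c) \<le> b" "vn (rad b c) \<le> vn c"
proof -
  have m: "max b (vn c) > 0" "vn c \<le> max b (vn c)" "b \<le> max b (vn c)" using b by auto
  have e: "vn (rad b c) = b / max b (vn c) * vn c" unfolding rad_def[abs_def] vn_scale using b m by simp
  have "b * (vn c / max b (vn c)) \<le> b * 1" using m b by (intro mult_left_mono) auto
  then show "vn (rad b c) \<le> b" unfolding e by simp
  have "b / max b (vn c) * vn c \<le> 1 * vn c" using m b by (intro mult_right_mono) auto
  then show "vn (rad b c) \<le> vn c" unfolding e by simp
qed

text \<open>The difference is b/mc times c - d plus a multiple of d carrying the change md - mc of
  the denominator; each part is at most vn (c - d). The constant 2 from this triangle inequality
  suffices for the Picard iteration.\<close>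

lemma rad_lipschitz:
  assumes b: "b > 0" and c: "c \<in> H2" and d: "d \<in> H2"
  shows "vn (\<lambda>k. rad b c k - rad b d k) \<le> 2 * vn (\<lambda>k. c k - d k)"
proof -
  define mc md where "mc = max b (vn c)" and "md = max b (vn d)"
  define e where "e k = c k - d k" for k
  have m: "mc > 0" "md > 0" "b \<le> mc" "vn d \<le> md" using b by (auto simp: mc_def md_def)
  have eH: "e \<in> H2" unfolding e_def[abs_def] by (rule H2_diff[OF c d])
  have "\<bar>mc - md\<bar> \<le> \<bar>vn c - vn d\<bar>" unfolding mc_def md_def by linarith
  also have "\<dots> \<le> vn e" unfolding e_def[abs_def] by (rule vn_diff_abs[OF c d])
  finally have mm: "\<bar>md - mc\<bar> \<le> vn e" by simp
  have r: "rad b c k - rad b d k = b / mc * e k + b * (md - mc) / (mc * md) * d k" for k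
    using m by (simp add: rad_def mc_def[symmetric] md_def[symmetric] e_def field_simps)
  have "vn (\<lambda>k. rad b c k - rad b d k) \<le> vn (\<lambda>k. b / mc * e k) + vn (\<lambda>k. b * (md - mc) / (mc * md) * d k)"
    unfolding r by (intro vn_triangle H2_scale eH d)
  also have "vn (\<lambda>k. b / mc * e k) \<le> vn e"
    unfolding vn_scale using m b mult_right_mono[of "b / mc" 1 "vn e"] by simp
  also have "vn (\<lambda>k. b * (md - mc) / (mc * md) * d k) = (b / mc) * (vn d / md) * \<bar>md - mc\<bar>"
    unfolding vn_scale using m b by (simp add: abs_mult)
  also have "\<dots> \<le> 1 * 1 * vn e"
    using m b by (intro mult_mono mm) auto
  finally show ?thesis by (simp add: e_def[abs_def])
qed

lemma Bf_square_diff: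
  assumes c: "c \<in> H2" and d: "d \<in> H2"
  shows "Bf c c k - Bf d d k = Bf (\<lambda>k. c k - d k) c k + Bf (\<lambda>k. c k - d k) d k"
  using Bf_linear[OF c d c, of 1 "-1" k] Bf_linear[OF c d d, of 1 "-1" k] Bf_commute[of d c] by simp

lemma Bf_square_add:
  assumes c: "c \<in> H2" and d: "d \<in> H2"
  shows "Bf (\<lambda>k. c k + d k) (\<lambda>k. c k + d k) k - Bf c c k = 2 * Bf c d k + Bf d d k"
proof -
  have s: "(\<lambda>k. c k + d k) \<in> H2" by (rule H2_add[OF c d])
  show ?thesis
    using Bf_linear[OF c d s, of 1 1 k] Bf_linear[OF c d c, of 1 1 k] Bf_linear[OF c d d, of 1 1 k]
      Bf_commute[of "\<lambda>k. c k + d k" c] Bf_commute[of "\<lambda>k. c k + d k" d] Bf_commute[of c d] by simp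
qed

text \<open>The weight lam^2 cancels the denominator in \<open>ib\<close>, and the remaining sum
  over k of z_k bas k (p_j) is the value of z at the sensor.\<close>

lemma feedback_energy:
  assumes z: "z \<in> H2"
  shows "integrable CM (\<lambda>k. (lam k)\<^sup>2 * z k * ib m p v k)"
    and "(\<integral>k. (lam k)\<^sup>2 * z k * ib m p v k \<partial>CM) = (\<Sum>j<m. vec_index v j * crep z (p j))"
proof -
  have e: "(lam k)\<^sup>2 * z k * ib m p v k = (\<Sum>j<m. vec_index v j * (z k * bas k (p j)))" for k
  proof -
    have "(lam k)\<^sup>2 * z k * ib m p v k = z k * (\<Sum>j<m. vec_index v j * bas k (p j))"
      using lam_gt0[of k] by (simp add: ib_def)
    then show ?thesis by (simp add: sum_distrib_left mult.left_commute)
  qed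
  have i: "integrable CM (\<lambda>k. vec_index v j * (z k * bas k (p j)))" for j
    by (intro integrable_mult_right crep_integrable H2_abs_summable z)
  show "integrable CM (\<lambda>k. (lam k)\<^sup>2 * z k * ib m p v k)" unfolding e by (rule Bochner_Integration.integrable_sum) (rule i)
  show "(\<integral>k. (lam k)\<^sup>2 * z k * ib m p v k \<partial>CM) = (\<Sum>j<m. vec_index v j * crep z (p j))"
    unfolding e by (subst Bochner_Integration.integral_sum[OF i]) (simp add: crep_def)
qed

text \<open>Membership and bound are kept together so that the estimate of a composite expression is
  assembled by its syntax, each rule supplying its share of the constant.\<close>

definition bd :: "(int^'n \<Rightarrow> real) \<Rightarrow> real \<Rightarrow> bool" where
  "bd c B \<longleftrightarrow> c \<in> sq_int CM \<and> nrm CM c \<le> B"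

lemma bd_add: "bd c A \<Longrightarrow> bd d B \<Longrightarrow> bd (\<lambda>k. c k + d k) (A + B)"
  unfolding bd_def using nrm_triangle[of c CM d] by (auto intro: sq_int_add)

lemma bd_diff: "bd c A \<Longrightarrow> bd d B \<Longrightarrow> bd (\<lambda>k. c k - d k) (A + B)"
  unfolding bd_def using nrm_triangle_diff[of c CM d] by (auto intro: sq_int_diff)

lemma bd_scale: "s \<ge> 0 \<Longrightarrow> bd c A \<Longrightarrow> bd (\<lambda>k. s * c k) (s * A)"
  unfolding bd_def by (auto intro: sq_int_scale simp: nrm_scale mult_left_mono)

lemma bd_Bf: "c \<in> H2 \<Longrightarrow> d \<in> H2 \<Longrightarrow> vn c \<le> A \<Longrightarrow> vn d \<le> B \<Longrightarrow> bd (Bf c d) (CB * A * B)"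
  unfolding bd_def
proof
  assume c: "c \<in> H2" and d: "d \<in> H2" and A: "vn c \<le> A" and B: "vn d \<le> B"
  show "Bf c d \<in> sq_int CM" by (rule Bf_bound(1)[OF c d])
  have "nrm CM (Bf c d) \<le> CB * vn c * vn d" by (rule Bf_bound(2)[OF c d])
  also have "\<dots> \<le> CB * A * B"
    using order_trans[OF vn_nonneg A] by (intro mult_mono A B mult_nonneg_nonneg CB_nonneg vn_nonneg order_refl)
  finally show "nrm CM (Bf c d) \<le> CB * A * B" .
qed

end

text \<open>\<open>r\<close> stands for the coefficients of the reference with the constant mode
  removed and with time frozen before 0, \<open>a\<close> for the gain divided by nu2, and
  \<open>b\<close> for the truncation radius measured by \<open>vn\<close>.\<close>

locale observer = ks_torus L nu0 nu1 nu2
  for L :: "real^'n" and nu0 nu1 nu2 :: real +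
  fixes r :: "real \<Rightarrow> int^'n \<Rightarrow> real" and Cr :: real and m :: nat and p :: "nat \<Rightarrow> real^'n"
    and \<Lambda> :: "real mat" and a b :: real
  assumes r_H2: "r t \<in> H2" and r_bound: "vn (r t) \<le> Cr"
    and r_meas: "(\<lambda>t. r t k) \<in> borel_measurable borel"
    and Lam: "\<Lambda> \<in> carrier_mat m m" and a_pos: "a > 0" and b_pos: "b > 0"
begin

definition obs :: "(int^'n \<Rightarrow> real) \<Rightarrow> real Matrix.vec" where
  "obs c = \<Lambda> *\<^sub>v Matrix.vec m (\<lambda>j. crep c (p j))"

text \<open>All terms of the error equation except the principal part and the feedback. Expanding
  the square of the gradient of r + z gives the terms 2 Bf r z and Bf z z, each times nu0/2; only
  the second is truncated.\<close>

definition pert :: "real \<Rightarrow> (int^'n \<Rightarrow> real) \<Rightarrow> int^'n \<Rightarrow> real" where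
  "pert t c k = lin k * c k - nu0 * Bf (r t) c k - nu0 / 2 * Bf (rad b c) (rad b c) k"

definition Nop :: "real \<Rightarrow> (int^'n \<Rightarrow> real) \<Rightarrow> int^'n \<Rightarrow> real" where
  "Nop t c k = pert t c k - a * ib m p (obs c) k"

text \<open>A linear growth bound: in the truncated square one factor is estimated by b and the
  other by the argument. It contains neither \<Lambda> nor \<open>a\<close>, which is why the grid
  can be fixed before either of them.\<close>

definition Kpert :: real where "Kpert = (2 * nu2 + nu1) + nu0 * (CB * Cr) + nu0 / 2 * (CB * b)"

definition Kfb :: real where
  "Kfb = (2 / sqrt vol) * (\<Sum>j<m. \<Sum>i<m. \<bar>\<Lambda> $$ (j, i)\<bar> * (2 / sqrt vol * S0)) * S0"

text \<open>The Lipschitz constant of the whole right-hand side; 4 is the constant 2 of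
  \<open>rad_lipschitz\<close> times the two terms of a difference of squares. It does depend on
  \<Lambda> and \<open>a\<close>, but serves only existence and uniqueness.\<close>

definition Kop :: real where
  "Kop = (2 * nu2 + nu1) + nu0 * (CB * Cr) + nu0 / 2 * (4 * CB * b) + a * Kfb"

lemma Cr_nonneg: "Cr \<ge> 0" using r_bound[of 0] vn_nonneg[of "r 0"] by linarith

lemma Kop_pos: "Kop > 0"
proof -
  have "Kfb \<ge> 0" unfolding Kfb_def using vol_pos
    by (intro mult_nonneg_nonneg sum_nonneg) auto
  then show ?thesis unfolding Kop_def using nu0_pos nu1_pos nu2_pos Cr_nonneg a_pos b_pos CB_nonneg
    by (intro add_pos_nonneg mult_nonneg_nonneg) auto
qed

lemma obs_index: "j < m \<Longrightarrow> vec_index (obs c) j = (\<Sum>i<m. \<Lambda> $$ (j, i) * crep c (p i))"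
  using Lam by (simp add: obs_def scalar_prod_def atLeast0LessThan)

lemma ib_obs_diff:
  assumes c: "c \<in> H2" and d: "d \<in> H2"
  shows "ib m p (obs c) k - ib m p (obs d) k = ib m p (obs (\<lambda>k. c k - d k)) k"
proof -
  have "crep (\<lambda>k. c k - d k) x = crep c x - crep d x" for x
    by (rule crep_diff) (intro H2_abs_summable c d)+
  then show ?thesis
    by (simp add: ib_def obs_index diff_divide_distrib sum_subtractf left_diff_distrib right_diff_distrib)
qed

lemma bd_ib:
  assumes c: "c \<in> H2" shows "bd (ib m p (obs c)) (Kfb * vn c)"
proof -
  have o: "\<bar>vec_index (obs c) j\<bar> \<le> (\<Sum>i<m. \<bar>\<Lambda> $$ (j, i)\<bar> * (2 / sqrt vol * S0)) * vn c" if "j < m" for j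
  proof -
    have "\<bar>vec_index (obs c) j\<bar> \<le> (\<Sum>i<m. \<bar>\<Lambda> $$ (j, i) * crep c (p i)\<bar>)" unfolding obs_index[OF that] by (rule sum_abs)
    also have "\<dots> \<le> (\<Sum>i<m. \<bar>\<Lambda> $$ (j, i)\<bar> * ((2 / sqrt vol * S0) * vn c))"
      unfolding abs_mult by (intro sum_mono mult_left_mono crep_vn_bound c) auto
    finally show ?thesis by (simp add: sum_distrib_right mult.assoc)
  qed
  have "nrm CM (ib m p (obs c)) \<le> vn (ib m p (obs c))" by (rule nrm_le_vn[OF ib_H2(1)])
  also have "\<dots> \<le> (2 / sqrt vol) * (\<Sum>j<m. \<bar>vec_index (obs c) j\<bar>) * S0" by (rule ib_H2(2))
  also have "\<dots> \<le> (2 / sqrt vol) * (\<Sum>j<m. (\<Sum>i<m. \<bar>\<Lambda> $$ (j, i)\<bar> * (2 / sqrt vol * S0)) * vn c) * S0"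
    using vol_pos by (intro mult_right_mono mult_left_mono sum_mono o) auto
  also have "\<dots> = Kfb * vn c" unfolding Kfb_def by (simp add: sum_distrib_right[symmetric])
  finally show ?thesis unfolding bd_def using H2_l2[OF ib_H2(1)] by blast
qed

lemma bd_lin:
  assumes c: "c \<in> H2" shows "bd (\<lambda>k. lin k * c k) ((2 * nu2 + nu1) * vn c)"
proof -
  have s: "(\<lambda>k. (2 * nu2 + nu1) * (lam k * c k)) \<in> sq_int CM" by (rule sq_int_scale) (use c in \<open>simp add: H2_def\<close>)
  have "\<bar>lin k\<bar> \<le> (2 * nu2 + nu1) * lam k" for k
  proof -
    have 1: "nu1 * 1 \<le> nu1 * lam k" "nu2 * 1 \<le> nu2 * lam k" using lam_ge1[of k] nu1_pos nu2_pos by (intro mult_left_mono; simp)+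
    have "lin k = 2 * (nu2 * lam k) - nu2 + (nu1 * lam k - nu1)" "(2 * nu2 + nu1) * lam k = 2 * (nu2 * lam k) + nu1 * lam k"
      by (simp_all add: lin_def algebra_simps)
    then show ?thesis using 1 nu1_pos nu2_pos by linarith
  qed
  then have "\<bar>lin k * c k\<bar> \<le> \<bar>(2 * nu2 + nu1) * (lam k * c k)\<bar>" for k
    using mult_right_mono[of "\<bar>lin k\<bar>" "(2 * nu2 + nu1) * lam k" "\<bar>c k\<bar>"] nu1_pos nu2_pos lam_gt0[of k]
    by (simp add: abs_mult)
  from sq_int_bound[OF s _ this] show ?thesis
    unfolding bd_def nrm_scale vn_def using nu1_pos nu2_pos by simp
qed

lemma bd_pert:
  assumes c: "c \<in> H2" shows "bd (pert t c) (Kpert * vn c)"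
proof -
  have "bd (pert t c) ((2 * nu2 + nu1) * vn c + nu0 * (CB * Cr * vn c) + nu0 / 2 * (CB * b * vn c))"
    unfolding pert_def[abs_def] using nu0_pos
    by (intro bd_diff bd_scale bd_lin bd_Bf c rad_H2 r_H2 r_bound rad_bound b_pos order_refl) auto
  then show ?thesis unfolding Kpert_def by (simp add: distrib_right mult.assoc)
qed

lemma Nop_bound_diff:
  assumes c: "c \<in> H2" and d: "d \<in> H2"
  shows "bd (\<lambda>k. Nop t c k - Nop t d k) (Kop * vn (\<lambda>k. c k - d k))"
proof -
  define e where "e k = c k - d k" for k
  define g where "g k = rad b c k - rad b d k" for k
  have eH: "e \<in> H2" unfolding e_def[abs_def] by (rule H2_diff[OF c d])
  have gH: "g \<in> H2" unfolding g_def[abs_def] by (intro H2_diff rad_H2 c d)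
  have gn: "vn g \<le> 2 * vn e" unfolding g_def[abs_def] e_def[abs_def] by (rule rad_lipschitz[OF b_pos c d])
  have "Bf (r t) c k - Bf (r t) d k = Bf (r t) e k" for k
    using Bf_linear[OF c d r_H2, of 1 "-1" t k] Bf_commute[of "r t"] by (simp add: e_def[abs_def])
  then have 1: "Bf (r t) c k = Bf (r t) d k + Bf (r t) e k" for k by (simp add: algebra_simps)
  have 2: "Bf (rad b c) (rad b c) k = Bf (rad b d) (rad b d) k + (Bf g (rad b c) k + Bf g (rad b d) k)" for k
    using Bf_square_diff[OF rad_H2[OF c, of b] rad_H2[OF d, of b], of k] by (simp add: g_def[abs_def])
  have 3: "ib m p (obs c) k = ib m p (obs d) k + ib m p (obs e) k" for k
    using ib_obs_diff[OF c d, of k] by (simp add: e_def[abs_def] algebra_simps)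
  have eq: "(\<lambda>k. Nop t c k - Nop t d k) = (\<lambda>k. lin k * e k - nu0 * Bf (r t) e k
      - nu0 / 2 * (Bf g (rad b c) k + Bf g (rad b d) k) - a * ib m p (obs e) k)"
    unfolding Nop_def pert_def 1 2 3 by (simp add: fun_eq_iff e_def algebra_simps)
  have "bd (\<lambda>k. Nop t c k - Nop t d k) ((2 * nu2 + nu1) * vn e + nu0 * (CB * Cr * vn e)
     + nu0 / 2 * (CB * (2 * vn e) * b + CB * (2 * vn e) * b) + a * (Kfb * vn e))"
    unfolding eq using nu0_pos a_pos
    by (intro bd_diff bd_add bd_scale bd_lin bd_Bf bd_ib c d eH gH rad_H2 r_H2 r_bound rad_bound b_pos gn order_refl) auto
  moreover have "(2 * nu2 + nu1) * vn e + nu0 * (CB * Cr * vn e)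
     + nu0 / 2 * (CB * (2 * vn e) * b + CB * (2 * vn e) * b) + a * (Kfb * vn e) = Kop * vn e"
    unfolding Kop_def by (simp add: algebra_simps)
  ultimately show ?thesis by (simp add: e_def[abs_def])
qed

lemma Nop_lip:
  assumes c: "E2 c < \<infinity>" and d: "E2 d < \<infinity>"
  shows "E0 (\<lambda>k. Nop t c k - Nop t d k) \<le> ennreal (Kop\<^sup>2) * E2 (\<lambda>k. c k - d k)"
proof -
  have c: "c \<in> H2" and d: "d \<in> H2" using assms by (simp_all only: E2_finite_iff)
  note b = Nop_bound_diff[OF c d, of t, unfolded bd_def]
  have "E0 (\<lambda>k. Nop t c k - Nop t d k) = ennreal ((nrm CM (\<lambda>k. Nop t c k - Nop t d k))\<^sup>2)"
    unfolding E0_def by (rule nn_integral_sq) (use b in blast)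
  also have "\<dots> \<le> ennreal ((Kop * vn (\<lambda>k. c k - d k))\<^sup>2)"
    by (intro ennreal_leI power_mono) (use b in auto)
  also have "\<dots> = ennreal (Kop\<^sup>2) * E2 (\<lambda>k. c k - d k)"
    unfolding E2_vn[OF H2_diff[OF c d]] by (simp add: power_mult_distrib ennreal_mult)
  finally show ?thesis .
qed

lemma Nop_zero: "Nop t (\<lambda>k. 0) k = 0"
proof -
  have z: "(\<lambda>k. 0) \<in> H2" by (simp add: H2_def)
  have B: "Bf (\<lambda>k. 0) d k = 0" if "d \<in> H2" for d using Bf_linear[OF z z that, of 0 0 k] by simp
  have "rad b (\<lambda>k. 0) = (\<lambda>k. 0)" by (simp add: rad_def fun_eq_iff)
  moreover have "crep (\<lambda>k. 0) x = 0" for x by (simp add: crep_def)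
  ultimately show ?thesis using B[OF z] B[OF r_H2[of t]] Bf_commute[of "r t" "\<lambda>k. 0"]
    by (simp add: Nop_def pert_def ib_def obs_index)
qed

lemma Nop_meas:
  assumes Z [measurable]: "\<And>k. (\<lambda>t. Z t k) \<in> borel_measurable borel" and fin: "\<And>t. E2 (Z t) < \<infinity>"
  shows "(\<lambda>t. Nop t (Z t) k) \<in> borel_measurable borel"
proof -
  have "vn (Z t) = sqrt (enn2real (E2 (Z t)))" for t
  proof -
    have "Z t \<in> H2" using fin[of t] by (simp only: E2_finite_iff)
    then show ?thesis by (simp add: E2_vn)
  qed
  moreover have [measurable]: "(\<lambda>t. E2 (Z t)) \<in> borel_measurable borel" by (rule measurable_E) (rule Z)
  ultimately have [measurable]: "(\<lambda>t. vn (Z t)) \<in> borel_measurable borel" by simp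
  have [measurable]: "(\<lambda>t. rad b (Z t) k) \<in> borel_measurable borel" for k unfolding rad_def by measurable
  have [measurable]: "(\<lambda>t. Bf (rad b (Z t)) (rad b (Z t)) k) \<in> borel_measurable borel" "(\<lambda>t. Bf (r t) (Z t) k) \<in> borel_measurable borel"
    using r_meas by (auto intro!: Bf_measurable)
  have [measurable]: "(\<lambda>t. crep (Z t) x) \<in> borel_measurable borel" for x
  proof -
    interpret CM: sigma_finite_measure "CM :: (int^'n) measure" by (rule sigma_finite_measure_count_space)
    have "(\<lambda>(t, k). Z t k * bas k x) \<in> borel_measurable (borel \<Otimes>\<^sub>M CM)"
      unfolding split_def
      by (rule measurable_compose_countable[where f = "\<lambda>k q. Z (fst q) k * bas k x" and g = snd]) measurable
    then show ?thesis unfolding crep_def by (rule CM.borel_measurable_lebesgue_integral)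
  qed
  have "ib m p (obs c) k = (\<Sum>j<m. (\<Sum>i<m. \<Lambda> $$ (j, i) * crep c (p i)) * bas k (p j)) / (lam k)\<^sup>2" for c
    by (simp add: ib_def obs_index)
  then show ?thesis unfolding Nop_def pert_def by (simp only:) measurable
qed

end

sublocale observer \<subseteq> evolution_rhs lam nu2 Nop "Kop\<^sup>2"
  using Kop_pos Nop_lip Nop_zero Nop_meas by unfold_locales (auto simp: less_top)

section \<open>Dissipation and decay of the truncated error\<close>

context observer
begin

text \<open>The principal part offers 2 nu2 times the square of \<open>an\<close>. One half absorbs
  the perturbation by Young, at the price Kpert^2/nu2 times the square of \<open>vn\<close>; the
  other half and the feedback dominate nu2 M times that square by observability. The value of
  \<open>a\<close> matches the measurement constant there, and \<open>M\<close> pays for the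
  perturbation and for the rate.\<close>

lemma dissipation:
  assumes z: "z \<in> H4"
    and form: "\<And>w. w \<in> carrier_vec m \<Longrightarrow> (\<Sum>i<m. (vec_index w i)\<^sup>2) \<le> 2 * (\<Sum>i<m. vec_index w i * vec_index (\<Lambda> *\<^sub>v w) i)"
    and obs_ineq: "M * (vn z)\<^sup>2 \<le> (an z)\<^sup>2 + (M\<^sup>2 * vol / 2) * (\<Sum>j<m. (crep z (p j))\<^sup>2)"
    and a: "a = nu2 * (M\<^sup>2 * vol / 2)" and M: "Kpert\<^sup>2 / nu2 + \<mu> \<le> nu2 * M"
  shows "(\<integral>k. 2 * (lam k)\<^sup>2 * z k * (Nop t z k - nu2 * (lam k)\<^sup>2 * z k) \<partial>CM) \<le> - \<mu> * (\<integral>k. (lam k * z k)\<^sup>2 \<partial>CM)"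
proof -
  have z2: "z \<in> H2" by (rule H4_subset_H2[OF z])
  have zs: "(\<lambda>k. (lam k)\<^sup>2 * z k) \<in> sq_int CM" using z by (simp add: H4_def)
  have ps: "pert t z \<in> sq_int CM" and pn: "nrm CM (pert t z) \<le> Kpert * vn z" using bd_pert[OF z2, of t] by (auto simp: bd_def)
  define X where "X = (\<integral>k. ((lam k)\<^sup>2 * z k) * pert t z k \<partial>CM)"
  define F where "F = (\<Sum>j<m. vec_index (obs z) j * crep z (p j))"
  define W where "W = (\<Sum>j<m. (crep z (p j))\<^sup>2)"
  have i1: "integrable CM (\<lambda>k. ((lam k)\<^sup>2 * z k) * pert t z k)" by (rule sq_int_mult_integrable[OF zs ps])
  have i2: "integrable CM (\<lambda>k. ((lam k)\<^sup>2 * z k)\<^sup>2)" by (rule sq_int_integrable[OF zs])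
  note fe = feedback_energy[OF z2, of m p "obs z"]
  have "(\<integral>k. 2 * (lam k)\<^sup>2 * z k * (Nop t z k - nu2 * (lam k)\<^sup>2 * z k) \<partial>CM)
     = (\<integral>k. 2 * (((lam k)\<^sup>2 * z k) * pert t z k) - (2 * a) * ((lam k)\<^sup>2 * z k * ib m p (obs z) k) - (2 * nu2) * ((lam k)\<^sup>2 * z k)\<^sup>2 \<partial>CM)"
    unfolding Nop_def power2_eq_square by (intro Bochner_Integration.integral_cong) (simp_all add: algebra_simps)
  also have "\<dots> = 2 * X - 2 * a * F - 2 * nu2 * (an z)\<^sup>2"
    using i1 i2 fe by (simp add: X_def F_def an_def nrm_sq)
  finally have E: "(\<integral>k. 2 * (lam k)\<^sup>2 * z k * (Nop t z k - nu2 * (lam k)\<^sup>2 * z k) \<partial>CM) = 2 * X - 2 * a * F - 2 * nu2 * (an z)\<^sup>2" .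
  have "X \<le> an z * nrm CM (pert t z)"
    using Cauchy_Schwarz_integral[OF zs ps] by (simp add: X_def an_def abs_le_iff)
  also have "\<dots> \<le> an z * (Kpert * vn z)" by (rule mult_left_mono[OF pn]) (simp add: an_def)
  finally have X: "X \<le> an z * (Kpert * vn z)" .
  have "W \<le> 2 * F"
    using form[of "Matrix.vec m (\<lambda>j. crep z (p j))"] by (simp add: W_def F_def obs_def mult.commute)
  then have "a * W \<le> 2 * a * F" using a_pos mult_left_mono[of W "2 * F" a] by simp
  moreover have "nu2 * (M * (vn z)\<^sup>2) \<le> nu2 * ((an z)\<^sup>2) + a * W"
    using mult_left_mono[OF obs_ineq, of nu2] nu2_pos by (simp add: W_def a distrib_left mult.assoc)
  moreover have "2 * (an z * (Kpert * vn z)) \<le> nu2 * (an z)\<^sup>2 + Kpert\<^sup>2 / nu2 * (vn z)\<^sup>2"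
  proof -
    have "0 \<le> (nu2 * an z - Kpert * vn z)\<^sup>2 / nu2" using nu2_pos by simp
    also have "\<dots> = nu2 * (an z)\<^sup>2 + Kpert\<^sup>2 / nu2 * (vn z)\<^sup>2 - 2 * (an z * (Kpert * vn z))"
      using nu2_pos by (simp add: power2_eq_square field_simps)
    finally show ?thesis by simp
  qed
  moreover have "Kpert\<^sup>2 / nu2 * (vn z)\<^sup>2 + \<mu> * (vn z)\<^sup>2 \<le> nu2 * (M * (vn z)\<^sup>2)"
    using mult_right_mono[OF M, of "(vn z)\<^sup>2"] by (simp add: distrib_right mult.assoc)
  ultimately have "2 * X - 2 * a * F - 2 * nu2 * (an z)\<^sup>2 \<le> - \<mu> * (vn z)\<^sup>2" using X by linarith
  then show ?thesis unfolding E by (simp add: vn_def nrm_sq)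
qed

text \<open>Dissipation is applied with rate 2 \<mu> because it concerns the squared norm. Decay
  from time 0 keeps \<open>vn\<close> at most \<open>b\<close>, where \<open>rad b\<close> is the
  identity.\<close>

theorem decaying_solution:
  assumes c: "c \<in> H2" and cb: "vn c \<le> b"
    and form: "\<And>w. w \<in> carrier_vec m \<Longrightarrow> (\<Sum>i<m. (vec_index w i)\<^sup>2) \<le> 2 * (\<Sum>i<m. vec_index w i * vec_index (\<Lambda> *\<^sub>v w) i)"
    and obs_ineq: "\<And>z. z \<in> H4 \<Longrightarrow> M * (vn z)\<^sup>2 \<le> (an z)\<^sup>2 + (M\<^sup>2 * vol / 2) * (\<Sum>j<m. (crep z (p j))\<^sup>2)"
    and a: "a = nu2 * (M\<^sup>2 * vol / 2)" and M: "Kpert\<^sup>2 / nu2 + 2 * \<mu> \<le> nu2 * M" and \<mu>: "\<mu> > 0"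
  obtains Z where "\<And>S. S \<ge> 0 \<Longrightarrow> modes S c (\<lambda>t. Nop t (Z t)) Z" "Z 0 = c"
    "\<And>t. t \<ge> 0 \<Longrightarrow> (\<integral>\<^sup>+s. indicator {0..t} s * E0 (Nop s (Z s)) \<partial>lborel) < \<infinity>"
    "\<And>t. Z t \<in> H2" "\<And>t. t \<ge> 0 \<Longrightarrow> vn (Z t) \<le> b"
    "\<And>s t. 0 \<le> s \<Longrightarrow> s \<le> t \<Longrightarrow> vn (Z t) \<le> exp (- \<mu> * (t - s)) * vn (Z s)"
proof -
  have c': "E2 c < \<infinity>" using c by (simp only: E2_finite_iff)
  obtain Z where st: "is_step c Z Z" and adm: "admissible c Z" using evolution_solution[OF c'] by blast
  have m: "modes S c (\<lambda>t. Nop t (Z t)) Z" if "S \<ge> 0" for S using st that by (simp add: is_step_def)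
  have Z0: "Z 0 = c" using st by (simp add: is_step_def)
  have fin: "(\<integral>\<^sup>+s. indicator {0..t} s * E0 (Nop s (Z s)) \<partial>lborel) < \<infinity>" if "t \<ge> 0" for t
    using admissible_integral[OF adm that] by (auto intro: le_less_trans)
  have ZH: "Z t \<in> H2" for t using admissible_fin[OF adm, of t] by (simp only: E2_finite_iff)
  have dec: "vn (Z t) \<le> exp (- \<mu> * (t - s)) * vn (Z s)" if "0 \<le> s" "s \<le> t" for s t
  proof -
    have "(\<integral>k. (lam k * Z t k)\<^sup>2 \<partial>CM) \<le> exp (- (2 * \<mu>) * (t - s)) * (\<integral>k. (lam k * Z s k)\<^sup>2 \<partial>CM)"
    proof (rule modes_decay[OF m c' fin _ _ that])
      fix s assume "E4 (Z s) < \<infinity>"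
      then have "Z s \<in> H4" by (simp only: E4_finite_iff)
      from dissipation[OF this form obs_ineq[OF this] a M]
      show "(\<integral>k. 2 * (lam k)\<^sup>2 * Z s k * (Nop s (Z s) k - nu2 * (lam k)\<^sup>2 * Z s k) \<partial>CM) \<le> - (2 * \<mu>) * (\<integral>k. (lam k * Z s k)\<^sup>2 \<partial>CM)" .
    qed (use \<mu> in auto)
    then have "(vn (Z t))\<^sup>2 \<le> exp (- (2 * \<mu>) * (t - s)) * (vn (Z s))\<^sup>2" by (simp add: vn_def nrm_sq)
    also have "\<dots> = (exp (- \<mu> * (t - s)) * vn (Z s))\<^sup>2"
      by (simp add: power_mult_distrib exp_double[symmetric] algebra_simps)
    finally show ?thesis by (rule power2_le_imp_le) simp
  qed
  have bnd: "vn (Z t) \<le> b" if "t \<ge> 0" for t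
  proof -
    have "vn (Z t) \<le> exp (- \<mu> * (t - 0)) * vn (Z 0)" using dec[of 0 t] that by simp
    also have "\<dots> \<le> 1 * vn (Z 0)" using \<mu> that by (intro mult_right_mono) auto
    finally show ?thesis using cb Z0 by simp
  qed
  show ?thesis by (rule that[OF m Z0 fin ZH bnd dec])
qed

lemma Nop_eq:
  assumes "vn c \<le> b"
  shows "Nop t c k = lin k * c k - nu0 * Bf (r t) c k - nu0 / 2 * Bf c c k - a * ib m p (obs c) k"
  unfolding Nop_def pert_def rad_id[OF b_pos assms] ..

end

context observer
begin

lemma obs_Z_op:
  assumes u: "u \<in> Sobolev L 2" and w: "w \<in> Sobolev L 2"
  shows "\<Lambda> *\<^sub>v (Z_op L m p u - Z_op L m p w) = obs (\<lambda>k. fc u k - fc w k)"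
proof -
  have "crep (\<lambda>k. fc u k - fc w k) x = crep (fc u) x - crep (fc w) x" for x
    by (rule crep_diff; rule H2_abs_summable) (use u w in \<open>simp_all add: Sobolev2_iff\<close>)
  then have "Z_op L m p u - Z_op L m p w = Matrix.vec m (\<lambda>j. crep (\<lambda>k. fc u k - fc w k) (p j))"
    unfolding Z_op_def cont_rep_Sobolev[OF u] cont_rep_Sobolev[OF w] by (intro eq_vecI) auto
  then show ?thesis by (simp add: obs_def)
qed

text \<open>\<open>R\<close> is the true reference, mean included, and \<open>r\<close> agrees with
  it off the constant mode; since gradients ignore that mode, the nonlinearity written with
  \<open>r\<close> is the one of the actual difference of the two equations.\<close>

lemma Nop_difference:
  assumes R: "R \<in> H2" "\<And>k. k \<noteq> 0 \<Longrightarrow> R k = r t k" and z: "z \<in> H2" "vn z \<le> b" and y: "\<And>k. y k = R k + z k"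
  shows "Nop t z k = lin k * z k - nu0 / 2 * (Bf y y k - Bf R R k) - a * ib m p (obs z) k"
proof -
  have y': "y = (\<lambda>k. R k + z k)" using y by (simp add: fun_eq_iff)
  have "Bf R z = Bf (r t) z" by (rule Bf_cong) (rule R(2))
  then show ?thesis unfolding Nop_eq[OF z(2)] y' Bf_square_add[OF R(1) z(1)] by (simp add: algebra_simps)
qed

end

section \<open>Existence, uniqueness and decay for the observer\<close>

context ks_torus
begin

lemma injection_fc:
  shows "(\<lambda>x. s * inv_bilap L (Z_adj L m p v) x) \<in> sq_int TM"
    and "fc (\<lambda>x. s * inv_bilap L (Z_adj L m p v) x) k = s * ib m p v k"
  by (intro sq_int_scale Sobolev_sq_int[OF inv_bilap_fc(1)]) (simp add: fc_scale inv_bilap_fc(2))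

lemma zero_mean_coefficients:
  assumes y: "y t \<in> Sobolev L 2"
  shows "zero_mean_part L y t \<in> Sobolev L 2" and "k \<noteq> 0 \<Longrightarrow> fc (zero_mean_part L y t) k = fc (y t) k"
proof -
  obtain A where A: "zero_mean_part L y t = (\<lambda>x. y t x - A * bas 0 x)"
  proof
    show "zero_mean_part L y t = (\<lambda>x. y t x - (sqrt vol / (\<integral>x. 1 \<partial>TM) * (\<integral>x. y t x \<partial>TM)) * bas 0 x)"
    proof -
      have "kap 0 = 0" by (simp add: kap_def Finite_Cartesian_Product.vec_eq_iff)
      then have "bas 0 x = 1 / sqrt vol" for x by (simp add: bas_def ebas_def)
      then show ?thesis using vol_pos by (simp add: zero_mean_part_def fun_eq_iff)
    qed
  qed
  have s: "y t \<in> sq_int TM" "(\<lambda>x. A * bas 0 x) \<in> sq_int TM" by (intro sq_int_scale bas_sq_int Sobolev_sq_int[OF y])+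
  have f: "fc (zero_mean_part L y t) k = fc (y t) k - A * fc (bas 0) k" for k
    unfolding A by (simp add: fc_diff[OF s] fc_scale)
  have "fc (zero_mean_part L y t) = (\<lambda>k. 1 * fc (y t) k + (- A) * fc (bas 0) k)" by (simp add: fun_eq_iff f)
  moreover have "(\<lambda>k. 1 * fc (y t) k + (- A) * fc (bas 0) k) \<in> H2"
    by (rule H2_lin) (use y bas_Sobolev[of 0] in \<open>simp_all add: Sobolev2_iff\<close>)
  moreover have "zero_mean_part L y t \<in> sq_int TM" unfolding A by (rule sq_int_diff[OF s])
  ultimately show "zero_mean_part L y t \<in> Sobolev L 2" by (simp add: Sobolev2_iff)
  show "fc (zero_mean_part L y t) k = fc (y t) k" if "k \<noteq> 0" using that by (simp add: f fc_bas)
qed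

text \<open>All constants are computed from \<open>C\<close>, \<open>R\<close>, \<mu> and the
  coefficients of the equation before \<Lambda> is introduced. The constructed solution is the
  reference plus the continuous representative of the decaying truncated error; any other solution
  is then identified with it.\<close>

theorem observer_converges:
  assumes yr: "KS_strong_solution L nu0 nu1 nu2 f yr" and C: "C \<ge> 0"
    and bound: "(SUP s\<in>{0..}. ennreal (V_norm L nu2 (zero_mean_part L yr s))) \<le> ennreal C"
    and R: "R > 0" and \<rho>: "\<rho> > 1" and \<mu>: "\<mu> > 0"
  shows "\<exists>S\<ge>1. \<forall>\<Lambda>\<in>carrier_mat (S ^ CARD('n)) (S ^ CARD('n)). smallest_eigenvalue (\<Lambda> + transpose_mat \<Lambda>) 1 \<longrightarrow>
    (\<exists>l>0. \<forall>ye0\<in>Sobolev L 2. V_norm L nu2 (\<lambda>x. ye0 x - yr 0 x) \<le> R \<longrightarrow>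
      (\<exists>ye. observer_solution L nu0 nu1 nu2 f yr (S ^ CARD('n)) (gpt S) \<Lambda> l ye0 ye \<and>
        (\<forall>y. observer_solution L nu0 nu1 nu2 f yr (S ^ CARD('n)) (gpt S) \<Lambda> l ye0 y \<longrightarrow>
           (\<forall>t\<ge>0. AE x in TM. y t x = ye t x)) \<and>
        (\<forall>s t. 0 \<le> s \<and> s \<le> t \<longrightarrow>
           V_norm L nu2 (\<lambda>x. ye t x - yr t x) \<le> \<rho> * exp (- \<mu> * (t - s)) * V_norm L nu2 (\<lambda>x. ye s x - yr s x))))"
proof -
  \<comment> \<open>Only the zero mean part of the reference is bounded, so its constant mode is
    discarded.\<close>
  define r where "r t k = (if k = 0 then 0 else fc (yr (max 0 t)) k)" for t and k :: "int^'n"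
  define Cr where "Cr = C / sqrt nu2"
  define b where "b = R / sqrt nu2"
  define K where "K = (2 * nu2 + nu1) + nu0 * (CB * Cr) + nu0 / 2 * (CB * b)"
  \<comment> \<open>Makes nu2 * M equal to K^2/nu2 + 2 \<mu>, the requirement of
    \<open>decaying_solution\<close>; \<open>K\<close> repeats \<open>Kpert\<close> outside its
    locale, since the locale presupposes \<Lambda>.\<close>
  define M where "M = (K\<^sup>2 / nu2 + 2 * \<mu>) / nu2"
  define a where "a = nu2 * (M\<^sup>2 * vol / 2)"
  have yr2: "yr t \<in> Sobolev L 2" if "t \<ge> 0" for t using yr that by (simp add: KS_solution_iff)
  have yrH: "fc (yr t) \<in> H2" if "t \<ge> 0" for t using yr2[OF that] by (simp add: Sobolev2_iff)
  have b: "b > 0" using R nu2_pos by (simp add: b_def)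
  have M: "M > 0" using nu2_pos \<mu> by (simp add: M_def add_nonneg_pos)
  have a: "a > 0" using nu2_pos M vol_pos by (simp add: a_def)
  have r: "r t \<in> H2" "vn (r t) \<le> Cr" for t
  proof -
    let ?t = "max 0 t"
    define u where "u = zero_mean_part L yr ?t"
    have u: "u \<in> Sobolev L 2" "\<And>k. k \<noteq> 0 \<Longrightarrow> fc u k = r t k"
      unfolding u_def r_def using zero_mean_coefficients[of yr ?t, OF yr2] by auto
    have us: "(\<lambda>k. lam k * fc u k) \<in> sq_int CM" using u(1) by (simp add: Sobolev2_iff H2_def)
    have le: "\<bar>lam k * r t k\<bar> \<le> \<bar>lam k * fc u k\<bar>" for k
      by (cases "k = 0") (simp add: r_def, simp add: u(2))
    from sq_int_bound[OF us _ le] have "(\<lambda>k. lam k * r t k) \<in> sq_int CM" "vn (r t) \<le> vn (fc u)" by (auto simp: vn_def)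
    moreover have "ennreal (V_norm L nu2 u) \<le> ennreal C"
      unfolding u_def by (rule order_trans[OF SUP_upper bound]) simp
    then have "sqrt nu2 * vn (fc u) \<le> C" using C unfolding V_norm_eq[OF u(1)] vn_def by simp
    then have "vn (fc u) \<le> Cr" using nu2_pos by (simp add: Cr_def field_simps)
    ultimately show "r t \<in> H2" "vn (r t) \<le> Cr" by (auto simp: H2_def)
  qed
  have rm: "(\<lambda>t. r t k) \<in> borel_measurable borel" for k
  proof (cases "k = 0")
    case False
    have "continuous_on UNIV (\<lambda>t. fc (yr (max 0 t)) k)" by (rule KS_forward[OF yr]) blast
    then show ?thesis using False by (simp add: r_def borel_measurable_continuous_onI)
  qed (simp add: r_def)
  obtain S where S: "S \<ge> 1" and obs_ineq: "\<And>c. c \<in> H4 \<Longrightarrow>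
    M * (vn c)\<^sup>2 \<le> (an c)\<^sup>2 + (M\<^sup>2 * vol / 2) * (\<Sum>j<S ^ CARD('n). (crep c (gpt S j))\<^sup>2)"
    using observability[OF M] by blast
  define m where "m = S ^ CARD('n)"
  define p where "p = gpt S"
  have m: "m > 0" using S by (simp add: m_def)
  have "\<exists>l>0. \<forall>ye0\<in>Sobolev L 2. V_norm L nu2 (\<lambda>x. ye0 x - yr 0 x) \<le> R \<longrightarrow>
      (\<exists>ye. observer_solution L nu0 nu1 nu2 f yr m p \<Lambda> l ye0 ye \<and>
        (\<forall>y. observer_solution L nu0 nu1 nu2 f yr m p \<Lambda> l ye0 y \<longrightarrow> (\<forall>t\<ge>0. AE x in TM. y t x = ye t x)) \<and>
        (\<forall>s t. 0 \<le> s \<and> s \<le> t \<longrightarrow>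
           V_norm L nu2 (\<lambda>x. ye t x - yr t x) \<le> \<rho> * exp (- \<mu> * (t - s)) * V_norm L nu2 (\<lambda>x. ye s x - yr s x)))"
    if \<Lambda>: "\<Lambda> \<in> carrier_mat m m" and sm: "smallest_eigenvalue (\<Lambda> + transpose_mat \<Lambda>) 1" for \<Lambda>
  \<comment> \<open>The observer carries the factor nu2^-1, so this gain leaves \<open>a\<close> in
    front of \<open>ib\<close>.\<close>
  proof (intro exI[of _ "a * nu2"] conjI ballI impI)
    show "a * nu2 > 0" using a nu2_pos by simp
    have an: "a * nu2 * inverse nu2 = a" using nu2_pos by simp
    fix ye0 assume ye0: "ye0 \<in> Sobolev L 2" and small: "V_norm L nu2 (\<lambda>x. ye0 x - yr 0 x) \<le> R"
    interpret O: observer L nu0 nu1 nu2 r Cr m p \<Lambda> a b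
      by unfold_locales (use r rm \<Lambda> a b in auto)
    define c where "c k = fc ye0 k - fc (yr 0) k" for k
    have fcd: "fc (\<lambda>x. ye0 x - yr 0 x) = c"
      by (rule ext) (simp add: c_def fc_diff[OF Sobolev_sq_int[OF ye0] Sobolev_sq_int[OF yr2]])
    have c: "c \<in> H2" unfolding c_def[abs_def] by (rule H2_diff) (use ye0 yrH in \<open>auto simp: Sobolev2_iff\<close>)
    have dS: "(\<lambda>x. ye0 x - yr 0 x) \<in> Sobolev L 2"
      using c fcd sq_int_diff[OF Sobolev_sq_int[OF ye0] Sobolev_sq_int[OF yr2]] by (simp add: Sobolev2_iff)
    have cb: "vn c \<le> b" using small nu2_pos unfolding V_norm_eq[OF dS] fcd vn_def b_def by (simp add: field_simps)
    have KM: "O.Kpert\<^sup>2 / nu2 + 2 * \<mu> \<le> nu2 * M"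
      using nu2_pos unfolding M_def O.Kpert_def K_def by simp
    obtain Z where Z: "\<And>S. S \<ge> 0 \<Longrightarrow> modes S c (\<lambda>t. O.Nop t (Z t)) Z" "Z 0 = c"
      "\<And>t. t \<ge> 0 \<Longrightarrow> (\<integral>\<^sup>+s. indicator {0..t} s * E0 (O.Nop s (Z s)) \<partial>lborel) < \<infinity>"
      "\<And>t. Z t \<in> H2" "\<And>t. t \<ge> 0 \<Longrightarrow> vn (Z t) \<le> b"
      "\<And>s t. 0 \<le> s \<Longrightarrow> s \<le> t \<Longrightarrow> vn (Z t) \<le> exp (- \<mu> * (t - s)) * vn (Z s)"
      using O.decaying_solution[OF c cb smallest_eigenvalue_form[OF \<Lambda> m sm] obs_ineq[folded m_def p_def] a_def KM \<mu>] by blast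
    define ye where "ye t x = yr t x + crep (Z t) x" for t x
    note Zi = H2_abs_summable(1)[OF Z(4)]
    have ye: "ye t \<in> sq_int TM" "fc (ye t) k = fc (yr t) k + Z t k" if "t \<ge> 0" for t k
    proof -
      show "ye t \<in> sq_int TM" unfolding ye_def[abs_def] by (intro sq_int_add Sobolev_sq_int[OF yr2[OF that]] crep_sq_int Zi)
      show "fc (ye t) k = fc (yr t) k + Z t k"
        unfolding ye_def[abs_def] by (simp add: fc_add[OF Sobolev_sq_int[OF yr2[OF that]] crep_sq_int[OF Zi]] fc_crep[OF Zi])
    qed
    have yeS: "ye t \<in> Sobolev L 2" if "t \<ge> 0" for t
    proof -
      have "fc (ye t) = (\<lambda>k. fc (yr t) k + Z t k)" using ye(2)[OF that] by (simp add: fun_eq_iff)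
      then show ?thesis using ye(1)[OF that] H2_add[OF yrH[OF that] Z(4)] by (simp add: Sobolev2_iff)
    qed
    let ?G = "\<lambda>y t x. a * nu2 * inverse nu2 * inv_bilap L (Z_adj L m p (\<Lambda> *\<^sub>v (Z_op L m p (y t) - Z_op L m p (yr t)))) x"
    have Gs: "?G y t \<in> sq_int TM" for y t by (rule injection_fc(1))
    have Gf: "fc (?G y t) k = a * ib m p (O.obs (\<lambda>k. fc (y t) k - fc (yr t) k)) k" if "y t \<in> Sobolev L 2" "t \<ge> 0" for y t k
      unfolding injection_fc(2) an O.obs_Z_op[OF that(1) yr2[OF that(2)]] ..
    have r_eq: "fc (yr t) k = r t k" if "t \<ge> 0" "k \<noteq> 0" for t k using that by (simp add: r_def)
    have sol: "observer_solution L nu0 nu1 nu2 f yr m p \<Lambda> (a * nu2) ye0 ye"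
      unfolding observer_solution_def
    proof
      show "KS_strong_solution L nu0 nu1 nu2 (\<lambda>t x. f t x - ?G ye t x) ye"
      proof (rule KS_build[OF yr Z(1) c Z(3) Z(4) Z(2) Gs _ ye])
        show "AE t in lborel. 0 < t \<longrightarrow> (\<forall>k. O.Nop t (Z t) k = lin k * Z t k
           - nu0 / 2 * (Bf (fc (ye t)) (fc (ye t)) k - Bf (fc (yr t)) (fc (yr t)) k) - fc (?G ye t) k)"
        proof (intro always_eventually allI impI)
          fix t :: real and k :: "int^'n" assume "0 < t"
          then have t: "0 \<le> t" by simp
          have "(\<lambda>k. fc (ye t) k - fc (yr t) k) = Z t" using ye(2)[OF t] by (simp add: fun_eq_iff)
          then show "O.Nop t (Z t) k = lin k * Z t k
           - nu0 / 2 * (Bf (fc (ye t)) (fc (ye t)) k - Bf (fc (yr t)) (fc (yr t)) k) - fc (?G ye t) k"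
            unfolding Gf[of ye t, OF yeS[OF t] t] using O.Nop_difference[OF yrH[OF t] r_eq[OF t] Z(4) Z(5)[OF t] ye(2)[OF t], of k] by simp
        qed
      qed
      show "AE x in TM. ye 0 x = ye0 x"
        by (rule fc_inj[OF ye(1) Sobolev_sq_int[OF ye0]]) (simp_all add: ye(2) Z(2) c_def)
    qed
    have unique: "AE x in TM. y t x = ye t x"
      if os: "observer_solution L nu0 nu1 nu2 f yr m p \<Lambda> (a * nu2) ye0 y" and t: "t \<ge> 0" for y t
    proof -
      have ys: "KS_strong_solution L nu0 nu1 nu2 (\<lambda>t x. f t x - ?G y t x) y" and y0: "AE x in TM. y 0 x = ye0 x"
        using os by (simp_all add: observer_solution_def)
      have y2: "y s \<in> Sobolev L 2" if "s \<ge> 0" for s using ys that by (simp add: KS_solution_iff)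
      define w where "w s k = fc (y (max 0 s)) k - fc (yr (max 0 s)) k" for s k
      have "fc (y 0) = fc ye0"
        by (rule fc_cong_AE[OF sq_int_measurable sq_int_measurable y0]; rule Sobolev_sq_int) (use y2 ye0 in auto)
      then have c': "(\<lambda>k. fc (y 0) k - fc (yr 0) k) = c" by (simp add: c_def fun_eq_iff)
      obtain h where h: "\<And>S. S \<ge> 0 \<Longrightarrow> modes S c h w"
        "\<And>t. t \<ge> 0 \<Longrightarrow> (\<integral>\<^sup>+\<tau>. indicator {0..t} \<tau> * E0 (h \<tau>) \<partial>lborel) < \<infinity>"
        "AE s in lborel. 0 < s \<longrightarrow> (\<forall>k. h s k = lin k * (fc (y s) k - fc (yr s) k)
           - nu0 / 2 * (Bf (fc (y s)) (fc (y s)) k - Bf (fc (yr s)) (fc (yr s)) k) - fc (?G y s) k)"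
        using KS_difference[where G = "?G y", OF yr ys Gs[of y]] unfolding c' w_def by blast
      have wH: "w s \<in> H2" for s
        unfolding w_def[abs_def] by (rule H2_diff) (use y2 yr2 in \<open>simp_all add: Sobolev2_iff\<close>)
      \<comment> \<open>The energy of an arbitrary solution on [0,t] is finite, which gives a bound
        of its error in V on that interval, possibly beyond the radius \<open>b\<close>.\<close>
      define Q where "Q = ennreal nu2 * E2 c + (\<integral>\<^sup>+\<tau>. indicator {0..t} \<tau> * E0 (h \<tau>) \<partial>lborel)"
      have "Q < \<infinity>" using h(2)[OF t] c by (simp add: Q_def ennreal_mult_less_top E2_finite_iff[symmetric])
      then obtain q where q: "q \<ge> 0" "Q = ennreal q" by (cases Q) auto
      have wb: "nu2 * (vn (w s))\<^sup>2 \<le> q" if "s \<in> {0..t}" for s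
      proof -
        have "ennreal (nu2 * (vn (w s))\<^sup>2) = ennreal nu2 * E2 (w s)"
          using nu2_pos by (simp add: E2_vn[OF wH] ennreal_mult)
        also have "\<dots> \<le> ennreal nu2 * E2 (w s) + ennreal (nu2\<^sup>2) * (\<integral>\<^sup>+\<tau>. indicator {0..s} \<tau> * E4 (w \<tau>) \<partial>lborel)"
          by (rule add_increasing2) auto
        also have "\<dots> \<le> ennreal nu2 * E2 c + (\<integral>\<^sup>+\<tau>. indicator {0..s} \<tau> * E0 (h \<tau>) \<partial>lborel)"
          by (rule modes_energy_le[OF _ _ h(1)[OF t]]) (use that in auto)
        also have "\<dots> \<le> Q"
          unfolding Q_def using that by (intro add_mono nn_integral_mono order_refl mult_right_mono) (auto simp: indicator_def)
        finally show ?thesis using q by simp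
      qed
      define B where "B = max b (sqrt (q / nu2))"
      have B: "B > 0" "b \<le> B" using b by (auto simp: B_def)
      have wB: "vn (w s) \<le> B" if "s \<in> {0..t}" for s
      proof -
        have "(vn (w s))\<^sup>2 \<le> q / nu2" using wb[OF that] nu2_pos by (simp add: field_simps)
        then have "vn (w s) \<le> sqrt (q / nu2)" by (rule real_le_rsqrt)
        then show ?thesis by (simp add: B_def)
      qed
      \<comment> \<open>With radius \<open>B\<close> the truncation acts on neither curve up to time
        t, so both solve the same globally Lipschitz problem; its Lipschitz constant feeds
        \<open>modes_unique\<close>.\<close>
      interpret P: observer L nu0 nu1 nu2 r Cr m p \<Lambda> a B
        by unfold_locales (use r rm \<Lambda> a B in auto)
      have lip: "AE s in lborel. s \<in> {0..t} \<longrightarrow> E0 (\<lambda>k. h s k - O.Nop s (Z s) k) \<le> ennreal (P.Kop\<^sup>2) * E2 (\<lambda>k. w s k - Z s k)"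
        using h(3) AE_lborel_singleton[of 0]
      proof eventually_elim
        case (elim s)
        show ?case
        proof
          assume "s \<in> {0..t}"
          then have s: "0 < s" "0 \<le> s" "s \<in> {0..t}" using elim(2) by auto
          have ws: "(\<lambda>k. fc (y s) k - fc (yr s) k) = w s" using s by (simp add: w_def[abs_def])
          have "h s = P.Nop s (w s)"
          proof
            fix k
            have "h s k = lin k * w s k - nu0 / 2 * (Bf (fc (y s)) (fc (y s)) k - Bf (fc (yr s)) (fc (yr s)) k) - a * ib m p (O.obs (w s)) k"
              using elim(1) s unfolding Gf[of y s, OF y2[OF s(2)] s(2)] ws by (simp add: ws[symmetric])
            then show "h s k = P.Nop s (w s) k"
              using P.Nop_difference[OF yrH[OF s(2)] r_eq[OF s(2)] wH wB[OF s(3)], of "fc (y s)" k] ws[THEN fun_cong, symmetric] by simp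
          qed
          moreover have "O.Nop s (Z s) = P.Nop s (Z s)"
            using O.Nop_eq[OF Z(5)[OF s(2)]] P.Nop_eq[OF order_trans[OF Z(5)[OF s(2)] B(2)]] by (simp add: fun_eq_iff)
          ultimately show "E0 (\<lambda>k. h s k - O.Nop s (Z s) k) \<le> ennreal (P.Kop\<^sup>2) * E2 (\<lambda>k. w s k - Z s k)"
            using P.Nop_lip[of "w s" "Z s" s] by (simp only: E2_finite_iff wH Z(4) simp_thms)
        qed
      qed
      have bnd: "E2 (\<lambda>k. w s k - Z s k) \<le> ennreal ((B + B)\<^sup>2)" if s: "s \<in> {0..t}" for s
      proof -
        have "vn (\<lambda>k. w s k - Z s k) \<le> vn (w s) + vn (Z s)"
          using vn_triangle[OF wH H2_scale[OF Z(4)], of s "-1" s] unfolding vn_scale by simp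
        also have "\<dots> \<le> B + B" using wB[OF s] Z(5)[of s] B(2) s by (intro add_mono) auto
        finally show ?thesis unfolding E2_vn[OF H2_diff[OF wH Z(4)]] by (intro ennreal_leI power_mono) auto
      qed
      have "w t = Z t"
        by (rule modes_unique[OF _ h(1)[OF t] Z(1)[OF t] lip _ bnd]) (use P.Kop_pos t in auto)
      then have "fc (y t) k - fc (yr t) k = Z t k" for k using t by (simp add: w_def fun_eq_iff max_def)
      then have "fc (y t) k = fc (ye t) k" for k unfolding ye(2)[OF t] by (simp add: algebra_simps)
      then show ?thesis by (intro fc_inj Sobolev_sq_int[OF y2[OF t]] ye(1) t)
    qed
    have V: "V_norm L nu2 (\<lambda>x. ye t x - yr t x) = sqrt nu2 * vn (Z t)" for t
    proof -
      have e: "(\<lambda>x. ye t x - yr t x) = crep (Z t)" by (simp add: ye_def fun_eq_iff)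
      have "crep (Z t) \<in> Sobolev L 2" using crep_sq_int[OF Zi] Z(4) by (simp add: Sobolev2_iff fc_crep[OF Zi])
      then show ?thesis unfolding e by (subst V_norm_eq) (simp_all add: fc_crep[OF Zi] vn_def)
    qed
    have dec: "V_norm L nu2 (\<lambda>x. ye t x - yr t x) \<le> \<rho> * exp (- \<mu> * (t - s)) * V_norm L nu2 (\<lambda>x. ye s x - yr s x)"
      if "0 \<le> s \<and> s \<le> t" for s t
    proof -
      have "vn (Z t) \<le> 1 * (exp (- \<mu> * (t - s)) * vn (Z s))" using Z(6)[of s t] that by simp
      also have "\<dots> \<le> \<rho> * (exp (- \<mu> * (t - s)) * vn (Z s))" using \<rho> by (intro mult_right_mono) auto
      finally have "sqrt nu2 * vn (Z t) \<le> sqrt nu2 * (\<rho> * (exp (- \<mu> * (t - s)) * vn (Z s)))"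
        using nu2_pos by (intro mult_left_mono) auto
      then show ?thesis unfolding V by (simp only: mult_ac)
    qed
    show "\<exists>ye. observer_solution L nu0 nu1 nu2 f yr m p \<Lambda> (a * nu2) ye0 ye \<and>
        (\<forall>y. observer_solution L nu0 nu1 nu2 f yr m p \<Lambda> (a * nu2) ye0 y \<longrightarrow> (\<forall>t\<ge>0. AE x in TM. y t x = ye t x)) \<and>
        (\<forall>s t. 0 \<le> s \<and> s \<le> t \<longrightarrow>
           V_norm L nu2 (\<lambda>x. ye t x - yr t x) \<le> \<rho> * exp (- \<mu> * (t - s)) * V_norm L nu2 (\<lambda>x. ye s x - yr s x))"
      using sol unique dec by blast
  qed
  then show ?thesis using S unfolding m_def p_def by blast
qed

end

text \<open>The phrase "the corresponding solution" is rendered as existence of \<open>ye\<close>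
  together with agreement of every other solution with it, at each time and up to null sets in
  space. Sensors are indexed from 0, and injectivity of the indexing says that their number is
  really \<sigma>(S).\<close>

theorem mainTheorem1:
  fixes L :: "real^'n"
    and \<nu>0 \<nu>1 \<nu>2 C \<tau> :: real
    and f yr :: "real \<Rightarrow> real^'n \<Rightarrow> real"
  assumes dim: "CARD('n) \<in> {1, 2, 3}"
    and L_pos: "\<And>i. L $ i > 0"
    and nu_pos: "\<nu>0 > 0" "\<nu>1 > 0" "\<nu>2 > 0"
    and yr_solution: "KS_strong_solution L \<nu>0 \<nu>1 \<nu>2 f yr"
    and yr_initial: "yr 0 \<in> Sobolev L 2"
    and C_nonneg: "C \<ge> 0"
    and tau_pos: "\<tau> > 0"
    and yr_bound_V:
      "(SUP s\<in>{0..}. ennreal (V_norm L \<nu>2 (zero_mean_part L yr s))) \<le> ennreal C"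
    and yr_bound_DA:
      "(SUP s\<in>{0..}. L2_DA_norm L \<nu>2 s (s + \<tau>) (zero_mean_part L yr)) < ennreal C"
  shows "\<exists>(\<sigma> :: nat \<Rightarrow> nat) (p :: nat \<Rightarrow> nat \<Rightarrow> real^'n).
    strict_mono_on {1..} \<sigma> \<and> (\<forall>S\<ge>1. \<sigma> S \<ge> 1) \<and>
    (\<forall>S\<ge>1. p S ` {..<\<sigma> S} \<subseteq> Torus L \<and> inj_on (p S) {..<\<sigma> S}) \<and>
    (\<forall>R>0. \<forall>\<rho>>1. \<forall>\<mu>>0. \<exists>S\<ge>1.
      \<forall>\<Lambda>\<in>carrier_mat (\<sigma> S) (\<sigma> S).
        smallest_eigenvalue (\<Lambda> + transpose_mat \<Lambda>) 1 \<longrightarrow>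
        (\<exists>l>0. \<forall>ye0\<in>Sobolev L 2.
          V_norm L \<nu>2 (\<lambda>x. ye0 x - yr 0 x) \<le> R \<longrightarrow>
          (\<exists>ye. observer_solution L \<nu>0 \<nu>1 \<nu>2 f yr (\<sigma> S) (p S) \<Lambda> l ye0 ye \<and>
            (\<forall>y. observer_solution L \<nu>0 \<nu>1 \<nu>2 f yr (\<sigma> S) (p S) \<Lambda> l ye0 y \<longrightarrow>
               (\<forall>t\<ge>0. AE x in lebesgue_on (Torus L). y t x = ye t x)) \<and>
            (\<forall>s t. 0 \<le> s \<and> s \<le> t \<longrightarrow>
               V_norm L \<nu>2 (\<lambda>x. ye t x - yr t x)
                 \<le> \<rho> * exp (- \<mu> * (t - s)) * V_norm L \<nu>2 (\<lambda>x. ye s x - yr s x)))))"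
proof -
  interpret ks_torus L \<nu>0 \<nu>1 \<nu>2
    using dim L_pos nu_pos by unfold_locales auto
  \<comment> \<open>A grid with S points in each coordinate direction.\<close>
  let ?\<sigma> = "\<lambda>S::nat. S ^ CARD('n)"
  have 1: "strict_mono_on {1..} ?\<sigma>"
    by (rule strict_mono_onI) (simp add: power_strict_mono)
  have 2: "\<forall>S\<ge>1. ?\<sigma> S \<ge> 1" by simp
  have 3: "\<forall>S\<ge>1. gpt S ` {..<?\<sigma> S} \<subseteq> Torus L \<and> inj_on (gpt S) {..<?\<sigma> S}"
    using gpt_bij grid_subset by (auto simp: bij_betw_def)
  have 4: "\<forall>R>0. \<forall>\<rho>>1. \<forall>\<mu>>0. \<exists>S\<ge>1. \<forall>\<Lambda>\<in>carrier_mat (?\<sigma> S) (?\<sigma> S).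
        smallest_eigenvalue (\<Lambda> + transpose_mat \<Lambda>) 1 \<longrightarrow>
        (\<exists>l>0. \<forall>ye0\<in>Sobolev L 2.
          V_norm L \<nu>2 (\<lambda>x. ye0 x - yr 0 x) \<le> R \<longrightarrow>
          (\<exists>ye. observer_solution L \<nu>0 \<nu>1 \<nu>2 f yr (?\<sigma> S) (gpt S) \<Lambda> l ye0 ye \<and>
            (\<forall>y. observer_solution L \<nu>0 \<nu>1 \<nu>2 f yr (?\<sigma> S) (gpt S) \<Lambda> l ye0 y \<longrightarrow>
               (\<forall>t\<ge>0. AE x in lebesgue_on (Torus L). y t x = ye t x)) \<and>
            (\<forall>s t. 0 \<le> s \<and> s \<le> t \<longrightarrow>
               V_norm L \<nu>2 (\<lambda>x. ye t x - yr t x)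
                 \<le> \<rho> * exp (- \<mu> * (t - s)) * V_norm L \<nu>2 (\<lambda>x. ye s x - yr s x))))"
    using observer_converges[OF yr_solution C_nonneg yr_bound_V] by blast
  show ?thesis by (intro exI[of _ ?\<sigma>] exI[of _ gpt] conjI 1 2 3 4)
qed

end
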